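(* Let $\mathcal W\subset\mathcal C^+_{\mathbb M_2}$ be a Weyl chamber with $e_1\in\overline{\mathcal W}$ and set $\Pi^+=\{\lambda\in\mathbb M_2:\langle\lambda,\mathcal W\rangle>0,\ \lambda^2\ge-2\}$. If $(\mathrm{Im}\,w)^2\gg0$, then $$\Phi_2(w)=2^8e^{2\pi i\langle e_1,w\rangle}\prod_{\lambda\in\Pi^+}\left(1-e^{2\pi i\langle\lambda,w\rangle}\right)^{(-1)^{\langle\lambda,e_1-f_1\rangle}c(\lambda^2/2)}.$$
   Context: $\Lambda=\mathbb U(2)\oplus\mathbb U\oplus\mathbb E_8(2)$ ($\mathbb U$ hyperbolic plane, $\mathbb E_8$ negative definite, $L(k)$ form scaled by $k$). Let $e_1,f_1$ be a basis of the $\mathbb U$-summand with $e_1^2=f_1^2=0,\langle e_1,f_1\rangle=1$, $e_2,f_2$ a basis of the $\mathbb U(2)$-summand with $e_2^2=f_2^2=0,\langle e_2,f_2\rangle=2$, $\mathbb M_1=\mathbb U(2)\oplus\mathbb E_8(2)$, $\mathbb M_2=\mathbb U\oplus\mathbb E_8(2)$. Put $\iota_1(u)=-(u^2/2)e_1+f_1+u$ and $\iota_2(u)=-(u^2/2)e_2+f_2/2-u$. The component $\Omega^+_\Lambda$ of $\{[\eta]:\eta^2=0,\langle\eta,\bar\eta\rangle>0\}$ is the one equal to $[\iota_1(\mathbb M_1\otimes\mathbf R+i\,\mathcal C^+_{\mathbb M_1})]$, where $\mathcal C^+_{\mathbb M_1}$ is the component of the positive cone of $\mathbb M_1\otimes\mathbf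 R$ whose closure contains $e_2,f_2$; $\mathcal C^+_{\mathbb M_2}$ is the component of the positive cone of $\mathbb M_2\otimes\mathbf R$ with $[\iota_2(\mathbb M_2\otimes\mathbf R+i\mathcal C^+_{\mathbb M_2})]=\Omega^+_\Lambda$; the signs of $e_1,f_1$ are chosen so that $e_1,f_1\in\overline{\mathcal C}^+_{\mathbb M_2}$. A Weyl chamber is a connected component of the complement in $\mathcal C^+_{\mathbb M_2}$ of the hyperplanes orthogonal to roots ($\lambda^2=-2$) of $\mathbb M_2$. The Borcherds $\Phi$-function is the holomorphic function on the cone over $\Omega^+_\Lambda$ with $\Phi(\lambda Z)=\lambda^{-4}\Phi(Z)$, $\Phi(gZ)=\chi(g)\Phi(Z)$ ($g\in O^+(\Lambda)$, $\chi$ a character) and zero divisor the cone over the union of hyperplanes orthogonal to roots of $\Lambda$, normalized by $\Phi(\iota_1(z))=\prod_{\lambda\in\mathbb M_1\cap\overline{\mathcal C}^+_{\mathbb M_1}\setminus\{0\}}\big(\frac{1-e^{\pi i\langle\lambda,z\rangle}}{1+e^{\pi i\langle\lambda,z\rangle}}\big)^{c(\lambda^2/2)}$ for $(\mathrm{Im}z)^2\gg0$, where $\sum_n c(n)e^{2\pi in\tau}=\eta(\tau)^{-8}\eta(2\tau)^8\eta(4\tau)^{-8}$ ($\eta$ = Dedekind eta). $\Phi_2(w):=\Phi(\iota_2(w))$. *)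

theory Defs
  imports "HOL-Analysis.Analysis" "HOL-Computational_Algebra.Formal_Power_Series"
begin

text \<open>Coordinates on Lambda = Z^12 (index type 12):
  index 0 = e2, 1 = f2 (basis of U(2)); 2 = e1, 3 = f1 (basis of U);
  indices 4..11 = a basis of simple roots of E8 (Dynkin diagram: chain 4-5-6-7-8-9-10,
  node 11 attached to node 6), with the form of E8 negative definite and scaled by 2.\<close>

definition e8adj :: "(12 \<times> 12) set" where
  "e8adj = {(4,5),(5,6),(6,7),(7,8),(8,9),(9,10),(6,11)}"

definition gram :: "12 \<Rightarrow> 12 \<Rightarrow> int" where
  "gram i j =
     (if {i,j} = {0,1} then 2
      else if {i,j} = {2,3} then 1
      else if i = j \<and> i \<notin> {0,1,2,3} then -4
      else if (i,j) \<in> e8adj \<or> (j,i) \<in> e8adj then 2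
      else 0)"

definition bil :: "'a::comm_ring_1 ^ 12 \<Rightarrow> 'a ^ 12 \<Rightarrow> 'a" where
  "bil v w = (\<Sum>i\<in>UNIV. \<Sum>j\<in>UNIV. of_int (gram i j) * v$i * w$j)"

definition sq :: "'a::comm_ring_1 ^ 12 \<Rightarrow> 'a" where
  "sq v = bil v v"

definition bv :: "12 \<Rightarrow> 'a::zero_neq_one ^ 12" where
  "bv k = (\<chi> i. if i = k then 1 else 0)"

abbreviation e2 where "e2 \<equiv> bv 0"
abbreviation f2 where "f2 \<equiv> bv 1"
abbreviation e1 where "e1 \<equiv> bv 2"
abbreviation f1 where "f1 \<equiv> bv 3"

definition lift :: "int ^ 12 \<Rightarrow> 'a::ring_1 ^ 12" where
  "lift v = (\<chi> i. of_int (v$i))"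

definition cvec :: "real ^ 12 \<Rightarrow> complex ^ 12" where
  "cvec y = (\<chi> i. complex_of_real (y$i))"

definition Imv :: "complex ^ 12 \<Rightarrow> real ^ 12" where
  "Imv w = (\<chi> i. Im (w$i))"

definition M1 :: "(int ^ 12) set" where "M1 = {v. v$2 = 0 \<and> v$3 = 0}"
definition M2 :: "(int ^ 12) set" where "M2 = {v. v$0 = 0 \<and> v$1 = 0}"
definition M1R :: "(real ^ 12) set" where "M1R = {v. v$2 = 0 \<and> v$3 = 0}"
definition M2R :: "(real ^ 12) set" where "M2R = {v. v$0 = 0 \<and> v$1 = 0}"
definition M1C :: "(complex ^ 12) set" where "M1C = {v. v$2 = 0 \<and> v$3 = 0}"
definition M2C :: "(complex ^ 12) set" where "M2C = {v. v$0 = 0 \<and> v$1 = 0}"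

definition C1plus :: "(real ^ 12) set" where
  "C1plus = {y \<in> M1R. sq y > 0 \<and> bil e2 y > 0}"
definition C2plus :: "(real ^ 12) set" where
  "C2plus = {y \<in> M2R. sq y > 0 \<and> bil e1 y > 0}"

definition iota1 :: "complex ^ 12 \<Rightarrow> complex ^ 12" where
  "iota1 u = (- (sq u / 2)) *s e1 + f1 + u"
definition iota2 :: "complex ^ 12 \<Rightarrow> complex ^ 12" where
  "iota2 u = (- (sq u / 2)) *s e2 + (1/2) *s f2 - u"

definition tube1 :: "(complex ^ 12) set" where "tube1 = {z \<in> M1C. Imv z \<in> C1plus}"
definition tube2 :: "(complex ^ 12) set" where "tube2 = {z \<in> M2C. Imv z \<in> C2plus}"

definition OmegaCone :: "(complex ^ 12) set" where
  "OmegaCone = {c *s iota1 z | c z. c \<noteq> 0 \<and> z \<in> tube1}"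

definition roots_Lambda :: "(int ^ 12) set" where
  "roots_Lambda = {l. sq l = -2}"
definition roots_M2 :: "(int ^ 12) set" where
  "roots_M2 = {l \<in> M2. sq l = -2}"

definition weyl_chamber :: "(real ^ 12) set \<Rightarrow> bool" where
  "weyl_chamber W \<longleftrightarrow>
     W \<in> components (C2plus - (\<Union>l\<in>roots_M2. {y. bil (lift l) y = 0}))"

definition cmat :: "int ^ 12 ^ 12 \<Rightarrow> complex ^ 12 ^ 12" where
  "cmat g = (\<chi> i j. of_int (g$i$j))"

definition Oplus :: "(int ^ 12 ^ 12) set" where
  "Oplus = {g. (\<exists>h. g ** h = mat 1 \<and> h ** g = mat 1)
              \<and> (\<forall>v w. bil (g *v v) (g *v w) = bil v w)
              \<and> (\<lambda>Z. cmat g *v Z) ` OmegaCone = OmegaCone}"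

definition holo_on :: "(complex ^ 12) set \<Rightarrow> (complex ^ 12 \<Rightarrow> complex) \<Rightarrow> bool" where
  "holo_on S f \<longleftrightarrow>
     (\<forall>z\<in>S. \<exists>D. (f has_derivative D) (at z) \<and> (\<forall>c v. D (c *s v) = c * D v))"

definition has_uprod :: "('a \<Rightarrow> complex) \<Rightarrow> 'a set \<Rightarrow> complex \<Rightarrow> bool" where
  "has_uprod f S P \<longleftrightarrow> ((\<lambda>F. prod f F) \<longlongrightarrow> P) (finite_subsets_at_top S)"

text \<open>geom_fps k = 1/(1 - q^k) for k > 0.\<close>
definition geom_fps :: "nat \<Rightarrow> int fps" where
  "geom_fps k = Abs_fps (\<lambda>j. if k dvd j then 1 else 0)"

text \<open>eta(tau)^-8 eta(2tau)^8 eta(4tau)^-8 = q^-1 * prod_{k>=1} (1-q^k)^-8 (1-q^2k)^8 (1-q^4k)^-8;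
  the factors with k > m do not affect the coefficient of q^m.\<close>
definition eta_trunc :: "nat \<Rightarrow> int fps" where
  "eta_trunc m = (\<Prod>k\<in>{1..m}. geom_fps k ^ 8 * (1 - fps_X ^ (2*k)) ^ 8 * geom_fps (4*k) ^ 8)"

definition cc :: "int \<Rightarrow> int" where
  "cc n = (if n < -1 then 0 else fps_nth (eta_trunc (nat (n+1))) (nat (n+1)))"

definition is_borcherds_Phi :: "(complex ^ 12 \<Rightarrow> complex) \<Rightarrow> bool" where
  "is_borcherds_Phi Phi \<longleftrightarrow>
     holo_on OmegaCone Phi
   \<and> (\<forall>Z\<in>OmegaCone. \<forall>c. c \<noteq> 0 \<longrightarrow> Phi (c *s Z) = c powi (-4) * Phi Z)
   \<and> (\<exists>chi :: int ^ 12 ^ 12 \<Rightarrow> complex.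
        (\<forall>g\<in>Oplus. \<forall>h\<in>Oplus. chi (g ** h) = chi g * chi h)
      \<and> (\<forall>g\<in>Oplus. \<forall>Z\<in>OmegaCone. Phi (cmat g *v Z) = chi g * Phi Z))
   \<and> (\<forall>Z\<in>OmegaCone. Phi Z = 0 \<longleftrightarrow> (\<exists>l\<in>roots_Lambda. bil (lift l) Z = 0))
   \<and> (\<exists>R. \<forall>z\<in>tube1. sq (Imv z) > R \<longrightarrow>
        has_uprod
          (\<lambda>l. ((1 - exp (pi * \<i> * bil (lift l) z)) / (1 + exp (pi * \<i> * bil (lift l) z)))
                 powi cc (sq l div 2))
          {l \<in> M1. l \<noteq> 0 \<and> lift l \<in> closure C1plus}
          (Phi (iota1 z)))"

end

theory Submission
  imports Defs "HOL-Complex_Analysis.Complex_Analysis" "HOL-Probability.Probability"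
begin

no_notation fps_nth (infixl \<open>$\<close> 75)

text \<open>
  On the common cone the two tube domains are related by \<open>iota2 w = - \<tau>' * iota1 z\<close> with
  \<open>\<tau>' = \<langle>e1, w\<rangle>\<close> and \<open>\<tau> = \<langle>e2, z\<rangle> = - 1 / \<tau>'\<close>, so homogeneity alone reduces the theorem to an identity
  between two infinite products.  The vectors of level \<open>0\<close> contribute theta constants, and
  \<open>\<theta>4 (- 1 / \<tau>') ^ 8 = \<tau>' ^ 4 * \<theta>2 \<tau>' ^ 8\<close> accounts for the factor \<open>2 ^ 8 * exp (2 pi i \<langle>e1, w\<rangle>)\<close>.
  Both logarithms of the remaining products are, level by level, Hecke-type sums over matrices of
  the vector-valued form built from \<open>\<eta>(\<tau>)^-8 \<eta>(2\<tau>)^8 \<eta>(4\<tau>)^-8\<close> and the theta function of \<open>E8\<close>; reducing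
  these matrices modulo \<open>SL2(Z)\<close> identifies the two sums.  This comparison needs \<open>w\<close> deep inside the cone;
  translating \<open>w\<close> along \<open>e1\<close> and continuing analytically extends the formula to all \<open>w\<close> with
  \<open>(Im w)^2 > 2\<close>, where the second product still converges.
\<close>

section \<open>Theta series\<close>

text \<open>The two products expand one function around different isotropic vectors, so their
  factors do not correspond one to one. What they share is a set of orbits: modulo left
  multiplication by SL2(Z), an integral matrix of determinant N whose first column is nonzero mod 2
  has one reduced form with lower left entry 0 and one with lower right entry 0. These two shapes
  index the level N parts of the two logarithms. The three nonzero columns mod 2 label three forms
  of weight -4 that SL2(Z) permutes and whose sum is zero; the weight 4 of the E8 theta function
  cancels theirs.

  The constant 2 comes from the bound exp (2 pi sqrt j) for the coefficients: a vector l of square 2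
  j in the cone has <l, Im w> >= sqrt (2 j (Im w)^2), and half of the exponent 2 pi <l, Im w> beats
  the growth once (Im w)^2 >= 2. Logarithms need more, because a root may pair negatively with Im w,
  and then |exp (2 pi i <l, w>)| > 1. Such factors have exponent 1, hence no poles, and this lets
  the identity be continued from deep inside the cone.\<close>

lemma summable_on_exp_abs_int:
  fixes c :: real
  assumes "c > 0"
  shows "(\<lambda>n::int. exp (- c * \<bar>real_of_int n\<bar>)) summable_on UNIV"
proof -
  have g: "(\<lambda>n. exp (- c) ^ n) summable_on (UNIV :: nat set)"
    using assms by (intro norm_summable_imp_summable_on) (auto simp: norm_power intro!: summable_geometric)
  have "(\<lambda>n::int. exp (- c * \<bar>real_of_int n\<bar>)) summable_on (range int)"
    by (subst summable_on_reindex)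
       (use g in \<open>auto simp: o_def exp_of_nat_mult [symmetric] mult.commute\<close>)
  moreover have "(\<lambda>n::int. exp (- c * \<bar>real_of_int n\<bar>)) summable_on (range (\<lambda>n. - int n))"
    by (subst summable_on_reindex)
       (use g in \<open>auto simp: o_def exp_of_nat_mult [symmetric] mult.commute inj_on_def\<close>)
  moreover have "UNIV = range int \<union> range (\<lambda>n. - int n)"
    by (auto simp: image_iff) (metis int_cases2)
  ultimately show ?thesis by (metis summable_on_union)
qed

text \<open>Induction over the coordinates; each new coordinate contributes one more factor, the
  total sum of f.\<close>

lemma summable_on_prod_finite_fun:
  fixes f :: "'b \<Rightarrow> real"
  assumes f: "f summable_on UNIV" and nonneg: "\<And>x. f x \<ge> 0" and fin: "finite (A :: 'a set)"
  shows "(\<lambda>g. \<Prod>j\<in>A. f (g j)) summable_on (PiE A (\<lambda>_. UNIV))"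
  using fin
proof (induction A)
  case empty
  show ?case by simp
next
  case (insert x A)
  have pi: "PiE (insert x A) (\<lambda>_. UNIV) = (\<lambda>(g, y). g(x := y)) ` (PiE A (\<lambda>_. UNIV :: 'b set) \<times> UNIV)"
    unfolding PiE_insert_eq
    by (subst product_swap [symmetric]) (auto simp add: image_image case_prod_unfold)
  have inj: "inj_on (\<lambda>(g, y). g(x := y)) (PiE A (\<lambda>_. UNIV :: 'b set) \<times> UNIV)"
    using inj_combinator'[of x A "\<lambda>_. UNIV"] insert.hyps by simp
  have "(\<lambda>(g, y). (\<Prod>j\<in>A. f (g j)) * f y) summable_on (PiE A (\<lambda>_. UNIV :: 'b set) \<times> UNIV)"
    using insert.IH f by (intro summable_on_SigmaI[where g = "\<lambda>g. (\<Prod>j\<in>A. f (g j)) * infsum f UNIV"])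
      (auto intro!: has_sum_cmult_right summable_on_cmult_left mult_nonneg_nonneg prod_nonneg nonneg)
  also have "?this \<longleftrightarrow> ((\<lambda>g. \<Prod>j\<in>insert x A. f (g j)) \<circ> (\<lambda>(g, y). g(x := y))) summable_on (PiE A (\<lambda>_. UNIV) \<times> UNIV)"
  proof (intro summable_on_cong, clarsimp)
    fix g y
    have "(\<Prod>j\<in>A. f (if j = x then y else g j)) = (\<Prod>j\<in>A. f (g j))"
      by (intro prod.cong) (use insert.hyps in auto)
    thus "(\<Prod>j\<in>A. f (g j)) * f y = (\<Prod>j\<in>insert x A. f (if j = x then y else g j))"
      using insert.hyps by (simp add: mult.commute)
  qed
  also have "\<dots> \<longleftrightarrow> ?case"
    unfolding pi using inj by (rule summable_on_reindex [symmetric])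
  finally show ?case .
qed

lemma summable_on_prod_vec:
  fixes f :: "'b \<Rightarrow> real"
  assumes f: "f summable_on UNIV" and nonneg: "\<And>x. f x \<ge> 0"
  shows "(\<lambda>u :: 'b ^ 'n::finite. \<Prod>j\<in>UNIV. f (u $ j)) summable_on UNIV"
proof -
  have "(\<lambda>g. \<Prod>j\<in>(UNIV::'n set). f (g j)) summable_on UNIV"
    using summable_on_prod_finite_fun[OF assms, of "UNIV :: 'n set"] by simp
  also have "?this \<longleftrightarrow> ?thesis"
    by (intro summable_on_reindex_bij_witness[of _ vec_nth vec_lambda]) auto
  finally show ?thesis .
qed

lemma infsum_prod_vec:
  fixes f :: "'n::finite \<Rightarrow> 'b \<Rightarrow> complex"
  assumes "\<And>j. (\<lambda>x. norm (f j x)) summable_on UNIV"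
  shows "(\<Sum>\<^sub>\<infinity>u :: 'b ^ 'n. \<Prod>j\<in>UNIV. f j (u $ j)) = (\<Prod>j\<in>UNIV. infsum (f j) UNIV)"
proof -
  have "(\<Sum>\<^sub>\<infinity>u :: 'b ^ 'n. \<Prod>j\<in>UNIV. f j (u $ j)) = (\<Sum>\<^sub>\<infinity>g. \<Prod>j\<in>UNIV. f j (g j))"
    by (intro infsum_reindex_bij_witness[of _ vec_lambda vec_nth]) auto
  also have "\<dots> = (\<Prod>j\<in>UNIV. infsum (f j) UNIV)"
    using infsum_prod_PiE_abs[of "UNIV :: 'n set" f "\<lambda>_. UNIV"] assms by simp
  finally show ?thesis .
qed

text \<open>Weierstrass's M-test on small discs. The majorant may depend on the point, because theta
  series have none that is uniform up to the boundary of the half-plane.\<close>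

lemma holomorphic_on_infsum:
  fixes f :: "'a \<Rightarrow> complex \<Rightarrow> complex"
  assumes S: "open S" and f: "\<And>i. i \<in> A \<Longrightarrow> f i holomorphic_on S"
    and M: "\<And>z. z \<in> S \<Longrightarrow> \<exists>r>0. \<exists>M. M summable_on A \<and>
               (\<forall>i\<in>A. \<forall>w \<in> cball z r \<inter> S. norm (f i w) \<le> M i)"
  shows "(\<lambda>z. infsum (\<lambda>i. f i z) A) holomorphic_on S"
proof (rule holomorphic_on_subset)
  let ?g = "\<lambda>z. infsum (\<lambda>i. f i z) A"
  define R where "R = {z. ?g analytic_on {z}}"
  show "S \<subseteq> S" by simp
  have "\<exists>r>0. ?g holomorphic_on ball z r" if z: "z \<in> S" for z
  proof -
    obtain r M where r: "r > 0" "M summable_on A" "\<forall>i\<in>A. \<forall>w \<in> cball z r \<inter> S. norm (f i w) \<le> M i"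
      using M[OF z] by blast
    obtain r' where r': "r' > 0" "cball z r' \<subseteq> S"
      using S z open_contains_cball by blast
    define r'' where "r'' = min r r'"
    have r'': "r'' > 0" "cball z r'' \<subseteq> cball z r \<inter> S"
      using r(1) r' by (auto simp: r''_def)
    have u: "uniform_limit (cball z r'') (\<lambda>X y. \<Sum>x\<in>X. f x y) ?g (finite_subsets_at_top A)"
      by (rule Weierstrass_m_test_general[where M = M]) (use r(2,3) r''(2) in blast)+
    have "\<forall>\<^sub>F X in finite_subsets_at_top A. continuous_on (cball z r'') (\<lambda>y. \<Sum>x\<in>X. f x y)
             \<and> (\<lambda>y. \<Sum>x\<in>X. f x y) holomorphic_on ball z r''"
    proof (rule eventually_finite_subsets_at_top_weakI)
      fix X assume X: "finite X" "X \<subseteq> A"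
      have "(\<lambda>y. \<Sum>x\<in>X. f x y) holomorphic_on S"
        using X f by (intro holomorphic_on_sum) auto
      hence "(\<lambda>y. \<Sum>x\<in>X. f x y) holomorphic_on cball z r''"
        by (rule holomorphic_on_subset) (use r'' in auto)
      thus "continuous_on (cball z r'') (\<lambda>y. \<Sum>x\<in>X. f x y)
             \<and> (\<lambda>y. \<Sum>x\<in>X. f x y) holomorphic_on ball z r''"
        using ball_subset_cball holomorphic_on_imp_continuous_on holomorphic_on_subset by blast
    qed
    from holomorphic_uniform_limit[OF this u] have "?g holomorphic_on ball z r''"
      by auto
    thus ?thesis using r'' by blast
  qed
  thus "?g holomorphic_on S"
    using S by (metis analytic_on_def analytic_imp_holomorphic)
qed

section \<open>The theta series and its convergence\<close>

text \<open>Jacobi's \<theta>3 with nome exp (pi i t). The other three classical theta functions are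
  its shifts by 1/2, by t/2 and by both, up to exponential factors.\<close>

definition th :: "complex \<Rightarrow> complex \<Rightarrow> complex" where
  "th t v = (\<Sum>\<^sub>\<infinity>n::int. exp (pi * \<i> * t * of_int n ^ 2 + 2 * pi * \<i> * of_int n * v))"

text \<open>Completing the square: the Gaussian absorbs the linear term and still leaves -|x|, so
  one geometric series majorizes all theta series with parameters in a given range.\<close>

lemma gauss_le_exp_abs:
  fixes a b x :: real
  assumes "a > 0"
  shows "- pi * a * x^2 + 2 * pi * b * \<bar>x\<bar> \<le> (2 * pi * b + 1)^2 / (4 * pi * a) - \<bar>x\<bar>"
proof -
  have "0 \<le> (2 * pi * a * \<bar>x\<bar> - (2 * pi * b + 1))^2 / (4 * pi * a)" using assms by simp
  also have "\<dots> = pi * a * x^2 - (2 * pi * b + 1) * \<bar>x\<bar> + (2 * pi * b + 1)^2 / (4 * pi * a)"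
    using assms by (simp add: power2_eq_square field_simps) 
  finally show ?thesis by (simp add: algebra_simps)
qed

lemma norm_th_term_le:
  assumes "a > 0" "Im t \<ge> a" "\<bar>Im v\<bar> \<le> b"
  shows "norm (exp (pi * \<i> * t * of_int n ^ 2 + 2 * pi * \<i> * of_int n * v))
            \<le> exp ((2 * pi * b + 1)^2 / (4 * pi * a)) * exp (- \<bar>real_of_int n\<bar>)"
proof -
  have "norm (exp (pi * \<i> * t * of_int n ^ 2 + 2 * pi * \<i> * of_int n * v))
        = exp (- pi * Im t * real_of_int n ^ 2 - 2 * pi * real_of_int n * Im v)"
    by (simp add: power2_eq_square Re_exp algebra_simps)
  also have "\<dots> \<le> exp (- pi * a * real_of_int n ^ 2 + 2 * pi * b * \<bar>real_of_int n\<bar>)"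
  proof -
    have "a * real_of_int n ^ 2 \<le> Im t * real_of_int n ^ 2" using assms by (intro mult_right_mono) auto
    moreover have "- (real_of_int n * Im v) \<le> \<bar>real_of_int n\<bar> * \<bar>Im v\<bar>"
      by (metis abs_ge_minus_self abs_mult)
    moreover have "\<bar>real_of_int n\<bar> * \<bar>Im v\<bar> \<le> \<bar>real_of_int n\<bar> * b"
      using assms by (intro mult_left_mono) auto
    ultimately have "a * real_of_int n ^ 2 \<le> Im t * real_of_int n ^ 2"
        and "- (real_of_int n * Im v) \<le> \<bar>real_of_int n\<bar> * b" 
      by (simp, metis order_trans)
    moreover have "pi * (x - y + 2 * (p - q)) \<le> 0" if "x \<le> y" "p \<le> q" for x y p q :: real
      using that by (simp add: mult_le_0_iff)
    ultimately have "pi * (a * real_of_int n ^ 2 - Im t * real_of_int n ^ 2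
        + 2 * (- (real_of_int n * Im v) - \<bar>real_of_int n\<bar> * b)) \<le> 0"
      by blast
    thus ?thesis by (simp add: algebra_simps)
  qed
  also have "\<dots> \<le> exp ((2 * pi * b + 1)^2 / (4 * pi * a) - \<bar>real_of_int n\<bar>)"
    using gauss_le_exp_abs[OF assms(1), of "real_of_int n" b] by simp
  finally show ?thesis by (simp add: exp_diff exp_minus field_simps)
qed

lemma abs_summable_th:
  assumes "Im t > 0"
  shows "(\<lambda>n::int. norm (exp (pi * \<i> * t * of_int n ^ 2 + 2 * pi * \<i> * of_int n * v))) summable_on UNIV"
  by (rule Infinite_Sum.abs_summable_on_comparison_test'[where g = "\<lambda>n::int. exp ((2 * pi * \<bar>Im v\<bar> + 1)^2 / (4 * pi * Im t)) * exp (- \<bar>real_of_int n\<bar>)"])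
     (use norm_th_term_le[of "Im t" t v "\<bar>Im v\<bar>"] assms summable_on_exp_abs_int[of 1]
      in \<open>auto intro!: summable_on_cmult_right\<close>)

lemma holomorphic_th:
  assumes S: "open S" and a: "a holomorphic_on S" and b: "b holomorphic_on S"
    and pos: "\<And>z. z \<in> S \<Longrightarrow> Im (a z) > 0"
  shows "(\<lambda>z. th (a z) (b z)) holomorphic_on S"
  unfolding th_def
proof (rule holomorphic_on_infsum[OF S])
  fix z assume z: "z \<in> S"
  obtain r where r: "r > 0" "cball z r \<subseteq> S" using S z open_contains_cball by blast
  have ca: "continuous_on (cball z r) (\<lambda>z. Im (a z))"
    using a r by (intro continuous_intros) (meson holomorphic_on_imp_continuous_on continuous_on_subset)
  have cb: "continuous_on (cball z r) (\<lambda>z. \<bar>Im (b z)\<bar>)"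
    using b r by (intro continuous_intros) (meson holomorphic_on_imp_continuous_on continuous_on_subset)
  \<comment> \<open>On the closed disc Im a has a positive minimum and |Im b| a maximum; these two
    values feed the uniform majorant.\<close>
  obtain x where x: "x \<in> cball z r" "\<And>y. y \<in> cball z r \<Longrightarrow> Im (a x) \<le> Im (a y)"
    using continuous_attains_inf[OF _ _ ca] r by auto
  obtain x' where x': "x' \<in> cball z r" "\<And>y. y \<in> cball z r \<Longrightarrow> \<bar>Im (b y)\<bar> \<le> \<bar>Im (b x')\<bar>"
    using continuous_attains_sup[OF _ _ cb] r by auto
  let ?M = "\<lambda>n::int. exp ((2 * pi * \<bar>Im (b x')\<bar> + 1)^2 / (4 * pi * Im (a x))) * exp (- \<bar>real_of_int n\<bar>)"
  have "?M summable_on UNIV" using summable_on_exp_abs_int[of 1] by (intro summable_on_cmult_right) auto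
  moreover have "\<forall>n\<in>UNIV. \<forall>w\<in>cball z r \<inter> S. 
     norm (exp (pi * \<i> * a w * of_int n ^ 2 + 2 * pi * \<i> * of_int n * b w)) \<le> ?M n"
    using x x' pos[of x] r by (intro ballI norm_th_term_le) auto
  ultimately show "\<exists>r>0. \<exists>M. M summable_on UNIV \<and> (\<forall>n\<in>UNIV. \<forall>w\<in>cball z r \<inter> S. 
     norm (exp (pi * \<i> * a w * of_int n ^ 2 + 2 * pi * \<i> * of_int n * b w)) \<le> M n)"
    using r by blast
qed (auto intro!: holomorphic_intros a b)

section \<open>Poisson summation for Gaussians\<close>

text \<open>A nonzero value at x0 is detected by powers of cos^2 (pi (x - x0)), a trigonometric
  polynomial whose only peak in [0,1] is x0. The integrals against all powers vanish, whereas the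
  neighbourhood of x0 contributes an exponentially dominant share. At an end point there would be a
  second peak at the other end, hence the restriction to the interior.\<close>

lemma fourier_uniqueness_interior:
  fixes g :: "real \<Rightarrow> complex"
  assumes cont: "continuous_on {0..1} g"
    and coeff: "\<And>k::int. integral {0..1} (\<lambda>x. g x * exp (2 * pi * \<i> * of_int k * x)) = 0"
    and x0: "0 < x0" "x0 < 1"
  shows "g x0 = 0"
proof (rule ccontr)
  assume nz: "g x0 \<noteq> 0"
  define K where "K x = cos (pi * (x - x0)) ^ 2" for x
  define e where "e k x = exp (2 * pi * \<i> * of_int k * complex_of_real x)" for k :: int and x :: real
  have ec [continuous_intros]: "continuous_on S (e k)" for S k
    unfolding e_def by (intro continuous_intros)
  have Kc [continuous_intros]: "continuous_on S K" for S
    unfolding K_def by (intro continuous_intros)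
  have Ke: "complex_of_real (K x) = 1/2 + (e 1 (-x0) / 4) * e 1 x + (e (-1) (-x0) / 4) * e (-1) x" for x
  proof -
    let ?y = "pi * (x - x0)"
    have "K x = (1 + cos (2 * ?y)) / 2" unfolding K_def by (simp add: cos_double_cos)
    also have "complex_of_real \<dots> = (1 + (exp (\<i> * (2 * ?y)) + exp (- (\<i> * (2 * ?y)))) / 2) / 2"
      by (simp add: cos_exp_eq flip: cos_of_real)
    also have "exp (\<i> * (2 * ?y)) = e 1 (-x0) * e 1 x"
      unfolding e_def exp_add [symmetric] by (simp add: algebra_simps)
    also have "exp (- (\<i> * (2 * ?y))) = e (-1) (-x0) * e (-1) x"
      unfolding e_def exp_add [symmetric] by (simp add: algebra_simps)
    finally show ?thesis by (simp add: field_simps)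
  qed
  have eadd: "e j x * e k x = e (j + k) x" for j k x
    unfolding e_def exp_add [symmetric] by (simp add: algebra_simps)
  \<comment> \<open>Multiplication by K moves the frequency by -1, 0 or 1, so the induction over n
    has to run for all frequencies at once.\<close>
  have int0: "integral {0..1} (\<lambda>x. g x * (of_real (K x) ^ n * e k x)) = 0" for n k
  proof (induction n arbitrary: k)
    case 0
    show ?case using coeff[of k] by (simp add: e_def)
  next
    case (Suc n)
    have i: "(\<lambda>x. g x * (of_real (K x) ^ n * e k x)) integrable_on {0..1}" for k
      by (intro integrable_continuous_interval continuous_intros cont)
    have eq: "(\<lambda>x. g x * (of_real (K x) ^ Suc n * e k x)) = (\<lambda>x. 
        1/2 * (g x * (of_real (K x) ^ n * e k x)) + (e 1 (-x0) / 4) * (g x * (of_real (K x) ^ n * e (k + 1) x))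
        + (e (-1) (-x0) / 4) * (g x * (of_real (K x) ^ n * e (k - 1) x)))"
    proof
      fix x
      have "e (k + 1) x = e k x * e 1 x" "e (k - 1) x = e k x * e (-1) x" by (simp_all add: eadd)
      thus "g x * (of_real (K x) ^ Suc n * e k x) = 
        1/2 * (g x * (of_real (K x) ^ n * e k x)) + (e 1 (-x0) / 4) * (g x * (of_real (K x) ^ n * e (k + 1) x))
        + (e (-1) (-x0) / 4) * (g x * (of_real (K x) ^ n * e (k - 1) x))"
        by (simp only: power_Suc Ke) (simp add: algebra_simps)
    qed
    show ?case
      unfolding eq using i by (simp add: integral_add integrable_add integrable_on_mult_right Suc)
  qed
  \<comment> \<open>Pairing with the conjugate of \<open>g x0\<close> gives a real function that is
    positive near x0.\<close>
  define h where "h x = Re (g x * cnj (g x0))" for x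
  have hc [continuous_intros]: "continuous_on S h" if "S \<subseteq> {0..1}" for S
    unfolding h_def by (intro continuous_intros continuous_on_subset[OF cont] that)
  have hint: "integral {0..1} (\<lambda>x. h x * K x ^ n) = 0" for n
  proof -
    have i: "(\<lambda>x. g x * (of_real (K x) ^ n * e 0 x)) integrable_on {0..1}"
      by (intro integrable_continuous_interval continuous_intros cont)
    have "integral {0..1} (\<lambda>x. (g x * (of_real (K x) ^ n * e 0 x)) * cnj (g x0)) = 0"
      using int0[of n 0] by (simp only: integral_mult_left mult_zero_left)
    hence "0 = Re (integral {0..1} (\<lambda>x. (g x * (of_real (K x) ^ n * e 0 x)) * cnj (g x0)))"
      by (metis zero_complex.sel(1))
    also have "\<dots> = integral {0..1} (\<lambda>x. Re ((g x * (of_real (K x) ^ n * e 0 x)) * cnj (g x0)))"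
      using integral_linear[OF integrable_on_mult_left[OF i, of "cnj (g x0)"] bounded_linear_Re]
      by (simp add: o_def)
    also have "(\<lambda>x. Re ((g x * (of_real (K x) ^ n * e 0 x)) * cnj (g x0))) = (\<lambda>x. h x * K x ^ n)"
    proof
      fix x
      have "(g x * (of_real (K x) ^ n * e 0 x)) * cnj (g x0) = (K x ^ n) *\<^sub>R (g x * cnj (g x0))"
        by (simp add: e_def scaleR_conv_of_real)
      also have "Re \<dots> = h x * K x ^ n" unfolding h_def scaleR_complex.sel by (simp only: mult.commute)
      finally show "Re ((g x * (of_real (K x) ^ n * e 0 x)) * cnj (g x0)) = h x * K x ^ n" .
    qed
    finally show ?thesis by simp
  qed
  \<comment> \<open>Half of \<open>h x0\<close>, so that continuity keeps h above \<epsilon> near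
    x0.\<close>
  define \<epsilon> where "\<epsilon> = norm (g x0) ^ 2 / 2"
  have eps: "\<epsilon> > 0" using nz by (simp add: \<epsilon>_def)
  have h0: "h x0 = 2 * \<epsilon>"
    unfolding h_def \<epsilon>_def complex_mult_cnj by (simp add: cmod_power2)
  have "{0<..<1} \<subseteq> {0..1::real}" by auto
  hence "isCont h x0" using hc[of "{0<..<1}"] x0 by (auto simp: continuous_on_eq_continuous_at)
  then obtain \<delta>1 where d1: "\<delta>1 > 0" "\<And>x. \<bar>x - x0\<bar> < \<delta>1 \<Longrightarrow> \<bar>h x - h x0\<bar> < \<epsilon>"
    using eps unfolding continuous_at_eps_delta by (auto simp: dist_real_def)
  \<comment> \<open>Below the distances to both end points, so the peak stays inside [0,1] and pi
    \<delta> stays below pi/2, where the cosine is positive.\<close>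
  define \<delta> where "\<delta> = Min {\<delta>1 / 2, x0 / 2, (1 - x0) / 2}"
  have d: "\<delta> > 0" "\<delta> < \<delta>1" "\<delta> < x0" "\<delta> < 1 - x0" "\<delta> < 1/2"
    unfolding \<delta>_def using d1 x0 by (auto simp: min_less_iff_disj)
  obtain M where M: "M > 0" "\<And>x. x \<in> {0..1} \<Longrightarrow> \<bar>h x\<bar> \<le> M"
  proof -
    have "bounded (h ` {0..1})" by (intro compact_imp_bounded compact_continuous_image hc) auto
    thus ?thesis using that by (auto simp: bounded_pos)
  qed
  define \<rho> \<rho>' where "\<rho> = cos (pi * \<delta>) ^ 2" and "\<rho>' = cos (pi * (\<delta>/2)) ^ 2"
  have cosd: "0 < cos (pi * \<delta>)" "cos (pi * \<delta>) < cos (pi * (\<delta> / 2))"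
    using d by (auto intro!: cos_gt_zero cos_monotone_0_pi)
  have rho: "0 < \<rho>" "\<rho> < \<rho>'" unfolding \<rho>_def \<rho>'_def using cosd by (auto intro!: power_strict_mono)
  \<comment> \<open>The distance to x0 lies between \<delta> and 1 - \<delta>, and there the cosine
    is at most cos (pi \<delta>) in absolute value.\<close>
  have K_far: "K x \<le> \<rho>" if "x \<in> {0..1}" "\<bar>x - x0\<bar> \<ge> \<delta>" for x
  proof -
    have a: "\<bar>x - x0\<bar> < 1 - \<delta>" using that x0 d by auto
    have "cos (pi * \<bar>x - x0\<bar>) \<le> cos (pi * \<delta>)" using that a d by (intro cos_monotone_0_pi_le) auto
    moreover have "cos (pi * (1 - \<delta>)) \<le> cos (pi * \<bar>x - x0\<bar>)" using that a d by (intro cos_monotone_0_pi_le) auto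
    moreover have "cos (pi * (1 - \<delta>)) = - cos (pi * \<delta>)" by (simp add: right_diff_distrib)
    ultimately have "\<bar>cos (pi * \<bar>x - x0\<bar>)\<bar> \<le> \<bar>cos (pi * \<delta>)\<bar>" by simp
    hence "cos (pi * \<bar>x - x0\<bar>) ^ 2 \<le> \<rho>" unfolding \<rho>_def by (subst (asm) abs_le_square_iff)
    moreover have "cos (pi * \<bar>x - x0\<bar>) = cos (pi * (x - x0))"
      by (cases "x \<ge> x0") (simp_all add: abs_if, metis cos_minus minus_diff_eq mult_minus_right)
    ultimately show ?thesis unfolding K_def by simp
  qed
  have K_near: "K x \<ge> \<rho>'" if "\<bar>x - x0\<bar> \<le> \<delta>/2" for x
  proof -
    have "cos (pi * (\<delta>/2)) \<le> cos (pi * \<bar>x - x0\<bar>)" using that d by (intro cos_monotone_0_pi_le) auto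
    moreover have "cos (pi * \<bar>x - x0\<bar>) = cos (pi * (x - x0))"
      by (cases "x \<ge> x0") (simp_all add: abs_if, metis cos_minus minus_diff_eq mult_minus_right)
    ultimately show ?thesis unfolding K_def \<rho>'_def using cosd by (intro power_mono) auto
  qed
  have main: "\<epsilon> * \<delta> * \<rho>' ^ n \<le> M * \<rho> ^ n" for n
  proof -
    let ?I = "{x0 - \<delta>/2 .. x0 + \<delta>/2}"
    have sub: "?I \<subseteq> {0..1}" using d by auto
    \<comment> \<open>Adding \<open>M * \<rho> ^ n\<close> makes the integrand nonnegative on the
      whole interval, so that restricting to the neighbourhood of x0 can only decrease the
      integral.\<close>
    have nonneg: "h x * K x ^ n + M * \<rho> ^ n \<ge> 0" if x: "x \<in> {0..1}" for x
    proof (cases "\<bar>x - x0\<bar> < \<delta>")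
      case True
      hence "h x > \<epsilon>" using d1(2)[of x] h0 d eps by auto
      thus ?thesis using eps M rho unfolding K_def by (intro add_nonneg_nonneg mult_nonneg_nonneg) auto
    next
      case False
      have "\<bar>h x * K x ^ n\<bar> \<le> M * \<rho> ^ n" unfolding abs_mult
        using M x K_far[OF x] False rho
        by (intro mult_mono) (auto simp: K_def abs_mult power_abs intro!: power_mono)
      thus ?thesis by linarith
    qed
    have ci: "(\<lambda>x. h x * K x ^ n + M * \<rho> ^ n) integrable_on S" if "S \<in> {{0..1}, ?I}" for S
      using that sub by (auto intro!: integrable_continuous_interval continuous_intros)
    have "\<epsilon> * \<delta> * \<rho>' ^ n = integral ?I (\<lambda>x. \<epsilon> * \<rho>' ^ n)" using d by (simp add: algebra_simps)
    also have "\<dots> \<le> integral ?I (\<lambda>x. h x * K x ^ n + M * \<rho> ^ n)"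
    proof (rule integral_le)
      fix x assume x: "x \<in> ?I"
      hence near: "\<bar>x - x0\<bar> \<le> \<delta>/2" unfolding abs_le_iff by auto
      hence "h x \<ge> \<epsilon>" using d1(2)[of x] h0 d by auto
      hence "\<epsilon> * \<rho>' ^ n \<le> h x * K x ^ n" using K_near[OF near] rho eps by (intro mult_mono power_mono) auto
      thus "\<epsilon> * \<rho>' ^ n \<le> h x * K x ^ n + M * \<rho> ^ n" using M rho by (smt (verit) mult_nonneg_nonneg zero_le_power)
    qed (use ci in auto)
    also have "\<dots> \<le> integral {0..1} (\<lambda>x. h x * K x ^ n + M * \<rho> ^ n)"
      by (intro integral_subset_le sub ci ballI nonneg) auto
    also have "\<dots> = integral {0..1} (\<lambda>x. h x * K x ^ n) + M * \<rho> ^ n"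
      by (subst integral_add) (auto intro!: integrable_continuous_interval continuous_intros)
    finally show ?thesis by (simp add: hint)
  qed
  have "(\<lambda>n. (\<rho> / \<rho>') ^ n) \<longlonglongrightarrow> 0" using rho by (intro LIMSEQ_power_zero) auto
  moreover have "\<epsilon> * \<delta> / M \<le> (\<rho> / \<rho>') ^ n" for n
    using main[of n] M rho by (simp add: field_simps)
  ultimately have "\<epsilon> * \<delta> / M \<le> 0" by (intro LIMSEQ_le_const) auto
  thus False using eps d M by (simp add: field_simps mult_le_0_iff)
qed

lemma integral_infsum_interval:
  fixes f :: "'a \<Rightarrow> real \<Rightarrow> complex"
  assumes cont: "\<And>i. continuous_on {a..b} (f i)"
    and M: "\<And>i x. x \<in> {a..b} \<Longrightarrow> norm (f i x) \<le> M i" "M summable_on UNIV"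
  shows "((\<lambda>i. integral {a..b} (f i)) has_sum integral {a..b} (\<lambda>x. infsum (\<lambda>i. f i x) UNIV)) UNIV"
    and "continuous_on {a..b} (\<lambda>x. infsum (\<lambda>i. f i x) UNIV)"
proof -
  have u: "uniform_limit {a..b} (\<lambda>X y. \<Sum>x\<in>X. f x y) (\<lambda>x. infsum (\<lambda>i. f i x) UNIV) (finite_subsets_at_top UNIV)"
    by (rule Weierstrass_m_test_general[where M = M]) (use M in auto)
  have c: "continuous_on {a..b} (\<lambda>y. \<Sum>x\<in>X. f x y)" for X
    by (intro continuous_intros cont)
  obtain I J where IJ: "\<And>X. ((\<lambda>y. \<Sum>x\<in>X. f x y) has_integral I X) {a..b}"
     "((\<lambda>x. infsum (\<lambda>i. f i x) UNIV) has_integral J) {a..b}" "(I \<longlongrightarrow> J) (finite_subsets_at_top UNIV)"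
    using uniform_limit_integral[OF u c] by (metis finite_subsets_at_top_neq_bot)
  have "I X = (\<Sum>x\<in>X. integral {a..b} (f x))" if "finite X" for X
  proof -
    have "I X = integral {a..b} (\<lambda>y. \<Sum>x\<in>X. f x y)" using IJ(1)[of X] by (simp add: integral_unique)
    also have "\<dots> = (\<Sum>x\<in>X. integral {a..b} (f x))"
      using that cont by (intro integral_sum integrable_continuous_interval) auto
    finally show ?thesis .
  qed
  hence "\<forall>\<^sub>F X in finite_subsets_at_top UNIV. I X = (\<Sum>x\<in>X. integral {a..b} (f x))"
    by (intro eventually_finite_subsets_at_top_weakI) auto
  hence "((\<lambda>X. \<Sum>x\<in>X. integral {a..b} (f x)) \<longlongrightarrow> J) (finite_subsets_at_top UNIV)"
    using IJ(3) by (rule Lim_transform_eventually[rotated])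
  moreover have "J = integral {a..b} (\<lambda>x. infsum (\<lambda>i. f i x) UNIV)"
    using IJ(2) by (simp add: integral_unique)
  ultimately show "((\<lambda>i. integral {a..b} (f i)) has_sum integral {a..b} (\<lambda>x. infsum (\<lambda>i. f i x) UNIV)) UNIV"
    by (simp add: has_sum_def)
  show "continuous_on {a..b} (\<lambda>x. infsum (\<lambda>i. f i x) UNIV)"
    by (rule uniform_limit_theorem[OF _ u]) (use c in auto)
qed

text \<open>The characteristic function of the standard normal distribution is the Fourier transform
  of a Gaussian; the substitution x -> r x with r^2 = s / (2 pi) adjusts the variance.\<close>

lemma gaussian_fourier:
  fixes s k :: real
  assumes s: "s > 0"
  shows "integrable lborel (\<lambda>x. complex_of_real (exp (- pi * x^2 / s)) * exp (2 * pi * \<i> * of_real k * of_real x))"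
    and "integral\<^sup>L lborel (\<lambda>x. complex_of_real (exp (- pi * x^2 / s)) * exp (2 * pi * \<i> * of_real k * of_real x))
           = of_real (sqrt s * exp (- pi * s * k^2))"
proof -
  define r where "r = sqrt (s / (2 * pi))"
  have r: "r > 0" "r^2 = s / (2 * pi)" using s by (auto simp: r_def)
  define f where "f x = complex_of_real (exp (- pi * x^2 / s)) * exp (2 * pi * \<i> * of_real k * of_real x)" for x :: real
  define t where "t = 2 * pi * k * r"
  have fr: "f (r * x) = complex_of_real (exp (- (x^2) / 2)) * exp (\<i> * of_real (t * x))" for x
  proof -
    have "pi * (r * x)^2 / s = x^2 / 2" using s r(2) by (simp add: power_mult_distrib)
    thus ?thesis by (simp add: f_def t_def mult_ac)
  qed
  have fr': "f (r * x) = sqrt (2 * pi) *\<^sub>R (std_normal_density x *\<^sub>R exp (\<i> * of_real (t * x)))" for x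
    unfolding fr by (simp add: std_normal_density_def scaleR_conv_of_real real_sqrt_mult)
  have "(\<lambda>x. f x) \<in> borel_measurable lborel" unfolding f_def
    by (intro borel_measurable_times borel_measurable_of_real) (auto intro!: borel_measurable_continuous_onI continuous_intros)
  have mi: "(\<lambda>x. exp (\<i> * of_real (t * x))) \<in> borel_measurable lborel"
    by (auto intro!: borel_measurable_continuous_onI continuous_intros)
  have i0: "integrable lborel (\<lambda>x. std_normal_density x *\<^sub>R exp (\<i> * of_real (t * x)))"
  proof (rule Bochner_Integration.integrable_bound)
    show "integrable lborel std_normal_density" using integrable_std_normal_moment[of 0] by simp
    show "(\<lambda>x. std_normal_density x *\<^sub>R exp (\<i> * of_real (t * x))) \<in> borel_measurable lborel" using mi by measurable
  qed (auto simp: normal_density_nonneg)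
  have i1: "integrable lborel (\<lambda>x. f (r * x))"
    unfolding fr' by (rule integrable_scaleR_right) (rule i0)
  have i2: "integral\<^sup>L lborel (\<lambda>x. std_normal_density x *\<^sub>R exp (\<i> * of_real (t * x))) = exp (- (t^2) / 2)"
  proof -
    have "exp (- (t^2) / 2) = char std_normal_distribution t" 
      by (simp add: char_std_normal_distribution)
    also have "\<dots> = integral\<^sup>L lborel (\<lambda>x. std_normal_density x *\<^sub>R exp (\<i> * of_real (t * x)))"
      unfolding char_def by (subst integral_density) (use mi in \<open>auto simp: normal_density_nonneg\<close>)
    finally show ?thesis by simp
  qed
  show "integrable lborel (\<lambda>x. complex_of_real (exp (- pi * x^2 / s)) * exp (2 * pi * \<i> * of_real k * of_real x))"
    using i1 lborel_integrable_real_affine_iff[of r f 0] r unfolding f_def by simp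
  have "integral\<^sup>L lborel f = r *\<^sub>R integral\<^sup>L lborel (\<lambda>x. f (r * x))"
    using lborel_integral_real_affine[of r f 0] r by simp
  also have "\<dots> = r *\<^sub>R (sqrt (2 * pi) *\<^sub>R complex_of_real (exp (- (t^2) / 2)))"
    unfolding fr' by (simp only: integral_scaleR_right i2)
  also have "\<dots> = of_real ((r * sqrt (2 * pi)) * exp (- (t^2) / 2))"
    by (simp add: scaleR_conv_of_real mult_ac)
  also have "r * sqrt (2 * pi) = sqrt s" using s by (simp add: r_def flip: real_sqrt_mult)
  also have "- (t^2) / 2 = - pi * s * k^2"
    using r(2) s by (simp add: t_def power_mult_distrib field_simps power2_eq_square)
  finally show "integral\<^sup>L lborel (\<lambda>x. complex_of_real (exp (- pi * x^2 / s)) * exp (2 * pi * \<i> * of_real k * of_real x))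
           = of_real (sqrt s * exp (- pi * s * k^2))"
    unfolding f_def .
qed

text \<open>The unfolding step of Poisson summation. The integrals over [-N,N] tend to the integral
  over the line by dominated convergence; since the series is assumed summable, this one exhausting
  sequence determines its value.\<close>

lemma has_sum_unit_intervals:
  fixes f :: "real \<Rightarrow> complex"
  assumes c: "continuous_on UNIV f" and i: "integrable lborel f"
    and s: "(\<lambda>n::int. integral {0..1} (\<lambda>x. f (x + of_int n))) summable_on UNIV"
  shows "((\<lambda>n::int. integral {0..1} (\<lambda>x. f (x + of_int n))) has_sum integral\<^sup>L lborel f) UNIV"
proof -
  define a where "a n = integral {0..1} (\<lambda>x. f (x + of_int n))" for n :: int
  have a: "a n = integral {of_int n..of_int n + 1} f" for n
    unfolding a_def using integral_shift_Icc_real[of 0 1 f "of_int n"] by (simp add: o_def add.commute)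
  have part: "(\<Sum>n\<in>{- int N..<int N}. a n) = integral {- real N..real N} f" for N
  proof (induction N)
    case 0
    show ?case by simp
  next
    case (Suc N)
    have e: "{- int (Suc N)..<int (Suc N)} = insert (- int (Suc N)) (insert (int N) {- int N..<int N})" by auto
    have ii: "f integrable_on {x..y}" for x y
      by (intro integrable_continuous_interval continuous_on_subset[OF c]) auto
    have "(\<Sum>n\<in>{- int (Suc N)..<int (Suc N)}. a n) = a (- int (Suc N)) + (a (int N) + integral {- real N..real N} f)"
      unfolding e by (subst sum.insert; simp add: Suc)+ 
    also have "\<dots> = integral {- real (Suc N).. - real N} f + (integral {- real N..real N} f + integral {real N..real (Suc N)} f)"
      by (simp add: a algebra_simps)
    also have "integral {- real N..real N} f + integral {real N..real (Suc N)} f = integral {- real N..real (Suc N)} f"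
      by (rule Henstock_Kurzweil_Integration.integral_combine) (use ii in auto)
    also have "integral {- real (Suc N).. - real N} f + integral {- real N..real (Suc N)} f = integral {- real (Suc N)..real (Suc N)} f"
      by (rule Henstock_Kurzweil_Integration.integral_combine) (use ii in auto)
    finally show ?case .
  qed
  have "(\<lambda>N. integral\<^sup>L lborel (\<lambda>x. indicator {- real N..real N} x *\<^sub>R f x)) \<longlonglongrightarrow> integral\<^sup>L lborel f"
  proof (rule integral_dominated_convergence[where w = "\<lambda>x. norm (f x)"])
    show "f \<in> borel_measurable lborel" using i by simp
    show "(\<lambda>x. indicator {- real N..real N} x *\<^sub>R f x) \<in> borel_measurable lborel" for N using i by measurable
    show "AE x in lborel. (\<lambda>N. indicator {- real N..real N} x *\<^sub>R f x) \<longlonglongrightarrow> f x"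
    proof (intro AE_I2 tendsto_eventually)
      fix x :: real
      obtain N0 where "\<bar>x\<bar> \<le> real N0" using real_arch_simple by blast
      thus "\<forall>\<^sub>F N in sequentially. indicator {- real N..real N} x *\<^sub>R f x = f x"
        by (intro eventually_sequentiallyI[of N0]) (auto simp: indicator_def)
    qed
    show "AE x in lborel. norm (indicator {- real N..real N} x *\<^sub>R f x) \<le> norm (f x)" for N
      by (auto simp: indicator_def)
  qed (use i in auto)
  moreover have "integral\<^sup>L lborel (\<lambda>x. indicator {- real N..real N} x *\<^sub>R f x) = integral {- real N..real N} f" for N
    using set_borel_integral_eq_integral(2)[of "{- real N..real N}" f] i
    by (simp add: set_lebesgue_integral_def set_integrable_def integrable_mult_indicator)
  ultimately have "(\<lambda>N. \<Sum>n\<in>{- int N..<int N}. a n) \<longlonglongrightarrow> integral\<^sup>L lborel f" by (simp add: part)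
  moreover have "(\<lambda>N. \<Sum>n\<in>{- int N..<int N}. a n) \<longlonglongrightarrow> infsum a UNIV"
  proof -
    have "(sum a \<longlongrightarrow> infsum a UNIV) (finite_subsets_at_top UNIV)"
      using s unfolding a_def by (rule infsum_tendsto)
    moreover have "filterlim (\<lambda>N. {- int N..<int N}) (finite_subsets_at_top UNIV) sequentially"
      unfolding filterlim_finite_subsets_at_top
    proof safe
      fix X :: "int set" assume X: "finite X"
      obtain B where B: "\<And>x. x \<in> X \<Longrightarrow> \<bar>x\<bar> \<le> B" using X by (metis Max_ge finite_imageI image_eqI)
      show "\<forall>\<^sub>F y in sequentially. finite {- int y..<int y} \<and> X \<subseteq> {- int y..<int y} \<and> {- int y..<int y} \<subseteq> UNIV"
        by (intro eventually_sequentiallyI[of "nat (B + 1)"]) (use B in \<open>force simp: abs_le_iff\<close>)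
    qed
    ultimately show ?thesis by (rule filterlim_compose)
  qed
  ultimately have "infsum a UNIV = integral\<^sup>L lborel f" by (rule LIMSEQ_unique[rotated])
  thus ?thesis using s has_sum_infsum unfolding a_def by metis
qed

text \<open>A majorant independent of x: expanding the square leaves a Gaussian in n with a linear
  perturbation.\<close>

lemma summable_shifted_gaussian:
  fixes s :: real
  assumes "s > 0" "\<bar>x\<bar> \<le> 1"
  shows "exp (- pi * (x + of_int n)^2 / s) \<le> exp ((2 * pi * (1 / s) + 1)^2 / (4 * pi * (1/s))) * exp (- \<bar>real_of_int n\<bar>)"
proof -
  have "- pi * (x + of_int n)^2 / s \<le> - pi * (1/s) * (of_int n)^2 + 2 * pi * (1/s) * \<bar>real_of_int n\<bar>"
  proof -
    have "- (x * of_int n) \<le> \<bar>real_of_int n\<bar>"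
    proof -
      have "- (x * of_int n) \<le> \<bar>x\<bar> * \<bar>real_of_int n\<bar>" by (metis abs_ge_minus_self abs_mult)
      also have "\<dots> \<le> 1 * \<bar>real_of_int n\<bar>" by (intro mult_right_mono assms) auto
      finally show ?thesis by simp
    qed
    moreover have "(x + of_int n)^2 = x^2 + 2 * (x * of_int n) + (of_int n)^2" by (simp add: power2_eq_square algebra_simps)
    ultimately have "- ((x + of_int n)^2) \<le> - ((real_of_int n)^2) + 2 * \<bar>real_of_int n\<bar>"
      by (smt (verit) zero_le_power2)
    hence "(pi / s) * (- ((x + of_int n)^2)) \<le> (pi / s) * (- ((real_of_int n)^2) + 2 * \<bar>real_of_int n\<bar>)"
      using assms by (intro mult_left_mono) auto
    thus ?thesis by (simp add: algebra_simps)
  qed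
  also have "\<dots> \<le> (2 * pi * (1/s) + 1)^2 / (4 * pi * (1/s)) - \<bar>real_of_int n\<bar>"
    using gauss_le_exp_abs[of "1/s" "of_int n" "1/s"] assms by simp
  finally have "exp (- pi * (x + of_int n)^2 / s) \<le> exp ((2 * pi * (1/s) + 1)^2 / (4 * pi * (1/s)) - \<bar>real_of_int n\<bar>)" by simp
  thus ?thesis by (simp only: exp_diff exp_minus divide_inverse)
qed

text \<open>Both sides are continuous on [0,1] and have the same Fourier coefficients: on the left a
  coefficient unfolds to an integral over the line, on the right orthogonality leaves one
  term.\<close>

lemma poisson_gaussian:
  fixes s x :: real
  assumes s: "s > 0" and x: "0 < x" "x < 1"
  shows "(\<Sum>\<^sub>\<infinity>n::int. complex_of_real (exp (- pi * (x + of_int n)^2 / s))) = sqrt s * th (\<i> * s) x"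
proof -
  define g where "g x = (\<Sum>\<^sub>\<infinity>n::int. complex_of_real (exp (- pi * (x + of_int n)^2 / s)))" for x :: real
  define h where "h x = complex_of_real (sqrt s) * th (\<i> * s) (complex_of_real x)" for x :: real
  define M where "M n = exp ((2 * pi * (1 / s) + 1)^2 / (4 * pi * (1/s))) * exp (- \<bar>real_of_int n\<bar>)" for n :: int
  have M: "M summable_on UNIV" unfolding M_def using summable_on_exp_abs_int[of 1] by (intro summable_on_cmult_right) auto
  define e where "e k x = exp (2 * pi * \<i> * of_int k * complex_of_real x)" for k :: int and x :: real
  have ne: "norm (e k x) = 1" for k x unfolding e_def by (simp add: norm_exp_eq_Re)
  have ec [continuous_intros]: "continuous_on S (e k)" for S k
    unfolding e_def by (intro continuous_intros)
  define N where "N n = exp (- pi * s * real_of_int n ^ 2)" for n :: int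
  have N: "N summable_on UNIV"
  proof -
    have "(\<lambda>n::int. norm (exp (pi * \<i> * (\<i> * s) * of_int n ^ 2 + 2 * pi * \<i> * of_int n * 0))) summable_on UNIV"
      by (rule abs_summable_th) (use s in auto)
    thus ?thesis unfolding N_def by (simp add: norm_exp_eq_Re power2_eq_square mult_ac)
  qed
  have hs: "h x = (\<Sum>\<^sub>\<infinity>n::int. of_real (sqrt s * N n) * e n x)" for x
  proof -
    have "th (\<i> * s) (complex_of_real x) = (\<Sum>\<^sub>\<infinity>n::int. of_real (N n) * e n x)"
      unfolding th_def N_def e_def
    proof (intro infsum_cong)
      fix n :: int
      have "pi * \<i> * (\<i> * s) * of_int n ^ 2 = complex_of_real (- pi * s * real_of_int n ^ 2)"
        by (simp add: complex_eq_iff power2_eq_square)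
      thus "exp (pi * \<i> * (\<i> * s) * of_int n ^ 2 + 2 * pi * \<i> * of_int n * complex_of_real x)
          = of_real (exp (- pi * s * real_of_int n ^ 2)) * exp (2 * pi * \<i> * of_int n * complex_of_real x)"
        by (simp only: exp_add exp_of_real)
    qed
    thus ?thesis unfolding h_def by (simp add: mult.assoc infsum_cmult_right')
  qed
  have G: "((\<lambda>n. integral {0..1} (\<lambda>x. complex_of_real (exp (- pi * (x + of_int n)^2 / s)) * e k x)) has_sum 
        integral {0..1} (\<lambda>x. infsum (\<lambda>n::int. complex_of_real (exp (- pi * (x + of_int n)^2 / s)) * e k x) UNIV)) UNIV"
      "continuous_on {0..1} (\<lambda>x. infsum (\<lambda>n::int. complex_of_real (exp (- pi * (x + of_int n)^2 / s)) * e k x) UNIV)" for k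
  proof -
    have c: "continuous_on {0..1} (\<lambda>x. complex_of_real (exp (- pi * (x + of_int n)^2 / s)) * e k x)" for n :: int
      by (intro continuous_intros) (use s in auto)
    have b: "norm (complex_of_real (exp (- pi * (x + of_int n)^2 / s)) * e k x) \<le> M n" if "x \<in> {0..1}" for n x
      using summable_shifted_gaussian[OF s, of x n] that unfolding M_def norm_mult ne by simp
    show "((\<lambda>n. integral {0..1} (\<lambda>x. complex_of_real (exp (- pi * (x + of_int n)^2 / s)) * e k x)) has_sum 
        integral {0..1} (\<lambda>x. infsum (\<lambda>n::int. complex_of_real (exp (- pi * (x + of_int n)^2 / s)) * e k x) UNIV)) UNIV"
      "continuous_on {0..1} (\<lambda>x. infsum (\<lambda>n::int. complex_of_real (exp (- pi * (x + of_int n)^2 / s)) * e k x) UNIV)"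
      using integral_infsum_interval[OF c b M] by auto
  qed
  have ge: "infsum (\<lambda>n::int. complex_of_real (exp (- pi * (x + of_int n)^2 / s)) * e k x) UNIV = g x * e k x" for x k
    unfolding g_def by (rule infsum_cmult_left')
  have cg: "continuous_on {0..1} g" using G(2)[of 0] unfolding ge by (simp add: e_def)
  have H: "((\<lambda>n. integral {0..1} (\<lambda>x. of_real (sqrt s * N n) * e (n + k) x)) has_sum 
        integral {0..1} (\<lambda>x. infsum (\<lambda>n::int. of_real (sqrt s * N n) * e (n + k) x) UNIV)) UNIV"
      "continuous_on {0..1} (\<lambda>x. infsum (\<lambda>n::int. of_real (sqrt s * N n) * e (n + k) x) UNIV)" for k
  proof -
    have c: "continuous_on {0..1} (\<lambda>x. of_real (sqrt s * N n) * e (n + k) x)" for n :: int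
      by (intro continuous_intros)
    have b: "norm (of_real (sqrt s * N n) * e (n + k) x) \<le> sqrt s * N n" if "x \<in> {0..1}" for n x
      using s unfolding norm_mult ne norm_of_real by (simp add: N_def)
    show "((\<lambda>n. integral {0..1} (\<lambda>x. of_real (sqrt s * N n) * e (n + k) x)) has_sum 
        integral {0..1} (\<lambda>x. infsum (\<lambda>n::int. of_real (sqrt s * N n) * e (n + k) x) UNIV)) UNIV"
      "continuous_on {0..1} (\<lambda>x. infsum (\<lambda>n::int. of_real (sqrt s * N n) * e (n + k) x) UNIV)"
      using integral_infsum_interval[OF c b summable_on_cmult_right[OF N]] by auto
  qed
  have he: "infsum (\<lambda>n::int. of_real (sqrt s * N n) * e (n + k) x) UNIV = h x * e k x" for x k
  proof -
    have "e (n + k) x = e n x * e k x" for n unfolding e_def exp_add [symmetric] by (simp add: algebra_simps)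
    thus ?thesis unfolding hs by (simp add: infsum_cmult_left' flip: mult.assoc)
  qed
  have ch: "continuous_on {0..1} h" using H(2)[of 0] unfolding he by (simp add: e_def)
  have gk: "integral {0..1} (\<lambda>x. g x * e k x) = of_real (sqrt s * N k)" for k
  proof -
    define f where "f x = complex_of_real (exp (- pi * x^2 / s)) * e k x" for x
    \<comment> \<open>The character \<open>e k\<close> has period 1, so every summand is a translate
      of one function on the line.\<close>
    have fe: "complex_of_real (exp (- pi * (x + of_int n)^2 / s)) * e k x = f (x + of_int n)" for x n
    proof -
      have "e k (x + of_int n) = e k x * exp (2 * pi * \<i> * of_int (k * n))"
        unfolding e_def exp_add [symmetric] by (simp add: algebra_simps)
      also have "exp (2 * pi * \<i> * of_int (k * n)) = 1" 
        using exp_integer_2pi[of "of_int (k * n)"] by (simp add: mult_ac)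
      finally show ?thesis unfolding f_def by simp
    qed
    have "((\<lambda>n::int. integral {0..1} (\<lambda>x. f (x + of_int n))) has_sum integral\<^sup>L lborel f) UNIV"
    proof (rule has_sum_unit_intervals)
      show "continuous_on UNIV f" unfolding f_def by (intro continuous_intros) (use s in auto)
      show "integrable lborel f" unfolding f_def e_def using gaussian_fourier(1)[OF s, of "of_int k"] by simp
      show "(\<lambda>n. integral {0..1} (\<lambda>x. f (x + real_of_int n))) summable_on UNIV"
        using G(1)[of k] unfolding fe by (rule has_sum_imp_summable)
    qed
    moreover have "integral\<^sup>L lborel f = of_real (sqrt s * N k)"
      unfolding f_def e_def N_def using gaussian_fourier(2)[OF s, of "of_int k"] by simp
    moreover have "((\<lambda>n::int. integral {0..1} (\<lambda>x. f (x + of_int n))) has_sum integral {0..1} (\<lambda>x. g x * e k x)) UNIV"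
      using G(1)[of k, unfolded ge] unfolding fe .
    ultimately show ?thesis using has_sum_unique by fastforce
  qed
  have e0: "integral {0..1} (e m) = (if m = 0 then 1 else 0)" for m
  proof (cases "m = 0")
    case False
    have "((\<lambda>x. e m x) has_integral (e m 1 / (2 * pi * \<i> * of_int m) - e m 0 / (2 * pi * \<i> * of_int m))) {0..1}"
      unfolding e_def
    proof (rule fundamental_theorem_of_calculus)
      fix x :: real
      let ?c = "2 * pi * \<i> * of_int m :: complex"
      have "((\<lambda>z. exp (?c * z) / ?c) has_field_derivative exp (?c * of_real x)) (at (of_real x))"
        using False by (auto intro!: derivative_eq_intros)
      from has_vector_derivative_real_field[OF this]
      show "((\<lambda>x. exp (?c * complex_of_real x) / ?c) has_vector_derivative exp (?c * complex_of_real x)) (at x within {0..1})"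
        by simp
    qed simp
    moreover have "e m 1 = 1" using exp_integer_2pi[of "of_int m"] by (simp add: e_def mult_ac)
    moreover have "e m 0 = 1" by (simp add: e_def)
    ultimately show ?thesis using False by (simp add: integral_unique)
  next
    case True
    hence "e m = (\<lambda>_. 1)" by (auto simp: e_def)
    thus ?thesis using True by simp
  qed
  have hk: "integral {0..1} (\<lambda>x. h x * e k x) = of_real (sqrt s * N k)" for k
  proof -
    \<comment> \<open>Only n = -k survives, and N is even in n.\<close>
    have "integral {0..1} (\<lambda>x. of_real (sqrt s * N n) * e (n + k) x) = (if n = -k then of_real (sqrt s * N k) else 0)" for n
      using e0[of "n + k"] by (auto simp: N_def add_eq_0_iff2)
    hence "((\<lambda>n. if n = -k then of_real (sqrt s * N k) else 0) has_sum integral {0..1} (\<lambda>x. h x * e k x)) UNIV"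
      using H(1)[of k] unfolding he by simp
    moreover have "((\<lambda>n. if n = -k then of_real (sqrt s * N k) else 0) has_sum complex_of_real (sqrt s * N k)) UNIV"
      by (rule has_sum_finite_neutralI[where B = "{-k}"]) auto
    ultimately show ?thesis by (rule has_sum_unique)
  qed
  have "g x - h x = 0"
  proof (rule fourier_uniqueness_interior[of "\<lambda>x. g x - h x"])
    show "continuous_on {0..1} (\<lambda>x. g x - h x)" by (intro continuous_intros cg ch)
    fix k :: int
    have "integral {0..1} (\<lambda>x. (g x - h x) * e k x) = integral {0..1} (\<lambda>x. g x * e k x) - integral {0..1} (\<lambda>x. h x * e k x)"
      unfolding left_diff_distrib
      by (intro integral_diff integrable_continuous_interval continuous_intros cg ch)
    hence "integral {0..1} (\<lambda>x. (g x - h x) * e k x) = 0" by (simp add: gk hk)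
    thus "integral {0..1} (\<lambda>x. (g x - h x) * exp (2 * pi * \<i> * of_int k * complex_of_real x)) = 0"
      by (simp add: e_def)
  qed (use x in auto)
  thus ?thesis unfolding g_def h_def by simp
qed

section \<open>The inversion formula of the theta function\<close>

lemma th_inversion_imaginary:
  fixes s x :: real
  assumes s: "s > 0" and x: "0 < x" "x < 1"
  shows "th (- 1 / (\<i> * s)) (x / (\<i> * s)) = csqrt (- \<i> * (\<i> * s)) * exp (pi * \<i> * x^2 / (\<i> * s)) * th (\<i> * s) x"
proof -
  have "th (- 1 / (\<i> * s)) (x / (\<i> * s)) = (\<Sum>\<^sub>\<infinity>n::int. exp (pi * \<i> * x^2 / (\<i> * s)) * complex_of_real (exp (- pi * (x - of_int n)^2 / s)))"
    unfolding th_def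
  proof (intro infsum_cong)
    fix n :: int
    have "pi * \<i> * (- 1 / (\<i> * s)) * of_int n ^ 2 + 2 * pi * \<i> * of_int n * (x / (\<i> * s))
       = pi * \<i> * x^2 / (\<i> * s) + complex_of_real (- pi * (x - of_int n)^2 / s)"
    proof -
      have a: "c / (\<i> * complex_of_real s) = - (\<i> * c) / s" for c
        by (simp flip: divide_divide_eq_left)
      show ?thesis unfolding a by (simp add: a power2_eq_square diff_divide_distrib add_divide_distrib algebra_simps)
    qed
    thus "exp (pi * \<i> * (- 1 / (\<i> * s)) * of_int n ^ 2 + 2 * pi * \<i> * of_int n * (x / (\<i> * s)))
       = exp (pi * \<i> * x^2 / (\<i> * s)) * complex_of_real (exp (- pi * (x - of_int n)^2 / s))"
      by (simp only: exp_add exp_of_real)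
  qed
  also have "\<dots> = exp (pi * \<i> * x^2 / (\<i> * s)) * (\<Sum>\<^sub>\<infinity>n::int. complex_of_real (exp (- pi * (x - of_int n)^2 / s)))"
    by (rule infsum_cmult_right')
  also have "(\<Sum>\<^sub>\<infinity>n::int. complex_of_real (exp (- pi * (x - of_int n)^2 / s))) = (\<Sum>\<^sub>\<infinity>n::int. complex_of_real (exp (- pi * (x + of_int n)^2 / s)))"
    by (rule infsum_reindex_bij_witness[of _ uminus uminus]) auto
  also have "\<dots> = sqrt s * th (\<i> * s) x" by (rule poisson_gaussian[OF assms])
  also have "complex_of_real (sqrt s) = csqrt (- \<i> * (\<i> * s))"
  proof -
    have "- \<i> * (\<i> * s) = complex_of_real s" by (simp flip: mult.assoc)
    thus ?thesis using s csqrt_of_real_nonneg[of s] by simp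
  qed
  finally show ?thesis by (simp add: mult_ac)
qed

text \<open>Two analytic continuations: in t from the imaginary axis for fixed v in (0,1), then in v
  from (0,1) to the plane. The principal root is holomorphic because -i t has positive real
  part.\<close>

theorem th_inversion:
  assumes t: "Im t > 0"
  shows "th (- 1 / t) (v / t) = csqrt (- \<i> * t) * exp (pi * \<i> * v^2 / t) * th t v"
proof -
  let ?H = "{t. Im t > 0}"
  have H: "open ?H" "connected ?H" 
    by (auto simp: open_halfspace_Im_gt convex_connected convex_halfspace_Im_gt)
  have inv: "Im (- 1 / t) > 0" if "Im t > 0" for t
    using that by (auto simp: Im_divide power2_eq_square intro!: divide_pos_pos add_nonneg_pos)
  have inv': "Im (1 / t) < 0" if "Im t > 0" for t using inv[OF that] by simp
  have real: "th (- 1 / t) (x / t) = csqrt (- \<i> * t) * exp (pi * \<i> * x^2 / t) * th t x"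
    if t: "Im t > 0" and x: "0 < x" "x < 1" for t :: complex and x :: real
  proof -
    define f where "f = (\<lambda>t::complex. th (- 1 / t) (x / t) - csqrt (- \<i> * t) * exp (pi * \<i> * x^2 / t) * th t x)"
    have "f t = 0"
    proof (rule analytic_continuation[of f ?H "{\<i> * of_real s | s. s > 0}" \<i>])
      have nz: "t \<noteq> 0" if "Im t > 0" for t using that by auto
      show "f holomorphic_on ?H" unfolding f_def
        by (intro holomorphic_intros holomorphic_th H holomorphic_on_csqrt'[unfolded o_def])
           (use inv' nz in \<open>auto simp: complex_nonpos_Reals_iff\<close>)
      show "\<i> islimpt {\<i> * complex_of_real s |s. 0 < s}"
        unfolding islimpt_approachable
      proof safe
        fix e :: real assume e: "e > 0"
        have "\<i> * complex_of_real (1 + e/2) \<in> {\<i> * complex_of_real s |s. 0 < s}"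
          unfolding mem_Collect_eq by (rule exI[of _ "1 + e/2"]) (use e in simp)
        moreover have "\<i> * complex_of_real (1 + e/2) \<noteq> \<i>" using e by simp
        moreover have "dist (\<i> * complex_of_real (1 + e/2)) \<i> < e" 
          using e by (simp add: dist_norm ring_distribs norm_mult)
        ultimately show "\<exists>x'\<in>{\<i> * complex_of_real s |s. 0 < s}. x' \<noteq> \<i> \<and> dist x' \<i> < e" by blast
      qed
      show "f z = 0" if "z \<in> {\<i> * complex_of_real s |s. 0 < s}" for z
        using that th_inversion_imaginary[OF _ x] by (auto simp: f_def)
    qed (use H t in auto)
    thus ?thesis by (simp add: f_def)
  qed
  define f where "f = (\<lambda>v::complex. th (- 1 / t) (v / t) - csqrt (- \<i> * t) * exp (pi * \<i> * v^2 / t) * th t v)"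
  have "f v = 0"
  proof (rule analytic_continuation[of f UNIV "of_real ` {0<..<1}" "1/2"])
    show "f holomorphic_on UNIV" unfolding f_def
      by (intro holomorphic_intros holomorphic_th) (use t inv'[OF t] in auto)
    show "1 / 2 islimpt complex_of_real ` {0<..<1}"
      unfolding islimpt_approachable
    proof safe
      fix e :: real assume e: "e > 0"
      define d where "d = min (1/4) (e/2)"
      have d: "d > 0" "d \<le> 1/4" "d < e" using e by (auto simp: d_def)
      have "complex_of_real (1/2 + d) \<in> complex_of_real ` {0<..<1}" using d by (intro imageI) auto
      moreover have "complex_of_real (1/2 + d) \<noteq> 1/2" using d by simp
      moreover have "dist (complex_of_real (1/2 + d)) (1/2) < e" using d by (simp add: dist_norm)
      ultimately show "\<exists>x'\<in>complex_of_real ` {0<..<1}. x' \<noteq> 1/2 \<and> dist x' (1/2) < e" by blast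
    qed
    show "f z = 0" if "z \<in> complex_of_real ` {0<..<1}" for z
      using that real[OF t] by (auto simp: f_def)
  qed auto
  thus ?thesis by (simp add: f_def)
qed

section \<open>The Jacobi triple product\<close>

text \<open>Dominated convergence for unordered sums. It carries both the triple product and the eta
  quotient from finite truncations to the limit.\<close>

lemma tannery_infsum:
  fixes a :: "'i \<Rightarrow> nat \<Rightarrow> complex"
  assumes lim: "\<And>i. i \<in> A \<Longrightarrow> (\<lambda>n. a i n) \<longlonglongrightarrow> b i"
    and M: "\<And>i n. i \<in> A \<Longrightarrow> norm (a i n) \<le> M i" "M summable_on A"
  shows "(\<lambda>n. infsum (\<lambda>i. a i n) A) \<longlonglongrightarrow> infsum b A" "(\<lambda>i. norm (b i)) summable_on A"
proof -
  have nb: "norm (b i) \<le> M i" if "i \<in> A" for i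
    using lim[OF that] M(1)[OF that] by (intro LIMSEQ_le_const2[OF tendsto_norm]) auto
  show s: "(\<lambda>i. norm (b i)) summable_on A"
    using M(2) nb by (rule Infinite_Sum.abs_summable_on_comparison_test')
  show "(\<lambda>n. infsum (\<lambda>i. a i n) A) \<longlonglongrightarrow> infsum b A"
  proof (rule swap_uniform_limit')
    show "uniform_limit UNIV (\<lambda>X n. \<Sum>i\<in>X. a i n) (\<lambda>n. infsum (\<lambda>i. a i n) A) (finite_subsets_at_top A)"
      by (rule Weierstrass_m_test_general[where M = M]) (use M in auto)
    show "\<forall>\<^sub>F X in finite_subsets_at_top A. ((\<lambda>n. \<Sum>i\<in>X. a i n) \<longlongrightarrow> (\<Sum>i\<in>X. b i)) sequentially"
      by (intro eventually_finite_subsets_at_top_weakI tendsto_sum lim) auto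
    show "((\<lambda>X. \<Sum>i\<in>X. b i) \<longlongrightarrow> infsum b A) (finite_subsets_at_top A)"
      by (rule infsum_tendsto[OF abs_summable_summable[OF s]])
  qed auto
qed

section \<open>Infinite q-products\<close>

text \<open>The q-Pochhammer symbol (a; p) with infinitely many factors.\<close>

definition qp :: "complex \<Rightarrow> complex \<Rightarrow> complex" where
  "qp a p = (\<Prod>k. 1 - a * p ^ k)"

lemma convergent_qp:
  fixes a p :: complex
  assumes "norm p < 1"
  shows "convergent_prod (\<lambda>k. 1 - a * p ^ k)"
proof (rule abs_convergent_prod_imp_convergent_prod)
  have "summable (\<lambda>k. norm a * norm p ^ k)" using assms by (intro summable_mult summable_geometric) auto
  thus "abs_convergent_prod (\<lambda>k. 1 - a * p ^ k)"
    by (simp add: abs_convergent_prod_conv_summable norm_mult norm_power)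
qed

lemma qp_tendsto:
  assumes "norm p < 1"
  shows "(\<lambda>n. \<Prod>k<n. 1 - a * p ^ k) \<longlonglongrightarrow> qp a p"
proof -
  have "(\<lambda>n. \<Prod>k\<le>n. 1 - a * p ^ k) \<longlonglongrightarrow> qp a p"
    unfolding qp_def using convergent_qp[OF assms] by (rule convergent_prod_LIMSEQ)
  hence "(\<lambda>n. \<Prod>k<Suc n. 1 - a * p ^ k) \<longlonglongrightarrow> qp a p"
    by (simp add: lessThan_Suc_atMost)
  thus ?thesis by (rule LIMSEQ_imp_Suc)
qed

lemma qp_nonzero:
  assumes "norm p < 1" "norm a < 1"
  shows "qp a p \<noteq> 0"
proof -
  have "1 - a * p ^ k \<noteq> 0" for k
  proof
    assume "1 - a * p ^ k = 0"
    hence "norm (a * p ^ k) = 1" by (metis eq_iff_diff_eq_0 norm_one)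
    moreover have "norm (a * p ^ k) \<le> norm a"
      using assms by (simp add: norm_mult norm_power mult_left_le power_le_one)
    ultimately show False using assms by simp
  qed
  thus ?thesis unfolding qp_def using convergent_qp[OF assms(1)] by (intro prodinf_nonzero) auto
qed

lemma qp_split:
  assumes "norm p < 1"
  shows "qp a p = qp a (p^2) * qp (a * p) (p^2)"
proof -
  have p2: "norm (p^2) < 1" using assms by (simp add: norm_power power_less_one_iff abs_square_less_1)
  have "(\<Prod>k<2 * n. 1 - a * p ^ k) = (\<Prod>k<n. 1 - a * (p^2) ^ k) * (\<Prod>k<n. 1 - (a * p) * (p^2) ^ k)" for n
    by (induction n) (auto simp: power_mult [symmetric] mult_ac)
  hence "(\<lambda>n. \<Prod>k<2 * n. 1 - a * p ^ k) \<longlonglongrightarrow> qp a (p^2) * qp (a * p) (p^2)"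
    by (simp add: tendsto_mult qp_tendsto p2)
  moreover have "(\<lambda>n. \<Prod>k<2 * n. 1 - a * p ^ k) \<longlonglongrightarrow> qp a p"
    by (rule filterlim_compose[OF qp_tendsto[OF assms]])
       (auto intro!: filterlim_subseq simp: strict_mono_def)
  ultimately show ?thesis by (rule LIMSEQ_unique[rotated])
qed

lemma qp_mult_neg:
  assumes "norm p < 1"
  shows "qp a p * qp (- a) p = qp (a^2) (p^2)"
proof -
  have p2: "norm (p^2) < 1" using assms by (simp add: norm_power power_less_one_iff abs_square_less_1)
  have "(\<Prod>k<n. 1 - a * p ^ k) * (\<Prod>k<n. 1 - (- a) * p ^ k) = (\<Prod>k<n. 1 - a^2 * (p^2) ^ k)" for n
    unfolding prod.distrib [symmetric]
    by (intro prod.cong refl) (simp add: power2_eq_square algebra_simps power_mult_distrib)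
  hence "(\<lambda>n. \<Prod>k<n. 1 - a^2 * (p^2) ^ k) \<longlonglongrightarrow> qp a p * qp (- a) p"
    using tendsto_mult[OF qp_tendsto[OF assms, of a] qp_tendsto[OF assms, of "- a"]] by simp
  thus ?thesis using qp_tendsto[OF p2] LIMSEQ_unique by blast
qed

lemma qp_shift:
  assumes "norm p < 1"
  shows "qp a p = (1 - a) * qp (a * p) p"
proof -
  have "(\<Prod>k<Suc n. 1 - a * p ^ k) = (1 - a) * (\<Prod>k<n. 1 - (a * p) * p ^ k)" for n
    by (subst prod.lessThan_Suc_shift) (simp add: mult_ac)
  hence "(\<lambda>n. \<Prod>k<Suc n. 1 - a * p ^ k) \<longlonglongrightarrow> (1 - a) * qp (a * p) p"
    by (auto intro!: tendsto_intros qp_tendsto assms simp del: prod.lessThan_Suc)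
  moreover have "(\<lambda>n. \<Prod>k<Suc n. 1 - a * p ^ k) \<longlonglongrightarrow> qp a p"
    by (rule LIMSEQ_Suc[OF qp_tendsto[OF assms]])
  ultimately show ?thesis by (rule LIMSEQ_unique[rotated])
qed

section \<open>Gaussian binomials and the finite triple product\<close>

text \<open>The q-Pascal recursion avoids division by factors 1 - p^k, which may vanish. The
  truncated difference m - j is harmless, since the coefficient it multiplies is zero for j >
  m.\<close>

fun gauss_binom :: "complex \<Rightarrow> nat \<Rightarrow> nat \<Rightarrow> complex" where
  "gauss_binom p m 0 = 1"
| "gauss_binom p 0 (Suc j) = 0"
| "gauss_binom p (Suc m) (Suc j) = gauss_binom p m (Suc j) + p ^ (m - j) * gauss_binom p m j"

lemma gauss_binom_eq_0: "j > m \<Longrightarrow> gauss_binom p m j = 0"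
  by (induction p m j rule: gauss_binom.induct) auto

text \<open>Denominators are cleared so that the induction needs no case distinction for roots of
  unity.\<close>

lemma gauss_binom_closed:
  "j \<le> m \<Longrightarrow> gauss_binom p m j * (\<Prod>k<j. 1 - p * p ^ k) * (\<Prod>k<m - j. 1 - p * p ^ k) = (\<Prod>k<m. 1 - p * p ^ k)"
proof (induction m arbitrary: j)
  case 0
  thus ?case by simp
next
  case (Suc m)
  let ?Q = "\<lambda>n. \<Prod>k<n. 1 - p * p ^ k"
  show ?case
  proof (cases j)
    case 0
    thus ?thesis by simp
  next
    case [simp]: (Suc i)
    have i: "i \<le> m" using Suc.prems by simp
    show ?thesis
    proof (cases "i = m")
      case True
      thus ?thesis using Suc.IH[of m] by (simp add: gauss_binom_eq_0 mult_ac)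
    next
      case False
      then obtain d where d: "m = i + Suc d" using i less_iff_Suc_add[of i m] by auto
      have 1: "gauss_binom p m (Suc i) * ?Q (Suc i) * ?Q d = ?Q m"
        using Suc.IH[of "Suc i"] d by simp
      have 2: "gauss_binom p m i * ?Q i * ?Q (Suc d) = ?Q m"
        using Suc.IH[of i] d by simp
      have "gauss_binom p (Suc m) (Suc i) * ?Q (Suc i) * ?Q (Suc d) = 
         (gauss_binom p m (Suc i) * ?Q (Suc i) * ?Q d) * (1 - p * p ^ d) +
         p ^ Suc d * (1 - p * p ^ i) * (gauss_binom p m i * ?Q i * ?Q (Suc d))"
        using d by (simp add: algebra_simps)
      also have "\<dots> = ?Q m * ((1 - p * p ^ d) + p ^ Suc d * (1 - p * p ^ i))"
        unfolding 1 2 by (simp add: algebra_simps)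
      also have "(1 - p * p ^ d) + p ^ Suc d * (1 - p * p ^ i) = 1 - p * p ^ m"
        using d by (simp add: algebra_simps power_add)
      finally show ?thesis using d by simp
    qed
  qed
qed

text \<open>In the induction the new factor 1 + x p^m matches the second term of the recursion,
  because (m - j) + j (j + 1) / 2 = m + j (j - 1) / 2.\<close>

lemma q_binomial:
  "(\<Prod>k<m. 1 + x * p ^ k) = (\<Sum>j\<le>m. gauss_binom p m j * p ^ (j * (j - 1) div 2) * x ^ j)"
proof (induction m)
  case 0
  show ?case by simp
next
  case (Suc m)
  let ?S = "\<Sum>j\<le>m. gauss_binom p m j * p ^ (j * (j - 1) div 2) * x ^ j"
  have tri: "Suc j * (Suc j - 1) div 2 = j * (j - 1) div 2 + j" for j :: nat
  proof -
    have "Suc j * (Suc j - 1) = j * (j - 1) + j * 2" by (cases j) auto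
    thus ?thesis by simp
  qed
  have "(\<Sum>j\<le>Suc m. gauss_binom p (Suc m) j * p ^ (j * (j - 1) div 2) * x ^ j)
      = 1 + (\<Sum>j\<le>m. gauss_binom p (Suc m) (Suc j) * p ^ (Suc j * (Suc j - 1) div 2) * x ^ Suc j)"
    by (subst sum.atMost_Suc_shift) simp
  also have "(\<Sum>j\<le>m. gauss_binom p (Suc m) (Suc j) * p ^ (Suc j * (Suc j - 1) div 2) * x ^ Suc j)
     = (\<Sum>j\<le>m. gauss_binom p m (Suc j) * p ^ (Suc j * (Suc j - 1) div 2) * x ^ Suc j)
       + (\<Sum>j\<le>m. (x * p ^ m) * (gauss_binom p m j * p ^ (j * (j - 1) div 2) * x ^ j))"
    unfolding sum.distrib [symmetric]
  proof (intro sum.cong refl)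
    fix j assume j: "j \<in> {..m}"
    have "p ^ (m - j) * p ^ (Suc j * (Suc j - 1) div 2) = p ^ m * p ^ (j * (j - 1) div 2)"
      unfolding tri power_add [symmetric] using j by (intro arg_cong[of _ _ "\<lambda>n. p ^ n"]) auto
    thus "gauss_binom p (Suc m) (Suc j) * p ^ (Suc j * (Suc j - 1) div 2) * x ^ Suc j =
       gauss_binom p m (Suc j) * p ^ (Suc j * (Suc j - 1) div 2) * x ^ Suc j +
       x * p ^ m * (gauss_binom p m j * p ^ (j * (j - 1) div 2) * x ^ j)"
      by (simp add: ring_distribs)
  qed
  also have "1 + ((\<Sum>j\<le>m. gauss_binom p m (Suc j) * p ^ (Suc j * (Suc j - 1) div 2) * x ^ Suc j)
       + (\<Sum>j\<le>m. (x * p ^ m) * (gauss_binom p m j * p ^ (j * (j - 1) div 2) * x ^ j)))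
     = (\<Sum>j\<le>Suc m. gauss_binom p m j * p ^ (j * (j - 1) div 2) * x ^ j) + (x * p ^ m) * ?S"
    by (subst sum.atMost_Suc_shift) (simp add: sum_distrib_left)
  also have "\<dots> = ?S * (1 + x * p ^ m)"
    by (simp add: gauss_binom_eq_0 algebra_simps)
  finally show ?case using Suc by simp
qed

lemma power_eq_powi: "int m = i \<Longrightarrow> q ^ m = q powi i"
  by (auto simp: power_int_of_nat)

lemma power_int_add3:
  fixes q :: complex
  shows "q \<noteq> 0 \<Longrightarrow> q powi a * q powi b * q powi c = q powi (a + b + c)"
  by (simp add: power_int_add)

text \<open>The q-binomial theorem for 2n factors, centred: with x = z q^(1 - 2n) the upper n
  factors are those in z q, and the lower n become those in q / z once their leading terms are
  pulled out. Shifting the summation index by n turns the exponent of q into a square.\<close>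

lemma finite_triple_product:
  assumes q: "q \<noteq> 0" and z: "z \<noteq> 0"
  shows "(\<Prod>k<n. 1 + z * q * (q^2) ^ k) * (\<Prod>k<n. 1 + q / z * (q^2) ^ k)
       = (\<Sum>i\<in>{- int n..int n}. gauss_binom (q^2) (2 * n) (nat (i + int n)) * (q powi (i^2) * z powi i))"
proof -
  define x where "x = z * q / (q^2) ^ n"
  have x: "x \<noteq> 0" using q z by (simp add: x_def)
  have xe: "x = z * q powi (1 - 2 * int n)"
  proof -
    have "(q^2) ^ n = q ^ (2 * n)" by (simp add: power_mult)
    also have "\<dots> = q powi (2 * int n)" by (rule power_eq_powi) simp
    finally show ?thesis using q by (simp add: x_def power_int_diff)
  qed
  have "(\<Prod>k<n + n. 1 + x * (q^2) ^ k) = (\<Prod>k<n. 1 + x * (q^2) ^ k) * (\<Prod>k<n. 1 + x * (q^2) ^ (k + n))"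
    using prod.atLeastLessThan_concat[of 0 n "n + n" "\<lambda>k. 1 + x * (q^2) ^ k"]
      prod.shift_bounds_nat_ivl[of "\<lambda>k. 1 + x * (q^2) ^ k" 0 n n]
    by (simp add: atLeast0LessThan)
  also have "(\<Prod>k<n. 1 + x * (q^2) ^ (k + n)) = (\<Prod>k<n. 1 + z * q * (q^2) ^ k)"
    using q by (intro prod.cong refl) (simp add: x_def power_add)
  also have "(\<Prod>k<n. 1 + x * (q^2) ^ k) = (\<Prod>k<n. 1 + x * (q^2) ^ (n - Suc k))"
    by (rule prod.nat_diff_reindex [symmetric])
  also have "\<dots> = (\<Prod>k<n. (z * q powi (- (2 * int k + 1))) * (1 + q / z * (q^2) ^ k))"
  proof (intro prod.cong refl)
    fix k assume k: "k \<in> {..<n}"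
    have "x * (q^2) ^ (n - Suc k) = z * (q powi (1 - 2 * int n) * q powi (2 * int (n - Suc k)))"
    proof -
      have "(q^2) ^ (n - Suc k) = q ^ (2 * (n - Suc k))" by (simp add: power_mult)
      also have "\<dots> = q powi (2 * int (n - Suc k))" by (rule power_eq_powi) simp
      finally show ?thesis unfolding xe by (simp only: mult.assoc)
    qed
    also have "q powi (1 - 2 * int n) * q powi (2 * int (n - Suc k)) = q powi (- (2 * int k + 1))"
    proof -
      have "q powi (1 - 2 * int n) * q powi (2 * int (n - Suc k)) = q powi (1 - 2 * int n + 2 * int (n - Suc k))"
        using q by (subst power_int_add) auto
      also have "1 - 2 * int n + 2 * int (n - Suc k) = - (2 * int k + 1)" using k by (auto simp: of_nat_diff)
      finally show ?thesis .
    qed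
    finally have e: "x * (q^2) ^ (n - Suc k) = z * q powi (- (2 * int k + 1))" .
    have "q * (q^2) ^ k = q ^ (2 * k + 1)" by (simp add: power_mult)
    also have "\<dots> = q powi (2 * int k + 1)" by (rule power_eq_powi) simp
    finally have "q powi (- (2 * int k + 1)) * (q * (q^2) ^ k) = q powi (- (2 * int k + 1)) * q powi (2 * int k + 1)"
      by simp
    also have "\<dots> = 1" using q by (simp only: power_int_minus) simp
    finally have "q powi (- (2 * int k + 1)) * (q * (q^2) ^ k) = 1" .
    thus "1 + x * (q^2) ^ (n - Suc k) = (z * q powi (- (2 * int k + 1))) * (1 + q / z * (q^2) ^ k)"
      unfolding e using z by (simp add: ring_distribs)
  qed
  also have "\<dots> = (\<Prod>k<n. z * q powi (- (2 * int k + 1))) * (\<Prod>k<n. 1 + q / z * (q^2) ^ k)"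
    by (rule prod.distrib)
  also have "(\<Prod>k<n. z * q powi (- (2 * int k + 1))) = z ^ n * q powi (- (int n ^ 2))"
  proof (induction n)
    case (Suc n)
    have "q powi (- (int n ^ 2)) * q powi (- (2 * int n + 1)) = q powi (- (int (Suc n) ^ 2))"
    proof -
      have "q powi (- (int n ^ 2)) * q powi (- (2 * int n + 1)) = q powi (- (int n ^ 2) + (- (2 * int n + 1)))"
        using q by (subst power_int_add) auto
      also have "- (int n ^ 2) + (- (2 * int n + 1)) = - (int (Suc n) ^ 2)"
        by (simp add: power2_eq_square algebra_simps)
      finally show ?thesis .
    qed
    thus ?case using Suc by (simp add: mult_ac)
  qed auto
  finally have prod2: "(\<Prod>k<2 * n. 1 + x * (q^2) ^ k) =
     z ^ n * q powi (- (int n ^ 2)) * (\<Prod>k<n. 1 + q / z * (q^2) ^ k) * (\<Prod>k<n. 1 + z * q * (q^2) ^ k)"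
    by (simp add: mult_2)
  have "z powi (- int n) * z ^ n = 1" "q powi (int n ^ 2) * q powi (- (int n ^ 2)) = 1"
    using q z by (simp_all add: power_int_minus)
  hence "(\<Prod>k<n. 1 + z * q * (q^2) ^ k) * (\<Prod>k<n. 1 + q / z * (q^2) ^ k)
      = (z powi (- int n) * z ^ n) * (q powi (int n ^ 2) * q powi (- (int n ^ 2))) *
        ((\<Prod>k<n. 1 + q / z * (q^2) ^ k) * (\<Prod>k<n. 1 + z * q * (q^2) ^ k))"
    by simp
  also have "\<dots> = z powi (- int n) * q powi (int n ^ 2) * (\<Prod>k<2 * n. 1 + x * (q^2) ^ k)"
    unfolding prod2 by (simp only: mult_ac)
  also have "\<dots> = (\<Sum>j\<le>2 * n. z powi (- int n) * q powi (int n ^ 2) * 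
      (gauss_binom (q^2) (2 * n) j * (q^2) ^ (j * (j - 1) div 2) * x ^ j))"
    by (simp only: q_binomial sum_distrib_left)
  also have "\<dots> = (\<Sum>i\<in>{- int n..int n}. gauss_binom (q^2) (2 * n) (nat (i + int n)) * (q powi (i^2) * z powi i))"
  proof (rule sum.reindex_bij_witness[where i = "\<lambda>i. nat (i + int n)" and j = "\<lambda>j. int j - int n"])
    fix j assume "j \<in> {..2 * n}"
    have "even (j * (j - 1))" by (cases j) auto
    hence "(q^2) ^ (j * (j - 1) div 2) = q ^ (j * (j - 1))" by (simp flip: power_mult)
    also have "\<dots> = q powi (int (j * (j - 1)))" by (rule power_int_of_nat [symmetric])
    also have "int (j * (j - 1)) = int j * (int j - 1)" by (cases j) (auto simp: algebra_simps)
    finally have a: "(q^2) ^ (j * (j - 1) div 2) = q powi (int j * (int j - 1))" .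
    have b: "x ^ j = z powi (int j) * q powi ((1 - 2 * int n) * int j)"
      unfolding xe power_mult_distrib by (simp add: power_int_mult)
    have c: "q powi (int n ^ 2) * q powi (int j * (int j - 1)) * q powi ((1 - 2 * int n) * int j) = q powi ((int j - int n)^2)"
    proof -
      have "q powi (int n ^ 2) * q powi (int j * (int j - 1)) * q powi ((1 - 2 * int n) * int j)
         = q powi (int n ^ 2 + int j * (int j - 1) + (1 - 2 * int n) * int j)"
        by (rule power_int_add3[OF q])
      also have "int n ^ 2 + int j * (int j - 1) + (1 - 2 * int n) * int j = (int j - int n)^2"
        by (simp add: algebra_simps power2_eq_square)
      finally show ?thesis .
    qed
    have d: "z powi (- int n) * z powi (int j) = z powi (int j - int n)"
      using z power_int_add[of z "- int n" "int j"] by simp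
    show "gauss_binom (q^2) (2 * n) (nat (int j - int n + int n)) * (q powi ((int j - int n)^2) * z powi (int j - int n)) =
       z powi (- int n) * q powi (int n ^ 2) * (gauss_binom (q^2) (2 * n) j * (q^2) ^ (j * (j - 1) div 2) * x ^ j)"
      unfolding a b c [symmetric] d [symmetric] by (simp add: mult_ac)
  qed auto
  finally show ?thesis .
qed

text \<open>The limit of the finite identity: the Gaussian binomials of order 2n around the centre
  are bounded and tend to the inverse of (q^2; q^2).\<close>

theorem jacobi_triple_product:
  assumes q: "q \<noteq> 0" "norm q < 1" and z: "z \<noteq> 0"
    and s: "(\<lambda>i::int. norm (q powi (i^2) * z powi i)) summable_on UNIV"
  shows "(\<Sum>\<^sub>\<infinity>i::int. q powi (i^2) * z powi i) = qp (q^2) (q^2) * qp (- z * q) (q^2) * qp (- q / z) (q^2)"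
proof -
  let ?p = "q^2"
  have p: "norm ?p < 1" using q by (simp add: norm_power power_less_one_iff abs_square_less_1)
  define Q where "Q n = (\<Prod>k<n. 1 - ?p * ?p ^ k)" for n
  have Q: "Q \<longlonglongrightarrow> qp ?p ?p" unfolding Q_def by (rule qp_tendsto[OF p])
  have Qnz: "Q n \<noteq> 0" for n
  proof -
    have "?p * ?p ^ k \<noteq> 1" for k
    proof
      assume "?p * ?p ^ k = 1"
      hence "norm ?p ^ Suc k = 1" by (metis norm_one norm_power power_Suc)
      moreover have "norm ?p ^ Suc k < 1" using p by (simp only: power_less_one_iff norm_ge_zero) simp
      ultimately show False by simp
    qed
    thus ?thesis by (simp add: Q_def prod_zero_iff)
  qed
  have nz: "qp ?p ?p \<noteq> 0" using p by (rule qp_nonzero) (use p in auto)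
  \<comment> \<open>Extension by 0 outside |i| <= n turns the finite sums into sums over all
    integers, as dominated convergence requires.\<close>
  define c where "c i n = (if \<bar>i\<bar> \<le> int n then gauss_binom ?p (2 * n) (nat (i + int n)) else 0)" for i :: int and n
  have cQ: "c i n = Q (2 * n) / (Q (nat (i + int n)) * Q (nat (int n - i)))" if "\<bar>i\<bar> \<le> int n" for i n
  proof -
    have "gauss_binom ?p (2 * n) (nat (i + int n)) * Q (nat (i + int n)) * Q (2 * n - nat (i + int n)) = Q (2 * n)"
      unfolding Q_def by (rule gauss_binom_closed) (use that in auto)
    moreover have "2 * n - nat (i + int n) = nat (int n - i)" using that by auto
    ultimately have "c i n * (Q (nat (i + int n)) * Q (nat (int n - i))) = Q (2 * n)"
      using that by (simp add: c_def mult.assoc)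
    thus ?thesis using Qnz by (simp add: nonzero_eq_divide_eq)
  qed
  \<comment> \<open>Boundedness of both Q and 1 / Q gives a bound on the coefficients that is
    uniform in i and n.\<close>
  obtain B where B: "\<And>n. norm (Q n) \<le> B"
    using convergent_imp_Bseq[OF convergentI[OF Q]] unfolding Bseq_def by blast
  have Qi: "(\<lambda>n. inverse (Q n)) \<longlonglongrightarrow> inverse (qp ?p ?p)" using Q nz by (rule tendsto_inverse)
  obtain B' where B': "\<And>n. norm (inverse (Q n)) \<le> B'"
    using convergent_imp_Bseq[OF convergentI[OF Qi]] unfolding Bseq_def by blast
  have B0: "B \<ge> 0" "B' \<ge> 0" using order_trans[OF norm_ge_zero B] order_trans[OF norm_ge_zero B'] by auto
  have cB: "norm (c i n) \<le> B * B' * B'" for i n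
  proof (cases "\<bar>i\<bar> \<le> int n")
    case True
    have "norm (c i n) = norm (Q (2 * n)) * norm (inverse (Q (nat (i + int n)))) * norm (inverse (Q (nat (int n - i))))"
      unfolding cQ[OF True] by (simp add: norm_mult norm_divide norm_inverse divide_inverse)
    also have "\<dots> \<le> B * B' * B'" by (intro mult_mono B B' mult_nonneg_nonneg B0) auto
    finally show ?thesis .
  qed (use B0 in \<open>auto simp: c_def\<close>)
  have sub: "filterlim (\<lambda>n. nat (i + int n)) sequentially sequentially" for i :: int
    unfolding filterlim_at_top
  proof
    fix Z show "\<forall>\<^sub>F n in sequentially. Z \<le> nat (i + int n)"
      by (rule eventually_sequentiallyI[of "nat (- i) + Z"]) auto
  qed
  have sub': "filterlim (\<lambda>n. nat (int n - i)) sequentially sequentially" for i :: int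
    using sub[of "-i"] by simp
  have clim: "(\<lambda>n. c i n) \<longlonglongrightarrow> 1 / qp ?p ?p" for i
  proof -
    have Q2: "(\<lambda>n. Q (2 * n)) \<longlonglongrightarrow> qp ?p ?p"
      by (rule filterlim_compose[OF Q]) (auto intro!: filterlim_subseq simp: strict_mono_def)
    have "(\<lambda>n. Q (2 * n) / (Q (nat (i + int n)) * Q (nat (int n - i)))) \<longlonglongrightarrow> qp ?p ?p / (qp ?p ?p * qp ?p ?p)"
      by (intro tendsto_divide tendsto_mult Q2 filterlim_compose[OF Q sub] filterlim_compose[OF Q sub']) (use nz in simp)
    moreover have "\<forall>\<^sub>F n in sequentially. Q (2 * n) / (Q (nat (i + int n)) * Q (nat (int n - i))) = c i n"
      by (intro eventually_sequentiallyI[of "nat \<bar>i\<bar>"] cQ [symmetric]) auto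
    ultimately show ?thesis using nz by (auto dest: Lim_transform_eventually)
  qed
  have fin: "(\<Prod>k<n. 1 + z * q * ?p ^ k) * (\<Prod>k<n. 1 + q / z * ?p ^ k) = (\<Sum>\<^sub>\<infinity>i. c i n * (q powi (i^2) * z powi i))" for n
  proof -
    have "(\<Sum>\<^sub>\<infinity>i. c i n * (q powi (i^2) * z powi i)) = (\<Sum>\<^sub>\<infinity>i\<in>{- int n..int n}. c i n * (q powi (i^2) * z powi i))"
      by (rule infsum_cong_neutral) (auto simp: c_def)
    also have "\<dots> = (\<Sum>i\<in>{- int n..int n}. gauss_binom ?p (2 * n) (nat (i + int n)) * (q powi (i^2) * z powi i))"
      by (auto intro!: sum.cong simp: c_def abs_le_iff)
    finally show ?thesis using finite_triple_product[OF q(1) z] by simp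
  qed
  have "(\<lambda>n. \<Sum>\<^sub>\<infinity>i. c i n * (q powi (i^2) * z powi i)) \<longlonglongrightarrow> (\<Sum>\<^sub>\<infinity>i. 1 / qp ?p ?p * (q powi (i^2) * z powi i))"
  proof (rule tannery_infsum(1)[where M = "\<lambda>i. B * B' * B' * norm (q powi (i^2) * z powi i)"])
    show "(\<lambda>i. B * B' * B' * norm (q powi (i^2) * z powi i)) summable_on UNIV"
      using s by (rule summable_on_cmult_right)
    show "norm (c i n * (q powi (i^2) * z powi i)) \<le> B * B' * B' * norm (q powi (i^2) * z powi i)" for i n
      unfolding norm_mult[of "c i n"] by (intro mult_right_mono cB) auto
    show "(\<lambda>n. c i n * (q powi (i^2) * z powi i)) \<longlonglongrightarrow> 1 / qp ?p ?p * (q powi (i^2) * z powi i)" for i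
      by (intro tendsto_mult clim tendsto_const)
  qed
  moreover have "(\<lambda>n. (\<Prod>k<n. 1 + z * q * ?p ^ k) * (\<Prod>k<n. 1 + q / z * ?p ^ k)) \<longlonglongrightarrow> qp (- z * q) ?p * qp (- q / z) ?p"
    using tendsto_mult[OF qp_tendsto[OF p, of "- z * q"] qp_tendsto[OF p, of "- q / z"]] by simp
  ultimately have "(\<Sum>\<^sub>\<infinity>i. 1 / qp ?p ?p * (q powi (i^2) * z powi i)) = qp (- z * q) ?p * qp (- q / z) ?p"
    unfolding fin by (rule LIMSEQ_unique)
  hence "1 / qp ?p ?p * (\<Sum>\<^sub>\<infinity>i. q powi (i^2) * z powi i) = qp (- z * q) ?p * qp (- q / z) ?p"
    by (simp only: infsum_cmult_right')
  thus ?thesis using nz by (simp add: field_simps)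
qed

section \<open>Product formulas for theta constants\<close>

text \<open>Jacobi's \<theta>2, written as a shift of \<open>th\<close> so that it inherits the
  properties of \<open>th\<close>; the usual sum over half-integers is
  \<open>th1_eq\<close>.\<close>

definition th1 :: "complex \<Rightarrow> complex \<Rightarrow> complex" where
  "th1 t v = exp (pi * \<i> * t / 4 + pi * \<i> * v) * th t (v + t / 2)"

lemma norm_exp_ii_lt_1: "Im t > 0 \<Longrightarrow> norm (exp (pi * \<i> * t)) < 1"
  by (simp add: norm_exp_eq_Re)

lemma exp_pi_ii_of_int: "exp (pi * \<i> * of_int n) = (- 1) powi n"
proof -
  have "exp (pi * \<i> * of_int n) = exp (of_int n * (\<i> * pi))" by (simp add: mult_ac)
  also have "\<dots> = exp (\<i> * pi) powi n" by (rule exp_power_int [symmetric])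
  finally show ?thesis by simp
qed

lemma th_triple:
  assumes t: "Im t > 0"
  shows "th t v = qp (exp (pi * \<i> * t) ^ 2) (exp (pi * \<i> * t) ^ 2)
    * qp (- exp (2 * pi * \<i> * v) * exp (pi * \<i> * t)) (exp (pi * \<i> * t) ^ 2)
    * qp (- exp (pi * \<i> * t) / exp (2 * pi * \<i> * v)) (exp (pi * \<i> * t) ^ 2)"
proof -
  have e: "exp (pi * \<i> * t * of_int n ^ 2 + 2 * pi * \<i> * of_int n * v)
         = exp (pi * \<i> * t) powi (n^2) * exp (2 * pi * \<i> * v) powi n" for n
    unfolding exp_add exp_power_int by (simp add: mult_ac)
  show ?thesis
    unfolding th_def e
  proof (rule jacobi_triple_product)
    show "(\<lambda>n. norm (exp (pi * \<i> * t) powi n\<^sup>2 * exp (2 * pi * \<i> * v) powi n)) summable_on UNIV"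
      using abs_summable_th[OF t, of v] unfolding e .
  qed (use norm_exp_ii_lt_1[OF t] in auto)
qed

text \<open>Euler's identity between odd parts and distinct parts: (q; q)(-q; q) = (q^2; q^2), while
  (q; q) = (q; q^2)(q^2; q^2).\<close>

lemma qp_euler:
  assumes q: "norm q < 1"
  shows "qp q (q^2) * qp (- q) q = 1"
proof -
  have q2: "norm (q^2) < 1" using q by (simp add: norm_power power_less_one_iff abs_square_less_1)
  have "qp q q = qp q (q^2) * qp (q^2) (q^2)" using qp_split[OF q, of q] by (simp add: power2_eq_square)
  moreover have "qp q q * qp (- q) q = qp (q^2) (q^2)" by (rule qp_mult_neg[OF q])
  ultimately have "qp (q^2) (q^2) * (qp q (q^2) * qp (- q) q) = qp (q^2) (q^2) * 1" by (simp add: mult_ac)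
  thus ?thesis using qp_nonzero[OF q2 q2] by (metis mult_left_cancel)
qed

lemma mult_eq_1_imp:
  fixes x y :: complex
  assumes "x * y = 1"
  shows "x = 1 / y"
proof -
  have "y \<noteq> 0" using assms by auto
  thus ?thesis using assms by (simp add: nonzero_eq_divide_eq)
qed

text \<open>Gauss's product for \<theta>4. Its eighth power is what the multiples of
  \<open>e2\<close> contribute to the product over \<open>M1\<close>.\<close>

lemma th_half_prod:
  assumes t: "Im t > 0"
  defines "q \<equiv> exp (pi * \<i> * t)"
  shows "th t (1/2) = qp q q / qp (- q) q"
proof -
  have q: "norm q < 1" unfolding q_def by (rule norm_exp_ii_lt_1[OF t])
  have "exp (2 * pi * \<i> * (1/2)) = - 1" by (simp add: mult_ac)
  hence "th t (1/2) = qp (q^2) (q^2) * qp q (q^2) * qp q (q^2)"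
    using th_triple[OF t, of "1/2"] unfolding q_def by simp
  also have "qp (q^2) (q^2) * qp q (q^2) = qp q q" using qp_split[OF q, of q] by (simp add: power2_eq_square)
  also have "qp q (q^2) = 1 / qp (- q) q" using qp_euler[OF q] by (rule mult_eq_1_imp)
  finally show ?thesis by simp
qed

text \<open>The shift by t/2 turns the factors of the triple product into products in the squared
  nome Q. In the eighth power the factors in front become 2^8 and exp (2 pi i t), those of the
  theorem.\<close>

lemma th1_zero_prod:
  assumes t: "Im t > 0"
  defines "Q \<equiv> exp (2 * pi * \<i> * t)"
  shows "th1 t 0 = 2 * exp (pi * \<i> * t / 4) * (qp (Q^2) (Q^2) / qp Q (Q^2))"
proof -
  define q where "q = exp (pi * \<i> * t)"
  have q: "norm q < 1" unfolding q_def by (rule norm_exp_ii_lt_1[OF t])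
  have Qq: "Q = q^2" unfolding Q_def q_def by (simp flip: exp_of_nat_mult add: mult_ac)
  have Q: "norm Q < 1" using q unfolding Qq by (simp add: norm_power power_less_one_iff abs_square_less_1)
  have Q2: "norm (Q^2) < 1" using Q by (simp add: norm_power power_less_one_iff abs_square_less_1)
  have e: "exp (2 * pi * \<i> * (t / 2)) = q" by (simp add: q_def mult.assoc)
  have q0: "q \<noteq> 0" by (simp add: q_def)
  have "th t (t / 2) = qp Q Q * qp (- Q) Q * qp (- 1) Q"
    using th_triple[OF t, of "t/2"] q0 unfolding e q_def [symmetric] Qq by (simp add: power2_eq_square)
  also have "qp (- 1) Q = 2 * qp (- Q) Q" using qp_shift[OF Q, of "-1"] by simp
  also have "qp Q Q = qp Q (Q^2) * qp (Q^2) (Q^2)" using qp_split[OF Q, of Q] by (simp add: power2_eq_square)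
  finally have "th t (t / 2) = 2 * qp (Q^2) (Q^2) * (qp Q (Q^2) * qp (- Q) Q) * qp (- Q) Q" by (simp add: mult_ac)
  also have "\<dots> = 2 * qp (Q^2) (Q^2) * qp (- Q) Q" by (simp only: qp_euler[OF Q] mult_1_right)
  also have "qp (- Q) Q = 1 / qp Q (Q^2)" using qp_euler[OF Q] by (intro mult_eq_1_imp) (simp only: mult.commute)
  finally show ?thesis unfolding th1_def by simp
qed

lemma th_half_nonzero:
  assumes t: "Im t > 0" shows "th t (1/2) \<noteq> 0"
proof -
  have q: "norm (exp (pi * \<i> * t)) < 1" by (rule norm_exp_ii_lt_1[OF t])
  have "qp (exp (pi * \<i> * t)) (exp (pi * \<i> * t)) \<noteq> 0" "qp (- exp (pi * \<i> * t)) (exp (pi * \<i> * t)) \<noteq> 0"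
    by (rule qp_nonzero; use q in simp)+
  thus ?thesis unfolding th_half_prod[OF t] by simp
qed

lemma th1_zero_nonzero:
  assumes t: "Im t > 0" shows "th1 t 0 \<noteq> 0"
proof -
  let ?Q = "exp (2 * pi * \<i> * t)"
  have q: "norm ?Q < 1" using norm_exp_ii_lt_1[of "2 * t"] t by (simp add: mult_ac)
  hence q2: "norm (?Q^2) < 1" by (simp add: norm_power power_less_one_iff abs_square_less_1 del: norm_exp_eq_Re)
  have "qp (?Q^2) (?Q^2) \<noteq> 0" "qp ?Q (?Q^2) \<noteq> 0"
    using q q2 qp_nonzero by blast+
  thus ?thesis unfolding th1_zero_prod[OF t] by simp
qed

text \<open>Since n^2 and n have the same parity, exp (pi i n^2) is the sign (-1)^n, which is a
  shift of v by 1/2.\<close>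

lemma th_shift_nat: "th (t + 1) v = th t (v + 1/2)"
  unfolding th_def
proof (intro infsum_cong)
  fix n :: int
  have "even (n^2 - n)" by simp
  then obtain k where k: "n^2 - n = 2 * k" by blast
  have k': "(of_int n)^2 = complex_of_int (n + 2 * k)" 
  proof -
    have "n^2 = n + 2 * k" using k by simp
    from arg_cong[OF this, of complex_of_int] show ?thesis by simp
  qed
  have "exp (pi * \<i> * (t + 1) * of_int n ^ 2 + 2 * pi * \<i> * of_int n * v)
     = exp (pi * \<i> * t * of_int n ^ 2 + 2 * pi * \<i> * of_int n * v) * exp (pi * \<i> * of_int n ^ 2)"
    unfolding exp_add [symmetric] by (simp add: algebra_simps)
  also have "exp (pi * \<i> * of_int n ^ 2) = exp (pi * \<i> * of_int n) * exp (2 * pi * \<i> * of_int k)"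
    unfolding k' exp_add [symmetric] by (simp add: algebra_simps)
  also have "exp (2 * pi * \<i> * of_int k) = 1" using exp_integer_2pi[of "of_int k"] by (simp add: mult_ac)
  also have "exp (pi * \<i> * t * of_int n ^ 2 + 2 * pi * \<i> * of_int n * v) * (exp (pi * \<i> * of_int n) * 1)
     = exp (pi * \<i> * t * of_int n ^ 2 + 2 * pi * \<i> * of_int n * (v + 1/2))"
    unfolding mult_1_right exp_add [symmetric] by (simp add: algebra_simps)
  finally show "exp (pi * \<i> * (t + 1) * of_int n ^ 2 + 2 * pi * \<i> * of_int n * v) = 
     exp (pi * \<i> * t * of_int n ^ 2 + 2 * pi * \<i> * of_int n * (v + 1/2))" .
qed

lemma th_period: "th t (v + 1) = th t v"
  unfolding th_def
proof (intro infsum_cong)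
  fix n :: int
  have "exp (pi * \<i> * t * of_int n ^ 2 + 2 * pi * \<i> * of_int n * (v + 1)) = 
     exp (pi * \<i> * t * of_int n ^ 2 + 2 * pi * \<i> * of_int n * v) * exp (2 * pi * \<i> * of_int n)"
    unfolding exp_add [symmetric] by (simp add: algebra_simps)
  also have "exp (2 * pi * \<i> * of_int n) = 1" using exp_integer_2pi[of "of_int n"] by (simp add: mult_ac)
  finally show "exp (pi * \<i> * t * of_int n ^ 2 + 2 * pi * \<i> * of_int n * (v + 1)) = 
     exp (pi * \<i> * t * of_int n ^ 2 + 2 * pi * \<i> * of_int n * v)" by simp
qed

section \<open>The eta quotient and its coefficients\<close>

text \<open>Convergence and value are bundled in one relation that is closed under ring operations;
  absolute convergence is included for the sake of Cauchy products. Formal identities thereby pass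
  to values.\<close>

definition eval_abs :: "int fps \<Rightarrow> complex \<Rightarrow> complex \<Rightarrow> bool" where
  "eval_abs A q v \<longleftrightarrow> summable (\<lambda>n. norm (of_int (fps_nth A n) * q ^ n))
      \<and> (\<lambda>n. of_int (fps_nth A n) * q ^ n) sums v"

lemma eval_abs_mult:
  assumes "eval_abs A q v" "eval_abs B q w"
  shows "eval_abs (A * B) q (v * w)"
proof -
  let ?a = "\<lambda>n. of_int (fps_nth A n) * q ^ n" and ?b = "\<lambda>n. of_int (fps_nth B n) * q ^ n"
  have s: "summable (\<lambda>n. norm (?a n))" "summable (\<lambda>n. norm (?b n))" using assms by (auto simp: eval_abs_def)
  have vw: "(\<Sum>n. ?a n) = v" "(\<Sum>n. ?b n) = w" using assms by (auto simp: eval_abs_def sums_iff)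
  have c: "(\<Sum>i\<le>n. ?a i * ?b (n - i)) = of_int (fps_nth (A * B) n) * q ^ n" for n
  proof -
    have "of_int (fps_nth (A * B) n) * q ^ n = (\<Sum>i\<le>n. of_int (fps_nth A i) * of_int (fps_nth B (n - i)) * q ^ n)"
      by (simp add: fps_mult_nth atLeast0AtMost sum_distrib_right)
    also have "\<dots> = (\<Sum>i\<le>n. ?a i * ?b (n - i))"
    proof (intro sum.cong refl)
      fix i assume "i \<in> {..n}"
      hence e: "q ^ n = q ^ i * q ^ (n - i)" by (simp flip: power_add)
      show "of_int (fps_nth A i) * of_int (fps_nth B (n - i)) * q ^ n = ?a i * ?b (n - i)"
        unfolding e by (simp only: mult_ac)
    qed
    finally show ?thesis by simp
  qed
  have "summable (\<lambda>n. \<Sum>i\<le>n. norm (?a i) * norm (?b (n - i)))"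
    by (rule summable_Cauchy_product) (use s in auto)
  hence "summable (\<lambda>n. norm (\<Sum>i\<le>n. ?a i * ?b (n - i)))"
    by (rule summable_comparison_test') (auto simp flip: norm_mult intro: norm_sum)
  moreover have "(\<lambda>n. \<Sum>i\<le>n. ?a i * ?b (n - i)) sums (v * w)"
    using Cauchy_product_sums[OF s] unfolding vw .
  ultimately show ?thesis unfolding eval_abs_def c by simp
qed

lemma eval_abs_monom: "eval_abs (fps_X ^ k) q (q ^ k)"
proof -
  have e: "of_int (fps_nth (fps_X ^ k) n) * q ^ n = (if n = k then q ^ k else 0)" for n
    by (auto simp: fps_X_power_nth)
  show ?thesis unfolding eval_abs_def e using sums_single[of k "\<lambda>_. q ^ k"] sums_single[of k "\<lambda>_. norm (q ^ k)"]
    by (auto simp: if_distrib[of norm] sums_iff cong: if_cong)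
qed

lemma eval_abs_one: "eval_abs 1 q 1"
  using eval_abs_monom[of 0 q] by simp

lemma eval_abs_diff:
  assumes "eval_abs A q v" "eval_abs B q w"
  shows "eval_abs (A - B) q (v - w)"
proof -
  have "summable (\<lambda>n. norm (of_int (fps_nth A n) * q ^ n) + norm (of_int (fps_nth B n) * q ^ n))"
    using assms by (intro summable_add) (auto simp: eval_abs_def)
  hence "summable (\<lambda>n. norm (of_int (fps_nth A n) * q ^ n - of_int (fps_nth B n) * q ^ n))"
    by (rule summable_comparison_test') (auto intro: norm_triangle_ineq4)
  moreover have "(\<lambda>n. of_int (fps_nth A n) * q ^ n - of_int (fps_nth B n) * q ^ n) sums (v - w)"
    using assms by (intro sums_diff) (auto simp: eval_abs_def)
  ultimately show ?thesis unfolding eval_abs_def by (simp add: left_diff_distrib)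
qed

lemma eval_abs_power: "eval_abs A q v \<Longrightarrow> eval_abs (A ^ n) q (v ^ n)"
  by (induction n) (auto intro: eval_abs_mult eval_abs_one)

lemma eval_abs_prod: "(\<And>i. i \<in> I \<Longrightarrow> eval_abs (A i) q (v i)) \<Longrightarrow> eval_abs (prod A I) q (prod v I)"
  by (induction I rule: infinite_finite_induct) (auto intro: eval_abs_mult eval_abs_one)

lemma eval_abs_unique: "eval_abs A q v \<Longrightarrow> eval_abs A q w \<Longrightarrow> v = w"
  unfolding eval_abs_def using sums_unique2 by blast

lemma geom_fps_inverse: "k > 0 \<Longrightarrow> geom_fps k * (1 - fps_X ^ k) = 1"
proof (rule fps_ext)
  fix n assume k: "k > 0"
  have "fps_nth (geom_fps k * (1 - fps_X ^ k)) n = fps_nth (geom_fps k) n - fps_nth (geom_fps k * fps_X ^ k) n"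
    by (simp add: right_diff_distrib)
  also have "fps_nth (geom_fps k * fps_X ^ k) n = (if n < k then 0 else fps_nth (geom_fps k) (n - k))"
    by (rule fps_X_power_mult_right_nth)
  also have "fps_nth (geom_fps k) n - \<dots> = fps_nth 1 n"
    using k by (auto simp: geom_fps_def dvd_minus_self dest: dvd_imp_le)
  finally show "fps_nth (geom_fps k * (1 - fps_X ^ k)) n = fps_nth 1 n" .
qed

lemma eval_abs_geom:
  assumes "k > 0" "norm q < 1"
  shows "eval_abs (geom_fps k) q (1 / (1 - q ^ k))"
proof -
  have s: "summable (\<lambda>n. norm (of_int (fps_nth (geom_fps k) n) * q ^ n))"
    by (rule summable_comparison_test'[where g = "\<lambda>n. norm q ^ n" and N = 0])
       (use assms in \<open>auto simp: geom_fps_def norm_mult norm_power intro: summable_geometric\<close>)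
  hence "summable (\<lambda>n. of_int (fps_nth (geom_fps k) n) * q ^ n)" by (rule summable_norm_cancel)
  then obtain v where v: "eval_abs (geom_fps k) q v" using s unfolding eval_abs_def by (auto simp: summable_def)
  have "eval_abs (geom_fps k * (1 - fps_X ^ k)) q (v * (1 - q ^ k))"
    by (intro eval_abs_mult v eval_abs_diff eval_abs_one eval_abs_monom)
  hence "v * (1 - q ^ k) = 1" unfolding geom_fps_inverse[OF assms(1)] using eval_abs_one eval_abs_unique by blast
  hence "v = 1 / (1 - q ^ k)" by (metis mult_zero_right nonzero_eq_divide_eq zero_neq_one)
  thus ?thesis using v by simp
qed

definition eta_val :: "nat \<Rightarrow> complex \<Rightarrow> complex" where
  "eta_val m q = (\<Prod>k\<in>{1..m}. (1 / (1 - q ^ k)) ^ 8 * (1 - q ^ (2 * k)) ^ 8 * (1 / (1 - q ^ (4 * k))) ^ 8)"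

lemma eval_abs_eta_trunc: "norm q < 1 \<Longrightarrow> eval_abs (eta_trunc m) q (eta_val m q)"
  unfolding eta_trunc_def eta_val_def
  by (intro eval_abs_prod eval_abs_mult eval_abs_power eval_abs_geom eval_abs_diff eval_abs_one eval_abs_monom) auto

lemma prod_1_to: "(\<Prod>k\<in>{1..m}. 1 - q ^ (c * k)) = (\<Prod>k<m. 1 - q ^ c * (q ^ c) ^ k)" for q :: complex
  by (rule prod.reindex_bij_witness[of _ Suc "\<lambda>k. k - 1"]) (auto simp: power_mult power_add[symmetric] simp flip: power_Suc)

lemma norm_power_lt_1: "norm (q::complex) < 1 \<Longrightarrow> c > 0 \<Longrightarrow> norm (q ^ c) < 1"
  by (simp add: norm_power power_less_one_iff)

lemma eta_val_tendsto:
  assumes q: "norm q < 1"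
  shows "(\<lambda>m. eta_val m q) \<longlonglongrightarrow> (qp (q^2) (q^2) / (qp q q * qp (q^4) (q^4))) ^ 8"
proof -
  have e: "eta_val m q = ((\<Prod>k\<in>{1..m}. 1 - q ^ (2 * k)) / ((\<Prod>k\<in>{1..m}. 1 - q ^ (1 * k)) * (\<Prod>k\<in>{1..m}. 1 - q ^ (4 * k)))) ^ 8" for m
    unfolding eta_val_def
    by (simp add: prod.distrib prod_dividef prod_power_distrib power_divide power_mult_distrib)
  note n = norm_power_lt_1[OF q, of 2, simplified] norm_power_lt_1[OF q, of 4, simplified]
  have nz: "qp q q \<noteq> 0" "qp (q^4) (q^4) \<noteq> 0" using qp_nonzero[OF q q] qp_nonzero[OF n(2) n(2)] by auto
  have "(\<lambda>m. ((\<Prod>k<m. 1 - q^2 * (q^2) ^ k) / ((\<Prod>k<m. 1 - q^1 * (q^1) ^ k) * (\<Prod>k<m. 1 - q^4 * (q^4) ^ k))) ^ 8)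
     \<longlonglongrightarrow> (qp (q^2) (q^2) / (qp (q^1) (q^1) * qp (q^4) (q^4))) ^ 8"
    by (intro tendsto_intros qp_tendsto) (use q n nz in auto)
  thus ?thesis unfolding e prod_1_to by simp
qed

text \<open>Congruence to 1 modulo q^(j+1). Multiplication by such a series leaves the coefficients
  up to j alone, which makes those of the truncated eta products stable.\<close>

definition one_upto :: "nat \<Rightarrow> int fps \<Rightarrow> bool" where
  "one_upto j B \<longleftrightarrow> fps_nth B 0 = 1 \<and> (\<forall>i. 0 < i \<longrightarrow> i \<le> j \<longrightarrow> fps_nth B i = 0)"

lemma nth_mult_one_upto:
  assumes "one_upto j B" "n \<le> j"
  shows "fps_nth (A * B) n = fps_nth A n"
proof -
  have "fps_nth (A * B) n = (\<Sum>i=0..n. if i = n then fps_nth A n else 0)"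
    unfolding fps_mult_nth using assms by (intro sum.cong) (auto simp: one_upto_def)
  thus ?thesis by simp
qed

lemma one_upto_mult: "one_upto j A \<Longrightarrow> one_upto j B \<Longrightarrow> one_upto j (A * B)"
  unfolding one_upto_def[of j "A * B"] using nth_mult_one_upto[of j B] by (auto simp: one_upto_def)

lemma one_upto_power: "one_upto j A \<Longrightarrow> one_upto j (A ^ n)"
  by (induction n) (auto intro: one_upto_mult simp: one_upto_def[of j 1])

lemma one_upto_factor:
  assumes "j < k"
  shows "one_upto j (geom_fps k ^ 8 * (1 - fps_X ^ (2*k)) ^ 8 * geom_fps (4*k) ^ 8)"
  using assms by (intro one_upto_mult one_upto_power) (auto simp: one_upto_def geom_fps_def fps_X_power_nth dest: dvd_imp_le)

lemma eta_trunc_Suc: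
  "eta_trunc (Suc m) = eta_trunc m * (geom_fps (Suc m) ^ 8 * (1 - fps_X ^ (2*Suc m)) ^ 8 * geom_fps (4*Suc m) ^ 8)"
  unfolding eta_trunc_def by (simp add: prod.nat_ivl_Suc' mult.commute)

lemma eta_trunc_stable: "n \<le> m \<Longrightarrow> fps_nth (eta_trunc m) n = fps_nth (eta_trunc n) n"
proof (induction m rule: dec_induct)
  case (step m)
  thus ?case using nth_mult_one_upto[OF one_upto_factor[of m "Suc m"], of n] by (simp only: eta_trunc_Suc)
qed auto

definition nonneg_fps :: "int fps \<Rightarrow> bool" where "nonneg_fps A \<longleftrightarrow> (\<forall>n. fps_nth A n \<ge> 0)"

lemma nonneg_fps_mult: "nonneg_fps A \<Longrightarrow> nonneg_fps B \<Longrightarrow> nonneg_fps (A * B)"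
  by (auto simp: nonneg_fps_def fps_mult_nth intro!: sum_nonneg)

lemma nonneg_fps_power: "nonneg_fps A \<Longrightarrow> nonneg_fps (A ^ n)"
  by (induction n) (auto intro: nonneg_fps_mult simp: nonneg_fps_def[of 1])

text \<open>The numerator cancels: (1 - q^(2k)) / (1 - q^k) = 1 + q^k. Nonnegative coefficients make
  the truncations increase with m, so that their limit \<open>cc\<close> dominates them all.\<close>

lemma nonneg_factor:
  assumes "k > 0"
  shows "nonneg_fps (geom_fps k ^ 8 * (1 - fps_X ^ (2*k)) ^ 8 * geom_fps (4*k) ^ 8)"
proof -
  have "1 - x ^ (2*k) = (1 - x ^ k) * (1 + x ^ k)" for x :: "int fps"
    unfolding mult_2 power_add by (simp add: algebra_simps)
  hence "geom_fps k * (1 - fps_X ^ (2*k)) = 1 + fps_X ^ k"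
    by (metis assms geom_fps_inverse mult.assoc mult_1)
  hence e: "geom_fps k ^ 8 * (1 - fps_X ^ (2*k)) ^ 8 * geom_fps (4*k) ^ 8 = (1 + fps_X ^ k) ^ 8 * geom_fps (4*k) ^ 8"
    by (metis power_mult_distrib)
  have "nonneg_fps (1 + fps_X ^ k)" "nonneg_fps (geom_fps (4*k))"
    by (auto simp: nonneg_fps_def fps_X_power_nth geom_fps_def)
  thus ?thesis unfolding e by (intro nonneg_fps_mult nonneg_fps_power)
qed

lemma nonneg_eta_trunc: "nonneg_fps (eta_trunc m)"
proof (induction m)
  case (Suc m)
  show ?case unfolding eta_trunc_Suc by (intro nonneg_fps_mult Suc nonneg_factor) auto
qed (simp add: eta_trunc_def nonneg_fps_def)

lemma eta_trunc_mono: "m \<le> m' \<Longrightarrow> fps_nth (eta_trunc m) n \<le> fps_nth (eta_trunc m') n"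
proof (induction m' rule: dec_induct)
  case (step m')
  let ?B = "geom_fps (Suc m') ^ 8 * (1 - fps_X ^ (2*Suc m')) ^ 8 * geom_fps (4*Suc m') ^ 8"
  have B: "nonneg_fps ?B" "fps_nth ?B 0 = 1"
    using nonneg_factor[of "Suc m'"] one_upto_factor[of 0 "Suc m'"] unfolding one_upto_def by auto
  have "fps_nth (eta_trunc m') n = (\<Sum>i\<in>{n}. fps_nth (eta_trunc m') i * fps_nth ?B (n - i))" using B by simp
  also have "\<dots> \<le> (\<Sum>i=0..n. fps_nth (eta_trunc m') i * fps_nth ?B (n - i))"
    using B nonneg_eta_trunc[of m'] unfolding nonneg_fps_def by (intro sum_mono2 mult_nonneg_nonneg) auto
  also have "\<dots> = fps_nth (eta_trunc (Suc m')) n" unfolding eta_trunc_Suc fps_mult_nth ..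
  finally show ?case using step by simp
qed auto

lemma cc_eq: "cc (int n - 1) = fps_nth (eta_trunc n) n"
  by (simp add: cc_def)

lemma nth_eta_trunc: "n \<le> m \<Longrightarrow> fps_nth (eta_trunc m) n = cc (int n - 1)"
  unfolding cc_eq by (rule eta_trunc_stable)

lemma cc_nonneg: "cc j \<ge> 0"
  using nonneg_eta_trunc by (auto simp: cc_def nonneg_fps_def)

lemma cc_eq_0: "j < -1 \<Longrightarrow> cc j = 0" by (simp add: cc_def)

lemma cc_minus_one: "cc (-1) = 1" by (simp add: cc_def eta_trunc_def)

lemma eta_trunc_le_cc: "fps_nth (eta_trunc m) n \<le> cc (int n - 1)"
proof (cases "m \<le> n")
  case True
  thus ?thesis using eta_trunc_mono[of m n n] by (simp add: cc_eq)
next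
  case False
  thus ?thesis using nth_eta_trunc[of n m] by simp
qed

text \<open>At |q| the partial sums are bounded by the truncated products, which converge, and
  nonnegativity turns this into summability. The resulting majorant lets coefficients and products
  pass to the limit together. The index n - 1 reflects the leading power q^-1 of the eta
  quotient.\<close>

theorem cc_sums:
  assumes q: "norm q < 1"
  shows "(\<lambda>n. norm (of_int (cc (int n - 1)) * q ^ n)) summable_on UNIV"
    and "((\<lambda>n. of_int (cc (int n - 1)) * q ^ n) has_sum (qp (q^2) (q^2) / (qp q q * qp (q^4) (q^4))) ^ 8) UNIV"
proof -
  define r where "r = complex_of_real (norm q)"
  have r: "norm r < 1" using q by (simp add: r_def)
  have "Bseq (\<lambda>m. eta_val m r)"
    by (rule convergent_imp_Bseq[OF convergentI[OF eta_val_tendsto[OF r]]])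
  then obtain B where B': "\<forall>m. norm (eta_val m r) \<le> B" unfolding Bseq_def by auto
  hence B: "norm (eta_val m r) \<le> B" for m by simp
  have "summable (\<lambda>n. of_int (cc (int n - 1)) * norm q ^ n)"
  proof (rule summableI_nonneg_bounded)
    fix N
    let ?f = "\<lambda>n. of_int (fps_nth (eta_trunc N) n) * norm q ^ n"
    have ev: "eval_abs (eta_trunc N) r (eta_val N r)" by (rule eval_abs_eta_trunc[OF r])
    have nn0: "fps_nth (eta_trunc N) n \<ge> 0" for n using nonneg_eta_trunc[of N] by (simp add: nonneg_fps_def)
    hence nn: "?f n \<ge> 0" for n by simp
    have fs: "(\<lambda>n. complex_of_real (?f n)) sums eta_val N r" using ev by (simp add: eval_abs_def r_def)
    have s: "summable ?f" using ev nn0 unfolding eval_abs_def by (simp add: norm_mult norm_power r_def abs_mult)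
    have "(\<lambda>n. complex_of_real (?f n)) sums complex_of_real (suminf ?f)"
      by (rule sums_of_real[OF summable_sums[OF s]])
    hence "complex_of_real (suminf ?f) = eta_val N r" using fs by (rule sums_unique2)
    hence "norm (complex_of_real (suminf ?f)) \<le> B" using B[of N] by simp
    hence B2: "suminf ?f \<le> B" unfolding norm_of_real by linarith
    have "(\<Sum>n<N. of_int (cc (int n - 1)) * norm q ^ n) = (\<Sum>n<N. ?f n)"
      by (intro sum.cong refl) (simp add: nth_eta_trunc)
    also have "\<dots> \<le> suminf ?f" by (rule sum_le_suminf[OF s]) (use nn in auto)
    also have "\<dots> \<le> B" by (rule B2)
    finally show "(\<Sum>n<N. of_int (cc (int n - 1)) * norm q ^ n) \<le> B" .
  qed (simp add: cc_nonneg)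
  hence s: "(\<lambda>n. of_int (cc (int n - 1)) * norm q ^ n) summable_on UNIV"
    by (intro norm_summable_imp_summable_on) (simp add: cc_nonneg abs_mult)
  have bound: "norm (of_int (fps_nth (eta_trunc m) n) * q ^ n) \<le> of_int (cc (int n - 1)) * norm q ^ n" for m n
    using eta_trunc_le_cc[of m n] nonneg_eta_trunc[of m] unfolding norm_mult norm_power
    by (intro mult_right_mono) (auto simp: nonneg_fps_def)
  have lim: "(\<lambda>m. of_int (fps_nth (eta_trunc m) n) * q ^ n) \<longlonglongrightarrow> of_int (cc (int n - 1)) * q ^ n" for n
    by (rule tendsto_eventually, rule eventually_sequentiallyI[of n]) (simp add: nth_eta_trunc)
  note T = tannery_infsum[where A = UNIV and a = "\<lambda>n m. of_int (fps_nth (eta_trunc m) n) * q ^ n" and b = "\<lambda>n. of_int (cc (int n - 1)) * q ^ n", OF lim bound s]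
  show s2: "(\<lambda>n. norm (of_int (cc (int n - 1)) * q ^ n)) summable_on UNIV" using T(2) by simp
  have ev: "(\<Sum>\<^sub>\<infinity>n. of_int (fps_nth (eta_trunc m) n) * q ^ n) = eta_val m q" for m
    using eval_abs_eta_trunc[OF q, of m] unfolding eval_abs_def by (auto intro!: infsumI norm_summable_imp_has_sum)
  have "(\<lambda>m. eta_val m q) \<longlonglongrightarrow> (\<Sum>\<^sub>\<infinity>n. of_int (cc (int n - 1)) * q ^ n)" using T(1) unfolding ev .
  hence "(\<Sum>\<^sub>\<infinity>n. of_int (cc (int n - 1)) * q ^ n) = (qp (q^2) (q^2) / (qp q q * qp (q^4) (q^4))) ^ 8"
    using eta_val_tendsto[OF q] by (rule LIMSEQ_unique)
  thus "((\<lambda>n. of_int (cc (int n - 1)) * q ^ n) has_sum (qp (q^2) (q^2) / (qp q q * qp (q^4) (q^4))) ^ 8) UNIV"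
    using has_sum_infsum[OF abs_summable_summable[OF s2]] by simp
qed

section \<open>Modular transformations of theta constants\<close>

lemma exp_2pi_int [simp]: "exp (2 * pi * \<i> * of_int n) = 1"
  using exp_integer_2pi[of "of_int n"] by (simp add: mult_ac)

lemma exp_cancel: "exp (- y) * (exp y * z) = z" for y z :: complex
  by (simp flip: mult.assoc exp_add)

lemma th1_eq: "th1 t v = (\<Sum>\<^sub>\<infinity>n::int. exp (pi * \<i> * t * (of_int n + 1/2) ^ 2 + 2 * pi * \<i> * (of_int n + 1/2) * v))"
proof -
  have "exp (pi * \<i> * t * (of_int n + 1/2) ^ 2 + 2 * pi * \<i> * (of_int n + 1/2) * v) =
     exp (pi * \<i> * t / 4 + pi * \<i> * v) * exp (pi * \<i> * t * of_int n ^ 2 + 2 * pi * \<i> * of_int n * (v + t / 2))" for n :: int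
    unfolding exp_add [symmetric] by (simp add: power2_eq_square algebra_simps add_divide_distrib)
  thus ?thesis unfolding th1_def th_def by (simp only: infsum_cmult_right')
qed

lemma abs_summable_th1:
  assumes "Im t > 0"
  shows "(\<lambda>n::int. norm (exp (pi * \<i> * t * (of_int n + 1/2) ^ 2 + 2 * pi * \<i> * (of_int n + 1/2) * v))) summable_on UNIV"
proof -
  have "exp (pi * \<i> * t * (of_int n + 1/2) ^ 2 + 2 * pi * \<i> * (of_int n + 1/2) * v) =
     exp (pi * \<i> * t / 4 + pi * \<i> * v) * exp (pi * \<i> * t * of_int n ^ 2 + 2 * pi * \<i> * of_int n * (v + t / 2))" for n :: int
    unfolding exp_add [symmetric] by (simp add: power2_eq_square algebra_simps add_divide_distrib)
  thus ?thesis using summable_on_cmult_right[OF abs_summable_th[OF assms, of "v + t/2"]]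
    by (simp only: norm_mult)
qed

text \<open>The shift by t completes a square and amounts to replacing n by n + 1.\<close>

lemma th_quasi: "th t (v + t) = exp (- pi * \<i> * t - 2 * pi * \<i> * v) * th t v"
proof -
  have "th t v = (\<Sum>\<^sub>\<infinity>n::int. exp (pi * \<i> * t * of_int (n + 1) ^ 2 + 2 * pi * \<i> * of_int (n + 1) * v))"
    unfolding th_def by (rule infsum_reindex_bij_witness[of _ "\<lambda>n. n + 1" "\<lambda>n. n - 1"]) auto
  also have "\<dots> = (\<Sum>\<^sub>\<infinity>n::int. exp (pi * \<i> * t + 2 * pi * \<i> * v) * exp (pi * \<i> * t * of_int n ^ 2 + 2 * pi * \<i> * of_int n * (v + t)))"
    unfolding exp_add [symmetric] by (simp add: power2_eq_square algebra_simps)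
  also have "\<dots> = exp (pi * \<i> * t + 2 * pi * \<i> * v) * th t (v + t)"
    unfolding th_def by (rule infsum_cmult_right')
  finally have "exp (- pi * \<i> * t - 2 * pi * \<i> * v) * th t v = 
      (exp (- pi * \<i> * t - 2 * pi * \<i> * v) * exp (pi * \<i> * t + 2 * pi * \<i> * v)) * th t (v + t)"
    by simp
  also have "exp (- pi * \<i> * t - 2 * pi * \<i> * v) * exp (pi * \<i> * t + 2 * pi * \<i> * v) = 1"
    unfolding exp_add [symmetric] by simp
  finally show ?thesis by simp
qed

section \<open>Products of theta functions and Jacobi's quartic identity\<close>

lemma infsum_prod_two:
  fixes f g :: "'a \<Rightarrow> complex"
  assumes "(\<lambda>x. norm (f x)) summable_on UNIV" "(\<lambda>x. norm (g x)) summable_on UNIV"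
  shows "((\<lambda>(x, y). f x * g y) has_sum (infsum f UNIV * infsum g UNIV)) UNIV"
proof -
  have "(\<lambda>(x, y). f x * g y) summable_on (UNIV \<times> UNIV)"
  proof (rule abs_summable_summable)
    have "((\<lambda>y. norm (f x) * norm (g y)) has_sum (norm (f x) * infsum (\<lambda>y. norm (g y)) UNIV)) UNIV" for x
      by (intro has_sum_cmult_right has_sum_infsum assms(2))
    hence "(\<lambda>(x, y). norm (f x) * norm (g y)) summable_on (UNIV \<times> UNIV)"
      by (intro summable_on_SigmaI[where g = "\<lambda>x. norm (f x) * infsum (\<lambda>y. norm (g y)) UNIV"])
         (auto intro!: summable_on_cmult_left assms(1))
    thus "(\<lambda>z. norm (case z of (x, y) \<Rightarrow> f x * g y)) summable_on (UNIV \<times> UNIV)"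
      by (simp add: case_prod_unfold norm_mult)
  qed
  moreover have "((\<lambda>y. f x * g y) has_sum (f x * infsum g UNIV)) UNIV" for x
    by (intro has_sum_cmult_right has_sum_infsum abs_summable_summable[OF assms(2)])
  moreover have "((\<lambda>x. f x * infsum g UNIV) has_sum (infsum f UNIV * infsum g UNIV)) UNIV"
    by (intro has_sum_cmult_left has_sum_infsum abs_summable_summable[OF assms(1)])
  ultimately show ?thesis
    using has_sum_SigmaI[where A = UNIV and f = "\<lambda>(x, y). f x * g y" and g = "\<lambda>x. f x * infsum g UNIV" and B = "\<lambda>_. UNIV"] by simp
qed

text \<open>Rotation of the lattice of pairs: m = a + b, n = a - b gives m^2 + n^2 = 2 (a^2 + b^2).
  Pairs with even sum come from integral (a, b), pairs with odd sum from half-integral ones, hence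
  the two products.\<close>

theorem th_mult:
  assumes t: "Im t > 0"
  shows "th t u * th t v = th (2 * t) (u + v) * th (2 * t) (u - v) + th1 (2 * t) (u + v) * th1 (2 * t) (u - v)"
proof -
  let ?f = "\<lambda>t v n. exp (pi * \<i> * t * of_int n ^ 2 + 2 * pi * \<i> * of_int n * v)"
  let ?g = "\<lambda>t v n. exp (pi * \<i> * t * (of_int n + 1/2) ^ 2 + 2 * pi * \<i> * (of_int n + 1/2) * v)"
  define P where "P = (\<lambda>(m::int, n). ?f t u m * ?f t v n)"
  have t2: "Im (2 * t) > 0" using t by simp
  have "(P has_sum (th t u * th t v)) UNIV"
    unfolding P_def th_def by (rule infsum_prod_two; rule abs_summable_th[OF t])
  moreover have "(P has_sum (th (2 * t) (u + v) * th (2 * t) (u - v))) {(m, n). even (m + n)}"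
  proof -
    have "((\<lambda>(a, b). ?f (2 * t) (u + v) a * ?f (2 * t) (u - v) b) has_sum (th (2 * t) (u + v) * th (2 * t) (u - v))) UNIV"
      unfolding th_def by (rule infsum_prod_two; rule abs_summable_th[OF t2])
    also have "?this \<longleftrightarrow> ?thesis"
    proof (rule has_sum_reindex_bij_witness[of _ "\<lambda>(m, n). ((m + n) div 2, (m - n) div 2)" "\<lambda>(a, b). (a + b, a - b)"])
      fix x :: "int \<times> int"
      obtain a b where x: "x = (a, b)" by force
      show "P (case x of (a, b) \<Rightarrow> (a + b, a - b)) = (case x of (a, b) \<Rightarrow> ?f (2 * t) (u + v) a * ?f (2 * t) (u - v) b)"
        unfolding x P_def by (simp add: algebra_simps power2_eq_square flip: exp_add)
    next
      fix x :: "int \<times> int"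
      assume "x \<in> {(m, n). even (m + n)}"
      then obtain m n where x: "x = (m, n)" "even (m + n)" by auto
      then obtain k where k: "m + n = 2 * k" by (elim evenE)
      hence "m - n = 2 * (k - n)" by simp
      hence "(m - n) div 2 = k - n" "(m + n) div 2 = k" using k by simp_all
      thus "(case (case x of (m, n) \<Rightarrow> ((m + n) div 2, (m - n) div 2)) of (a, b) \<Rightarrow> (a + b, a - b)) = x"
        using k by (simp add: x)
    qed auto
    finally show ?thesis .
  qed
  moreover have "(P has_sum (th1 (2 * t) (u + v) * th1 (2 * t) (u - v))) {(m, n). odd (m + n)}"
  proof -
    have "((\<lambda>(a, b). ?g (2 * t) (u + v) a * ?g (2 * t) (u - v) b) has_sum (th1 (2 * t) (u + v) * th1 (2 * t) (u - v))) UNIV"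
      unfolding th1_eq by (rule infsum_prod_two; rule abs_summable_th1[OF t2])
    also have "?this \<longleftrightarrow> ?thesis"
    proof (rule has_sum_reindex_bij_witness[of _ "\<lambda>(m, n). ((m + n - 1) div 2, (m - n - 1) div 2)" "\<lambda>(a, b). (a + b + 1, a - b)"])
      fix x :: "int \<times> int"
      obtain a b where x: "x = (a, b)" by force
      show "P (case x of (a, b) \<Rightarrow> (a + b + 1, a - b)) = (case x of (a, b) \<Rightarrow> ?g (2 * t) (u + v) a * ?g (2 * t) (u - v) b)"
        unfolding x P_def by (simp add: algebra_simps power2_eq_square add_divide_distrib flip: exp_add)
    next
      fix x :: "int \<times> int"
      assume "x \<in> {(m, n). odd (m + n)}"
      then obtain m n where x: "x = (m, n)" "odd (m + n)" by auto
      then obtain k where k: "m + n = 2 * k + 1" by (elim oddE)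
      hence "m - n - 1 = 2 * (k - n)" by simp
      hence "(m - n - 1) div 2 = k - n" "(m + n - 1) div 2 = k" using k by simp_all
      thus "(case (case x of (m, n) \<Rightarrow> ((m + n - 1) div 2, (m - n - 1) div 2)) of (a, b) \<Rightarrow> (a + b + 1, a - b)) = x"
        using k by (simp add: x)
    qed auto
    finally show ?thesis .
  qed
  moreover have "UNIV = {(m::int, n). even (m + n)} \<union> {(m, n). odd (m + n)}" by auto
  ultimately show ?thesis
    using has_sum_Un_disjoint[where f = P and A = "{(m, n). even (m + n)}" and B = "{(m, n). odd (m + n)}"] has_sum_unique
    by fastforce
qed

abbreviation "\<theta>2 t \<equiv> th1 t 0"
abbreviation "\<theta>3 t \<equiv> th t 0"
abbreviation "\<theta>4 t \<equiv> th t (1/2)"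

lemma theta3_square: "Im t > 0 \<Longrightarrow> \<theta>3 t ^ 2 = \<theta>3 (2 * t) ^ 2 + \<theta>2 (2 * t) ^ 2"
  using th_mult[of t 0 0] by (simp add: power2_eq_square)

text \<open>The case u = v = t/2 of \<open>th_mult\<close>: quasi-periodicity makes both summands
  the same multiple of \<theta>2 \<theta>3 at 2t.\<close>

lemma theta2_square:
  assumes t: "Im t > 0"
  shows "\<theta>2 t ^ 2 = 2 * \<theta>2 (2 * t) * \<theta>3 (2 * t)"
proof -
  have a: "th (2 * t) t = exp (- (pi * \<i> * t / 2)) * \<theta>2 (2 * t)"
  proof -
    have "\<theta>2 (2 * t) = exp (pi * \<i> * t / 2) * th (2 * t) t" unfolding th1_def by (simp add: mult_ac)
    thus ?thesis by (simp only: exp_cancel)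
  qed
  have "th1 (2 * t) t = exp (pi * \<i> * t / 2 + pi * \<i> * t) * th (2 * t) (0 + 2 * t)"
    unfolding th1_def by simp
  also have "\<dots> = exp (pi * \<i> * t / 2 + pi * \<i> * t) * exp (- pi * \<i> * (2 * t) - 2 * pi * \<i> * 0) * \<theta>3 (2 * t)"
    unfolding th_quasi by simp
  also have "exp (pi * \<i> * t / 2 + pi * \<i> * t) * exp (- pi * \<i> * (2 * t) - 2 * pi * \<i> * 0) = exp (- (pi * \<i> * t / 2))"
    unfolding exp_add [symmetric] by (rule arg_cong[of _ _ exp]) (simp add: field_simps)
  finally have b: "th1 (2 * t) t = exp (- (pi * \<i> * t / 2)) * \<theta>3 (2 * t)" .
  have A: "th t (t/2) * th t (t/2) = exp (- (pi * \<i> * t / 2)) * (2 * \<theta>2 (2 * t) * \<theta>3 (2 * t))"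
    using th_mult[OF t, of "t/2" "t/2"] a b by simp
  have B: "\<theta>2 t ^ 2 = (exp (pi * \<i> * t / 4) * exp (pi * \<i> * t / 4)) * (th t (t/2) * th t (t/2))"
    unfolding th1_def by (simp add: power2_eq_square)
  have C: "exp (pi * \<i> * t / 4) * exp (pi * \<i> * t / 4) * exp (- (pi * \<i> * t / 2)) = 1"
    unfolding exp_add [symmetric] by simp
  have "\<theta>2 t ^ 2 = (exp (pi * \<i> * t / 4) * exp (pi * \<i> * t / 4) * exp (- (pi * \<i> * t / 2))) * (2 * \<theta>2 (2 * t) * \<theta>3 (2 * t))"
    unfolding A B by (simp only: mult.assoc)
  thus ?thesis unfolding C by simp
qed

lemma theta3_shift: "\<theta>3 (t + 1) = \<theta>4 t" using th_shift_nat[of t 0] by simp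

lemma theta4_shift: "\<theta>4 (t + 1) = \<theta>3 t" using th_shift_nat[of t "1/2"] th_period[of t 0] by simp

lemma theta2_shift: "\<theta>2 (t + 1) = exp (pi * \<i> / 4) * \<theta>2 t"
proof -
  have "th (t + 1) ((t + 1) / 2) = th t (t/2 + 1)" unfolding th_shift_nat by (simp add: add_divide_distrib add_ac)
  thus ?thesis unfolding th1_def th_period by (simp add: add_divide_distrib algebra_simps flip: exp_add)
qed

lemma exp_pi_quarter_4: "exp (pi * \<i> / 4) ^ 4 = - 1"
  by (simp flip: exp_of_nat_mult)

lemma theta2_shift_4: "\<theta>2 (t + 1) ^ 4 = - (\<theta>2 t ^ 4)"
  unfolding theta2_shift power_mult_distrib exp_pi_quarter_4 by simp

lemma theta2_shift_8: "\<theta>2 (t + 1) ^ 8 = \<theta>2 t ^ 8"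
proof -
  have "x ^ 8 = (x ^ 4) ^ 2" for x :: complex by (simp flip: power_mult)
  note p8 = this
  show ?thesis unfolding p8[of "\<theta>2 (t + 1)"] p8[of "\<theta>2 t"] theta2_shift_4 by simp
qed

text \<open>The translate of \<open>theta3_square\<close> by 1; moving 2t by 2 multiplies the square
  of \<theta>2 by exp (pi i / 4)^4 = -1.\<close>

lemma theta4_square:
  assumes t: "Im t > 0" shows "\<theta>4 t ^ 2 = \<theta>3 (2 * t) ^ 2 - \<theta>2 (2 * t) ^ 2"
proof -
  have "\<theta>4 t ^ 2 = \<theta>3 (2 * (t + 1)) ^ 2 + \<theta>2 (2 * (t + 1)) ^ 2"
    using theta3_square[of "t + 1"] t by (simp add: theta3_shift)
  also have "2 * (t + 1) = 2 * t + 1 + 1" by simp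
  also have "\<theta>3 (2 * t + 1 + 1) = \<theta>3 (2 * t)" by (simp only: theta3_shift theta4_shift)
  also have "\<theta>2 (2 * t + 1 + 1) ^ 2 = exp (pi * \<i> / 4) ^ 4 * \<theta>2 (2 * t) ^ 2"
    unfolding theta2_shift by (simp add: power_mult_distrib flip: power_mult power_add mult.assoc power2_eq_square)
  finally show ?thesis by (simp add: exp_pi_quarter_4)
qed

text \<open>The two duplication formulas have the shapes A + B and A - B, and (A + B)^2 - (A - B)^2
  = 4 A B.\<close>

theorem jacobi_quartic:
  assumes t: "Im t > 0" shows "\<theta>3 t ^ 4 - \<theta>4 t ^ 4 = \<theta>2 t ^ 4"
proof -
  have p4: "x ^ 4 = (x ^ 2) ^ 2" for x :: complex by (simp flip: power_mult)
  have "\<theta>3 t ^ 4 - \<theta>4 t ^ 4 = 4 * \<theta>3 (2 * t) ^ 2 * \<theta>2 (2 * t) ^ 2"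
    unfolding p4[of "\<theta>3 t"] p4[of "\<theta>4 t"] theta3_square[OF t] theta4_square[OF t]
    by (simp add: power2_eq_square algebra_simps)
  also have "\<dots> = \<theta>2 t ^ 4"
    unfolding p4[of "\<theta>2 t"] theta2_square[OF t] by (simp add: power2_eq_square)
  finally show ?thesis .
qed

lemma theta4_double:
  assumes t: "Im t > 0" shows "\<theta>4 (2 * t) ^ 8 = (\<theta>3 t * \<theta>4 t) ^ 4"
proof -
  have "\<theta>4 (2 * t) ^ 4 = \<theta>3 (2 * t) ^ 4 - \<theta>2 (2 * t) ^ 4"
    using jacobi_quartic[of "2 * t"] t by (simp add: algebra_simps)
  also have "\<dots> = (\<theta>3 (2 * t) ^ 2 + \<theta>2 (2 * t) ^ 2) * (\<theta>3 (2 * t) ^ 2 - \<theta>2 (2 * t) ^ 2)"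
    by (simp add: algebra_simps flip: power_add)
  also have "\<dots> = (\<theta>3 t * \<theta>4 t) ^ 2"
    unfolding theta3_square[OF t, symmetric] theta4_square[OF t, symmetric] by (simp add: power_mult_distrib)
  finally have "(\<theta>4 (2 * t) ^ 4) ^ 2 = ((\<theta>3 t * \<theta>4 t) ^ 2) ^ 2" by simp
  thus ?thesis by (simp flip: power_mult)
qed

lemma theta3_nonzero: "Im t > 0 \<Longrightarrow> \<theta>3 t \<noteq> 0"
  using th_half_nonzero[of "t + 1"] theta4_shift[of t] by simp

section \<open>Three forms of weight -4 permuted by the modular group\<close>

text \<open>In terms of the eta function \<open>g1\<close> is 16 \<eta>(2t)^8 / \<eta>(t)^16,
  \<open>g2\<close> is \<eta>(t/2)^8 / \<eta>(t)^16, and \<open>g3\<close> is the translate of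
  \<open>g2\<close> by 1. Translation fixes \<open>g1\<close> and exchanges the other two, inversion
  exchanges \<open>g1\<close> and \<open>g2\<close> and fixes \<open>g3\<close>: the action of
  SL2(Z) on the three nonzero vectors mod 2.\<close>

definition g1 :: "complex \<Rightarrow> complex" where "g1 t = 16 / \<theta>4 (2 * t) ^ 8"
definition g2 :: "complex \<Rightarrow> complex" where "g2 t = 2 ^ 8 / \<theta>2 (t / 2) ^ 8"
definition g3 :: "complex \<Rightarrow> complex" where "g3 t = 2 ^ 8 / \<theta>2 ((t + 1) / 2) ^ 8"

text \<open>With x, y, z the fourth powers of \<theta>2, \<theta>3, \<theta>4 the terms are 16 / (y
  z), 16 / (x y) and -16 / (x z). Their sum is a multiple of x + z - y, which vanishes by Jacobi's
  quartic identity.\<close>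

theorem g_sum_zero:
  assumes t: "Im t > 0"
  shows "g1 t + g2 t + g3 t = 0"
proof -
  have p8: "x ^ 8 = (x ^ 2) ^ 4" for x :: complex by (simp flip: power_mult)
  have t2: "Im (t/2) > 0" "Im ((t+1)/2) > 0" using t by auto
  have a: "\<theta>2 (t/2) ^ 8 = 16 * \<theta>2 t ^ 4 * \<theta>3 t ^ 4"
    unfolding p8 theta2_square[OF t2(1)] by (simp add: power_mult_distrib)
  have b: "\<theta>2 ((t+1)/2) ^ 8 = - (16 * \<theta>2 t ^ 4 * \<theta>4 t ^ 4)"
  proof -
    have e: "2 * ((t + 1) / 2) = t + 1" by simp
    show ?thesis
      unfolding p8 theta2_square[OF t2(2), unfolded e] by (simp add: power_mult_distrib theta2_shift_4 theta3_shift)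
  qed
  note nz = th1_zero_nonzero[OF t] theta3_nonzero[OF t] th_half_nonzero[OF t]
  define x y z where "x = \<theta>2 t ^ 4" and "y = \<theta>3 t ^ 4" and "z = \<theta>4 t ^ 4"
  have nz': "x \<noteq> 0" "y \<noteq> 0" "z \<noteq> 0" using nz by (auto simp: x_def y_def z_def)
  have xyz: "x = y - z" using jacobi_quartic[OF t] by (simp add: x_def y_def z_def)
  have "g1 t = 16 / (y * z)" unfolding g1_def theta4_double[OF t] by (simp add: y_def z_def power_mult_distrib)
  moreover have "g2 t = 16 / (x * y)" unfolding g2_def a by (simp add: y_def x_def)
  moreover have "g3 t = - 16 / (x * z)" unfolding g3_def b by (simp add: x_def z_def)
  moreover have "16 / (y * z) + 16 / (x * y) + - 16 / (x * z) = 16 * (x + z - y) / (x * y * z)"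
    using nz' by (simp add: field_simps)
  ultimately show ?thesis by (simp add: xyz)
qed

lemma g1_shift: "g1 (t + 1) = g1 t"
proof -
  have "2 * (t + 1) = 2 * t + 1 + 1" by simp
  hence "\<theta>4 (2 * (t + 1)) = \<theta>4 (2 * t)" by (simp only: theta3_shift theta4_shift)
  thus ?thesis by (simp only: g1_def)
qed

lemma g2_shift: "g2 (t + 1) = g3 t" by (simp add: g2_def g3_def)

lemma g3_shift: "g3 (t + 1) = g2 t"
proof -
  have "(t + 1 + 1) / 2 = t / 2 + 1" by (simp add: add_divide_distrib)
  thus ?thesis by (simp only: g2_def g3_def theta2_shift_8)
qed

section \<open>Inversion of the shifted theta functions\<close>

lemma csqrt_ii_8: "csqrt (- \<i> * t) ^ 8 = t ^ 4"
proof -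
  have "x ^ 8 = (x ^ 2) ^ 4" for x :: complex by (simp flip: power_mult)
  hence "csqrt (- \<i> * t) ^ 8 = (csqrt (- \<i> * t) ^ 2) ^ 4" by blast
  also have "\<dots> = (- \<i> * t) ^ 4" by (simp only: power2_csqrt)
  also have "\<dots> = t ^ 4" by (simp add: power_mult_distrib)
  finally show ?thesis .
qed

lemma th_half_inversion:
  assumes t: "Im t > 0"
  shows "th (- 1 / t) (v / t + 1/2) = csqrt (- \<i> * t) * exp (pi * \<i> * v^2 / t) * th1 t v"
proof -
  have nz: "t \<noteq> 0" using t by auto
  have "v / t + 1/2 = (v + t / 2) / t" using nz by (simp add: field_simps)
  hence "th (- 1 / t) (v / t + 1/2) = csqrt (- \<i> * t) * exp (pi * \<i> * (v + t/2)^2 / t) * th t (v + t/2)"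
    using th_inversion[OF t, of "v + t/2"] by simp
  also have "pi * \<i> * (v + t/2)^2 / t = pi * \<i> * v^2 / t + (pi * \<i> * t / 4 + pi * \<i> * v)"
    using nz by (simp add: power2_eq_square field_simps)
  finally show ?thesis unfolding th1_def exp_add by (simp add: mult_ac)
qed

lemma th1_inversion:
  assumes t: "Im t > 0"
  shows "th1 (- 1 / t) (v / t) = csqrt (- \<i> * t) * exp (pi * \<i> * v^2 / t) * th t (v + 1/2)"
proof -
  have nz: "t \<noteq> 0" using t by auto
  have "v / t + (- 1 / t) / 2 = (v - 1/2) / t" using nz by (simp add: field_simps)
  hence "th1 (- 1 / t) (v / t) = exp (pi * \<i> * (- 1 / t) / 4 + pi * \<i> * (v / t)) *
      (csqrt (- \<i> * t) * exp (pi * \<i> * (v - 1/2)^2 / t) * th t (v - 1/2))"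
    using th_inversion[OF t, of "v - 1/2"] by (simp add: th1_def)
  also have "th t (v - 1/2) = th t (v + 1/2)" using th_period[of t "v - 1/2"] by (simp add: add.commute)
  also have "exp (pi * \<i> * (- 1 / t) / 4 + pi * \<i> * (v / t)) * (csqrt (- \<i> * t) * exp (pi * \<i> * (v - 1/2)^2 / t) * th t (v + 1/2))
     = csqrt (- \<i> * t) * (exp (pi * \<i> * (- 1 / t) / 4 + pi * \<i> * (v / t)) * exp (pi * \<i> * (v - 1/2)^2 / t)) * th t (v + 1/2)"
    by (simp add: mult_ac)
  also have "exp (pi * \<i> * (- 1 / t) / 4 + pi * \<i> * (v / t)) * exp (pi * \<i> * (v - 1/2)^2 / t) = exp (pi * \<i> * v^2 / t)"
    unfolding exp_add [symmetric] using nz by (intro arg_cong[of _ _ exp]) (simp add: power2_eq_square field_simps)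
  finally show ?thesis .
qed

lemma th1_period: "th1 t (v + 1) = - th1 t v"
proof -
  have "th t (v + 1 + t / 2) = th t (v + t / 2)" using th_period[of t "v + t/2"] by (simp add: add_ac)
  moreover have "exp (pi * \<i> * t / 4 + pi * \<i> * (v + 1)) = - exp (pi * \<i> * t / 4 + pi * \<i> * v)"
    by (simp add: distrib_left exp_add mult_ac)
  ultimately show ?thesis unfolding th1_def by simp
qed

lemma exp_pi_ii_half: "exp (pi * \<i> / 2) = \<i>"
  using cis_conv_exp[of "pi/2"] by (simp add: mult_ac)

text \<open>This shift gives the odd theta function, which inversion preserves up to a constant. The
  factor \<i> disappears in products of eight.\<close>

lemma th1_half_inversion:
  assumes t: "Im t > 0"
  shows "th1 (- 1 / t) (v / t + 1/2) = \<i> * (csqrt (- \<i> * t) * exp (pi * \<i> * v^2 / t) * th1 t (v - 1/2))"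
proof -
  have nz: "t \<noteq> 0" using t by auto
  have "v / t + 1/2 = (v + t/2) / t" using nz by (simp add: field_simps)
  hence "th1 (- 1 / t) (v / t + 1/2) = csqrt (- \<i> * t) * exp (pi * \<i> * (v + t/2)^2 / t) * th t (v + t/2 + 1/2)"
    using th1_inversion[OF t, of "v + t/2"] by simp
  also have "th t (v + t/2 + 1/2) = th t ((v - 1/2) + t/2)" using th_period[of t "v - 1/2 + t/2"] by (simp add: algebra_simps)
  also have "\<dots> = exp (- (pi * \<i> * t / 4 + pi * \<i> * (v - 1/2))) * th1 t (v - 1/2)"
    unfolding th1_def by (simp only: exp_cancel)
  also have "csqrt (- \<i> * t) * exp (pi * \<i> * (v + t/2)^2 / t) * (exp (- (pi * \<i> * t / 4 + pi * \<i> * (v - 1/2))) * th1 t (v - 1/2))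
     = csqrt (- \<i> * t) * (exp (pi * \<i> * (v + t/2)^2 / t) * exp (- (pi * \<i> * t / 4 + pi * \<i> * (v - 1/2)))) * th1 t (v - 1/2)"
    by (simp add: mult_ac)
  also have "exp (pi * \<i> * (v + t/2)^2 / t) * exp (- (pi * \<i> * t / 4 + pi * \<i> * (v - 1/2))) = exp (pi * \<i> * v^2 / t + pi * \<i> / 2)"
    unfolding exp_add [symmetric] using nz by (intro arg_cong[of _ _ exp]) (simp add: power2_eq_square field_simps)
  also have "\<dots> = \<i> * exp (pi * \<i> * v^2 / t)" by (simp add: exp_add exp_pi_ii_half)
  finally show ?thesis by (simp add: mult_ac)
qed

lemma theta4_inversion_8: "Im t > 0 \<Longrightarrow> \<theta>4 (- 1 / t) ^ 8 = t ^ 4 * \<theta>2 t ^ 8"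
  using th_half_inversion[of t 0] by (simp add: power_mult_distrib csqrt_ii_8[simplified])

lemma theta2_inversion_8: "Im t > 0 \<Longrightarrow> \<theta>2 (- 1 / t) ^ 8 = t ^ 4 * \<theta>4 t ^ 8"
  using th1_inversion[of t 0] by (simp add: power_mult_distrib csqrt_ii_8[simplified])

lemma g1_inversion:
  assumes t: "Im t > 0" shows "g1 (- 1 / t) = g2 t / t ^ 4"
proof -
  have "2 * (- 1 / t) = - 1 / (t / 2)" by simp
  hence "g1 (- 1 / t) = 16 / \<theta>4 (- 1 / (t/2)) ^ 8" by (simp only: g1_def)
  also have "\<dots> = 16 / ((t/2) ^ 4 * \<theta>2 (t/2) ^ 8)" using theta4_inversion_8[of "t/2"] t by simp
  finally show ?thesis by (simp add: g2_def power_divide)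
qed

lemma g2_inversion:
  assumes t: "Im t > 0" shows "g2 (- 1 / t) = g1 t / t ^ 4"
proof -
  have "- 1 / t / 2 = - 1 / (2 * t)" by simp
  hence "g2 (- 1 / t) = 2^8 / \<theta>2 (- 1 / (2 * t)) ^ 8" by (simp only: g2_def)
  also have "\<dots> = 2^8 / ((2 * t) ^ 4 * \<theta>4 (2 * t) ^ 8)" using theta2_inversion_8[of "2 * t"] t by simp
  finally show ?thesis by (simp add: g1_def power_mult_distrib)
qed

lemma Im_minus_inverse_pos: "Im t > 0 \<Longrightarrow> Im (- 1 / t) > 0"
  by (auto simp: Im_divide power2_eq_square intro!: divide_pos_pos add_nonneg_pos)

text \<open>Read off from the linear relation; a direct treatment of \<theta>2 at the shifted
  argument would need a longer word in translations and inversions.\<close>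

lemma g3_inversion:
  assumes t: "Im t > 0" shows "g3 (- 1 / t) = g3 t / t ^ 4"
proof -
  have "g3 (- 1 / t) = - (g1 (- 1 / t) + g2 (- 1 / t))"
    using g_sum_zero[OF Im_minus_inverse_pos[OF t]] by (simp add: add_eq_0_iff)
  also have "\<dots> = - (g1 t + g2 t) / t ^ 4"
    unfolding g1_inversion[OF t] g2_inversion[OF t] by (simp add: diff_divide_distrib algebra_simps)
  also have "- (g1 t + g2 t) = g3 t" using g_sum_zero[OF t] by (simp add: add_eq_0_iff)
  finally show ?thesis .
qed

lemma has_sum_shift_cc:
  assumes "((\<lambda>n. f (int n - 1)) has_sum s) UNIV" and "\<And>j. j < -1 \<Longrightarrow> f j = (0 :: complex)"
  shows "(f has_sum s) UNIV"
proof -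
  have "(f has_sum s) {-1..} \<longleftrightarrow> ((\<lambda>n. f (int n - 1)) has_sum s) UNIV"
    by (rule has_sum_reindex_bij_witness[of _ "\<lambda>n. int n - 1" "\<lambda>j. nat (j + 1)"]) auto
  hence "(f has_sum s) {-1..}" using assms(1) by simp
  thus ?thesis by (rule has_sum_cong_neutral[THEN iffD1, rotated -1]) (use assms(2) in auto)
qed

text \<open>With q = exp (pi i t) the generating series is the eta quotient at t/2. The half shift
  in \<open>g3\<close> replaces q by -q in the product for \<theta>2, which produces the minus sign,
  and the products match by (q^2; q^2)^2 = (q; q)(q^4; q^4)(-q; q^2).\<close>

theorem cc_has_sum_g3:
  assumes t: "Im t > 0"
  shows "((\<lambda>j. of_int (cc j) * exp (2 * pi * \<i> * of_int j * (t / 2))) has_sum - g3 t) UNIV"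
proof -
  define q where "q = exp (pi * \<i> * t)"
  have q: "norm q < 1" unfolding q_def by (rule norm_exp_ii_lt_1[OF t])
  have q0: "q \<noteq> 0" by (simp add: q_def)
  note n = norm_power_lt_1[OF q, of 2, simplified] 
  have n2: "norm (q^2) < 1" and n4: "norm (q^4) < 1" using norm_power_lt_1[OF q] by auto
  have e: "of_int (cc (int n - 1)) * exp (2 * pi * \<i> * of_int (int n - 1) * (t / 2)) = of_int (cc (int n - 1)) * q ^ n / q" for n
  proof -
    have "2 * pi * \<i> * of_int (int n - 1) * (t / 2) = of_nat n * (pi * \<i> * t) - pi * \<i> * t"
      by (simp add: field_simps)
    thus ?thesis by (simp add: exp_diff q_def exp_of_nat_mult)
  qed
  have s: "((\<lambda>n. of_int (cc (int n - 1)) * q ^ n / q) has_sum (qp (q^2) (q^2) / (qp q q * qp (q^4) (q^4))) ^ 8 / q) UNIV"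
    by (rule has_sum_divide_const[OF cc_sums(2)[OF q]])
  have "2 * pi * \<i> * ((t + 1) / 2) = pi * \<i> * t + \<i> * pi" by (simp add: field_simps)
  hence "exp (2 * pi * \<i> * ((t + 1) / 2)) = - q" by (simp only: exp_add exp_pi_i' q_def) simp
  hence "\<theta>2 ((t + 1) / 2) = 2 * exp (pi * \<i> * ((t + 1) / 2) / 4) * (qp (q^2) (q^2) / qp (- q) (q^2))"
    using th1_zero_prod[of "(t+1)/2"] t by simp
  hence "\<theta>2 ((t + 1) / 2) ^ 8 = 2 ^ 8 * exp (pi * \<i> * ((t + 1) / 2) / 4) ^ 8 * (qp (q^2) (q^2) / qp (- q) (q^2)) ^ 8"
    by (simp only: power_mult_distrib)
  also have "exp (pi * \<i> * ((t + 1) / 2) / 4) ^ 8 = - q"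
  proof -
    have "of_nat 8 * (pi * \<i> * ((t + 1) / 2) / 4) = pi * \<i> * t + \<i> * pi" by (simp add: field_simps)
    thus ?thesis by (simp only: exp_add exp_pi_i' q_def flip: exp_of_nat_mult) simp
  qed
  finally have g: "g3 t = - 1 / (q * (qp (q^2) (q^2) / qp (- q) (q^2)) ^ 8)"
    unfolding g3_def by simp
  have a: "qp q q = qp q (q^2) * qp (q^2) (q^2)" using qp_split[OF q, of q] by (simp add: power2_eq_square)
  have b: "qp (q^2) (q^2) = qp (q^2) (q^4) * qp (q^4) (q^4)"
    using qp_split[OF n2, of "q^2"] by (simp flip: power_add power_mult)
  have c: "qp q (q^2) * qp (- q) (q^2) = qp (q^2) (q^4)"
    using qp_mult_neg[OF n2, of q] by (simp flip: power_mult)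
  note nz = qp_nonzero[OF q q] qp_nonzero[OF n2 n2] qp_nonzero[OF n4 n4] qp_nonzero[OF n2 q]
  have nz5: "qp (- q) (q^2) \<noteq> 0" using qp_nonzero[OF n2, of "-q"] q by simp
  have "qp (q^2) (q^2) * qp (q^2) (q^2) = qp q q * qp (q^4) (q^4) * qp (- q) (q^2)"
  proof -
    have "qp q q * qp (q^4) (q^4) * qp (- q) (q^2) = (qp q (q^2) * qp (- q) (q^2)) * qp (q^4) (q^4) * qp (q^2) (q^2)"
      unfolding a by (simp only: mult_ac)
    also have "\<dots> = qp (q^2) (q^2) * qp (q^2) (q^2)" unfolding c b [symmetric] ..
    finally show ?thesis ..
  qed
  hence "qp (q^2) (q^2) / (qp q q * qp (q^4) (q^4)) = 1 / (qp (q^2) (q^2) / qp (- q) (q^2))"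
    using nz nz5 by (simp add: divide_eq_eq eq_divide_eq mult_ac)
  hence val: "(qp (q^2) (q^2) / (qp q q * qp (q^4) (q^4))) ^ 8 / q = - g3 t"
    unfolding g by (simp only: power_divide power_one) (simp add: power_divide)
  show ?thesis
    by (rule has_sum_shift_cc) (use s in \<open>simp_all only: e val\<close>, simp add: cc_eq_0)
qed

lemma cc_abs_summable_exp:
  assumes t: "Im t > 0"
  shows "(\<lambda>j. norm (of_int (cc j) * exp (2 * pi * \<i> * of_int j * (t / 2)))) summable_on UNIV"
  using has_sum_imp_summable[OF cc_has_sum_g3[OF t]] by (simp only: summable_on_iff_abs_summable_on_complex)

section \<open>The theta function of E8\<close>

text \<open>The E8 lattice in doubled coordinates: u/2 has coordinates that are all integral or all
  half-integral, with even sum. Doubling keeps the vectors integral, at the price of a factor 1/4 in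
  norms.\<close>

definition Lam8 :: "(int ^ 8) set" where
  "Lam8 = {u. ((\<forall>j. even (u $ j)) \<or> (\<forall>j. odd (u $ j))) \<and> 4 dvd (\<Sum>j\<in>UNIV. u $ j)}"

definition usq :: "int ^ 8 \<Rightarrow> int" where "usq u = (\<Sum>j\<in>UNIV. (u $ j)^2)"

definition udot :: "int ^ 8 \<Rightarrow> complex ^ 8 \<Rightarrow> complex" where
  "udot u v = (\<Sum>j\<in>UNIV. of_int (u $ j) * v $ j)"

text \<open>In the true coordinates x = u/2 the exponent is pi i t |x|^2 + 2 pi i <x, v>.\<close>

definition E8term :: "complex \<Rightarrow> complex ^ 8 \<Rightarrow> int ^ 8 \<Rightarrow> complex" where
  "E8term t v u = exp (pi * \<i> * t * of_int (usq u) / 4 + pi * \<i> * udot u v)"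

definition ThE8 :: "complex \<Rightarrow> complex ^ 8 \<Rightarrow> complex" where
  "ThE8 t v = infsum (E8term t v) Lam8"

text \<open>E8 is an even lattice. For odd coordinates this holds because odd squares are 1 mod 8
  and there are eight of them; for even ones because a sum of squares has the parity of the
  sum.\<close>

lemma usq_dvd_8:
  assumes "u \<in> Lam8"
  shows "8 dvd usq u"
proof -
  from assms have s: "4 dvd (\<Sum>j\<in>UNIV. u $ j)" and "(\<forall>j. even (u $ j)) \<or> (\<forall>j. odd (u $ j))"
    by (auto simp: Lam8_def)
  from this(2) show ?thesis
  proof
    assume "\<forall>j. even (u $ j)"
    hence u: "u $ j = 2 * (u $ j div 2)" for j by simp
    define n where "n j = u $ j div 2" for j
    have un: "u $ j = 2 * n j" for j using u by (simp add: n_def)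
    have "4 dvd 2 * (\<Sum>j\<in>UNIV. n j)" using s by (simp add: un sum_distrib_left)
    hence "even (\<Sum>j\<in>UNIV. n j)" by presburger
    moreover have "even (\<Sum>j\<in>UNIV. (n j)^2 - n j)" by (intro dvd_sum) simp
    ultimately have "even (\<Sum>j\<in>UNIV. (n j)^2)" by (simp add: sum_subtractf)
    hence "4 * 2 dvd 4 * (\<Sum>j\<in>UNIV. (n j)^2)" by (intro mult_dvd_mono) auto
    thus ?thesis by (simp add: usq_def un power_mult_distrib sum_distrib_left)
  next
    assume odd: "\<forall>j. odd (u $ j)"
    define n where "n j = u $ j div 2" for j
    have un: "u $ j = 2 * n j + 1" for j using odd by (simp add: n_def)
    have "usq u = (\<Sum>j\<in>(UNIV :: 8 set). 4 * ((n j)^2 + n j) + 1)"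
      unfolding usq_def by (intro sum.cong refl) (simp add: un power2_eq_square algebra_simps)
    also have "\<dots> = 4 * (\<Sum>j\<in>(UNIV :: 8 set). (n j)^2 + n j) + 8" 
      by (simp add: sum.distrib sum_distrib_left)
    also have "even (\<Sum>j\<in>(UNIV :: 8 set). (n j)^2 + n j)" by (intro dvd_sum) simp
    hence "4 * 2 dvd 4 * (\<Sum>j\<in>(UNIV :: 8 set). (n j)^2 + n j)" by (intro mult_dvd_mono) auto
    hence "8 dvd 4 * (\<Sum>j\<in>(UNIV :: 8 set). (n j)^2 + n j) + 8" by simp
    finally show ?thesis .
  qed
qed

lemma exp_sum_complex: "exp (\<Sum>j\<in>A. f j) = (\<Prod>j\<in>A. exp (f j :: complex))"
  by (induction A rule: infinite_finite_induct) (auto simp: exp_add)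

lemma E8term_prod: "E8term t v u = (\<Prod>j\<in>UNIV. exp (pi * \<i> * t * of_int (u $ j)^2 / 4 + pi * \<i> * of_int (u $ j) * v $ j))"
  unfolding E8term_def usq_def udot_def exp_sum_complex [symmetric]
  by (simp add: sum.distrib sum_distrib_left sum_divide_distrib mult.assoc)

lemma abs_summable_theta_quarter:
  assumes t: "Im t > 0"
  shows "(\<lambda>n::int. norm (exp (pi * \<i> * t * of_int n ^ 2 / 4 + pi * \<i> * of_int n * v))) summable_on UNIV"
  using abs_summable_th[of "t / 4" "v / 2"] t by (simp add: field_simps)

lemma summable_prod_vec_complex:
  fixes f :: "8 \<Rightarrow> int \<Rightarrow> complex"
  assumes "\<And>j. (\<lambda>n. norm (f j n)) summable_on UNIV"
  shows "(\<lambda>u :: int ^ 8. norm (\<Prod>j\<in>UNIV. f j (u $ j))) summable_on UNIV"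
proof -
  \<comment> \<open>One function dominating all eight factors reduces the claim to products of a
    single function.\<close>
  define g where "g n = (\<Sum>j\<in>UNIV. norm (f j n))" for n
  have g: "g summable_on UNIV" unfolding g_def
    using finite[of "UNIV :: 8 set"] by (induction rule: finite_induct) (auto intro: summable_on_add assms)
  have "(\<lambda>u :: int ^ 8. \<Prod>j\<in>UNIV. g (u $ j)) summable_on UNIV"
    by (rule summable_on_prod_vec[OF g]) (auto simp: g_def intro: sum_nonneg)
  thus ?thesis
  proof (rule Infinite_Sum.abs_summable_on_comparison_test')
    fix u :: "int ^ 8"
    show "norm (\<Prod>j\<in>UNIV. f j (u $ j)) \<le> (\<Prod>j\<in>UNIV. g (u $ j))"
      unfolding prod_norm [symmetric] g_def by (intro prod_mono) (auto intro: member_le_sum)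
  qed
qed

lemma abs_summable_E8term:
  assumes t: "Im t > 0"
  shows "(\<lambda>u. norm (E8term t v u)) summable_on A"
proof -
  have "(\<lambda>u. norm (E8term t v u)) summable_on UNIV"
    unfolding E8term_prod
    by (rule summable_prod_vec_complex[of "\<lambda>j n. exp (pi * \<i> * t * of_int n^2 / 4 + pi * \<i> * of_int n * v $ j)"])
       (rule abs_summable_theta_quarter[OF t])
  thus ?thesis by (rule summable_on_subset) auto
qed

section \<open>The E8 theta function in terms of Jacobi theta functions\<close>

lemma prod_const_sign:
  "(\<Prod>j\<in>(UNIV :: 8 set). exp (pi * \<i> * of_int (n j))) = (if even (\<Sum>j\<in>UNIV. n j) then 1 else - 1)"
proof -
  have "(\<Prod>j\<in>(UNIV :: 8 set). exp (pi * \<i> * of_int (n j))) = exp (pi * \<i> * of_int (\<Sum>j\<in>UNIV. n j))"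
    unfolding exp_sum_complex [symmetric] by (simp add: sum_distrib_left)
  thus ?thesis unfolding exp_pi_ii_of_int by (auto simp: power_int_minus_one_minus)
qed

text \<open>The parity condition is imposed by averaging over the trivial and the sign character of
  the coordinate sum; both resulting sums factor over the coordinates.\<close>

lemma ThE8_half_sum:
  fixes f :: "8 \<Rightarrow> int \<Rightarrow> complex"
  assumes s: "\<And>j. (\<lambda>n. norm (f j n)) summable_on UNIV"
  shows "(\<Sum>\<^sub>\<infinity>n\<in>{n :: int ^ 8. even (\<Sum>j\<in>UNIV. n $ j)}. \<Prod>j\<in>UNIV. f j (n $ j))
       = ((\<Prod>j\<in>UNIV. infsum (f j) UNIV) + (\<Prod>j\<in>UNIV. \<Sum>\<^sub>\<infinity>n. exp (pi * \<i> * of_int n) * f j n)) / 2"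
proof -
  let ?P = "\<lambda>n :: int ^ 8. \<Prod>j\<in>UNIV. f j (n $ j)"
  let ?Q = "\<lambda>n :: int ^ 8. \<Prod>j\<in>UNIV. exp (pi * \<i> * of_int (n $ j)) * f j (n $ j)"
  have s': "(\<lambda>n. norm (exp (pi * \<i> * of_int n) * f j n)) summable_on UNIV" for j
    using s[of j] by (simp add: norm_mult norm_exp_eq_Re)
  have a: "?P summable_on UNIV" "?Q summable_on UNIV"
    by (rule abs_summable_summable, rule summable_prod_vec_complex, rule s,
        rule abs_summable_summable, rule summable_prod_vec_complex[of "\<lambda>j n. exp (pi * \<i> * of_int n) * f j n"], rule s')
  have "?P n / 2 + ?Q n / 2 = (if even (\<Sum>j\<in>UNIV. n $ j) then ?P n else 0)" for n
    unfolding prod.distrib prod_const_sign by auto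
  hence "(\<Sum>\<^sub>\<infinity>n\<in>{n :: int ^ 8. even (\<Sum>j\<in>UNIV. n $ j)}. ?P n) = (\<Sum>\<^sub>\<infinity>n. ?P n / 2 + ?Q n / 2)"
    by (intro infsum_cong_neutral) auto
  also have "\<dots> = (\<Sum>\<^sub>\<infinity>n. ?P n / 2) + (\<Sum>\<^sub>\<infinity>n. ?Q n / 2)"
    using a summable_on_cmult_left[of ?P UNIV "1/2"] summable_on_cmult_left[of ?Q UNIV "1/2"]
    by (intro infsum_add) auto
  also have "\<dots> = (\<Sum>\<^sub>\<infinity>n. ?P n) / 2 + (\<Sum>\<^sub>\<infinity>n. ?Q n) / 2"
    unfolding divide_inverse by (simp only: infsum_cmult_left')
  also have "(\<Sum>\<^sub>\<infinity>n. ?P n) = (\<Prod>j\<in>UNIV. infsum (f j) UNIV)" by (rule infsum_prod_vec[OF s])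
  also have "(\<Sum>\<^sub>\<infinity>n. ?Q n) = (\<Prod>j\<in>UNIV. \<Sum>\<^sub>\<infinity>n. exp (pi * \<i> * of_int n) * f j n)"
    by (rule infsum_prod_vec[OF s'])
  finally show ?thesis by (simp add: add_divide_distrib)
qed

lemma prod8_const: "(\<Prod>j\<in>(UNIV :: 8 set). c * f j) = c ^ 8 * (\<Prod>j\<in>UNIV. f j)" for c :: complex
  by (simp add: prod.distrib)

text \<open>Writing u = 2n or u = 2n + 1 coordinatewise, the condition mod 4 says in both cases that
  n has even coordinate sum, since the eight ones add up to 8. Each of the two classes then gives
  two products.\<close>

theorem ThE8_eq:
  assumes t: "Im t > 0"
  shows "ThE8 t v = ((\<Prod>j\<in>UNIV. th t (v $ j)) + (\<Prod>j\<in>UNIV. th t (v $ j + 1/2))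
     + (\<Prod>j\<in>UNIV. th1 t (v $ j)) + (\<Prod>j\<in>UNIV. th1 t (v $ j + 1/2))) / 2"
proof -
  let ?e = "\<lambda>j n. exp (pi * \<i> * t * of_int n^2 / 4 + pi * \<i> * of_int n * v $ j)"
  let ?E = "{n :: int ^ 8. even (\<Sum>j\<in>UNIV. n $ j)}"
  have se: "(\<lambda>n. norm (?e j n)) summable_on UNIV" for j by (rule abs_summable_theta_quarter[OF t])
  define L0 where "L0 = {u \<in> Lam8. \<forall>j. even (u $ j)}"
  define L1 where "L1 = {u \<in> Lam8. \<forall>j. odd (u $ j)}"
  have L: "Lam8 = L0 \<union> L1" "L0 \<inter> L1 = {}" by (auto simp: L0_def L1_def Lam8_def)
  have split: "ThE8 t v = infsum (E8term t v) L0 + infsum (E8term t v) L1"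
    unfolding ThE8_def L(1)
    by (rule infsum_Un_disjoint) (use abs_summable_E8term[OF t] L(2) in \<open>auto intro: abs_summable_summable\<close>)
  have "infsum (E8term t v) L0 = (\<Sum>\<^sub>\<infinity>n\<in>?E. \<Prod>j\<in>UNIV. ?e j (2 * n $ j))"
  proof (rule infsum_reindex_bij_witness[of _ "\<lambda>n. \<chi> j. 2 * n $ j" "\<lambda>u. \<chi> j. u $ j div 2"])
    fix u assume "u \<in> L0"
    hence u: "even (u $ j)" "4 dvd (\<Sum>j\<in>UNIV. u $ j)" for j by (auto simp: L0_def Lam8_def)
    show "(\<chi> j. 2 * (\<chi> j. u $ j div 2) $ j) = u" using u by (simp add: vec_eq_iff)
    have "(\<Sum>j\<in>UNIV. u $ j) = 2 * (\<Sum>j\<in>UNIV. u $ j div 2)" unfolding sum_distrib_left using u by (intro sum.cong) auto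
    thus "(\<chi> j. u $ j div 2) \<in> ?E" using u(2) by simp presburger
    show "(\<Prod>j\<in>UNIV. ?e j (2 * (\<chi> j. u $ j div 2) $ j)) = E8term t v u"
      unfolding E8term_prod by (intro prod.cong refl) (use u in simp)
  next
    fix n assume n: "n \<in> ?E"
    show "(\<chi> j. (\<chi> j. 2 * n $ j) $ j div 2) = n" by (simp add: vec_eq_iff)
    show "(\<chi> j. 2 * n $ j) \<in> L0" using n by (simp add: L0_def Lam8_def flip: sum_distrib_left) presburger
  qed
  also have "\<dots> = ((\<Prod>j\<in>UNIV. \<Sum>\<^sub>\<infinity>n. ?e j (2 * n)) + (\<Prod>j\<in>UNIV. \<Sum>\<^sub>\<infinity>n. exp (pi * \<i> * of_int n) * ?e j (2 * n))) / 2"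
  proof (rule ThE8_half_sum)
    fix j
    have "(\<lambda>n. norm (?e j n)) summable_on (range (\<lambda>n. 2 * n))" using se by (rule summable_on_subset) auto
    thus "(\<lambda>n. norm (?e j (2 * n))) summable_on UNIV" by (subst (asm) summable_on_reindex) (auto simp: inj_on_def o_def)
  qed
  finally have A0: "infsum (E8term t v) L0 = ((\<Prod>j\<in>UNIV. \<Sum>\<^sub>\<infinity>n. ?e j (2 * n)) + (\<Prod>j\<in>UNIV. \<Sum>\<^sub>\<infinity>n. exp (pi * \<i> * of_int n) * ?e j (2 * n))) / 2" .
  have B0: "(\<Sum>\<^sub>\<infinity>n. ?e j (2 * n)) = th t (v $ j)" for j
    unfolding th_def by (intro infsum_cong) (simp add: power_mult_distrib mult_ac)
  have B1: "(\<Sum>\<^sub>\<infinity>n. exp (pi * \<i> * of_int n) * ?e j (2 * n)) = th t (v $ j + 1/2)" for j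
    unfolding th_def by (intro infsum_cong) (simp add: power_mult_distrib algebra_simps flip: exp_add)
  have "infsum (E8term t v) L1 = (\<Sum>\<^sub>\<infinity>n\<in>?E. \<Prod>j\<in>UNIV. ?e j (2 * n $ j + 1))"
  proof (rule infsum_reindex_bij_witness[of _ "\<lambda>n. \<chi> j. 2 * n $ j + 1" "\<lambda>u. \<chi> j. u $ j div 2"])
    fix u assume "u \<in> L1"
    hence u: "odd (u $ j)" "4 dvd (\<Sum>j\<in>UNIV. u $ j)" for j by (auto simp: L1_def Lam8_def)
    show "(\<chi> j. 2 * (\<chi> j. u $ j div 2) $ j + 1) = u" using u by (simp add: vec_eq_iff)
    have "(\<Sum>j\<in>UNIV. u $ j) = (\<Sum>j\<in>(UNIV::8 set). 2 * (u $ j div 2) + 1)" using u by (intro sum.cong) auto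
    also have "\<dots> = 2 * (\<Sum>j\<in>UNIV. u $ j div 2) + 8" by (simp add: sum.distrib sum_distrib_left)
    finally show "(\<chi> j. u $ j div 2) \<in> ?E" using u(2) by simp presburger
    show "(\<Prod>j\<in>UNIV. ?e j (2 * (\<chi> j. u $ j div 2) $ j + 1)) = E8term t v u"
      unfolding E8term_prod by (intro prod.cong refl) (use u in simp)
  next
    fix n assume n: "n \<in> ?E"
    show "(\<chi> j. (\<chi> j. 2 * n $ j + 1) $ j div 2) = n" by (simp add: vec_eq_iff)
    show "(\<chi> j. 2 * n $ j + 1) \<in> L1" using n by (simp add: L1_def Lam8_def sum.distrib flip: sum_distrib_left) presburger
  qed
  also have "\<dots> = ((\<Prod>j\<in>UNIV. \<Sum>\<^sub>\<infinity>n. ?e j (2 * n + 1)) + (\<Prod>j\<in>UNIV. \<Sum>\<^sub>\<infinity>n. exp (pi * \<i> * of_int n) * ?e j (2 * n + 1))) / 2"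
  proof (rule ThE8_half_sum)
    fix j
    have "(\<lambda>n. norm (?e j n)) summable_on (range (\<lambda>n. 2 * n + 1))" using se by (rule summable_on_subset) auto
    thus "(\<lambda>n. norm (?e j (2 * n + 1))) summable_on UNIV" by (subst (asm) summable_on_reindex) (auto simp: inj_on_def o_def)
  qed
  finally have A1: "infsum (E8term t v) L1 = ((\<Prod>j\<in>UNIV. \<Sum>\<^sub>\<infinity>n. ?e j (2 * n + 1)) + (\<Prod>j\<in>UNIV. \<Sum>\<^sub>\<infinity>n. exp (pi * \<i> * of_int n) * ?e j (2 * n + 1))) / 2" .
  have C0: "(\<Sum>\<^sub>\<infinity>n. ?e j (2 * n + 1)) = th1 t (v $ j)" for j
    unfolding th1_eq 
    by (intro infsum_cong arg_cong[of _ _ exp]) (simp add: power2_eq_square field_simps)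
  have C1: "(\<Sum>\<^sub>\<infinity>n. exp (pi * \<i> * of_int n) * ?e j (2 * n + 1)) = (- \<i>) * th1 t (v $ j + 1/2)" for j
  proof -
    have "exp (pi * \<i> * of_int n) * ?e j (2 * n + 1) = exp (- (pi * \<i> / 2)) * 
       exp (pi * \<i> * t * (of_int n + 1/2) ^ 2 + 2 * pi * \<i> * (of_int n + 1/2) * (v $ j + 1/2))" for n
      unfolding exp_add [symmetric] by (intro arg_cong[of _ _ exp]) (simp add: power2_eq_square field_simps)
    moreover have "exp (- (pi * \<i> / 2)) = - \<i>" by (simp add: exp_minus exp_pi_ii_half)
    ultimately show ?thesis unfolding th1_eq by (simp only: infsum_cmult_right')
  qed
  have "(\<Prod>j\<in>UNIV. (- \<i>) * th1 t (v $ j + 1/2)) = (\<Prod>j\<in>UNIV. th1 t (v $ j + 1/2))"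
    unfolding prod8_const by simp
  thus ?thesis unfolding split A0 A1 B0 B1 C0 C1 by (simp only: add_divide_distrib add.assoc)
qed

lemma ThE8_shift: "ThE8 (t + 1) v = ThE8 t v"
  unfolding ThE8_def
proof (intro infsum_cong)
  fix u assume "u \<in> Lam8"
  then obtain k where k: "usq u = 8 * k" using usq_dvd_8 by blast
  have "E8term (t + 1) v u = E8term t v u * exp (2 * pi * \<i> * of_int k)"
    unfolding E8term_def exp_add [symmetric] k by (intro arg_cong[of _ _ exp]) (simp add: field_simps)
  thus "E8term (t + 1) v u = E8term t v u" by (simp only: exp_2pi_int mult_1_right)
qed

lemma uminus_Lam8: "u \<in> Lam8 \<Longrightarrow> - u \<in> Lam8"
  by (simp add: Lam8_def sum_negf)

lemma ThE8_minus: "ThE8 t (- v) = ThE8 t v"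
  unfolding ThE8_def
  by (rule infsum_reindex_bij_witness[of _ uminus uminus])
     (auto simp: uminus_Lam8 E8term_def usq_def udot_def sum_negf)

definition kap :: "complex ^ 8 \<Rightarrow> complex" where "kap v = (\<Sum>j\<in>UNIV. (v $ j)^2)"

text \<open>Inversion preserves the first and the fourth product and exchanges the other two. The
  constants \<i> and -1 that occur have trivial eighth power, and eight roots of -i t multiply to
  t^4.\<close>

theorem ThE8_inversion:
  assumes t: "Im t > 0"
  shows "ThE8 (- 1 / t) ((1 / t) *s v) = t ^ 4 * exp (pi * \<i> * kap v / t) * ThE8 t v"
proof -
  let ?C = "csqrt (- \<i> * t)"
  have e: "(\<Prod>j\<in>UNIV. exp (pi * \<i> * (v $ j)^2 / t)) = exp (pi * \<i> * kap v / t)"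
    unfolding exp_sum_complex [symmetric] kap_def by (simp add: sum_divide_distrib sum_distrib_left)
  let ?K = "t ^ 4 * exp (pi * \<i> * kap v / t)"
  have P: "(\<Prod>j\<in>UNIV. ?C * exp (pi * \<i> * (v $ j)^2 / t) * f j) = ?K * (\<Prod>j\<in>UNIV. f j)" for f
  proof -
    have "(\<Prod>j\<in>UNIV. ?C * exp (pi * \<i> * (v $ j)^2 / t) * f j) = (\<Prod>j\<in>UNIV. ?C * (exp (pi * \<i> * (v $ j)^2 / t) * f j))"
      by (simp only: mult.assoc)
    also have "\<dots> = ?C ^ 8 * (\<Prod>j\<in>UNIV. exp (pi * \<i> * (v $ j)^2 / t) * f j)" by (rule prod8_const)
    also have "\<dots> = ?K * (\<Prod>j\<in>UNIV. f j)" unfolding prod.distrib e csqrt_ii_8 by (simp only: mult.assoc)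
    finally show ?thesis .
  qed
  have a: "(\<Prod>j\<in>UNIV. th (- 1 / t) (v $ j / t)) = ?K * (\<Prod>j\<in>UNIV. th t (v $ j))"
    unfolding th_inversion[OF t] P ..
  have b: "(\<Prod>j\<in>UNIV. th (- 1 / t) (v $ j / t + 1/2)) = ?K * (\<Prod>j\<in>UNIV. th1 t (v $ j))"
    unfolding th_half_inversion[OF t] P ..
  have c: "(\<Prod>j\<in>UNIV. th1 (- 1 / t) (v $ j / t)) = ?K * (\<Prod>j\<in>UNIV. th t (v $ j + 1/2))"
    unfolding th1_inversion[OF t] P ..
  have "th1 t (w - 1/2) = (- 1) * th1 t (w + 1/2)" for w using th1_period[of t "w - 1/2"] by (simp add: add.commute)
  hence d: "(\<Prod>j\<in>UNIV. th1 (- 1 / t) (v $ j / t + 1/2)) = ?K * (\<Prod>j\<in>UNIV. th1 t (v $ j + 1/2))"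
    unfolding th1_half_inversion[OF t] prod8_const P by (simp only: prod8_const) simp
  have "ThE8 (- 1 / t) ((1 / t) *s v) = ((\<Prod>j\<in>UNIV. th (- 1 / t) (v $ j / t)) + (\<Prod>j\<in>UNIV. th (- 1 / t) (v $ j / t + 1/2))
     + (\<Prod>j\<in>UNIV. th1 (- 1 / t) (v $ j / t)) + (\<Prod>j\<in>UNIV. th1 (- 1 / t) (v $ j / t + 1/2))) / 2"
    using ThE8_eq[OF Im_minus_inverse_pos[OF t], of "(1 / t) *s v"] by simp
  also have "\<dots> = ?K * ThE8 t v"
    unfolding a b c d ThE8_eq[OF t] by (simp add: algebra_simps)
  finally show ?thesis .
qed

section \<open>The Hecke-type identity\<close>

text \<open>A quadruple (p, e, r, s) stands for the matrix with rows (p, e) and (r, s).\<close>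

type_synonym quad = "int \<times> int \<times> int \<times> int"

fun qdet :: "quad \<Rightarrow> int" where "qdet (p, e, r, s) = p * s - e * r"

definition mob :: "complex \<Rightarrow> quad \<Rightarrow> complex" where
  "mob \<tau> = (\<lambda>(p, e, r, s). (of_int p * \<tau> + of_int e) / (of_int r * \<tau> + of_int s))"

text \<open>The component belonging to the first column mod 2. For a column with both entries even
  the value is a dummy; \<open>primitive_parity\<close> excludes this case.\<close>

definition gsel :: "int \<Rightarrow> int \<Rightarrow> complex \<Rightarrow> complex" where
  "gsel p r = (if even r then g1 else if even p then g2 else g3)"

text \<open>The action of a matrix of determinant N on the Jacobi form given by the components times
  \<open>ThE8\<close>. The exponential is the automorphy factor of the theta function; the weights
  -4 and 4 cancel, so no power of r \<tau> + s appears.\<close>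

definition Psi :: "complex \<Rightarrow> complex ^ 8 \<Rightarrow> int \<Rightarrow> quad \<Rightarrow> complex" where
  "Psi \<tau> v N = (\<lambda>(p, e, r, s).
     exp (- (pi * \<i> * of_int N * of_int r * kap v / (of_int r * \<tau> + of_int s)))
     * gsel p r (mob \<tau> (p, e, r, s))
     * ThE8 (mob \<tau> (p, e, r, s)) ((of_int N / (of_int r * \<tau> + of_int s)) *s v))"

lemma denom_nonzero:
  assumes "Im \<tau> > 0" "(r, s) \<noteq> (0, 0)"
  shows "of_int r * \<tau> + of_int s \<noteq> 0"
proof
  assume z: "of_int r * \<tau> + of_int s = 0"
  hence "Im (of_int r * \<tau> + of_int s) = 0" by simp
  hence "r = 0" using assms by simp
  with z assms show False by simp
qed

lemma Im_mob_pos: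
  assumes \<tau>: "Im \<tau> > 0" and d: "p * s - e * r > 0"
  shows "Im (mob \<tau> (p, e, r, s)) > 0"
proof -
  let ?w = "of_int r * \<tau> + of_int s"
  have nz: "?w \<noteq> 0" by (rule denom_nonzero[OF \<tau>]) (use d in auto)
  have "Im (mob \<tau> (p, e, r, s)) = Im ((of_int p * \<tau> + of_int e) * cnj ?w) / (norm ?w)^2"
    unfolding mob_def by (simp add: Im_complex_div_eq_0 complex_div_cnj[of _ ?w])
  also have "Im ((of_int p * \<tau> + of_int e) * cnj ?w) = real_of_int (p * s - e * r) * Im \<tau>"
    by (simp add: algebra_simps)
  finally have eq: "Im (mob \<tau> (p, e, r, s)) = real_of_int (p * s - e * r) * Im \<tau> / (norm ?w)^2" .
  have "real_of_int (p * s - e * r) > 0" using d by (simp only: of_int_0_less_iff)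
  thus ?thesis unfolding eq using nz \<tau> by (intro divide_pos_pos mult_pos_pos) auto
qed

lemma Psi_T:
  assumes "\<not> (even p \<and> even r)"  and nz: "of_int r * \<tau> + of_int s \<noteq> 0"
  shows "Psi \<tau> v N (p + r, e + s, r, s) = Psi \<tau> v N (p, e, r, s)"
proof -
  have m: "mob \<tau> (p + r, e + s, r, s) = mob \<tau> (p, e, r, s) + 1"
    unfolding mob_def using nz by (simp add: field_simps)
  have "gsel (p + r) r (t + 1) = gsel p r t" for t
    using assms(1) by (simp add: gsel_def g1_shift g2_shift g3_shift)
  thus ?thesis unfolding Psi_def by (simp add: m ThE8_shift)
qed

lemma kap_scale: "kap (c *s v) = c^2 * kap v"
  by (simp add: kap_def power_mult_distrib sum_distrib_left)

text \<open>The powers t^4 cancel, and the exponents agree because N = p (r \<tau> + s) - r (p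
  \<tau> + e).\<close>

lemma Psi_S:
  assumes ne: "\<not> (even p \<and> even r)" and \<tau>: "Im \<tau> > 0" and d: "p * s - e * r = N" "N > 0"
  shows "Psi \<tau> v N (- r, - s, p, e) = Psi \<tau> v N (p, e, r, s)"
proof -
  define w where "w = of_int r * \<tau> + of_int s"
  define x where "x = of_int p * \<tau> + of_int e"
  have w: "w \<noteq> 0" unfolding w_def by (rule denom_nonzero[OF \<tau>]) (use d in auto)
  have x: "x \<noteq> 0" unfolding x_def by (rule denom_nonzero[OF \<tau>]) (use d in auto)
  define t where "t = x / w"
  have t0: "t \<noteq> 0" using w x by (simp add: t_def)
  have t: "Im t > 0" using Im_mob_pos[OF \<tau>, of p s e r] d unfolding t_def x_def w_def mob_def by simp
  have m: "mob \<tau> (p, e, r, s) = t" by (simp add: mob_def t_def x_def w_def)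
  have w': "of_int (- r) * \<tau> + of_int (- s) = - w" by (simp add: w_def)
  have m': "mob \<tau> (- r, - s, p, e) = - 1 / t"
    unfolding mob_def prod.case w' x_def[symmetric] t_def by simp
  have g: "gsel (- r) p (- 1 / t) = gsel p r t / t ^ 4"
    using ne by (auto simp: gsel_def g1_inversion[OF t, simplified] g2_inversion[OF t, simplified] g3_inversion[OF t, simplified])
  have v: "(of_int N / x) *s v = (1 / t) *s ((of_int N / w) *s v)"
    using w x by (simp add: t_def vec_eq_iff)
  have th: "ThE8 (- 1 / t) ((of_int N / x) *s v) = t ^ 4 * exp (pi * \<i> * ((of_int N / w)^2 * kap v) / t) * ThE8 t ((of_int N / w) *s v)"
    unfolding v ThE8_inversion[OF t] kap_scale ..
  have N: "of_int N = of_int p * w - of_int r * x"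
    unfolding d(1)[symmetric] w_def x_def by (simp add: algebra_simps)
  have e: "- (pi * \<i> * of_int N * of_int p * kap v / x) + pi * \<i> * ((of_int N / w)^2 * kap v) / t
      = - (pi * \<i> * of_int N * of_int r * kap v / w)"
  proof -
    have "- (of_int p / x) + of_int N / (w * x) = - (of_int r / w)"
      unfolding N using w x by (simp add: field_simps)
    hence "pi * \<i> * of_int N * kap v * (- (of_int p / x) + of_int N / (w * x)) = pi * \<i> * of_int N * kap v * (- (of_int r / w))"
      by (rule arg_cong)
    moreover have "pi * \<i> * ((of_int N / w)^2 * kap v) / t = pi * \<i> * of_int N * kap v * (of_int N / (w * x))"
      using w x by (simp add: t_def power2_eq_square field_simps)
    ultimately show ?thesis by (simp add: algebra_simps)
  qed
  have "Psi \<tau> v N (- r, - s, p, e) = exp (- (pi * \<i> * of_int N * of_int p * kap v / x)) * (gsel p r t / t ^ 4) *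
     (t ^ 4 * exp (pi * \<i> * ((of_int N / w)^2 * kap v) / t) * ThE8 t ((of_int N / w) *s v))"
    unfolding Psi_def prod.case m' g x_def[symmetric] th ..
  also have "\<dots> = (exp (- (pi * \<i> * of_int N * of_int p * kap v / x)) * exp (pi * \<i> * ((of_int N / w)^2 * kap v) / t)) * gsel p r t
     * ThE8 t ((of_int N / w) *s v)"
    using t0 by simp
  also have "\<dots> = Psi \<tau> v N (p, e, r, s)"
    unfolding exp_add [symmetric] e Psi_def prod.case m w_def[symmetric] ..
  finally show ?thesis .
qed

section \<open>Orbits of integral matrices under SL2(Z)\<close>

text \<open>The orbit is generated by steps, so that invariance of \<open>Psi\<close> is an
  induction over generators. Only the translation has its inverse as a rule, since the inverse of S
  is its cube.\<close>

inductive sl2 :: "quad \<Rightarrow> quad \<Rightarrow> bool" for m where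
  sl2_refl: "sl2 m m"
| sl2_T: "sl2 m (p, e, r, s) \<Longrightarrow> sl2 m (p + r, e + s, r, s)"
| sl2_T': "sl2 m (p, e, r, s) \<Longrightarrow> sl2 m (p - r, e - s, r, s)"
| sl2_S: "sl2 m (p, e, r, s) \<Longrightarrow> sl2 m (- r, - s, p, e)"

lemma sl2_trans: "sl2 m' m'' \<Longrightarrow> sl2 m m' \<Longrightarrow> sl2 m m''"
  by (induction rule: sl2.induct) (auto intro: sl2.intros)

definition primitive_parity :: "quad \<Rightarrow> bool" where
  "primitive_parity = (\<lambda>(p, e, r, s). \<not> (even p \<and> even r))"

lemma sl2_invariant:
  assumes "sl2 m m'" "primitive_parity m" "qdet m = N" "N > 0" "Im \<tau> > 0"
  shows "primitive_parity m' \<and> qdet m' = N \<and> Psi \<tau> v N m' = Psi \<tau> v N m"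
  using assms(1)
proof (induction rule: sl2.induct)
  case sl2_refl
  thus ?case using assms by auto
next
  case (sl2_T p e r s)
  have "of_int r * \<tau> + of_int s \<noteq> 0" by (rule denom_nonzero[OF assms(5)]) (use sl2_T assms in auto)
  thus ?case using sl2_T.IH Psi_T[of p r \<tau> s v N e] by (auto simp: primitive_parity_def algebra_simps)
next
  case (sl2_T' p e r s)
  have "of_int r * \<tau> + of_int s \<noteq> 0" by (rule denom_nonzero[OF assms(5)]) (use sl2_T' assms in auto)
  thus ?case using sl2_T'.IH Psi_T[of "p - r" r \<tau> s v N "e - s"] by (auto simp: primitive_parity_def algebra_simps)
next
  case (sl2_S p e r s)
  thus ?case using Psi_S[of p r \<tau> s e N v] assms by (auto simp: primitive_parity_def algebra_simps)
qed

text \<open>The way back to an explicit unimodular matrix, on which uniqueness of the reduced forms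
  rests.\<close>

lemma sl2_matrix:
  assumes "sl2 (p, e, r, s) m'"
  shows "\<exists>a b c d. a * d - b * c = 1 \<and> m' = (a * p + b * r, a * e + b * s, c * p + d * r, c * e + d * s)"
  using assms
proof (induction rule: sl2.induct)
  case sl2_refl
  show ?case by (rule exI[of _ 1], rule exI[of _ 0], rule exI[of _ 0], rule exI[of _ 1]) simp
next
  case (sl2_T p' e' r' s')
  then obtain a b c d where "a * d - b * c = 1" "(p', e', r', s') = (a * p + b * r, a * e + b * s, c * p + d * r, c * e + d * s)" by blast
  thus ?case by (intro exI[of _ "a + c"] exI[of _ "b + d"] exI[of _ c] exI[of _ d]) (auto simp: algebra_simps)
next
  case (sl2_T' p' e' r' s')
  then obtain a b c d where "a * d - b * c = 1" "(p', e', r', s') = (a * p + b * r, a * e + b * s, c * p + d * r, c * e + d * s)" by blast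
  thus ?case by (intro exI[of _ "a - c"] exI[of _ "b - d"] exI[of _ c] exI[of _ d]) (auto simp: algebra_simps)
next
  case (sl2_S p' e' r' s')
  then obtain a b c d where "a * d - b * c = 1" "(p', e', r', s') = (a * p + b * r, a * e + b * s, c * p + d * r, c * e + d * s)" by blast
  thus ?case by (intro exI[of _ "- c"] exI[of _ "- d"] exI[of _ a] exI[of _ b]) (auto simp: algebra_simps)
qed

lemma sl2_T_pow: "sl2 m (p, e, r, s) \<Longrightarrow> sl2 m (p + j * r, e + j * s, r, s)" for j :: int
proof (induction j rule: int_induct[where k = 0])
  case (step1 i)
  thus ?case using sl2_T[of m "p + i * r" "e + i * s" r s] by (simp add: algebra_simps)
next
  case (step2 i)
  thus ?case using sl2_T'[of m "p + i * r" "e + i * s" r s] by (simp add: algebra_simps)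
qed simp

text \<open>The Euclidean algorithm on the first column: a power of T reduces p mod r, and S
  exchanges the rows. Once r = 0, the square of S fixes the sign and a power of T reduces the upper
  right entry.\<close>

lemma hermite_exists:
  assumes "p * s - e * r = N" "N > 0"
  shows "\<exists>k x n. sl2 (p, e, r, s) (k, x, 0, n) \<and> k > 0 \<and> n > 0 \<and> k * n = N \<and> 0 \<le> x \<and> x < n"
  using assms(1)
proof (induction "nat \<bar>r\<bar>" arbitrary: p e r s rule: less_induct)
  case less
  show ?case
  proof (cases "r = 0")
    case False
    define j where "j = - (p div r)"
    have pm: "p + j * r = p mod r" by (simp add: j_def minus_div_mult_eq_mod)
    have 1: "sl2 (p, e, r, s) (p mod r, e + j * s, r, s)"
      using sl2_T_pow[OF sl2_refl, of p e r s j] by (simp add: pm)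
    have 2: "sl2 (p, e, r, s) (- r, - s, p mod r, e + j * s)" by (rule sl2_S[OF 1])
    have "(- r) * (e + j * s) - (- s) * (p mod r) = N"
      using less.prems by (simp add: algebra_simps flip: pm)
    moreover have "nat \<bar>p mod r\<bar> < nat \<bar>r\<bar>" using False by (simp add: abs_mod_less)
    ultimately obtain k x n where "sl2 (- r, - s, p mod r, e + j * s) (k, x, 0, n)" "k > 0" "n > 0" "k * n = N" "0 \<le> x" "x < n"
      using less.hyps[of "p mod r" "- r" "e + j * s" "- s"] by blast
    thus ?thesis using sl2_trans[OF _ 2] by blast
  next
    case True
    have main: "\<exists>k x n. sl2 m (k, x, 0, n) \<and> k > 0 \<and> n > 0 \<and> k * n = N \<and> 0 \<le> x \<and> x < n"
      if "sl2 m (p, e, 0, s)" "p * s = N" "p > 0" for m p e s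
    proof -
      have s: "s > 0" using that assms(2) by (metis zero_less_mult_pos)
      have "sl2 m (p, e + (- (e div s)) * s, 0, s)" using sl2_T_pow[OF that(1), of "- (e div s)"] by simp
      moreover have "e + (- (e div s)) * s = e mod s" by (simp add: minus_div_mult_eq_mod)
      ultimately show ?thesis using that s by (intro exI[of _ p] exI[of _ "e mod s"] exI[of _ s]) auto
    qed
    have ps: "p * s = N" using less.prems True by simp
    show ?thesis
    proof (cases "p > 0")
      case True': True
      show ?thesis using main[OF sl2_refl ps True'] True by simp
    next
      case False
      have "p \<noteq> 0" using ps assms(2) by auto
      hence "- p > 0" using False by simp
      moreover have "sl2 (p, e, r, s) (- p, - e, - r, - s)" by (intro sl2_S sl2_refl)
      ultimately show ?thesis using main[of "(p, e, r, s)" "- p" "- e" "- s"] ps True by simp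
    qed
  qed
qed

text \<open>Zero lower left entries force the unimodular matrix to be upper triangular, and
  positivity makes it unipotent; it can then only shift x by multiples of n.\<close>

lemma hermite_unique:
  assumes "sl2 (k, x, 0, n) (k', x', 0, n')" "k > 0" "k' > 0" "n > 0" "n' > 0" "0 \<le> x" "x < n" "0 \<le> x'" "x' < n'"
  shows "(k, x, 0, n) = (k', x', 0 :: int, n')"
proof -
  obtain a b c d where abcd: "a * d - b * c = 1" and
    "(k', x', 0, n') = (a * k + b * 0, a * x + b * n, c * k + d * 0, c * x + d * n)"
    using sl2_matrix[OF assms(1)] by blast
  hence eqs: "k' = a * k" "x' = a * x + b * n" "c * k = 0" "n' = c * x + d * n" by auto
  have c: "c = 0" using eqs(3) assms(2) by simp
  have ad: "a * d = 1" using abcd c by simp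
  have a: "a > 0" using eqs(1) assms(2,3) by (metis zero_less_mult_pos2)
  have a1: "a = 1" using ad a by (metis zmult_eq_1_iff order.asym zero_less_one neg_less_0_iff_less)
  hence d1: "d = 1" using ad by simp
  have nn: "n' = n" using eqs(4) c d1 by simp
  have x: "x' = x + b * n" using eqs(2) a1 by simp
  have "x' = x" 
  proof -
    have "x' mod n = x mod n" by (simp add: x)
    thus ?thesis using assms nn by simp
  qed
  thus ?thesis using eqs(1) a1 nn by simp
qed

text \<open>Right multiplication by a rotation of order four. It commutes with the left action and
  turns a zero lower left entry into a zero lower right one, so the reduction theory carries over to
  the second shape.\<close>

fun qrot :: "quad \<Rightarrow> quad" where "qrot (p, e, r, s) = (- e, p, - s, r)"

lemma sl2_qrot: "sl2 m m' \<Longrightarrow> sl2 (qrot m) (qrot m')"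
proof (induction rule: sl2.induct)
  case (sl2_T p e r s)
  thus ?case using sl2.sl2_T[of "qrot m" "- e" p "- s" r] by simp
next
  case (sl2_T' p e r s)
  thus ?case using sl2.sl2_T'[of "qrot m" "- e" p "- s" r] by simp
next
  case (sl2_S p e r s)
  thus ?case using sl2.sl2_S[of "qrot m" "- e" p "- s" r] by simp
qed (auto intro: sl2.intros)

lemma qrot_4: "qrot (qrot (qrot (qrot m))) = m"
  by (cases m) simp

text \<open>Reduced forms with zero lower left entry; oddness of k is the parity condition on the
  column (k, 0).\<close>

definition H1 :: "int \<Rightarrow> quad set" where
  "H1 N = {(k, x, 0, n) | k x n. k > 0 \<and> n > 0 \<and> k * n = N \<and> 0 \<le> x \<and> x < n \<and> odd k}"
text \<open>Reduced forms of the same orbits with zero lower right entry; the parity condition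
  concerns the column (x, b).\<close>

definition H2 :: "int \<Rightarrow> quad set" where
  "H2 N = {(x, - k, b, 0) | k x b. k > 0 \<and> b > 0 \<and> k * b = N \<and> 0 \<le> x \<and> x < b \<and> \<not> (even x \<and> even b)}"

lemma H1_exists:
  assumes "qdet m = N" "N > 0" "primitive_parity m"
  shows "\<exists>m'\<in>H1 N. sl2 m m'"
proof -
  obtain p e r s where m: "m = (p, e, r, s)" by (cases m)
  obtain k x n where k: "sl2 m (k, x, 0, n)" "k > 0" "n > 0" "k * n = N" "0 \<le> x" "x < n"
    using hermite_exists[of p s e r N] assms m by auto
  \<comment> \<open>Only the parity part of the invariance is wanted, so any point of the upper
    half-plane serves for \<tau>.\<close>
  have "primitive_parity (k, x, 0, n)"
    using sl2_invariant[OF k(1) assms(3,1,2), of \<i>] by simp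
  hence "odd k" by (simp add: primitive_parity_def)
  hence "(k, x, 0, n) \<in> H1 N" unfolding H1_def using k by blast
  thus ?thesis using k(1) by blast
qed

lemma H2_exists:
  assumes "qdet m = N" "N > 0" "primitive_parity m"
  shows "\<exists>m'\<in>H2 N. sl2 m m'"
proof -
  obtain p e r s where m: "m = (p, e, r, s)" by (cases m)
  obtain k x n where k: "sl2 (qrot m) (k, x, 0, n)" "k > 0" "n > 0" "k * n = N" "0 \<le> x" "x < n"
    using hermite_exists[of "- e" r p "- s" N] assms m by (auto simp: algebra_simps)
  \<comment> \<open>Three further rotations undo the first, since four of them are the
    identity.\<close>
  have "sl2 (qrot (qrot (qrot (qrot m)))) (qrot (qrot (qrot (k, x, 0, n))))"
    by (intro sl2_qrot k)
  hence s: "sl2 m (x, - k, n, 0)" by (simp add: qrot_4)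
  have "primitive_parity (x, - k, n, 0)"
    using sl2_invariant[OF s assms(3,1,2), of \<i>] by simp
  hence "\<not> (even x \<and> even n)" by (simp add: primitive_parity_def)
  hence "(x, - k, n, 0) \<in> H2 N" unfolding H2_def using k by blast
  thus ?thesis using s by blast
qed

lemma H1_unique: "m \<in> H1 N \<Longrightarrow> m' \<in> H1 N \<Longrightarrow> sl2 m m' \<Longrightarrow> m = m'"
  by (auto simp: H1_def dest: hermite_unique)

lemma H2_unique:
  assumes "m \<in> H2 N" "m' \<in> H2 N" "sl2 m m'"
  shows "m = m'"
proof -
  obtain k x b where m: "m = (x, - k, b, 0)" "k > 0" "b > 0" "0 \<le> x" "x < b" using assms(1) by (auto simp: H2_def)
  obtain k' x' b' where m': "m' = (x', - k', b', 0)" "k' > 0" "b' > 0" "0 \<le> x'" "x' < b'" using assms(2) by (auto simp: H2_def)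
  have "sl2 (k, x, 0, b) (k', x', 0, b')" using sl2_qrot[OF assms(3)] m m' by simp
  from hermite_unique[OF this] show ?thesis using m m' by simp
qed

lemma H1_props: "m \<in> H1 N \<Longrightarrow> qdet m = N \<and> primitive_parity m"
  by (auto simp: H1_def primitive_parity_def)

lemma H2_props: "m \<in> H2 N \<Longrightarrow> qdet m = N \<and> primitive_parity m"
  by (auto simp: H2_def primitive_parity_def)

text \<open>Both sets meet every admissible orbit in exactly one point, and \<open>Psi\<close> is
  constant on orbits.\<close>

theorem sum_Psi_H1_H2:
  assumes \<tau>: "Im \<tau> > 0" and N: "N > 0"
  shows "sum (Psi \<tau> v N) (H1 N) = sum (Psi \<tau> v N) (H2 N)"
proof -
  define i where "i m = (SOME m'. m' \<in> H1 N \<and> sl2 m m')" for m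
  define j where "j m = (SOME m'. m' \<in> H2 N \<and> sl2 m m')" for m
  have i: "i m \<in> H1 N" "sl2 m (i m)" if "qdet m = N" "primitive_parity m" for m
    using H1_exists[OF that(1) N that(2)] someI_ex[of "\<lambda>m'. m' \<in> H1 N \<and> sl2 m m'"] unfolding i_def by blast+
  have j: "j m \<in> H2 N" "sl2 m (j m)" if "qdet m = N" "primitive_parity m" for m
    using H2_exists[OF that(1) N that(2)] someI_ex[of "\<lambda>m'. m' \<in> H2 N \<and> sl2 m m'"] unfolding j_def by blast+
  show ?thesis
  proof (rule sum.reindex_bij_witness[of _ i j])
    fix m assume m: "m \<in> H1 N"
    note p = H1_props[OF m]
    note jm = j[of m] p
    have p': "qdet (j m) = N \<and> primitive_parity (j m)" using H2_props[of "j m"] jm by blast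
    have "sl2 m (i (j m))" using sl2_trans[of "j m" "i (j m)" m] i(2)[of "j m"] jm p' by blast
    thus "i (j m) = m" using H1_unique[OF m, of "i (j m)"] i(1)[of "j m"] p' by auto
    show "j m \<in> H2 N" using jm by blast
    show "Psi \<tau> v N (j m) = Psi \<tau> v N m" using sl2_invariant[of m "j m" N \<tau> v] jm N \<tau> by blast
  next
    fix m assume m: "m \<in> H2 N"
    note p = H2_props[OF m]
    note im = i[of m] p
    have p': "qdet (i m) = N \<and> primitive_parity (i m)" using H1_props[of "i m"] im by blast
    have "sl2 m (j (i m))" using sl2_trans[of "i m" "j (i m)" m] j(2)[of "i m"] im p' by blast
    thus "j (i m) = m" using H2_unique[OF m, of "j (i m)"] j(1)[of "i m"] p' by auto
    show "i m \<in> H1 N" using im by blast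
  qed
qed

section \<open>Matrix sums as sums over divisors\<close>

text \<open>Up to sign the double series over the coefficients \<open>cc\<close> and the vectors of
  E8, from which both logarithms are built.\<close>

definition g3E :: "complex \<Rightarrow> complex ^ 8 \<Rightarrow> complex" where "g3E t v = g3 t * ThE8 t v"

text \<open>Translation turns \<open>g3\<close> into \<open>g2\<close>, and here the linear relation
  between the three components enters.\<close>

lemma g3E_shift_sum:
  assumes "Im t > 0"
  shows "g3E t v + g3E (t + 1) v = - (g1 t * ThE8 t v)"
proof -
  have "g3E t v + g3E (t + 1) v = (g3 t + g2 t) * ThE8 t v"
    by (simp only: g3E_def g3_shift ThE8_shift distrib_right)
  also have "g3 t + g2 t = - g1 t" using g_sum_zero[OF assms] by (simp add: eq_neg_iff_add_eq_0 add_ac)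
  finally show ?thesis by simp
qed

text \<open>Pairs (n, k) index the k-th power in the logarithm of the factors of level n.\<close>

definition dpairs :: "nat \<Rightarrow> (nat \<times> nat) set" where
  "dpairs N = {(n, k). n > 0 \<and> k > 0 \<and> n * k = N}"

lemma finite_dpairs: "N > 0 \<Longrightarrow> finite (dpairs N)"
proof -
  assume N: "N > 0"
  have "dpairs N \<subseteq> {..N} \<times> {..N}" by (auto simp: dpairs_def)
  thus ?thesis by (rule finite_subset) auto
qed

lemma sum_double: "(\<Sum>r<2 * n. f r) = (\<Sum>r<n. f r + f (r + n))" for f :: "nat \<Rightarrow> complex"
proof -
  have "(\<Sum>r<2 * n. f r) = (\<Sum>r<n + n. f r)" by (simp add: mult_2)
  also have "\<dots> = (\<Sum>r<n. f r) + (\<Sum>r<n. f (n + r))"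
    using sum.atLeastLessThan_concat[of 0 n "n + n" f] sum.shift_bounds_nat_ivl[of f 0 n n]
    by (simp add: atLeast0LessThan add.commute)
  finally show ?thesis by (simp add: sum.distrib add.commute)
qed

text \<open>The arguments for r and r + n differ by a translation by 1, so the two terms add up to
  minus the component \<open>g1\<close>, the one for a zero lower left entry. What remains is a sum
  over r mod n.\<close>

lemma hecke_first:
  assumes \<tau>: "Im \<tau> > 0" and N: "N > 0"
  shows "(\<Sum>(n, k)\<in>{x \<in> dpairs N. odd (snd x)}. \<Sum>r<2 * n. g3E ((of_nat k * \<tau> + of_nat r) / of_nat n) (of_nat k *s v))
     = - sum (Psi \<tau> v (int N)) (H1 (int N))"
proof -
  have fin: "finite {x \<in> dpairs N. odd (snd x)}" using finite_dpairs[OF N] by simp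
  have "(\<Sum>r<2 * n. g3E ((of_nat k * \<tau> + of_nat r) / of_nat n) (of_nat k *s v))
      = - (\<Sum>r<n. Psi \<tau> v (int N) (int k, int r, 0, int n))" if nk: "(n, k) \<in> dpairs N" "odd k" for n k
  proof -
    have n: "n > 0" "k > 0" "n * k = N" using nk by (auto simp: dpairs_def)
    have 1: "g3E ((of_nat k * \<tau> + of_nat r) / of_nat n) (of_nat k *s v) + g3E ((of_nat k * \<tau> + of_nat (r + n)) / of_nat n) (of_nat k *s v)
      = - Psi \<tau> v (int N) (int k, int r, 0, int n)" for r
    proof -
      let ?t = "(of_nat k * \<tau> + of_nat r) / of_nat n"
      have t: "Im ?t > 0" using n \<tau> by (simp add: Im_divide_of_nat)
      have a: "(of_nat k * \<tau> + of_nat (r + n)) / of_nat n = ?t + 1" using n by (simp add: field_simps)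
      have "of_int (int N) / (of_int 0 * \<tau> + of_int (int n)) = (of_nat k :: complex)" using n(1) unfolding n(3)[symmetric] by simp
      hence "Psi \<tau> v (int N) (int k, int r, 0, int n) = g1 ?t * ThE8 ?t (of_nat k *s v)"
        using nk(2) unfolding Psi_def prod.case by (simp add: gsel_def mob_def)
      thus ?thesis unfolding a g3E_shift_sum[OF t] by simp
    qed
    show ?thesis unfolding sum_double 1 by (simp add: sum_negf)
  qed
  hence "(\<Sum>(n, k)\<in>{x \<in> dpairs N. odd (snd x)}. \<Sum>r<2 * n. g3E ((of_nat k * \<tau> + of_nat r) / of_nat n) (of_nat k *s v))
     = (\<Sum>x\<in>{x \<in> dpairs N. odd (snd x)}. \<Sum>r<fst x. - Psi \<tau> v (int N) (int (snd x), int r, 0, int (fst x)))"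
    by (intro sum.cong refl) (auto simp: sum_negf)
  also have "\<dots> = (\<Sum>(x, r)\<in>(SIGMA x:{x \<in> dpairs N. odd (snd x)}. {..<fst x}). - Psi \<tau> v (int N) (int (snd x), int r, 0, int (fst x)))"
    by (rule sum.Sigma) (use fin in auto)
  also have "\<dots> = (\<Sum>m\<in>H1 (int N). - Psi \<tau> v (int N) m)"
  proof (rule sum.reindex_bij_witness[of _ "\<lambda>(k, x, z, n). ((nat n, nat k), nat x)" "\<lambda>(x, r). (int (snd x), int r, 0, int (fst x))"])
    fix m assume "m \<in> H1 (int N)"
    then obtain k x n where m: "m = (k, x, 0, n)" "k > 0" "n > 0" "k * n = int N" "0 \<le> x" "x < n" "odd k"
      by (auto simp: H1_def)
    have "nat n * nat k = N" using m by (metis mult.commute nat_int nat_mult_distrib order_less_imp_le)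
    thus "(case m of (k, x, z, n) \<Rightarrow> ((nat n, nat k), nat x)) \<in> (SIGMA x:{x \<in> dpairs N. odd (snd x)}. {..<fst x})"
      using m by (auto simp: dpairs_def even_nat_iff)
  qed (auto simp: H1_def dpairs_def mult.commute)
  finally show ?thesis by (simp add: sum_negf)
qed

text \<open>The numbers 2s + 1 run over the odd numbers below 2b. For odd b they represent every
  residue mod b once, directly with component \<open>g3\<close>, and the minus sign is (-1)^b. For
  even b they represent every odd residue twice, and the two translates add up to minus
  \<open>g1\<close>.\<close>

lemma hecke_second_term:
  assumes \<tau>: "Im \<tau> > 0" and n: "b > 0" "k > 0" "b * k = N"
  shows "exp (- (pi * \<i> * of_nat N * kap v / \<tau>)) *
     ((- 1) ^ b * (\<Sum>s<b. g3E ((of_nat (2 * s + 1) * \<tau> - of_nat k) / (of_nat b * \<tau>)) ((of_nat k / \<tau>) *s v)))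
     = - (\<Sum>x\<in>{x. x < b \<and> \<not> (even x \<and> even b)}. Psi \<tau> v (int N) (int x, - int k, int b, 0))"
proof -
  have \<tau>0: "\<tau> \<noteq> 0" using \<tau> by auto
  let ?e = "exp (- (pi * \<i> * of_nat N * kap v / \<tau>))"
  let ?w = "(of_nat k / \<tau>) *s v"
  let ?P = "\<lambda>x. Psi \<tau> v (int N) (int x, - int k, int b, 0)"
  define t where "t x = (of_nat x * \<tau> - of_nat k) / (of_nat b * \<tau>)" for x :: nat
  have tm: "mob \<tau> (int x, - int k, int b, 0) = t x" for x by (simp add: mob_def t_def)
  have tpos: "Im (t x) > 0" for x
    unfolding tm [symmetric] by (rule Im_mob_pos[OF \<tau>]) (use n in auto)
  have tshift: "t (x + b) = t x + 1" for x using n \<tau>0 by (simp add: t_def field_simps)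
  have ex: "pi * \<i> * of_int (int N) * of_int (int b) * kap v / (of_int (int b) * \<tau> + of_int 0) = pi * \<i> * of_nat N * kap v / \<tau>"
    using n \<tau>0 by (simp add: field_simps)
  have vx: "of_int (int N) / (of_int (int b) * \<tau> + of_int 0) = of_nat k / \<tau>"
    using n(1) \<tau>0 unfolding n(3)[symmetric] by simp
  have P: "?P x = ?e * gsel (int x) (int b) (t x) * ThE8 (t x) ?w" for x
    unfolding Psi_def prod.case tm ex vx ..
  have Pshift: "?P (x + b) = ?P x" if "\<not> (even x \<and> even b)" for x
    using Psi_T[of "int x" "int b" \<tau> 0 v "int N" "- int k"] that n \<tau>0 by simp
  show ?thesis
  proof (cases "even b")
    case False
    have eq: "?e * g3E (t (2 * s + 1)) ?w = ?P (2 * s + 1)" for s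
      unfolding P g3E_def using False by (simp add: gsel_def)
    \<comment> \<open>An even x < b is represented by the odd number x + b; \<open>Psi\<close>
      depends on x mod b only.\<close>
    have re: "(\<Sum>s<b. ?P (2 * s + 1)) = (\<Sum>x<b. ?P x)"
    proof (rule sum.reindex_bij_witness[of _ "\<lambda>x. if odd x then x div 2 else (x + b) div 2" "\<lambda>s. if 2 * s + 1 < b then 2 * s + 1 else 2 * s + 1 - b"])
      fix s assume s: "s \<in> {..<b}"
      show "?P (if 2 * s + 1 < b then 2 * s + 1 else 2 * s + 1 - b) = ?P (2 * s + 1)"
        using Pshift[of "2 * s + 1 - b"] False by auto
      show "(if odd (if 2 * s + 1 < b then 2 * s + 1 else 2 * s + 1 - b) then (if 2 * s + 1 < b then 2 * s + 1 else 2 * s + 1 - b) div 2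
          else ((if 2 * s + 1 < b then 2 * s + 1 else 2 * s + 1 - b) + b) div 2) = s"
        using s False by (auto simp: even_diff_nat)
      show "(if 2 * s + 1 < b then 2 * s + 1 else 2 * s + 1 - b) \<in> {..<b}" using s by auto
    next
      fix x assume x: "x \<in> {..<b}"
      show "(if odd x then x div 2 else (x + b) div 2) \<in> {..<b}" using x by auto
      show "(if 2 * (if odd x then x div 2 else (x + b) div 2) + 1 < b then 2 * (if odd x then x div 2 else (x + b) div 2) + 1
         else 2 * (if odd x then x div 2 else (x + b) div 2) + 1 - b) = x"
      proof (cases "odd x")
        case True
        hence "2 * (x div 2) + 1 = x" by simp
        thus ?thesis using True x by simp
      next
        case f: False
        hence "odd (x + b)" using False by simp
        hence "2 * ((x + b) div 2) + 1 = x + b" by simp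
        thus ?thesis using f x by simp
      qed
    qed
    have set: "{x. x < b \<and> \<not> (even x \<and> even b)} = {..<b}" using False by auto
    have A: "?e * (\<Sum>s<b. g3E (t (2 * s + 1)) ?w) = (\<Sum>s<b. ?P (2 * s + 1))"
      by (simp only: sum_distrib_left eq)
    have "?e * ((- 1) ^ b * X) = - (?e * X)" for X using False by simp
    thus ?thesis unfolding t_def[symmetric] set re[symmetric] A[symmetric] .
  next
    case True
    then obtain c where c: "b = 2 * c" by blast
    have eq: "?e * (g3E (t (2 * s + 1)) ?w + g3E (t (2 * (s + c) + 1)) ?w) = - ?P (2 * s + 1)" for s
    proof -
      have "2 * (s + c) + 1 = (2 * s + 1) + b" using c by simp
      hence "g3E (t (2 * s + 1)) ?w + g3E (t (2 * (s + c) + 1)) ?w = - (g1 (t (2 * s + 1)) * ThE8 (t (2 * s + 1)) ?w)"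
        using tshift[of "2 * s + 1"] g3E_shift_sum[OF tpos[of "2 * s + 1"]] by metis
      thus ?thesis unfolding P using True by (simp add: gsel_def)
    qed
    have "?e * ((- 1) ^ b * (\<Sum>s<b. g3E (t (2 * s + 1)) ?w)) = ?e * (\<Sum>s<c. g3E (t (2 * s + 1)) ?w + g3E (t (2 * (s + c) + 1)) ?w)"
      using True unfolding c sum_double by simp
    also have "\<dots> = (\<Sum>s<c. - ?P (2 * s + 1))" unfolding sum_distrib_left eq ..
    also have "\<dots> = (\<Sum>x\<in>{x. x < b \<and> \<not> (even x \<and> even b)}. - ?P x)"
      by (rule sum.reindex_bij_witness[of _ "\<lambda>x. x div 2" "\<lambda>s. 2 * s + 1"]) (use c in auto)
    finally show ?thesis unfolding t_def by (simp add: sum_negf)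
  qed
qed

lemma hecke_second:
  assumes \<tau>: "Im \<tau> > 0" and N: "N > 0"
  shows "exp (- (pi * \<i> * of_nat N * kap v / \<tau>)) * (\<Sum>(b, k)\<in>dpairs N.
       (- 1) ^ b * (\<Sum>s<b. g3E ((of_nat (2 * s + 1) * \<tau> - of_nat k) / (of_nat b * \<tau>)) ((of_nat k / \<tau>) *s v)))
     = - sum (Psi \<tau> v (int N)) (H2 (int N))"
proof -
  let ?S = "\<lambda>b :: nat. {x. x < b \<and> \<not> (even x \<and> even b)}"
  have fin: "finite (dpairs N)" by (rule finite_dpairs[OF N])
  have "exp (- (pi * \<i> * of_nat N * kap v / \<tau>)) * (\<Sum>(b, k)\<in>dpairs N.
       (- 1) ^ b * (\<Sum>s<b. g3E ((of_nat (2 * s + 1) * \<tau> - of_nat k) / (of_nat b * \<tau>)) ((of_nat k / \<tau>) *s v)))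
     = (\<Sum>x\<in>dpairs N. \<Sum>y\<in>?S (fst x). - Psi \<tau> v (int N) (int y, - int (snd x), int (fst x), 0))"
  proof (subst sum_distrib_left, intro sum.cong refl)
    fix x assume x: "x \<in> dpairs N"
    obtain b k where bk: "x = (b, k)" by force
    have "b > 0" "k > 0" "b * k = N" using x bk by (auto simp: dpairs_def)
    from hecke_second_term[OF \<tau> this, of v]
    show "exp (- (pi * \<i> * of_nat N * kap v / \<tau>)) * (case x of (b, k) \<Rightarrow> 
       (- 1) ^ b * (\<Sum>s<b. g3E ((of_nat (2 * s + 1) * \<tau> - of_nat k) / (of_nat b * \<tau>)) ((of_nat k / \<tau>) *s v)))
      = (\<Sum>y\<in>?S (fst x). - Psi \<tau> v (int N) (int y, - int (snd x), int (fst x), 0))"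
      unfolding bk prod.case fst_conv snd_conv sum_negf .
  qed
  also have "\<dots> = (\<Sum>(x, y)\<in>(SIGMA x:dpairs N. ?S (fst x)). - Psi \<tau> v (int N) (int y, - int (snd x), int (fst x), 0))"
    by (rule sum.Sigma) (use fin in auto)
  also have "\<dots> = (\<Sum>m\<in>H2 (int N). - Psi \<tau> v (int N) m)"
  proof (rule sum.reindex_bij_witness[of _ "\<lambda>(x, k, b, z). ((nat b, nat (- k)), nat x)" "\<lambda>(x, y). (int y, - int (snd x), int (fst x), 0)"])
    fix m assume "m \<in> H2 (int N)"
    then obtain k x b where m: "m = (x, - k, b, 0)" "k > 0" "b > 0" "k * b = int N" "0 \<le> x" "x < b" "\<not> (even x \<and> even b)"
      by (auto simp: H2_def)
    have "nat b * nat k = N" using m by (metis mult.commute nat_int nat_mult_distrib order_less_imp_le)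
    thus "(case m of (x, k, b, z) \<Rightarrow> ((nat b, nat (- k)), nat x)) \<in> (SIGMA x:dpairs N. ?S (fst x))"
      using m by (auto simp: dpairs_def even_nat_iff)
  qed (auto simp: H2_def dpairs_def mult.commute)
  finally show ?thesis by (simp add: sum_negf)
qed

theorem hecke_identity:
  assumes \<tau>: "Im \<tau> > 0" and N: "N > 0"
  shows "(\<Sum>(n, k)\<in>{x \<in> dpairs N. odd (snd x)}. \<Sum>r<2 * n. g3E ((of_nat k * \<tau> + of_nat r) / of_nat n) (of_nat k *s v))
     = exp (- (pi * \<i> * of_nat N * kap v / \<tau>)) * (\<Sum>(b, k)\<in>dpairs N.
       (- 1) ^ b * (\<Sum>s<b. g3E ((of_nat (2 * s + 1) * \<tau> - of_nat k) / (of_nat b * \<tau>)) ((of_nat k / \<tau>) *s v)))"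
  unfolding hecke_first[OF assms] hecke_second[OF assms] using sum_Psi_H1_H2[OF \<tau>, of "int N" v] N by simp

section \<open>Growth of the coefficients and lattice sums\<close>

text \<open>The norm of u/2, that is of the E8 vector itself.\<close>

definition Qf :: "int ^ 8 \<Rightarrow> int" where "Qf u = usq u div 4"

lemma usq_eq_Qf: "u \<in> Lam8 \<Longrightarrow> usq u = 4 * Qf u"
  using usq_dvd_8[of u] by (auto simp: Qf_def)

lemma even_Qf: "u \<in> Lam8 \<Longrightarrow> even (Qf u)"
  using usq_dvd_8[of u] by (auto simp: Qf_def)

lemma E8term_Qf:
  assumes "u \<in> Lam8"
  shows "E8term t v u = exp (pi * \<i> * of_int (Qf u) * t + pi * \<i> * udot u v)"
  unfolding E8term_def usq_eq_Qf[OF assms] by (rule arg_cong[of _ _ exp]) (simp add: field_simps)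

section \<open>Growth of the coefficients of the eta quotient\<close>

text \<open>On the imaginary axis all terms are nonnegative, so the absolute value of
  \<open>g3\<close> is the series itself and bounds each single term.\<close>

lemma cc_real_has_sum:
  assumes y: "y > 0"
  shows "((\<lambda>j. real_of_int (cc j) * exp (- pi * real_of_int j * y)) has_sum norm (g3 (\<i> * y))) UNIV"
proof -
  let ?f = "\<lambda>j. real_of_int (cc j) * exp (- pi * real_of_int j * y)"
  have e: "of_int (cc j) * exp (2 * pi * \<i> * of_int j * (\<i> * y / 2)) = complex_of_real (?f j)" for j
  proof -
    have "2 * pi * \<i> * of_int j * (\<i> * y / 2) = complex_of_real (- pi * real_of_int j * y)"
      by (simp add: complex_eq_iff)
    hence "exp (2 * pi * \<i> * of_int j * (\<i> * y / 2)) = complex_of_real (exp (- pi * real_of_int j * y))"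
      by (simp only: exp_of_real)
    thus ?thesis by simp
  qed
  have s: "((\<lambda>j. complex_of_real (?f j)) has_sum - g3 (\<i> * y)) UNIV"
    using cc_has_sum_g3[of "\<i> * y"] y unfolding e by simp
  have "?f summable_on UNIV"
    using cc_abs_summable_exp[of "\<i> * y"] y unfolding e norm_of_real by (simp add: cc_nonneg abs_mult)
  hence h: "(?f has_sum infsum ?f UNIV) UNIV" by simp
  hence "((\<lambda>j. complex_of_real (?f j)) has_sum of_real (infsum ?f UNIV)) UNIV" by (rule has_sum_of_real)
  with s have g: "- g3 (\<i> * y) = of_real (infsum ?f UNIV)" by (rule has_sum_unique)
  have "norm (g3 (\<i> * y)) = norm (- g3 (\<i> * y))" by (rule norm_minus_cancel [symmetric])
  hence "norm (g3 (\<i> * y)) = \<bar>infsum ?f UNIV\<bar>" unfolding g norm_of_real .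
  moreover have "infsum ?f UNIV \<ge> 0" by (rule infsum_nonneg) (simp add: cc_nonneg)
  ultimately show ?thesis using h by simp
qed

lemma has_sum_ge_term:
  fixes f :: "'a \<Rightarrow> real"
  assumes "(f has_sum s) A" "x \<in> A" "\<And>y. y \<in> A \<Longrightarrow> f y \<ge> 0"
  shows "f x \<le> s"
  using finite_sum_le_has_sum[OF assms(1), of "{x}"] assms(2,3) by auto

text \<open>A single term is bounded by the whole series at i y. For y = 1/s inversion leads to the
  value at i s, which grows at most like exp (pi s) because the lowest index is -1. With s = sqrt j
  both exponentials contribute pi sqrt j. The form with an upper bound x for j is made for lattice
  vectors that have been shifted.\<close>

theorem cc_growth:
  shows "\<exists>C>0. \<forall>j x. real_of_int j \<le> x \<longrightarrow> x \<ge> 0 \<longrightarrow> real_of_int (cc j) \<le> C * exp (2 * pi * sqrt x)"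
proof -
  define K where "K = norm (g3 \<i>)"
  have K1: "real_of_int (cc j) * exp (- pi * real_of_int j) \<le> K" for j
    using has_sum_ge_term[OF cc_real_has_sum[of 1], of j] by (simp add: K_def cc_nonneg)
  have "exp pi \<le> K" using K1[of "-1"] by (simp add: cc_minus_one)
  hence K0: "K > 0" by (rule less_le_trans[OF exp_gt_zero])
  \<comment> \<open>Comparison with the series at i: for j >= -1 and s >= 1 one has -j s <= s - 1 -
    j.\<close>
  have tail: "norm (g3 (\<i> * s)) \<le> exp (pi * s) * (exp (- pi) * K)" if s: "s \<ge> 1" for s :: real
  proof (rule has_sum_mono[OF cc_real_has_sum])
    show "s > 0" using s by simp
    have "((\<lambda>j. (exp (pi * s) * exp (- pi)) * (real_of_int (cc j) * exp (- pi * real_of_int j * 1))) has_sum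
       (exp (pi * s) * exp (- pi)) * norm (g3 (\<i> * complex_of_real 1))) UNIV"
      by (intro has_sum_cmult_right cc_real_has_sum) simp
    thus "((\<lambda>j. (exp (pi * s) * exp (- pi)) * (real_of_int (cc j) * exp (- pi * real_of_int j * 1))) has_sum
       exp (pi * s) * (exp (- pi) * K)) UNIV" by (simp add: K_def mult.assoc)
  next
    fix j
    show "real_of_int (cc j) * exp (- pi * real_of_int j * s) \<le> (exp (pi * s) * exp (- pi)) * (real_of_int (cc j) * exp (- pi * real_of_int j * 1))"
    proof (cases "j < -1")
      case False
      have "0 \<le> (real_of_int j + 1) * (s - 1)" using False s by (intro mult_nonneg_nonneg) auto
      hence "pi * (- real_of_int j * s) \<le> pi * (s - 1 - real_of_int j)" by (intro mult_left_mono) (simp_all add: algebra_simps)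
      hence "exp (- pi * real_of_int j * s) \<le> exp (pi * s + - pi + - pi * real_of_int j * 1)" by (simp add: algebra_simps)
      hence "exp (- pi * real_of_int j * s) \<le> (exp (pi * s) * exp (- pi)) * exp (- pi * real_of_int j * 1)"
        by (simp only: exp_add)
      hence "real_of_int (cc j) * exp (- pi * real_of_int j * s) \<le> real_of_int (cc j) * ((exp (pi * s) * exp (- pi)) * exp (- pi * real_of_int j * 1))"
        by (rule mult_left_mono) (simp add: cc_nonneg)
      thus ?thesis by (simp only: mult_ac)
    qed (simp add: cc_eq_0)
  qed
  \<comment> \<open>Large enough for the indices -1 and 0 too, which the choice s = sqrt j does not
    reach.\<close>
  define C where "C = max K 1 * exp pi"
  have C: "C > 0" by (simp add: C_def)
  have CK: "K \<le> C"
  proof -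
    have "K * 1 \<le> max K 1 * exp pi" by (intro mult_mono) (use K0 in auto)
    thus ?thesis by (simp add: C_def)
  qed
  have bound: "real_of_int (cc j) \<le> C * exp (2 * pi * sqrt (real_of_int j))" if j: "j \<ge> 1" for j
  proof -
    define s where "s = sqrt (real_of_int j)"
    have s: "s \<ge> 1" "s * s = real_of_int j" using j by (auto simp: s_def)
    have y: "1 / s > 0" using s by auto
    have "real_of_int (cc j) * exp (- pi * real_of_int j * (1 / s)) \<le> norm (g3 (\<i> * (1 / s)))"
      using has_sum_ge_term[OF cc_real_has_sum[OF y], of j] by (simp add: cc_nonneg)
    also have "- pi * real_of_int j * (1 / s) = - (pi * s)" using s by (simp add: field_simps flip: s(2))
    also have "norm (g3 (\<i> * (1 / s))) \<le> norm (g3 (\<i> * s))"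
    proof -
      have "\<i> * (1 / s) = - 1 / (\<i> * s)" using s by (simp add: field_simps)
      hence "g3 (\<i> * (1 / s)) = g3 (\<i> * s) / (\<i> * s) ^ 4" using g3_inversion[of "\<i> * s"] s by simp
      also have "(\<i> * s) ^ 4 = complex_of_real (s ^ 4)" by (simp add: power_mult_distrib)
      finally have "norm (g3 (\<i> * (1 / s))) = norm (g3 (\<i> * s)) / s ^ 4" using s by (simp add: norm_divide norm_power)
      also have "\<dots> \<le> norm (g3 (\<i> * s)) / 1" using s by (intro divide_left_mono) (auto simp: one_le_power)
      finally show ?thesis by simp
    qed
    also have "\<dots> \<le> exp (pi * s) * (exp (- pi) * K)" by (rule tail[OF s(1)])
    also have "exp (- pi) * K \<le> C"
    proof -
      have "exp (- pi) * K \<le> 1 * K" by (intro mult_right_mono) (use K0 in auto)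
      thus ?thesis using CK by simp
    qed
    finally have "real_of_int (cc j) * exp (- (pi * s)) \<le> exp (pi * s) * C" by simp
    hence "(real_of_int (cc j) * exp (- (pi * s))) * exp (pi * s) \<le> (exp (pi * s) * C) * exp (pi * s)"
      by (rule mult_right_mono) simp
    thus ?thesis by (simp add: s_def mult_ac exp_minus field_simps flip: exp_add)
  qed
  have "real_of_int (cc j) \<le> C * exp (2 * pi * sqrt x)" if jx: "real_of_int j \<le> x" "x \<ge> 0" for j x
  proof (cases "j \<ge> 1")
    case True
    have "C * exp (2 * pi * sqrt (real_of_int j)) \<le> C * exp (2 * pi * sqrt x)"
      using C jx by simp
    thus ?thesis using bound[OF True] by linarith
  next
    case False
    have "real_of_int (cc j) \<le> C"
    proof (cases "j < -1")
      case False
      hence "j = -1 \<or> j = 0" using \<open>\<not> j \<ge> 1\<close> by auto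
      thus ?thesis
      proof
        assume j: "j = -1"
        have "1 * 1 \<le> max K 1 * exp pi" by (intro mult_mono) auto
        thus ?thesis by (simp add: j C_def cc_minus_one)
      next
        assume "j = 0"
        thus ?thesis using K1[of 0] CK by simp
      qed
    qed (use C in \<open>simp add: cc_eq_0\<close>)
    moreover have "C * 1 \<le> C * exp (2 * pi * sqrt x)" using C jx by (intro mult_left_mono) auto
    ultimately show ?thesis by linarith
  qed
  with C show ?thesis by blast
qed

section \<open>Lattice sums at a fixed level\<close>

lemma sum_roots_of_unity:
  assumes d: "d > 0"
  shows "(\<Sum>r<d. exp (2 * pi * \<i> * of_int m * of_nat r / of_nat d)) = (if int d dvd m then of_nat d else 0)"
proof -
  define z where "z = exp (2 * pi * \<i> * of_int m / of_nat d)"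
  have zr: "exp (2 * pi * \<i> * of_int m * of_nat r / of_nat d) = z ^ r" for r
    unfolding z_def exp_of_nat_mult [symmetric] by (rule arg_cong[of _ _ exp]) simp
  have zd: "z ^ d = 1"
  proof -
    have "z ^ d = exp (2 * pi * \<i> * of_int m)"
      unfolding z_def exp_of_nat_mult [symmetric] by (rule arg_cong[of _ _ exp]) (use d in simp)
    thus ?thesis by (simp only: exp_2pi_int)
  qed
  have z1: "z = 1 \<longleftrightarrow> int d dvd m"
  proof
    assume "int d dvd m"
    then obtain k where k: "m = int d * k" by blast
    have "z = exp (2 * pi * \<i> * of_int k)" unfolding z_def k by (rule arg_cong[of _ _ exp]) (use d in simp)
    thus "z = 1" by (simp only: exp_2pi_int)
  next
    assume "z = 1"
    then obtain n :: int where n: "Im (2 * pi * \<i> * of_int m / of_nat d) = of_int (2 * n) * pi"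
      unfolding z_def exp_eq_1 by blast
    have "Im (2 * pi * \<i> * of_int m / of_nat d) = 2 * pi * of_int m / of_nat d" by (simp add: Im_divide_of_nat)
    hence "of_int m = (of_int (n * int d) :: real)" using n d by (simp add: field_simps)
    hence "m = n * int d" by (simp only: of_int_eq_iff)
    thus "int d dvd m" by simp
  qed
  show ?thesis
  proof (cases "z = 1")
    case True
    thus ?thesis using z1 unfolding zr by simp
  next
    case False
    hence "(\<Sum>r<d. z ^ r) = (z ^ d - 1) / (z - 1)" by (rule geometric_sum)
    thus ?thesis using z1 False zd unfolding zr by simp
  qed
qed

lemma has_sum_finite_sum:
  fixes f :: "'i \<Rightarrow> 'a \<Rightarrow> complex"
  assumes "finite I" "\<And>i. i \<in> I \<Longrightarrow> (f i has_sum s i) A"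
  shows "((\<lambda>x. \<Sum>i\<in>I. f i x) has_sum (\<Sum>i\<in>I. s i)) A"
  using assms by (induction I rule: finite_induct) (auto intro: has_sum_add)

text \<open>For fixed u the admissible j are those congruent to -Qf u mod d, and the quotient a
  becomes the free coordinate.\<close>

lemma has_sum_reindex_level:
  fixes g :: "int \<times> (int ^ 8) \<Rightarrow> 'c :: {comm_monoid_add, t2_space}"
  assumes "d > 0"
  shows "(g has_sum s) {(j, u). u \<in> Lam8 \<and> int d dvd j + Qf u}
     \<longleftrightarrow> ((\<lambda>x. g (case x of (a, u) \<Rightarrow> (a * int d - Qf u, u))) has_sum s) (UNIV \<times> Lam8)"
  by (rule sym, rule has_sum_reindex_bij_witness[of _ "\<lambda>(j, u). ((j + Qf u) div int d, u)" "\<lambda>(a, u). (a * int d - Qf u, u)"])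
     (use assms in auto)

text \<open>The sum over \<open>r\<close> detects divisibility of \<open>j + Qf u\<close> by \<open>d\<close>, which is what makes a
  coefficient of index \<open>j\<close> contribute to the lattice vector with \<open>a d - Qf u = j\<close>.\<close>

theorem cc_lattice_sum:
  assumes d: "d > 0" and \<alpha>: "Im \<alpha> > 0"
  shows "(\<lambda>(a, u). norm (of_int (cc (a * int d - Qf u)) * exp (2 * pi * \<i> * of_int a * \<alpha> + pi * \<i> * udot u v)))
            summable_on (UNIV \<times> Lam8)"
    and "((\<lambda>(a, u). of_int (cc (a * int d - Qf u)) * exp (2 * pi * \<i> * of_int a * \<alpha> + pi * \<i> * udot u v))
            has_sum - ((\<Sum>r<d. g3E (2 * (\<alpha> + of_nat r) / of_nat d) v) / of_nat d)) (UNIV \<times> Lam8)"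
proof -
  \<comment> \<open>With this t the indices j and Qf u enter the exponent only through (j + Qf
    u)(\<alpha> + r) / d.\<close>
  define t where "t r = 2 * (\<alpha> + of_nat r) / of_nat d" for r :: nat
  have t: "Im (t r) > 0" for r using d \<alpha> by (simp add: t_def Im_divide_of_nat)
  define f where "f r = (\<lambda>(j, u). (of_int (cc j) * exp (2 * pi * \<i> * of_int j * (t r / 2))) * E8term (t r) v u)" for r
  have fe: "f r (j, u) = of_int (cc j) * exp (2 * pi * \<i> * of_int (j + Qf u) * \<alpha> / of_nat d + pi * \<i> * udot u v)
      * exp (2 * pi * \<i> * of_int (j + Qf u) * of_nat r / of_nat d)" if "u \<in> Lam8" for r j u
    unfolding f_def prod.case E8term_Qf[OF that] mult.assoc exp_add [symmetric]
    using d by (intro arg_cong2[of _ _ _ _ "(*)"] arg_cong[of _ _ exp] refl) (simp add: t_def field_simps)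
  have f_abs: "(\<lambda>x. norm (f r x)) summable_on (UNIV \<times> Lam8)" for r
  proof -
    have a: "(\<lambda>j. norm (of_int (cc j) * exp (2 * pi * \<i> * of_int j * (t r / 2)))) summable_on UNIV"
      by (rule cc_abs_summable_exp[OF t])
    have b: "(\<lambda>u. norm (E8term (t r) v u)) summable_on Lam8" by (rule abs_summable_E8term[OF t])
    have "(\<lambda>(j, u). norm (of_int (cc j) * exp (2 * pi * \<i> * of_int j * (t r / 2))) * norm (E8term (t r) v u)) summable_on (UNIV \<times> Lam8)"
      by (rule summable_on_SigmaI[where g = "\<lambda>j. norm (of_int (cc j) * exp (2 * pi * \<i> * of_int j * (t r / 2))) * infsum (\<lambda>u. norm (E8term (t r) v u)) Lam8"])
         (use a b in \<open>auto intro!: has_sum_cmult_right summable_on_cmult_left\<close>)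
    thus ?thesis by (simp only: f_def case_prod_unfold norm_mult)
  qed
  have f_sum: "(f r has_sum - g3E (t r) v) (UNIV \<times> Lam8)" for r
  proof -
    have "((\<lambda>u. f r (j, u)) has_sum (of_int (cc j) * exp (2 * pi * \<i> * of_int j * (t r / 2))) * ThE8 (t r) v) Lam8" for j
      unfolding f_def prod.case ThE8_def
      by (rule has_sum_cmult_right[OF has_sum_infsum[OF abs_summable_summable[OF abs_summable_E8term[OF t]]]])
    moreover have "((\<lambda>j. (of_int (cc j) * exp (2 * pi * \<i> * of_int j * (t r / 2))) * ThE8 (t r) v) has_sum (- g3 (t r)) * ThE8 (t r) v) UNIV"
      by (intro has_sum_cmult_left cc_has_sum_g3 t)
    ultimately have "(f r has_sum (- g3 (t r)) * ThE8 (t r) v) (UNIV \<times> Lam8)"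
      by (rule has_sum_SigmaI[where f = "f r" and A = UNIV and B = "\<lambda>_. Lam8"]) (rule abs_summable_summable[OF f_abs[of r]])
    thus ?thesis by (simp add: g3E_def)
  qed
  let ?D = "{(j, u). u \<in> Lam8 \<and> int d dvd j + Qf u}"
  let ?h = "\<lambda>(a, u). of_int (cc (a * int d - Qf u)) * exp (2 * pi * \<i> * of_int a * \<alpha> + pi * \<i> * udot u v)"
  have h0: "?h x = f 0 (case x of (a, u) \<Rightarrow> (a * int d - Qf u, u))" if xm: "x \<in> UNIV \<times> Lam8" for x
  proof -
    obtain a u where x: "x = (a, u)" "u \<in> Lam8" using xm by auto
    show ?thesis unfolding x(1) prod.case fe[OF x(2)] using d by (simp add: mult.assoc)
  qed
  note reindex = has_sum_reindex_level[OF d]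
  have "(\<lambda>x. norm (f 0 x)) summable_on ?D"
    by (rule summable_on_subset[OF f_abs[of 0]]) auto
  hence "(\<lambda>x. norm (f 0 (case x of (a, u) \<Rightarrow> (a * int d - Qf u, u)))) summable_on (UNIV \<times> Lam8)"
    using reindex[of "\<lambda>x. norm (f 0 x)"] unfolding summable_on_def by blast
  hence "(\<lambda>x. norm (?h x)) summable_on (UNIV \<times> Lam8)"
    by (subst summable_on_cong[where g = "\<lambda>x. norm (f 0 (case x of (a, u) \<Rightarrow> (a * int d - Qf u, u)))"]) (simp_all only: h0)
  thus "(\<lambda>(a, u). norm (of_int (cc (a * int d - Qf u)) * exp (2 * pi * \<i> * of_int a * \<alpha> + pi * \<i> * udot u v)))
            summable_on (UNIV \<times> Lam8)" by (simp only: case_prod_unfold)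
  have "((\<lambda>x. (\<Sum>r<d. f r x) / of_nat d) has_sum (\<Sum>r<d. - g3E (t r) v) / of_nat d) (UNIV \<times> Lam8)"
    by (intro has_sum_divide_const has_sum_finite_sum f_sum) simp
  also have "?this \<longleftrightarrow> (f 0 has_sum (\<Sum>r<d. - g3E (t r) v) / of_nat d) ?D"
  proof (rule has_sum_cong_neutral)
    have S: "(\<Sum>r<d. f r x) / of_nat d = (if x \<in> ?D then f 0 x else 0)" if "x \<in> UNIV \<times> Lam8" for x
    proof -
      obtain j u where x: "x = (j, u)" "u \<in> Lam8" using \<open>x \<in> UNIV \<times> Lam8\<close> by auto
      show ?thesis unfolding x(1) fe[OF x(2)] sum_distrib_left [symmetric] sum_roots_of_unity[OF d]
        using d x(2) by simp
    qed
    show "(\<Sum>r<d. f r x) / of_nat d = f 0 x" if "x \<in> (UNIV \<times> Lam8) \<inter> ?D" for x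
      using S[of x] that by simp
    show "(\<Sum>r<d. f r x) / of_nat d = 0" if "x \<in> (UNIV \<times> Lam8) - ?D" for x
      using S[of x] that by simp
  qed auto
  also have "\<dots> \<longleftrightarrow> ((\<lambda>x. f 0 (case x of (a, u) \<Rightarrow> (a * int d - Qf u, u))) has_sum (\<Sum>r<d. - g3E (t r) v) / of_nat d) (UNIV \<times> Lam8)"
    by (rule reindex)
  also have "\<dots> \<longleftrightarrow> (?h has_sum (\<Sum>r<d. - g3E (t r) v) / of_nat d) (UNIV \<times> Lam8)"
    by (rule has_sum_cong) (simp only: h0)
  finally show "(?h has_sum - ((\<Sum>r<d. g3E (2 * (\<alpha> + of_nat r) / of_nat d) v) / of_nat d)) (UNIV \<times> Lam8)"
    by (simp add: sum_negf t_def)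
qed

section \<open>Estimates in the positive cone and convergence\<close>

text \<open>The reversed Cauchy-Schwarz inequality of a Lorentzian space, with the definite parts
  replaced by their lengths m and H. It follows from the inequality of means and (2pq - mH/2)^2 - 2
  (2q^2 - H^2/2)(p^2 - m^2/4) = (mq - pH)^2. The second bound is coercivity: strictly inside the
  cone the pairing controls the size of the vector.\<close>

lemma reversed_cauchy_schwarz:
  fixes A B H a b m :: real
  assumes A: "A > 0" "B > 0" and H: "H \<ge> 0" and S: "2 * A * B - H^2 / 2 > 0"
    and ab: "a \<ge> 0" "b \<ge> 0" and m: "m \<ge> 0" "m^2 \<le> 4 * a * b"
  shows "a * A + b * B - m * H / 2 \<ge> sqrt (2 * (2 * A * B - H^2 / 2) * (a * b - m^2 / 4))"
    and "a * A + b * B - m * H / 2 \<ge> (1 - H / (2 * sqrt (A * B))) * (a * A + b * B)"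
proof -
  define p q where "p = sqrt (a * b)" and "q = sqrt (A * B)"
  have p: "p \<ge> 0" "p^2 = a * b" using ab by (auto simp: p_def)
  have q: "q > 0" "q^2 = A * B" using A by (auto simp: q_def)
  have amgm: "2 * p * q \<le> a * A + b * B"
  proof -
    have "(sqrt (a * A) - sqrt (b * B))^2 \<ge> 0" by simp
    moreover have "sqrt (a * A) * sqrt (b * B) = p * q"
      unfolding p_def q_def by (simp add: real_sqrt_mult mult_ac)
    ultimately show ?thesis using ab A by (simp add: power2_diff)
  qed
  have mp: "m \<le> 2 * p"
  proof (rule power2_le_imp_le)
    show "m^2 \<le> (2 * p)^2" using m p by (simp add: power_mult_distrib)
  qed (use p in simp)
  have Hq: "H < 2 * q"
  proof (rule power2_less_imp_less)
    show "H^2 < (2 * q)^2" using S q by (simp add: power_mult_distrib)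
  qed (use q in simp)
  have mH: "m * H \<le> (2 * p) * (2 * q)" using mp Hq m H p by (intro mult_mono) auto
  have "sqrt (2 * (2 * A * B - H^2 / 2) * (a * b - m^2 / 4)) \<le> 2 * p * q - m * H / 2"
  proof (rule real_le_lsqrt)
    show "0 \<le> 2 * p * q - m * H / 2" using mH by simp
    have "(2 * p * q - m * H / 2)^2 - 2 * (2 * q^2 - H^2 / 2) * (p^2 - m^2 / 4) = (m * q - p * H)^2"
      by (simp add: power2_eq_square algebra_simps)
    hence "2 * (2 * q^2 - H^2 / 2) * (p^2 - m^2 / 4) \<le> (2 * p * q - m * H / 2)^2"
      using zero_le_power2[of "m * q - p * H"] by linarith
    thus "2 * (2 * A * B - H^2 / 2) * (a * b - m^2 / 4) \<le> (2 * p * q - m * H / 2)^2"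
      by (simp add: p q mult.assoc)
  qed
  thus "a * A + b * B - m * H / 2 \<ge> sqrt (2 * (2 * A * B - H^2 / 2) * (a * b - m^2 / 4))"
    using amgm by linarith
  have "m * H / 2 \<le> p * H" using mult_right_mono[OF mp H] by simp
  also have "\<dots> = (H / (2 * q)) * (2 * p * q)" using q by simp
  also have "\<dots> \<le> (H / (2 * q)) * (a * A + b * B)" using amgm H q by (intro mult_left_mono) auto
  finally show "a * A + b * B - m * H / 2 \<ge> (1 - H / (2 * sqrt (A * B))) * (a * A + b * B)"
    unfolding q_def [symmetric] by (simp add: algebra_simps)
qed

definition ru :: "int ^ 8 \<Rightarrow> real ^ 8" where "ru u = (\<chi> j. of_int (u $ j))"

text \<open>The pairing of a lattice vector with an imaginary part that has hyperbolic coordinates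
  A, B and E8 part h; the factor 1/2 belongs to E8(2) in doubled coordinates.\<close>

definition Lr :: "real \<Rightarrow> real \<Rightarrow> real ^ 8 \<Rightarrow> int \<times> int \<times> (int ^ 8) \<Rightarrow> real" where
  "Lr A B h = (\<lambda>(a, b, u). of_int a * A + of_int b * B - (ru u \<bullet> h) / 2)"

lemma norm_ru: "norm (ru u) ^ 2 = of_int (usq u)"
  by (simp only: power2_norm_eq_inner inner_vec_def ru_def usq_def) (simp add: power2_eq_square)

lemma Qf_nonneg: "Qf u \<ge> 0"
  by (simp add: Qf_def usq_def sum_nonneg pos_imp_zdiv_nonneg_iff)

text \<open>The first bound is to beat the growth of the coefficients, the second to sum over all
  ten lattice coordinates.\<close>

lemma Lr_cone:
  assumes A: "A > 0" "B > 0" and S: "2 * A * B - norm h ^ 2 / 2 > 0"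
  obtains \<eta> where "\<eta> > 0"
    "\<And>a b u. u \<in> Lam8 \<Longrightarrow> a \<ge> 0 \<Longrightarrow> b \<ge> 0 \<Longrightarrow> Qf u \<le> a * b \<Longrightarrow>
        Lr A B h (a, b, u) \<ge> sqrt (2 * (2 * A * B - norm h ^ 2 / 2) * of_int (a * b - Qf u))
        \<and> Lr A B h (a, b, u) \<ge> \<eta> * (of_int a + of_int b + (\<Sum>j\<in>UNIV. \<bar>of_int (u $ j)\<bar>))"
proof -
  define H where "H = norm h"
  define \<rho> where "\<rho> = H / (2 * sqrt (A * B))"
  have "\<rho> < 1"
  proof -
    have "H < 2 * sqrt (A * B)"
      by (rule power2_less_imp_less) (use S A in \<open>simp_all add: H_def power_mult_distrib\<close>)
    thus ?thesis using A by (simp add: \<rho>_def)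
  qed
  \<comment> \<open>Each of the eight |u_j| is at most a + b, so all coordinates together are at
    most 9 (a + b).\<close>
  define \<eta> where "\<eta> = (1 - \<rho>) * min A B / 9"
  have \<eta>: "\<eta> > 0" using \<open>\<rho> < 1\<close> A by (simp add: \<eta>_def)
  have "Lr A B h (a, b, u) \<ge> sqrt (2 * (2 * A * B - norm h ^ 2 / 2) * of_int (a * b - Qf u))
        \<and> Lr A B h (a, b, u) \<ge> \<eta> * (of_int a + of_int b + (\<Sum>j\<in>UNIV. \<bar>of_int (u $ j)\<bar>))"
    if u: "u \<in> Lam8" and ab: "a \<ge> 0" "b \<ge> 0" and Q: "Qf u \<le> a * b" for a b u
  proof -
    define m where "m = norm (ru u)"
    have m2: "m^2 = 4 * of_int (Qf u)" unfolding m_def norm_ru usq_eq_Qf[OF u] by simp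
    have mab: "m^2 \<le> 4 * of_int a * of_int b"
    proof -
      have "real_of_int (Qf u) \<le> of_int (a * b)" using Q by (simp only: of_int_le_iff)
      thus ?thesis using m2 by simp
    qed
    have ab': "real_of_int a \<ge> 0" "real_of_int b \<ge> 0" using ab by auto
    have m0: "m \<ge> 0" "H \<ge> 0" by (simp_all add: m_def H_def)
    have "ru u \<bullet> h \<le> m * H" unfolding m_def H_def by (rule norm_cauchy_schwarz)
    hence L: "Lr A B h (a, b, u) \<ge> of_int a * A + of_int b * B - m * H / 2" by (simp add: Lr_def)
    note R = reversed_cauchy_schwarz[OF A m0(2) S[folded H_def] ab' m0(1) mab]
    have "of_int a * of_int b - m^2 / 4 = real_of_int (a * b - Qf u)" using m2 by simp
    hence 1: "Lr A B h (a, b, u) \<ge> sqrt (2 * (2 * A * B - norm h ^ 2 / 2) * of_int (a * b - Qf u))"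
      using R(1) L by (simp add: H_def)
    have "m \<le> of_int a + of_int b"
    proof (rule power2_le_imp_le)
      have "0 \<le> (real_of_int a - of_int b)^2" by simp
      thus "m^2 \<le> (of_int a + of_int b)^2" using mab by (simp add: power2_eq_square algebra_simps)
    qed (use ab' in simp)
    moreover have "\<bar>of_int (u $ j)\<bar> \<le> m" for j
      using component_le_norm_cart[of "ru u" j] by (simp add: m_def ru_def)
    ultimately have "\<bar>real_of_int (u $ j)\<bar> \<le> of_int a + of_int b" for j by (meson order_trans)
    hence "(\<Sum>j\<in>(UNIV :: 8 set). \<bar>real_of_int (u $ j)\<bar>) \<le> (\<Sum>j\<in>(UNIV :: 8 set). of_int a + of_int b)" by (intro sum_mono)
    hence "of_int a + of_int b + (\<Sum>j\<in>UNIV. \<bar>real_of_int (u $ j)\<bar>) \<le> 9 * (of_int a + of_int b)" by simp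
    hence "\<eta> * (of_int a + of_int b + (\<Sum>j\<in>UNIV. \<bar>real_of_int (u $ j)\<bar>)) \<le> \<eta> * (9 * (of_int a + of_int b))"
      using \<eta> by (intro mult_left_mono) auto
    also have "\<dots> = (1 - \<rho>) * (of_int a * min A B + of_int b * min A B)"
    proof -
      have "\<eta> * 9 = (1 - \<rho>) * min A B" by (simp add: \<eta>_def)
      hence "(\<eta> * 9) * (of_int a + of_int b) = ((1 - \<rho>) * min A B) * (of_int a + of_int b)" by (rule arg_cong)
      thus ?thesis by (simp only: distrib_left mult_ac)
    qed
    also have "\<dots> \<le> (1 - \<rho>) * (of_int a * A + of_int b * B)"
      using \<open>\<rho> < 1\<close> ab' by (intro mult_left_mono add_mono) auto
    also have "\<dots> \<le> of_int a * A + of_int b * B - m * H / 2" using R(2) by (simp add: \<rho>_def)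
    finally show ?thesis using 1 L by linarith
  qed
  with \<eta> show thesis by (rule that)
qed

text \<open>The vectors of positive level: up to scale, b is the pairing with the isotropic vector
  whose coefficient is a.\<close>

definition Lvl :: "(int \<times> int \<times> (int ^ 8)) set" where
  "Lvl = {(a, b, u). b \<ge> 1 \<and> u \<in> Lam8}"

definition cl :: "int \<times> int \<times> (int ^ 8) \<Rightarrow> int" where "cl = (\<lambda>(a, b, u). cc (a * b - Qf u))"

lemma cl_nonneg: "cl x \<ge> 0" by (auto simp: cl_def cc_nonneg split: prod.splits)

text \<open>Adding the isotropic vector \<open>e1\<close> (so \<open>a\<close> becomes \<open>a + 1\<close>) moves every root of positive
  level into the closed positive cone.\<close>

lemma Lvl_shift:
  assumes "b \<ge> (1::int)" "Qf u \<le> a * b + 1"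
  shows "a + 1 \<ge> 0" "Qf u \<le> (a + 1) * b"
proof -
  show Q: "Qf u \<le> (a + 1) * b" using assms by (simp add: algebra_simps)
  hence "0 \<le> (a + 1) * b" using Qf_nonneg[of u] by linarith
  thus "a + 1 \<ge> 0" using assms(1) by (simp add: zero_le_mult_iff)
qed

lemma cl_nonzero_imp: "cl (a, b, u) \<noteq> 0 \<Longrightarrow> Qf u \<le> a * b + 1"
  by (rule ccontr) (simp add: cl_def cc_eq_0)

text \<open>The shift by the isotropic vector raises the pairing by A and makes it nonnegative.
  Roots may thus pair negatively, but not below -A.\<close>

lemma Lr_ge:
  assumes A: "A > 0" "B > 0" and S: "2 * A * B - norm h ^ 2 / 2 > 0"
    and x: "(a, b, u) \<in> Lvl" "Qf u \<le> a * b + 1"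
  shows "Lr A B h (a, b, u) \<ge> - A"
proof -
  obtain \<eta> where \<eta>: "\<eta> > 0"
    "\<And>a b u. u \<in> Lam8 \<Longrightarrow> a \<ge> 0 \<Longrightarrow> b \<ge> 0 \<Longrightarrow> Qf u \<le> a * b \<Longrightarrow>
        Lr A B h (a, b, u) \<ge> sqrt (2 * (2 * A * B - norm h ^ 2 / 2) * of_int (a * b - Qf u))
        \<and> Lr A B h (a, b, u) \<ge> \<eta> * (of_int a + of_int b + (\<Sum>j\<in>UNIV. \<bar>of_int (u $ j)\<bar>))"
    using Lr_cone[OF A S] by blast
  have b: "b \<ge> 1" "u \<in> Lam8" using x(1) by (auto simp: Lvl_def)
  note s = Lvl_shift[OF b(1) x(2)]
  have "Lr A B h (a + 1, b, u) \<ge> \<eta> * (of_int (a + 1) + of_int b + (\<Sum>j\<in>UNIV. \<bar>of_int (u $ j)\<bar>))"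
    using \<eta>(2)[OF b(2) s(1) _ s(2)] b by auto
  moreover have "\<eta> * (of_int (a + 1) + of_int b + (\<Sum>j\<in>UNIV. \<bar>real_of_int (u $ j)\<bar>)) \<ge> 0"
    using \<eta>(1) s(1) b by (intro mult_nonneg_nonneg add_nonneg_nonneg sum_nonneg) auto
  ultimately have "Lr A B h (a + 1, b, u) \<ge> 0" by linarith
  thus ?thesis by (simp add: Lr_def algebra_simps)
qed

lemma summable_lattice_exp:
  fixes \<eta> :: real
  assumes \<eta>: "\<eta> > 0"
  shows "(\<lambda>(a :: int, b :: int, u :: int ^ 8). exp (- \<eta> * (\<bar>of_int a\<bar> + \<bar>of_int b\<bar> + (\<Sum>j\<in>UNIV. \<bar>of_int (u $ j)\<bar>)))) summable_on UNIV"
proof -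
  let ?f = "\<lambda>n::int. exp (- \<eta> * \<bar>real_of_int n\<bar>)"
  have f: "?f summable_on UNIV" by (rule summable_on_exp_abs_int[OF \<eta>])
  have g: "(\<lambda>u :: int ^ 8. \<Prod>j\<in>UNIV. ?f (u $ j)) summable_on UNIV"
    by (rule summable_on_prod_vec[OF f]) simp
  have fg: "(\<lambda>(b, u :: int ^ 8). ?f b * (\<Prod>j\<in>UNIV. ?f (u $ j))) summable_on (UNIV \<times> UNIV)"
    by (rule summable_on_SigmaI[where g = "\<lambda>b. ?f b * infsum (\<lambda>u :: int ^ 8. \<Prod>j\<in>UNIV. ?f (u $ j)) UNIV"])
       (use f g in \<open>auto intro!: has_sum_cmult_right summable_on_cmult_left prod_nonneg mult_nonneg_nonneg\<close>)
  let ?g = "\<lambda>(b, u :: int ^ 8). ?f b * (\<Prod>j\<in>UNIV. ?f (u $ j))"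
  have fg': "?g summable_on UNIV" using fg by simp
  have h: "((\<lambda>y. (\<lambda>(a, (b, u :: int ^ 8)). ?f a * (?f b * (\<Prod>j\<in>UNIV. ?f (u $ j)))) (a, y)) has_sum (?f a * infsum ?g UNIV)) UNIV" for a
    using has_sum_cmult_right[OF has_sum_infsum[OF fg'], of "?f a"] by (simp only: case_prod_unfold fst_conv snd_conv)
  have "(\<lambda>(a, (b, u :: int ^ 8)). ?f a * (?f b * (\<Prod>j\<in>UNIV. ?f (u $ j)))) summable_on (UNIV \<times> UNIV)"
    by (rule summable_on_SigmaI[OF h summable_on_cmult_left[OF f]]) (auto intro!: prod_nonneg mult_nonneg_nonneg)
  also have "(\<lambda>(a, (b, u :: int ^ 8)). ?f a * (?f b * (\<Prod>j\<in>UNIV. ?f (u $ j))))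
     = (\<lambda>(a :: int, b :: int, u :: int ^ 8). exp (- \<eta> * (\<bar>of_int a\<bar> + \<bar>of_int b\<bar> + (\<Sum>j\<in>UNIV. \<bar>of_int (u $ j)\<bar>))))"
  proof (intro ext, clarify)
    fix a b :: int and u :: "int ^ 8"
    have "(\<Prod>j\<in>UNIV. ?f (u $ j)) = exp (\<Sum>j\<in>UNIV. - \<eta> * \<bar>of_int (u $ j)\<bar>)" by (simp add: exp_sum)
    also have "(\<Sum>j\<in>UNIV. - \<eta> * \<bar>of_int (u $ j)\<bar>) = - \<eta> * (\<Sum>j\<in>UNIV. \<bar>of_int (u $ j)\<bar>)" by (rule sum_distrib_left [symmetric])
    finally show "?f a * (?f b * (\<Prod>j\<in>UNIV. ?f (u $ j))) = exp (- \<eta> * (\<bar>of_int a\<bar> + \<bar>of_int b\<bar> + (\<Sum>j\<in>UNIV. \<bar>of_int (u $ j)\<bar>)))"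
      by (simp add: distrib_left flip: exp_add)
  qed
  finally show ?thesis by simp
qed

text \<open>Half of the exponent pays for the coefficients: 2 pi sqrt j <= (\<kappa>/2) L by the
  reversed Cauchy-Schwarz inequality, which is the condition with 4 pi. The other half gives
  exponential decay in all coordinates. If S is the square of the imaginary part, \<kappa> = 2 pi
  requires S >= 2 and \<kappa> = pi requires S >= 8.\<close>

theorem summable_cl_exp:
  assumes A: "A > 0" "B > 0" and S: "2 * A * B - norm h ^ 2 / 2 > 0"
    and \<kappa>: "\<kappa> > 0" "\<kappa> * sqrt (2 * (2 * A * B - norm h ^ 2 / 2)) \<ge> 4 * pi"
  shows "(\<lambda>x. of_int (cl x) * exp (- \<kappa> * Lr A B h x)) summable_on Lvl"
proof -
  define S where "S = 2 * A * B - norm h ^ 2 / 2"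
  obtain \<eta> where \<eta>: "\<eta> > 0"
    "\<And>a b u. u \<in> Lam8 \<Longrightarrow> a \<ge> 0 \<Longrightarrow> b \<ge> 0 \<Longrightarrow> Qf u \<le> a * b \<Longrightarrow>
        Lr A B h (a, b, u) \<ge> sqrt (2 * S * of_int (a * b - Qf u))
        \<and> Lr A B h (a, b, u) \<ge> \<eta> * (of_int a + of_int b + (\<Sum>j\<in>UNIV. \<bar>of_int (u $ j)\<bar>))"
    using Lr_cone[OF A assms(3)] unfolding S_def by blast
  obtain C where C: "C > 0" "\<And>j x. real_of_int j \<le> x \<Longrightarrow> x \<ge> 0 \<Longrightarrow> real_of_int (cc j) \<le> C * exp (2 * pi * sqrt x)"
    using cc_growth by blast
  define \<delta> where "\<delta> = \<kappa> * \<eta> / 2"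
  have \<delta>: "\<delta> > 0" using \<kappa> \<eta> by (simp add: \<delta>_def)
  \<comment> \<open>\<open>exp (\<kappa> * A)\<close> pays for the shift by the isotropic vector,
    \<open>exp \<delta>\<close> for |a| <= a + 2, valid since a >= -1.\<close>
  define M where "M = C * exp (\<kappa> * A) * exp \<delta>"
  have M: "M \<ge> 0" using C by (simp add: M_def)
  let ?n = "\<lambda>(a :: int, b :: int, u :: int ^ 8). exp (- \<delta> * (\<bar>of_int a\<bar> + \<bar>of_int b\<bar> + (\<Sum>j\<in>UNIV. \<bar>of_int (u $ j)\<bar>)))"
  have "?n summable_on Lvl" by (rule summable_on_subset[OF summable_lattice_exp[OF \<delta>]]) auto
  hence s: "(\<lambda>x. M * ?n x) summable_on Lvl" by (rule summable_on_cmult_right)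
  have "norm (of_int (cl x) * exp (- \<kappa> * Lr A B h x)) \<le> M * ?n x" if x: "x \<in> Lvl" for x
  proof (cases "cl x = 0")
    case True
    thus ?thesis using M by (auto split: prod.splits)
  next
    case False
    obtain a b u where xe: "x = (a, b, u)" by (cases x)
    have b: "b \<ge> 1" "u \<in> Lam8" using x xe by (auto simp: Lvl_def)
    note sh = Lvl_shift[OF b(1) cl_nonzero_imp[OF False[unfolded xe]]]
    define j where "j = (a + 1) * b - Qf u"
    have j: "j \<ge> 0" using sh by (simp add: j_def)
    define L where "L = Lr A B h (a + 1, b, u)"
    have L1: "L \<ge> sqrt (2 * S * of_int j)"
      and L2: "L \<ge> \<eta> * (of_int (a + 1) + of_int b + (\<Sum>j\<in>UNIV. \<bar>of_int (u $ j)\<bar>))"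
      using \<eta>(2)[OF b(2) sh(1) _ sh(2)] b unfolding L_def j_def by auto
    have Lx: "Lr A B h x = L - A" by (simp add: L_def xe Lr_def algebra_simps)
    have c: "real_of_int (cl x) \<le> C * exp (2 * pi * sqrt (of_int j))"
    proof -
      have "a * b - Qf u \<le> j" using b by (simp add: j_def algebra_simps)
      hence "real_of_int (a * b - Qf u) \<le> of_int j" by (simp only: of_int_le_iff)
      thus ?thesis using C(2)[of "a * b - Qf u" "of_int j"] j by (simp add: cl_def xe)
    qed
    have "2 * pi * sqrt (of_int j) \<le> (\<kappa> / 2) * L"
    proof -
      have "4 * pi * sqrt (of_int j) \<le> \<kappa> * sqrt (2 * S) * sqrt (of_int j)"
        using \<kappa>(2) j unfolding S_def by (intro mult_right_mono) auto
      also have "\<dots> = \<kappa> * sqrt (2 * S * of_int j)" by (simp add: real_sqrt_mult)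
      also have "\<dots> \<le> \<kappa> * L" using L1 \<kappa>(1) by (intro mult_left_mono) auto
      finally show ?thesis by simp
    qed
    hence "2 * pi * sqrt (of_int j) - \<kappa> * Lr A B h x \<le> \<kappa> * A - (\<kappa> / 2) * L"
      unfolding Lx by (simp add: algebra_simps)
    also have "\<dots> \<le> \<kappa> * A + \<delta> - \<delta> * (\<bar>of_int a\<bar> + \<bar>of_int b\<bar> + (\<Sum>j\<in>UNIV. \<bar>of_int (u $ j)\<bar>))"
    proof -
      let ?s = "(\<Sum>j\<in>UNIV. \<bar>real_of_int (u $ j)\<bar>)"
      have "(\<kappa> / 2) * (\<eta> * (of_int (a + 1) + of_int b + ?s)) \<le> (\<kappa> / 2) * L"
        using L2 \<kappa>(1) by (intro mult_left_mono) auto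
      moreover have "(\<kappa> / 2) * (\<eta> * (of_int (a + 1) + of_int b + ?s)) = \<delta> * (of_int (a + 1) + of_int b + ?s)"
        by (simp add: \<delta>_def)
      moreover have "\<delta> * (\<bar>of_int a\<bar> + \<bar>of_int b\<bar> + ?s - 1) \<le> \<delta> * (of_int (a + 1) + of_int b + ?s)"
        using \<delta> sh(1) b by (intro mult_left_mono) auto
      ultimately show ?thesis by (simp add: algebra_simps)
    qed
    finally have e: "exp (2 * pi * sqrt (of_int j) - \<kappa> * Lr A B h x) \<le> exp (\<kappa> * A + \<delta> + - \<delta> * (\<bar>of_int a\<bar> + \<bar>of_int b\<bar> + (\<Sum>j\<in>UNIV. \<bar>of_int (u $ j)\<bar>)))"
      by simp
    have "norm (of_int (cl x) * exp (- \<kappa> * Lr A B h x)) = of_int (cl x) * exp (- \<kappa> * Lr A B h x)"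
      using cl_nonneg[of x] by (simp add: abs_mult)
    also have "\<dots> \<le> C * exp (2 * pi * sqrt (of_int j)) * exp (- \<kappa> * Lr A B h x)" using c by (rule mult_right_mono) simp
    also have "\<dots> = C * exp (2 * pi * sqrt (of_int j) - \<kappa> * Lr A B h x)" by (simp add: exp_diff exp_minus field_simps)
    also have "\<dots> \<le> C * exp (\<kappa> * A + \<delta> + - \<delta> * (\<bar>of_int a\<bar> + \<bar>of_int b\<bar> + (\<Sum>j\<in>UNIV. \<bar>of_int (u $ j)\<bar>)))"
      using e C by (intro mult_left_mono) auto
    also have "\<dots> = M * ?n x" unfolding M_def xe exp_add by (simp only: prod.case mult.assoc)
    finally show ?thesis .
  qed
  from Infinite_Sum.abs_summable_on_comparison_test'[OF s this]
  show ?thesis by (rule abs_summable_summable)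
qed

section \<open>Logarithms of the two products\<close>

lemma has_uprod_exp_sum:
  assumes "(g has_sum s) S" "\<And>i. i \<in> S \<Longrightarrow> f i = exp (g i)"
  shows "has_uprod f S (exp s)"
proof -
  have "((\<lambda>F. exp (sum g F)) \<longlongrightarrow> exp s) (finite_subsets_at_top S)"
    using assms(1) unfolding has_sum_def by (rule tendsto_exp)
  moreover have "\<forall>\<^sub>F F in finite_subsets_at_top S. exp (sum g F) = prod f F"
  proof (rule eventually_finite_subsets_at_top_weakI)
    fix F assume "finite F" "F \<subseteq> S"
    thus "exp (sum g F) = prod f F" unfolding exp_sum_complex by (intro prod.cong) (auto simp: assms(2))
  qed
  ultimately show ?thesis unfolding has_uprod_def by (rule Lim_transform_eventually)
qed

lemma has_uprod_unique: "has_uprod f S P \<Longrightarrow> has_uprod f S Q \<Longrightarrow> P = Q"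
  unfolding has_uprod_def using tendsto_unique finite_subsets_at_top_neq_bot by blast

lemma has_uprod_finite: "finite S \<Longrightarrow> has_uprod f S (prod f S)"
  unfolding has_uprod_def by (intro tendsto_eventually) (auto simp: eventually_finite_subsets_at_top)

lemma has_uprod_Un:
  assumes "has_uprod f A P" "has_uprod f B Q" "A \<inter> B = {}"
  shows "has_uprod f (A \<union> B) (P * Q)"
proof -
  have fl: "filterlim (\<lambda>F. F \<inter> C) (finite_subsets_at_top C) (finite_subsets_at_top (A \<union> B))" if "C \<subseteq> A \<union> B" for C
    unfolding filterlim_finite_subsets_at_top eventually_finite_subsets_at_top using that by blast
  have "((\<lambda>F. prod f (F \<inter> A) * prod f (F \<inter> B)) \<longlongrightarrow> P * Q) (finite_subsets_at_top (A \<union> B))"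
    using assms(1,2) unfolding has_uprod_def
    by (intro tendsto_mult filterlim_compose[OF _ fl]) auto
  moreover have "\<forall>\<^sub>F F in finite_subsets_at_top (A \<union> B). prod f (F \<inter> A) * prod f (F \<inter> B) = prod f F"
  proof (rule eventually_finite_subsets_at_top_weakI)
    fix F assume F: "finite F" "F \<subseteq> A \<union> B"
    have "F = (F \<inter> A) \<union> (F \<inter> B)" using F by blast
    moreover have "(F \<inter> A) \<inter> (F \<inter> B) = {}" using assms(3) by blast
    ultimately show "prod f (F \<inter> A) * prod f (F \<inter> B) = prod f F"
      using prod.union_disjoint[of "F \<inter> A" "F \<inter> B" f] F(1) by simp
  qed
  ultimately show ?thesis unfolding has_uprod_def by (rule Lim_transform_eventually)
qed

lemma has_sum_Ln_one_minus:
  assumes "norm z < 1"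
  shows "((\<lambda>k. - (z ^ k / of_nat k)) has_sum Ln (1 - z)) {1..}"
proof -
  have e: "(- 1) ^ Suc n / of_nat n * (- z) ^ n = - (z ^ n / of_nat n)" for n
    by (cases "even n") auto
  have "(\<lambda>n. - (z ^ n / of_nat n)) sums Ln (1 - z)"
    using Ln_series[of "- z"] assms unfolding e by simp
  moreover have "summable (\<lambda>n. norm (- (z ^ n / of_nat n)))"
  proof (rule summable_comparison_test'[where g = "\<lambda>n. norm z ^ n" and N = 0])
    fix n :: nat
    have "norm z ^ n / real n \<le> norm z ^ n"
    proof (cases n)
      case (Suc m)
      have "norm z ^ n * 1 \<le> norm z ^ n * real n" using Suc by (intro mult_left_mono) auto
      thus ?thesis using Suc by (simp add: divide_le_eq)
    qed simp
    thus "norm (norm (- (z ^ n / of_nat n))) \<le> norm z ^ n" by (simp add: norm_divide norm_power)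
  qed (use assms in \<open>auto intro: summable_geometric\<close>)
  ultimately have "((\<lambda>n. - (z ^ n / of_nat n)) has_sum Ln (1 - z)) UNIV" by (intro norm_summable_imp_has_sum)
  \<comment> \<open>The term k = 0 is a division by zero and counts as 0.\<close>
  thus ?thesis by (rule has_sum_cong_neutral[THEN iffD1, rotated -1]) auto
qed

text \<open>The bound 1/2 turns the logarithm series into a geometric one, |u^k / k| <= |u| /
  2^(k-1), so summability of the first powers suffices.\<close>

lemma summable_log_terms:
  fixes cf u :: "'a \<Rightarrow> complex"
  assumes s: "(\<lambda>x. norm (cf x) * norm (u x)) summable_on I"
    and half: "\<And>x. x \<in> I \<Longrightarrow> cf x \<noteq> 0 \<Longrightarrow> norm (u x) \<le> 1/2"
    and K: "K \<subseteq> {1..}"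
  shows "(\<lambda>(x, k). cf x * (u x ^ k / of_nat k)) summable_on (I \<times> K)"
proof -
  have "(\<lambda>n. (1/2 :: real) ^ n) summable_on UNIV"
    by (intro norm_summable_imp_summable_on) (simp add: summable_geometric)
  hence g: "(\<lambda>k. (1/2 :: real) ^ (k - 1)) summable_on {1..}"
    by (subst summable_on_reindex_bij_witness[of _ Suc "\<lambda>k. k - 1"]) auto
  hence g': "(\<lambda>k. (1/2 :: real) ^ (k - 1)) summable_on K" using K by (rule summable_on_subset)
  have G: "(\<lambda>(x, k). (norm (cf x) * norm (u x)) * (1/2) ^ (k - 1)) summable_on (I \<times> K)"
    by (rule summable_on_SigmaI[where g = "\<lambda>x. (norm (cf x) * norm (u x)) * infsum (\<lambda>k. (1/2) ^ (k - 1)) K"])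
       (use s g' in \<open>auto intro!: has_sum_cmult_right summable_on_cmult_left\<close>)
  have "norm ((\<lambda>(x, k). cf x * (u x ^ k / of_nat k)) y) \<le> (\<lambda>(x, k). (norm (cf x) * norm (u x)) * (1/2) ^ (k - 1)) y"
    if y: "y \<in> I \<times> K" for y
  proof -
    obtain x k where xk: "y = (x, k)" "x \<in> I" "k \<in> K" using y by auto
    have k: "k \<ge> 1" using xk K by auto
    show ?thesis
    proof (cases "cf x = 0")
      case False
      have "norm (u x) ^ (k - 1) \<le> (1/2) ^ (k - 1)" using half[OF xk(2) False] by (intro power_mono) auto
      hence "norm (u x) * norm (u x) ^ (k - 1) \<le> norm (u x) * (1/2) ^ (k - 1)" by (intro mult_left_mono) auto
      moreover have "norm (u x) * norm (u x) ^ (k - 1) = norm (u x) ^ k" using k by (simp flip: power_Suc)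
      moreover have "norm (u x) ^ k / real k \<le> norm (u x) ^ k"
      proof -
        have "norm (u x) ^ k * 1 \<le> norm (u x) ^ k * real k" using k by (intro mult_left_mono) auto
        thus ?thesis using k by (simp add: divide_le_eq)
      qed
      ultimately have "norm (u x) ^ k / real k \<le> norm (u x) * (1/2) ^ (k - 1)" by linarith
      hence "norm (cf x) * (norm (u x) ^ k / real k) \<le> norm (cf x) * (norm (u x) * (1/2) ^ (k - 1))"
        by (intro mult_left_mono) auto
      thus ?thesis by (simp add: xk(1) norm_mult norm_divide norm_power mult.assoc)
    qed (simp add: xk(1))
  qed
  from Infinite_Sum.abs_summable_on_comparison_test'[OF G this] show ?thesis by (rule abs_summable_summable)
qed

text \<open>Each N has finitely many factorizations, so the double series may be collected by n k,
  the level of the k-th multiple of a vector of level n.\<close>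

lemma has_sum_group_by_product:
  fixes f :: "nat \<times> nat \<Rightarrow> complex"
  assumes f: "(f has_sum S) ({1..} \<times> K)" and K: "K \<subseteq> {1..}"
  shows "((\<lambda>N. \<Sum>x\<in>{x \<in> dpairs N. snd x \<in> K}. f x) has_sum S) {1..}"
proof -
  have "((\<lambda>(N, x). f x) has_sum S) (SIGMA N:{1..}. {x \<in> dpairs N. snd x \<in> K}) \<longleftrightarrow> (f has_sum S) ({1..} \<times> K)"
    by (rule has_sum_reindex_bij_witness[of _ "\<lambda>x. (fst x * snd x, x)" snd])
       (use K in \<open>auto simp: dpairs_def Suc_le_eq\<close>)
  hence "((\<lambda>(N, x). f x) has_sum S) (SIGMA N:{1..}. {x \<in> dpairs N. snd x \<in> K})" using f by simp
  thus ?thesis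
  proof (rule has_sum_SigmaD)
    fix N :: nat assume "N \<in> {1..}"
    hence "finite {x \<in> dpairs N. snd x \<in> K}" using finite_dpairs[of N] by simp
    thus "((\<lambda>x. (\<lambda>(N, x). f x) (N, x)) has_sum (\<Sum>x\<in>{x \<in> dpairs N. snd x \<in> K}. f x)) {x \<in> dpairs N. snd x \<in> K}"
      by simp
  qed
qed

section \<open>The logarithm of the second product\<close>

lemma udot_scale: "udot u (c *s v) = c * udot u v"
  by (simp add: udot_def sum_distrib_left mult_ac)

text \<open>exp (2 pi i <l, w>) in lattice coordinates, with \<tau> = \<open>w$3\<close>, \<sigma> =
  \<open>w$2\<close> and \<omega> the E8 part of w.\<close>

definition u2 :: "complex \<Rightarrow> complex \<Rightarrow> complex ^ 8 \<Rightarrow> int \<times> int \<times> (int ^ 8) \<Rightarrow> complex" where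
  "u2 \<tau> \<sigma> \<omega> = (\<lambda>(a, b, y). exp (2 * pi * \<i> * (of_int a * \<tau> + of_int b * \<sigma> - udot y \<omega> / 2)))"

text \<open>The sign of the exponent in the theorem, since <l, e1 - f1> = b - a.\<close>

definition sg :: "int \<times> int \<times> (int ^ 8) \<Rightarrow> int" where
  "sg = (\<lambda>(a, b, y). if even (b - a) then 1 else - 1)"

lemma has_sum_regroup:
  fixes F :: "(int \<times> int \<times> (int ^ 8)) \<times> nat \<Rightarrow> complex"
  assumes F: "(F has_sum S) (Lvl \<times> K)" and K: "K \<subseteq> {1..}"
    and inner: "\<And>b k. b \<ge> 1 \<Longrightarrow> k \<in> K \<Longrightarrow> ((\<lambda>(a, y). F ((a, int b, y), k)) has_sum h (b, k)) (UNIV \<times> Lam8)"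
  shows "((\<lambda>N. \<Sum>x\<in>{x \<in> dpairs N. snd x \<in> K}. h x) has_sum S) {1..}"
proof -
  let ?G = "\<lambda>((b, k), (a, y)). F ((a, int b, y), k)"
  have "(?G has_sum S) (({1..} \<times> K) \<times> (UNIV \<times> Lam8)) \<longleftrightarrow> (F has_sum S) (Lvl \<times> K)"
    by (rule has_sum_reindex_bij_witness[of _ "\<lambda>((a, b, y), k). ((nat b, k), (a, y))" "\<lambda>((b, k), (a, y)). ((a, int b, y), k)"])
       (auto simp: Lvl_def)
  hence G: "(?G has_sum S) (({1..} \<times> K) \<times> (UNIV \<times> Lam8))" using F by simp
  have "(h has_sum S) ({1..} \<times> K)"
  proof (rule has_sum_SigmaD[OF G])
    fix x :: "nat \<times> nat" assume "x \<in> {1..} \<times> K"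
    then obtain b k where x: "x = (b, k)" "b \<ge> 1" "k \<in> K" by auto
    show "((\<lambda>z. ?G (x, z)) has_sum h x) (UNIV \<times> Lam8)"
      using inner[OF x(2,3)] by (simp add: x(1) case_prod_unfold)
  qed
  thus ?thesis using K by (rule has_sum_group_by_product)
qed

text \<open>The part (-1)^a of the sign is absorbed by adding 1/2 to the argument k \<tau>; only
  (-1)^b stays outside. As the sign multiplies the logarithm and not u, the shift is 1/2 for every
  k. The denominators k of the logarithm and b of the lattice sum combine to N.\<close>

theorem log_second_product:
  assumes \<tau>: "Im \<tau> > 0"
    and s: "(\<lambda>x. of_int (cl x) * norm (u2 \<tau> \<sigma> \<omega> x)) summable_on Lvl"
    and half: "\<And>x. x \<in> Lvl \<Longrightarrow> cl x \<noteq> 0 \<Longrightarrow> norm (u2 \<tau> \<sigma> \<omega> x) \<le> 1/2"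
  shows "\<exists>S. ((\<lambda>x. of_int (sg x * cl x) * Ln (1 - u2 \<tau> \<sigma> \<omega> x)) has_sum S) Lvl \<and>
     ((\<lambda>N. exp (2 * pi * \<i> * of_nat N * \<sigma>) / of_nat N * (\<Sum>(b, k)\<in>dpairs N. 
        (- 1) ^ b * (\<Sum>r<b. g3E (2 * (of_nat k * \<tau> + 1/2 + of_nat r) / of_nat b) ((- of_nat k) *s \<omega>)))) has_sum S) {1..}"
proof -
  let ?u = "u2 \<tau> \<sigma> \<omega>"
  define cf where "cf x = - complex_of_int (sg x * cl x)" for x
  define F where "F = (\<lambda>(x, k). cf x * (?u x ^ k / of_nat k))"
  have nsg: "norm (cf x) = of_int (cl x)" for x
    using cl_nonneg[of x] by (auto simp: cf_def sg_def norm_mult split: prod.splits)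
  have half': "norm (?u x) \<le> 1/2" if "x \<in> Lvl" "cf x \<noteq> 0" for x
  proof (rule half[OF that(1)])
    show "cl x \<noteq> 0" using that(2) by (auto simp: cf_def)
  qed
  have Fs: "F summable_on (Lvl \<times> {1..})"
    unfolding F_def by (rule summable_log_terms) (use s half' in \<open>simp_all add: nsg\<close>)
  define S where "S = infsum F (Lvl \<times> {1..})"
  have FS: "(F has_sum S) (Lvl \<times> {1..})" unfolding S_def using Fs by (rule has_sum_infsum)
  have logs: "((\<lambda>x. of_int (sg x * cl x) * Ln (1 - ?u x)) has_sum S) Lvl"
  proof (rule has_sum_SigmaD[OF FS])
    fix x assume x: "x \<in> Lvl"
    show "((\<lambda>k. F (x, k)) has_sum of_int (sg x * cl x) * Ln (1 - ?u x)) {1..}"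
    proof (cases "cf x = 0")
      case True
      hence "complex_of_int (sg x * cl x) = 0" by (simp only: cf_def neg_equal_0_iff_equal)
      thus ?thesis unfolding F_def prod.case True by (simp only:) simp
    next
      case False
      have "((\<lambda>k. of_int (sg x * cl x) * - (?u x ^ k / of_nat k)) has_sum of_int (sg x * cl x) * Ln (1 - ?u x)) {1..}"
        using half'[OF x False] by (intro has_sum_cmult_right has_sum_Ln_one_minus) simp
      thus ?thesis by (simp add: F_def cf_def)
    qed
  qed
  define h where "h = (\<lambda>(b, k). (- ((- 1) ^ b / of_nat k) * exp (2 * pi * \<i> * of_nat (b * k) * \<sigma>)) *
        - ((\<Sum>r<b. g3E (2 * (of_nat k * \<tau> + 1/2 + of_nat r) / of_nat b) ((- of_nat k) *s \<omega>)) / of_nat b))"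
  have "((\<lambda>N. \<Sum>x\<in>{x \<in> dpairs N. snd x \<in> {1..}}. h x) has_sum S) {1..}"
  proof (rule has_sum_regroup[OF FS])
    fix b k :: nat assume bk: "b \<ge> 1" "k \<in> {1..}"
    have \<alpha>: "Im (of_nat k * \<tau> + 1/2) > 0" using \<tau> bk by simp
    have d: "b > 0" using bk by simp
    have "F ((a, int b, y), k) = (- ((- 1) ^ b / of_nat k) * exp (2 * pi * \<i> * of_nat (b * k) * \<sigma>)) *
       (of_int (cc (a * int b - Qf y)) * exp (2 * pi * \<i> * of_int a * (of_nat k * \<tau> + 1/2) + pi * \<i> * udot y ((- of_nat k) *s \<omega>)))" for a y
    proof -
      have "?u (a, int b, y) ^ k = exp (of_nat k * (2 * pi * \<i> * (of_int a * \<tau> + of_int (int b) * \<sigma> - udot y \<omega> / 2)))"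
        by (simp only: u2_def prod.case exp_of_nat_mult)
      also have "of_nat k * (2 * pi * \<i> * (of_int a * \<tau> + of_int (int b) * \<sigma> - udot y \<omega> / 2))
         = 2 * pi * \<i> * of_nat (b * k) * \<sigma> + (2 * pi * \<i> * of_int a * (of_nat k * \<tau> + 1/2) + pi * \<i> * udot y ((- of_nat k) *s \<omega>)) + - (pi * \<i> * of_int a)"
        unfolding udot_scale by (simp add: field_simps)
      finally have u: "?u (a, int b, y) ^ k = exp (2 * pi * \<i> * of_nat (b * k) * \<sigma>) *
          exp (2 * pi * \<i> * of_int a * (of_nat k * \<tau> + 1/2) + pi * \<i> * udot y ((- of_nat k) *s \<omega>)) * exp (- (pi * \<i> * of_int a))"
        by (simp only: exp_add)
      have "exp (- (pi * \<i> * of_int a)) = inverse ((- 1) powi a)" by (simp only: exp_minus exp_pi_ii_of_int)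
      also have "\<dots> = (if even a then 1 else - 1)" by (auto simp: power_int_minus_one_minus)
      finally have "of_int (sg (a, int b, y)) * exp (- (pi * \<i> * of_int a)) = (- 1) ^ b"
        by (auto simp: sg_def)
      hence c: "cf (a, int b, y) * exp (- (pi * \<i> * of_int a)) = - ((- 1) ^ b) * of_int (cc (a * int b - Qf y))"
        by (simp add: cf_def cl_def mult_ac)
      have "F ((a, int b, y), k) = (cf (a, int b, y) * exp (- (pi * \<i> * of_int a))) * (exp (2 * pi * \<i> * of_nat (b * k) * \<sigma>) *
          exp (2 * pi * \<i> * of_int a * (of_nat k * \<tau> + 1/2) + pi * \<i> * udot y ((- of_nat k) *s \<omega>)) / of_nat k)"
        unfolding F_def prod.case u by (simp only: mult_ac times_divide_eq_right times_divide_eq_left)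
      thus ?thesis unfolding c by (simp only: mult_ac times_divide_eq_right times_divide_eq_left mult_minus_left mult_minus_right divide_minus_left)
    qed
    hence e: "(\<lambda>(a, y). F ((a, int b, y), k)) = (\<lambda>z. (- ((- 1) ^ b / of_nat k) * exp (2 * pi * \<i> * of_nat (b * k) * \<sigma>)) * 
      (\<lambda>(a, y). of_int (cc (a * int b - Qf y)) * exp (2 * pi * \<i> * of_int a * (of_nat k * \<tau> + 1/2) + pi * \<i> * udot y ((- of_nat k) *s \<omega>))) z)"
      by (auto simp: fun_eq_iff)
    show "((\<lambda>(a, y). F ((a, int b, y), k)) has_sum h (b, k)) (UNIV \<times> Lam8)"
      unfolding e h_def prod.case by (rule has_sum_cmult_right[OF cc_lattice_sum(2)[OF d \<alpha>]])
  qed auto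
  also have "?this \<longleftrightarrow> ((\<lambda>N. exp (2 * pi * \<i> * of_nat N * \<sigma>) / of_nat N * (\<Sum>(b, k)\<in>dpairs N. 
        (- 1) ^ b * (\<Sum>r<b. g3E (2 * (of_nat k * \<tau> + 1/2 + of_nat r) / of_nat b) ((- of_nat k) *s \<omega>)))) has_sum S) {1..}"
  proof (rule has_sum_cong)
    fix N :: nat assume N: "N \<in> {1..}"
    have set: "{x \<in> dpairs N. snd x \<in> {1..}} = dpairs N" by (auto simp: dpairs_def)
    show "(\<Sum>x\<in>{x \<in> dpairs N. snd x \<in> {1..}}. h x) = exp (2 * pi * \<i> * of_nat N * \<sigma>) / of_nat N * (\<Sum>(b, k)\<in>dpairs N. 
        (- 1) ^ b * (\<Sum>r<b. g3E (2 * (of_nat k * \<tau> + 1/2 + of_nat r) / of_nat b) ((- of_nat k) *s \<omega>)))"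
      unfolding set
    proof (subst sum_distrib_left, intro sum.cong refl)
      fix x assume "x \<in> dpairs N"
      then obtain b k where x: "x = (b, k)" "b > 0" "k > 0" "N = b * k" by (auto simp: dpairs_def)
      show "h x = exp (2 * pi * \<i> * of_nat N * \<sigma>) / of_nat N * (case x of (b, k) \<Rightarrow> 
        (- 1) ^ b * (\<Sum>r<b. g3E (2 * (of_nat k * \<tau> + 1/2 + of_nat r) / of_nat b) ((- of_nat k) *s \<omega>)))"
        unfolding x(1) x(4) h_def prod.case by (simp add: mult_ac)
    qed
  qed
  finally show ?thesis using logs by blast
qed

section \<open>The logarithm of the first product and the comparison\<close>

text \<open>exp (pi i <l, z>) in lattice coordinates, with \<tau> = \<open>2 * z$1\<close>, \<sigma>
  = \<open>2 * z$0\<close> and \<xi> the E8 part of z.\<close>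

definition u1 :: "complex \<Rightarrow> complex \<Rightarrow> complex ^ 8 \<Rightarrow> int \<times> int \<times> (int ^ 8) \<Rightarrow> complex" where
  "u1 \<tau> \<sigma> \<xi> = (\<lambda>(a, n, y). exp (pi * \<i> * (of_int a * \<tau> + of_int n * \<sigma> - udot y \<xi> / 2)))"

text \<open>The hyperbolic plane of \<open>M1\<close> is scaled by 2, so half the square of a vector
  is 2 a n - Qf y; hence the doubled level.\<close>

definition cl1 :: "int \<times> int \<times> (int ^ 8) \<Rightarrow> int" where
  "cl1 = (\<lambda>(a, n, y). cl (a, 2 * n, y))"

text \<open>Even powers cancel in the difference of logarithms; the surviving odd k are those of
  \<open>H1\<close>.\<close>

lemma has_sum_Ln_quotient:
  assumes z: "norm z < 1"
  shows "((\<lambda>k. - 2 * (z ^ k / of_nat k)) has_sum (Ln (1 - z) - Ln (1 + z))) {k. odd k}"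
proof -
  have "((\<lambda>k. - (z ^ k / of_nat k) + - 1 * (- ((- z) ^ k / of_nat k))) has_sum (Ln (1 - z) + - 1 * Ln (1 - (- z)))) {1..}"
    by (intro has_sum_add has_sum_cmult_right has_sum_Ln_one_minus) (use z in auto)
  hence "((\<lambda>k. - (z ^ k / of_nat k) + (- z) ^ k / of_nat k) has_sum (Ln (1 - z) - Ln (1 + z))) {1..}" by simp
  thus ?thesis
    by (rule has_sum_cong_neutral[THEN iffD1, rotated -1]) (auto simp: odd_pos Suc_le_eq)
qed

text \<open>Level n enters the lattice sum with modulus 2n, and the 2 of the odd logarithm series
  cancels the one in 1 / (2n), which leaves 1 / N.\<close>

theorem log_first_product:
  assumes \<tau>: "Im \<tau> > 0"
    and s: "(\<lambda>x. of_int (cl1 x) * norm (u1 \<tau> \<sigma> \<xi> x)) summable_on Lvl"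
    and half: "\<And>x. x \<in> Lvl \<Longrightarrow> cl1 x \<noteq> 0 \<Longrightarrow> norm (u1 \<tau> \<sigma> \<xi> x) \<le> 1/2"
  shows "\<exists>S. ((\<lambda>x. of_int (cl1 x) * (Ln (1 - u1 \<tau> \<sigma> \<xi> x) - Ln (1 + u1 \<tau> \<sigma> \<xi> x))) has_sum S) Lvl \<and>
     ((\<lambda>N. exp (pi * \<i> * of_nat N * \<sigma>) / of_nat N * (\<Sum>(n, k)\<in>{x \<in> dpairs N. odd (snd x)}. 
        (\<Sum>r<2 * n. g3E ((of_nat k * (\<tau> / 2) + of_nat r) / of_nat n) (of_nat k *s ((- 1/2) *s \<xi>))))) has_sum S) {1..}"
proof -
  let ?u = "u1 \<tau> \<sigma> \<xi>"
  have K: "{k :: nat. odd k} \<subseteq> {1..}" by (auto simp: odd_pos Suc_le_eq)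
  define cf where "cf x = - 2 * complex_of_int (cl1 x)" for x
  define F where "F = (\<lambda>(x, k). cf x * (?u x ^ k / of_nat k))"
  have c0: "cl1 x \<ge> 0" for x by (auto simp: cl1_def cl_nonneg split: prod.splits)
  have ncf: "norm (cf x) * norm (?u x) = 2 * (of_int (cl1 x) * norm (?u x))" for x
    using c0[of x] by (simp add: cf_def norm_mult)
  have half': "norm (?u x) \<le> 1/2" if "x \<in> Lvl" "cf x \<noteq> 0" for x
    using half[OF that(1)] that(2) by (auto simp: cf_def)
  have Fs: "F summable_on (Lvl \<times> {k. odd k})"
    unfolding F_def
  proof (rule summable_log_terms[OF _ _ K])
    show "(\<lambda>x. norm (cf x) * norm (?u x)) summable_on Lvl" unfolding ncf by (rule summable_on_cmult_right[OF s])
  qed (rule half')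
  define S where "S = infsum F (Lvl \<times> {k. odd k})"
  have FS: "(F has_sum S) (Lvl \<times> {k. odd k})" unfolding S_def using Fs by (rule has_sum_infsum)
  have logs: "((\<lambda>x. of_int (cl1 x) * (Ln (1 - ?u x) - Ln (1 + ?u x))) has_sum S) Lvl"
  proof (rule has_sum_SigmaD[OF FS])
    fix x assume x: "x \<in> Lvl"
    show "((\<lambda>k. F (x, k)) has_sum of_int (cl1 x) * (Ln (1 - ?u x) - Ln (1 + ?u x))) {k. odd k}"
    proof (cases "cf x = 0")
      case True
      thus ?thesis by (simp add: F_def cf_def)
    next
      case False
      have "((\<lambda>k. of_int (cl1 x) * (- 2 * (?u x ^ k / of_nat k))) has_sum of_int (cl1 x) * (Ln (1 - ?u x) - Ln (1 + ?u x))) {k. odd k}"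
        using half'[OF x False] by (intro has_sum_cmult_right has_sum_Ln_quotient) simp
      thus ?thesis by (simp add: F_def cf_def mult_ac)
    qed
  qed
  define h where "h = (\<lambda>(n, k). ((- 2 / of_nat k) * exp (pi * \<i> * of_nat (n * k) * \<sigma>)) *
        - ((\<Sum>r<2 * n. g3E (2 * (of_nat k * (\<tau> / 2) + of_nat r) / of_nat (2 * n)) (of_nat k *s ((- 1/2) *s \<xi>))) / of_nat (2 * n)))"
  have "((\<lambda>N. \<Sum>x\<in>{x \<in> dpairs N. snd x \<in> {k. odd k}}. h x) has_sum S) {1..}"
  proof (rule has_sum_regroup[OF FS K])
    fix n k :: nat assume nk: "n \<ge> 1" "k \<in> {k. odd k}"
    have \<alpha>: "Im (of_nat k * (\<tau> / 2)) > 0" using \<tau> nk by (simp add: odd_pos)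
    have d: "2 * n > 0" using nk by simp
    have "F ((a, int n, y), k) = ((- 2 / of_nat k) * exp (pi * \<i> * of_nat (n * k) * \<sigma>)) *
       (of_int (cc (a * int (2 * n) - Qf y)) * exp (2 * pi * \<i> * of_int a * (of_nat k * (\<tau> / 2)) + pi * \<i> * udot y (of_nat k *s ((- 1/2) *s \<xi>))))" for a y
    proof -
      have "?u (a, int n, y) ^ k = exp (of_nat k * (pi * \<i> * (of_int a * \<tau> + of_int (int n) * \<sigma> - udot y \<xi> / 2)))"
        by (simp only: u1_def prod.case exp_of_nat_mult)
      also have "of_nat k * (pi * \<i> * (of_int a * \<tau> + of_int (int n) * \<sigma> - udot y \<xi> / 2))
         = pi * \<i> * of_nat (n * k) * \<sigma> + (2 * pi * \<i> * of_int a * (of_nat k * (\<tau> / 2)) + pi * \<i> * udot y (of_nat k *s ((- 1/2) *s \<xi>)))"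
        unfolding udot_scale by (simp add: field_simps)
      finally have u: "?u (a, int n, y) ^ k = exp (pi * \<i> * of_nat (n * k) * \<sigma>) *
          exp (2 * pi * \<i> * of_int a * (of_nat k * (\<tau> / 2)) + pi * \<i> * udot y (of_nat k *s ((- 1/2) *s \<xi>)))"
        by (simp only: exp_add)
      have c: "cf (a, int n, y) = - 2 * of_int (cc (a * int (2 * n) - Qf y))"
        by (simp add: cf_def cl1_def cl_def)
      show ?thesis unfolding F_def prod.case u c by (simp only: mult_ac times_divide_eq_right times_divide_eq_left)
    qed
    hence e: "(\<lambda>(a, y). F ((a, int n, y), k)) = (\<lambda>z. ((- 2 / of_nat k) * exp (pi * \<i> * of_nat (n * k) * \<sigma>)) * 
      (\<lambda>(a, y). of_int (cc (a * int (2 * n) - Qf y)) * exp (2 * pi * \<i> * of_int a * (of_nat k * (\<tau> / 2)) + pi * \<i> * udot y (of_nat k *s ((- 1/2) *s \<xi>)))) z)"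
      by (auto simp: fun_eq_iff)
    show "((\<lambda>(a, y). F ((a, int n, y), k)) has_sum h (n, k)) (UNIV \<times> Lam8)"
      unfolding e h_def prod.case by (rule has_sum_cmult_right[OF cc_lattice_sum(2)[OF d \<alpha>]])
  qed
  also have "?this \<longleftrightarrow> ((\<lambda>N. exp (pi * \<i> * of_nat N * \<sigma>) / of_nat N * (\<Sum>(n, k)\<in>{x \<in> dpairs N. odd (snd x)}. 
        (\<Sum>r<2 * n. g3E ((of_nat k * (\<tau> / 2) + of_nat r) / of_nat n) (of_nat k *s ((- 1/2) *s \<xi>))))) has_sum S) {1..}"
  proof (rule has_sum_cong)
    fix N :: nat assume N: "N \<in> {1..}"
    show "(\<Sum>x\<in>{x \<in> dpairs N. snd x \<in> {k. odd k}}. h x) = exp (pi * \<i> * of_nat N * \<sigma>) / of_nat N * (\<Sum>(n, k)\<in>{x \<in> dpairs N. odd (snd x)}. 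
        (\<Sum>r<2 * n. g3E ((of_nat k * (\<tau> / 2) + of_nat r) / of_nat n) (of_nat k *s ((- 1/2) *s \<xi>))))"
    proof (subst sum_distrib_left, intro sum.cong)
      fix x assume "x \<in> {x \<in> dpairs N. odd (snd x)}"
      then obtain n k where x: "x = (n, k)" "n > 0" "k > 0" "N = n * k" by (auto simp: dpairs_def)
      have t: "2 * z / of_nat (2 * n) = z / of_nat n" for z :: complex using x(2) by simp
      show "h x = exp (pi * \<i> * of_nat N * \<sigma>) / of_nat N * (case x of (n, k) \<Rightarrow> 
        (\<Sum>r<2 * n. g3E ((of_nat k * (\<tau> / 2) + of_nat r) / of_nat n) (of_nat k *s ((- 1/2) *s \<xi>))))"
        unfolding x(1) x(4) h_def prod.case t using x(2,3) by (simp add: field_simps)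
    qed auto
  qed
  finally show ?thesis using logs by blast
qed

text \<open>The Hecke identity at \<tau>/2 and v = -\<xi>/2, level by level. Its exponential
  prefactor is the change from \<sigma> to 2 \<sigma>2, and the sign of the vector argument is
  immaterial because the E8 theta function is even.\<close>

theorem log_products_agree:
  assumes \<tau>: "Im \<tau> > 0" and \<tau>2: "\<tau>2 = - 1 / \<tau>" and \<omega>: "\<omega> = (- 1 / \<tau>) *s \<xi>"
    and \<sigma>2: "\<sigma>2 = (\<sigma> - kap \<xi> / (2 * \<tau>)) / 2"
    and s1: "(\<lambda>x. of_int (cl1 x) * norm (u1 \<tau> \<sigma> \<xi> x)) summable_on Lvl"
    and half1: "\<And>x. x \<in> Lvl \<Longrightarrow> cl1 x \<noteq> 0 \<Longrightarrow> norm (u1 \<tau> \<sigma> \<xi> x) \<le> 1/2"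
    and s2: "(\<lambda>x. of_int (cl x) * norm (u2 \<tau>2 \<sigma>2 \<omega> x)) summable_on Lvl"
    and half2: "\<And>x. x \<in> Lvl \<Longrightarrow> cl x \<noteq> 0 \<Longrightarrow> norm (u2 \<tau>2 \<sigma>2 \<omega> x) \<le> 1/2"
  shows "\<exists>S. ((\<lambda>x. of_int (cl1 x) * (Ln (1 - u1 \<tau> \<sigma> \<xi> x) - Ln (1 + u1 \<tau> \<sigma> \<xi> x))) has_sum S) Lvl \<and>
     ((\<lambda>x. of_int (sg x * cl x) * Ln (1 - u2 \<tau>2 \<sigma>2 \<omega> x)) has_sum S) Lvl"
proof -
  have \<tau>0: "\<tau> \<noteq> 0" using \<tau> by auto
  have \<tau>2': "Im \<tau>2 > 0" unfolding \<tau>2 by (rule Im_minus_inverse_pos[OF \<tau>])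
  obtain S1 where S1: "((\<lambda>x. of_int (cl1 x) * (Ln (1 - u1 \<tau> \<sigma> \<xi> x) - Ln (1 + u1 \<tau> \<sigma> \<xi> x))) has_sum S1) Lvl"
    and A: "((\<lambda>N. exp (pi * \<i> * of_nat N * \<sigma>) / of_nat N * (\<Sum>(n, k)\<in>{x \<in> dpairs N. odd (snd x)}. 
        (\<Sum>r<2 * n. g3E ((of_nat k * (\<tau> / 2) + of_nat r) / of_nat n) (of_nat k *s ((- 1/2) *s \<xi>))))) has_sum S1) {1..}"
    using log_first_product[OF \<tau> s1 half1] by blast
  obtain S2 where S2: "((\<lambda>x. of_int (sg x * cl x) * Ln (1 - u2 \<tau>2 \<sigma>2 \<omega> x)) has_sum S2) Lvl"
    and B: "((\<lambda>N. exp (2 * pi * \<i> * of_nat N * \<sigma>2) / of_nat N * (\<Sum>(b, k)\<in>dpairs N. 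
        (- 1) ^ b * (\<Sum>r<b. g3E (2 * (of_nat k * \<tau>2 + 1/2 + of_nat r) / of_nat b) ((- of_nat k) *s \<omega>)))) has_sum S2) {1..}"
    using log_second_product[OF \<tau>2' s2 half2] by blast
  have "exp (pi * \<i> * of_nat N * \<sigma>) / of_nat N * (\<Sum>(n, k)\<in>{x \<in> dpairs N. odd (snd x)}. 
        (\<Sum>r<2 * n. g3E ((of_nat k * (\<tau> / 2) + of_nat r) / of_nat n) (of_nat k *s ((- 1/2) *s \<xi>))))
     = exp (2 * pi * \<i> * of_nat N * \<sigma>2) / of_nat N * (\<Sum>(b, k)\<in>dpairs N. 
        (- 1) ^ b * (\<Sum>r<b. g3E (2 * (of_nat k * \<tau>2 + 1/2 + of_nat r) / of_nat b) ((- of_nat k) *s \<omega>)))" if N: "N \<in> {1..}" for N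
  proof -
    have t2: "Im (\<tau> / 2) > 0" using \<tau> by simp
    have N0: "N > 0" using N by simp
    have e: "- (pi * \<i> * of_nat N * kap ((- 1/2) *s \<xi>) / (\<tau> / 2)) + pi * \<i> * of_nat N * \<sigma> = 2 * pi * \<i> * of_nat N * \<sigma>2"
      unfolding kap_scale \<sigma>2 using \<tau>0 by (simp add: field_simps power2_eq_square)
    have R: "(\<Sum>(b, k)\<in>dpairs N. (- 1) ^ b * (\<Sum>s<b. g3E ((of_nat (2 * s + 1) * (\<tau> / 2) - of_nat k) / (of_nat b * (\<tau> / 2))) ((of_nat k / (\<tau> / 2)) *s ((- 1/2) *s \<xi>))))
      = (\<Sum>(b, k)\<in>dpairs N. (- 1) ^ b * (\<Sum>r<b. g3E (2 * (of_nat k * \<tau>2 + 1/2 + of_nat r) / of_nat b) ((- of_nat k) *s \<omega>)))"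
    proof (rule sum.cong[OF refl], clarify, intro arg_cong2[of _ _ _ _ "(*)"] refl sum.cong)
      fix b k r assume bk: "(b, k) \<in> dpairs N"
      have b: "of_nat b \<noteq> (0 :: complex)" using bk by (auto simp: dpairs_def)
      have a1: "(of_nat (2 * r + 1) * (\<tau> / 2) - of_nat k) / (of_nat b * (\<tau> / 2)) = 2 * (of_nat k * \<tau>2 + 1/2 + of_nat r) / of_nat b"
        unfolding \<tau>2 using b \<tau>0 by (simp add: field_simps)
      have a2: "(of_nat k / (\<tau> / 2)) *s ((- 1/2) *s \<xi>) = - ((- of_nat k) *s \<omega>)"
        unfolding \<omega> using \<tau>0 by (simp add: vec_eq_iff)
      show "g3E ((of_nat (2 * r + 1) * (\<tau> / 2) - of_nat k) / (of_nat b * (\<tau> / 2))) ((of_nat k / (\<tau> / 2)) *s ((- 1/2) *s \<xi>))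
         = g3E (2 * (of_nat k * \<tau>2 + 1/2 + of_nat r) / of_nat b) ((- of_nat k) *s \<omega>)"
        unfolding a1 a2 g3E_def ThE8_minus ..
    qed
    show ?thesis
      unfolding hecke_identity[OF t2 N0] R e[symmetric] exp_add by (simp only: mult_ac times_divide_eq_right times_divide_eq_left)
  qed
  hence "((\<lambda>N. exp (2 * pi * \<i> * of_nat N * \<sigma>2) / of_nat N * (\<Sum>(b, k)\<in>dpairs N. 
        (- 1) ^ b * (\<Sum>r<b. g3E (2 * (of_nat k * \<tau>2 + 1/2 + of_nat r) / of_nat b) ((- of_nat k) *s \<omega>)))) has_sum S1) {1..}"
    using A has_sum_cong by (metis (no_types, lifting))
  hence "S1 = S2" using B by (rule has_sum_unique)
  thus ?thesis using S1 S2 by blast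
qed

section \<open>Products over the multiples of an isotropic vector\<close>

text \<open>\<open>qp\<close> is a limit over initial segments only. Absolutely summable logarithms
  give unordered convergence, and the initial segments then identify the value.\<close>

lemma has_uprod_qp:
  assumes p: "norm p < 1" and a: "norm a < 1"
  shows "has_uprod (\<lambda>k. 1 - a * p ^ k) UNIV (qp a p)"
proof -
  have apk: "norm (a * p ^ k) \<le> norm p ^ k" for k
    using mult_right_mono[of "norm a" 1 "norm p ^ k"] a by (simp add: norm_mult norm_power)
  have lt: "norm (a * p ^ k) < 1" for k
  proof -
    have "norm (a * p ^ k) = norm a * norm p ^ k" by (simp add: norm_mult norm_power)
    also have "\<dots> \<le> norm a * 1" using p by (intro mult_left_mono power_le_one) auto
    finally show ?thesis using a by simp
  qed
  have nz: "1 - a * p ^ k \<noteq> 0" for k using lt[of k] by auto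
  have "(\<lambda>k. norm p ^ k) \<longlonglongrightarrow> 0" using p by (intro LIMSEQ_power_zero) auto
  hence "eventually (\<lambda>k. norm p ^ k < 1/2) sequentially" by (rule order_tendstoD) simp
  then obtain N where N: "\<And>k. k \<ge> N \<Longrightarrow> norm p ^ k < 1/2" by (auto simp: eventually_sequentially)
  have "summable (\<lambda>k. norm (Ln (1 - a * p ^ k)))"
  proof (rule summable_comparison_test'[where g = "\<lambda>k. 2 * norm p ^ k" and N = N])
    fix k assume "k \<ge> N"
    hence "norm (Ln (1 + - (a * p ^ k))) \<le> 2 * norm (- (a * p ^ k))"
      using N[of k] apk[of k] by (intro norm_Ln_le) auto
    thus "norm (norm (Ln (1 - a * p ^ k))) \<le> 2 * norm p ^ k" using apk[of k] by auto
  qed (use p in \<open>auto intro!: summable_mult summable_geometric\<close>)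
  hence s: "((\<lambda>k. Ln (1 - a * p ^ k)) has_sum (\<Sum>k. Ln (1 - a * p ^ k))) UNIV" (is "(_ has_sum ?s) _")
    by (intro norm_summable_imp_has_sum) (auto intro: summable_sums[OF summable_norm_cancel])
  have "(\<lambda>n. exp (\<Sum>k<n. Ln (1 - a * p ^ k))) \<longlonglongrightarrow> exp ?s"
    using has_sum_imp_sums[OF s] unfolding sums_def by (rule tendsto_exp)
  hence "(\<lambda>n. \<Prod>k<n. 1 - a * p ^ k) \<longlonglongrightarrow> exp ?s"
    unfolding exp_sum_complex using nz by simp
  hence "exp ?s = qp a p" using qp_tendsto[OF p] LIMSEQ_unique by blast
  moreover have "has_uprod (\<lambda>k. 1 - a * p ^ k) UNIV (exp ?s)"
    using s by (rule has_uprod_exp_sum) (use nz in simp)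
  ultimately show ?thesis by simp
qed

lemma has_uprod_divide: "has_uprod f S P \<Longrightarrow> has_uprod g S Q \<Longrightarrow> Q \<noteq> 0 \<Longrightarrow> has_uprod (\<lambda>x. f x / g x) S (P / Q)"
  using tendsto_divide[of "prod f" P _ "prod g" Q] by (simp add: has_uprod_def prod_dividef)

lemma has_uprod_power: "has_uprod f S P \<Longrightarrow> has_uprod (\<lambda>x. f x ^ n) S (P ^ n)"
  using tendsto_power[of "prod f" P _ n] by (simp add: has_uprod_def prod_power_distrib)

lemma has_uprod_1: "has_uprod (\<lambda>x. 1) S 1"
  by (simp add: has_uprod_def)

lemma has_uprod_cong: "(\<And>x. x \<in> S \<Longrightarrow> f x = g x) \<Longrightarrow> has_uprod f S P \<longleftrightarrow> has_uprod g S P"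
  unfolding has_uprod_def
  by (rule tendsto_cong, rule eventually_finite_subsets_at_top_weakI, rule prod.cong) auto

lemma has_uprod_reindex: "inj_on h S \<Longrightarrow> has_uprod f (h ` S) P \<longleftrightarrow> has_uprod (\<lambda>x. f (h x)) S P"
  unfolding has_uprod_def filtermap_image_finite_subsets_at_top[symmetric] filterlim_filtermap
  by (rule tendsto_cong, rule eventually_finite_subsets_at_top_weakI) (auto simp: prod.reindex inj_on_subset)

text \<open>The exponent of every isotropic vector, up to sign; it makes their products eighth
  powers of theta constants.\<close>

lemma cc_zero: "cc 0 = 8"
proof -
  have p: "fps_nth (f ^ n) 1 = of_nat n * fps_nth f 1" if "fps_nth f 0 = 1" for f :: "int fps" and n
    by (induction n) (auto simp: fps_mult_nth_1 that fps_nth_power_0 algebra_simps)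
  have X: "fps_nth (fps_X ^ 2) 1 = (0 :: int)" by (simp add: fps_X_power_iff)
  show ?thesis
    by (simp add: cc_def eta_trunc_def fps_mult_nth_1[unfolded One_nat_def] p[unfolded One_nat_def] X[unfolded One_nat_def] fps_nth_power_0 geom_fps_def fps_nth_power_0)
qed

lemma has_uprod_isotropic_1:
  assumes \<tau>: "Im \<tau> > 0"
  shows "has_uprod (\<lambda>k::nat. ((1 - exp (pi * \<i> * of_nat (Suc k) * \<tau>)) / (1 + exp (pi * \<i> * of_nat (Suc k) * \<tau>))) powi cc 0) UNIV (th \<tau> (1/2) ^ 8)"
proof -
  define q where "q = exp (pi * \<i> * \<tau>)"
  have q: "norm q < 1" unfolding q_def by (rule norm_exp_ii_lt_1[OF \<tau>])
  have e: "exp (pi * \<i> * of_nat (Suc k) * \<tau>) = q * q ^ k" for k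
  proof -
    have "q * q ^ k = q ^ Suc k" by simp
    also have "\<dots> = exp (of_nat (Suc k) * (pi * \<i> * \<tau>))" unfolding q_def by (simp only: exp_of_nat_mult)
    also have "of_nat (Suc k) * (pi * \<i> * \<tau>) = pi * \<i> * of_nat (Suc k) * \<tau>" by (simp only: mult_ac)
    finally show ?thesis ..
  qed
  have "has_uprod (\<lambda>k. ((1 - q * q ^ k) / (1 - (- q) * q ^ k)) ^ 8) UNIV ((qp q q / qp (- q) q) ^ 8)"
    using q by (intro has_uprod_power has_uprod_divide has_uprod_qp qp_nonzero) auto
  thus ?thesis unfolding e cc_zero th_half_prod[OF \<tau>, folded q_def] by simp
qed

text \<open>The pairing of k e1 with e1 - f1 is -k, so even multiples have exponent 8 and odd ones
  -8. The quotient is the eighth power of \<theta>2 without its leading factor.\<close>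

lemma has_uprod_isotropic_2:
  assumes \<tau>: "Im \<tau> > 0"
  shows "\<exists>P. has_uprod (\<lambda>k::nat. (1 - exp (2 * pi * \<i> * of_nat (Suc k) * \<tau>)) powi ((if even (Suc k) then 1 else -1) * cc 0)) UNIV P
     \<and> 2 ^ 8 * exp (2 * pi * \<i> * \<tau>) * P = th1 \<tau> 0 ^ 8"
proof -
  define Q where "Q = exp (2 * pi * \<i> * \<tau>)"
  have Q: "norm Q < 1" using norm_exp_ii_lt_1[of "2 * \<tau>"] \<tau> unfolding Q_def by (simp add: mult_ac)
  have Q2: "norm (Q^2) < 1" using Q by (simp add: norm_power power_less_one_iff abs_square_less_1)
  have e: "exp (2 * pi * \<i> * of_nat k * \<tau>) = Q ^ k" for k
    unfolding Q_def exp_of_nat_mult[symmetric] by (rule arg_cong[of _ _ exp]) (simp only: mult_ac)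
  let ?f = "\<lambda>k::nat. (1 - Q ^ Suc k) powi ((if even (Suc k) then 1 else -1) * 8)"
  define P where "P = (qp (Q^2) (Q^2) / qp Q (Q^2)) ^ 8"
  \<comment> \<open>An even index k means the odd multiple k + 1.\<close>
  have 1: "has_uprod ?f ((\<lambda>k. 2 * k) ` UNIV) ((1 / qp Q (Q^2)) ^ 8)"
  proof (subst has_uprod_reindex)
    have "has_uprod (\<lambda>k. (1 / (1 - Q * (Q^2) ^ k)) ^ 8) UNIV ((1 / qp Q (Q^2)) ^ 8)"
      using Q Q2 by (intro has_uprod_power has_uprod_divide has_uprod_1 has_uprod_qp qp_nonzero) auto
    thus "has_uprod (\<lambda>x. ?f (2 * x)) UNIV ((1 / qp Q (Q^2)) ^ 8)"
      by (simp add: power_int_minus power_mult power_divide divide_inverse power_inverse)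
  qed (auto intro: injI)
  have 2: "has_uprod ?f ((\<lambda>k. 2 * k + 1) ` UNIV) (qp (Q^2) (Q^2) ^ 8)"
  proof (subst has_uprod_reindex)
    have "has_uprod (\<lambda>k. (1 - Q^2 * (Q^2) ^ k) ^ 8) UNIV (qp (Q^2) (Q^2) ^ 8)"
      using Q2 by (intro has_uprod_power has_uprod_qp) auto
    moreover have "Q ^ Suc (2 * k + 1) = Q^2 * (Q^2) ^ k" for k
      by (simp add: power_mult power_add power2_eq_square)
    ultimately show "has_uprod (\<lambda>x. ?f (2 * x + 1)) UNIV (qp (Q^2) (Q^2) ^ 8)" by simp
  qed (auto intro: injI)
  have evens: "range (\<lambda>k::nat. 2 * k) = {k. even k}" and odds: "range (\<lambda>k::nat. 2 * k + 1) = {k. odd k}"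
    by (auto simp: dvd_def odd_iff_mod_2_eq_one image_iff) presburger+
  have "has_uprod ?f ((\<lambda>k. 2 * k) ` UNIV \<union> (\<lambda>k. 2 * k + 1) ` UNIV) ((1 / qp Q (Q^2)) ^ 8 * qp (Q^2) (Q^2) ^ 8)"
    by (rule has_uprod_Un[OF 1 2]) (unfold evens odds, auto)
  moreover have "((\<lambda>k. 2 * k) ` UNIV \<union> (\<lambda>k. 2 * k + 1) ` UNIV :: nat set) = UNIV"
    unfolding evens odds by auto
  moreover have "(1 / qp Q (Q^2)) ^ 8 * qp (Q^2) (Q^2) ^ 8 = P" by (simp add: P_def power_divide)
  ultimately have u: "has_uprod ?f UNIV P" by simp
  have "th1 \<tau> 0 ^ 8 = 2 ^ 8 * exp (pi * \<i> * \<tau> / 4) ^ 8 * P"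
    unfolding th1_zero_prod[OF \<tau>] P_def Q_def by (simp only: power_mult_distrib)
  also have "exp (pi * \<i> * \<tau> / 4) ^ 8 = exp (2 * pi * \<i> * \<tau>)"
    unfolding exp_of_nat_mult[symmetric] by (rule arg_cong[of _ _ exp]) simp
  finally show ?thesis using u unfolding cc_zero e by (intro exI[of _ P]) simp
qed

lemma theta_isotropic_ratio:
  assumes \<tau>: "Im \<tau> > 0"
  shows "\<tau> powi (-4) * th (- 1 / \<tau>) (1/2) ^ 8 = th1 \<tau> 0 ^ 8"
proof -
  have "\<tau> \<noteq> 0" using \<tau> by auto
  thus ?thesis unfolding theta4_inversion_8[OF \<tau>] by (simp add: power_int_minus)
qed

section \<open>Coordinates on the lattice\<close>

lemma UNIV_8: "(UNIV :: 8 set) = {1, 2, 3, 4, 5, 6, 7, 8}"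
  by (rule sym, rule card_subset_eq) simp_all

lemma UNIV_12: "(UNIV :: 12 set) = {0, 1, 2, 3, 4, 5, 6, 7, 8, 9, 10, 11}"
  by (rule sym, rule card_subset_eq) simp_all

text \<open>The columns are twice Bourbaki's simple roots of E8: index 4 is (\<epsilon>1 -
  \<epsilon>2 - ... - \<epsilon>7 + \<epsilon>8) / 2, index 11 is \<epsilon>1 + \<epsilon>2, and the
  indices 5 to 10 are the differences \<epsilon>2 - \<epsilon>1 up to \<epsilon>7 -
  \<epsilon>6.\<close>

definition Ev :: "'a::comm_ring_1 ^ 12 \<Rightarrow> 'a ^ 8" where
  "Ev v = (\<chi> j.
     if j = 1 then v$4 + 2 * v$11 - 2 * v$5
     else if j = 2 then - v$4 + 2 * v$11 + 2 * v$5 - 2 * v$6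
     else if j = 3 then - v$4 + 2 * v$6 - 2 * v$7
     else if j = 4 then - v$4 + 2 * v$7 - 2 * v$8
     else if j = 5 then - v$4 + 2 * v$8 - 2 * v$9
     else if j = 6 then - v$4 + 2 * v$9 - 2 * v$10
     else if j = 7 then - v$4 + 2 * v$10
     else v$4)"

lemma Ev_simps:
  "Ev v $ 1 = v$4 + 2 * v$11 - 2 * v$5" "Ev v $ 2 = - v$4 + 2 * v$11 + 2 * v$5 - 2 * v$6"
  "Ev v $ 3 = - v$4 + 2 * v$6 - 2 * v$7" "Ev v $ 4 = - v$4 + 2 * v$7 - 2 * v$8"
  "Ev v $ 5 = - v$4 + 2 * v$8 - 2 * v$9" "Ev v $ 6 = - v$4 + 2 * v$9 - 2 * v$10"
  "Ev v $ 7 = - v$4 + 2 * v$10" "Ev v $ 8 = v$4"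
  by (simp_all add: Ev_def)

lemma bil_expand:
  fixes v w :: "'a::comm_ring_1 ^ 12"
  shows "bil v w = 2 * (v$0 * w$1 + v$1 * w$0) + (v$2 * w$3 + v$3 * w$2)
    - 4 * (v$4 * w$4 + v$5 * w$5 + v$6 * w$6 + v$7 * w$7 + v$8 * w$8 + v$9 * w$9 + v$10 * w$10 + v$11 * w$11)
    + 2 * (v$4 * w$5 + v$5 * w$4 + v$5 * w$6 + v$6 * w$5 + v$6 * w$7 + v$7 * w$6 + v$7 * w$8 + v$8 * w$7
         + v$8 * w$9 + v$9 * w$8 + v$9 * w$10 + v$10 * w$9 + v$6 * w$11 + v$11 * w$6)"
proof -
  define R where "R i = (\<Sum>j\<in>UNIV. of_int (gram i j) * w$j)" for i
  have row: "(\<Sum>j\<in>UNIV. of_int (gram i j) * v$i * w$j) = v$i * R i" for i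
    by (simp add: R_def sum_distrib_left mult_ac)
  have r: "R 0 = 2 * w$1"
    "R 1 = 2 * w$0"
    "R 2 = w$3"
    "R 3 = w$2"
    "R 4 = - 4 * w$4 + 2 * w$5"
    "R 5 = - 4 * w$5 + 2 * w$4 + 2 * w$6"
    "R 6 = - 4 * w$6 + 2 * w$5 + 2 * w$7 + 2 * w$11"
    "R 7 = - 4 * w$7 + 2 * w$6 + 2 * w$8"
    "R 8 = - 4 * w$8 + 2 * w$7 + 2 * w$9"
    "R 9 = - 4 * w$9 + 2 * w$8 + 2 * w$10"
    "R 10 = - 4 * w$10 + 2 * w$9"
    "R 11 = - 4 * w$11 + 2 * w$6"
    unfolding R_def UNIV_12 by (simp_all add: gram_def e8adj_def doubleton_eq_iff)
  show ?thesis unfolding bil_def row unfolding UNIV_12 by (simp add: r algebra_simps)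
qed

text \<open>In doubled coordinates the form of E8(2) is -1/2 times the standard scalar product; the
  overall factor 2 avoids this fraction over a general ring.\<close>

lemma bil_Ev:
  fixes v w :: "'a::comm_ring_1 ^ 12"
  shows "2 * bil v w = 4 * (v$0 * w$1 + v$1 * w$0) + 2 * (v$2 * w$3 + v$3 * w$2) - (\<Sum>j\<in>UNIV. Ev v $ j * Ev w $ j)"
  unfolding bil_expand UNIV_8 by (simp add: Ev_simps algebra_simps)


lemma norm_vec_sq: "norm (x :: real ^ 8) ^ 2 = (\<Sum>j\<in>UNIV. x$j * x$j)"
  by (simp only: power2_norm_eq_inner inner_vec_def) simp

lemma Ev_lift: "Ev (lift l) $ j = of_int (Ev l $ j)"
  by (simp add: Ev_def lift_def)

lemma Ev_in_Lam8: "Ev l \<in> Lam8"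
proof -
  have "(\<forall>j. even (Ev l $ j)) \<or> (\<forall>j. odd (Ev l $ j))"
    by (cases "even (l $ 4)") (auto simp: Ev_def)
  moreover have "(\<Sum>j\<in>UNIV. Ev l $ j) = 4 * (l$11 - l$4)"
    unfolding UNIV_8 by (simp add: Ev_simps)
  ultimately show ?thesis by (auto simp: Lam8_def)
qed

text \<open>The linear system is solved from the last coordinate backwards. Equal parity of the
  coordinates permits the halvings, and divisibility of their sum by 4 yields the coefficient
  \<open>c11\<close>.\<close>

lemma Ev_surj:
  assumes "u \<in> Lam8"
  shows "\<exists>c :: int ^ 12. Ev c = u \<and> c$0 = a0 \<and> c$1 = a1 \<and> c$2 = a2 \<and> c$3 = a3"
proof -
  have par: "(\<forall>j. even (u $ j)) \<or> (\<forall>j. odd (u $ j))" using assms by (simp add: Lam8_def)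
  have "4 dvd (\<Sum>j\<in>UNIV. u $ j)" using assms by (simp add: Lam8_def)
  also have "(\<Sum>j\<in>UNIV. u $ j) = u$1 + u$2 + u$3 + u$4 + u$5 + u$6 + u$7 + u$8"
    unfolding UNIV_8 by simp
  finally have d4: "4 dvd u$1 + u$2 + u$3 + u$4 + u$5 + u$6 + u$7 + u$8" .
  have ev: "even (u$j + u$8)" for j using par by auto
  obtain c10 where c10: "u$7 + u$8 = 2 * c10" using ev by (rule evenE)
  obtain h9 where h9: "u$6 + u$8 = 2 * h9" using ev by (rule evenE)
  obtain h8 where h8: "u$5 + u$8 = 2 * h8" using ev by (rule evenE)
  obtain h7 where h7: "u$4 + u$8 = 2 * h7" using ev by (rule evenE)
  obtain h6 where h6: "u$3 + u$8 = 2 * h6" using ev by (rule evenE)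
  define c9 c8 c7 c6 where "c9 = h9 + c10" and "c8 = h8 + h9 + c10" and "c7 = h7 + h8 + h9 + c10"
    and "c6 = h6 + h7 + h8 + h9 + c10"
  obtain k where k: "u$1 + u$2 + u$3 + u$4 + u$5 + u$6 + u$7 + u$8 = 4 * k" using d4 by (rule dvdE)
  define c11 where "c11 = k + u$8"
  obtain h5 where h5: "u$1 + u$8 = 2 * h5" using ev by (rule evenE)
  define c5 where "c5 = c11 + u$8 - h5"
  define c :: "int ^ 12" where "c = (\<chi> i. if i = 0 then a0 else if i = 1 then a1 else if i = 2 then a2
     else if i = 3 then a3 else if i = 4 then u$8 else if i = 5 then c5 else if i = 6 then c6 else if i = 7 then c7
     else if i = 8 then c8 else if i = 9 then c9 else if i = 10 then c10 else c11)"
  have c: "c$0 = a0" "c$1 = a1" "c$2 = a2" "c$3 = a3" "c$4 = u$8" "c$5 = c5" "c$6 = c6" "c$7 = c7"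
    "c$8 = c8" "c$9 = c9" "c$10 = c10" "c$11 = c11" by (simp_all add: c_def)
  have s: "u$7 = 2 * c10 - u$8" "u$6 = 2 * h9 - u$8" "u$5 = 2 * h8 - u$8" "u$4 = 2 * h7 - u$8"
    "u$3 = 2 * h6 - u$8" "u$1 = 2 * h5 - u$8"
    by (simp_all only: eq_diff_eq c10 h9 h8 h7 h6 h5)
  have "u$2 = 4 * k - u$1 - u$3 - u$4 - u$5 - u$6 - u$7 - u$8"
    using k by (simp add: algebra_simps)
  also have "\<dots> = 4 * k - 2 * h5 - 2 * h6 - 2 * h7 - 2 * h8 - 2 * h9 - 2 * c10 + 5 * u$8"
    unfolding s by (simp add: algebra_simps)
  finally have s2: "u$2 = 4 * k - 2 * h5 - 2 * h6 - 2 * h7 - 2 * h8 - 2 * h9 - 2 * c10 + 5 * u$8" .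
  have E: "Ev c $ 1 = u $ 1 \<and> Ev c $ 2 = u $ 2 \<and> Ev c $ 3 = u $ 3 \<and> Ev c $ 4 = u $ 4 \<and>
    Ev c $ 5 = u $ 5 \<and> Ev c $ 6 = u $ 6 \<and> Ev c $ 7 = u $ 7 \<and> Ev c $ 8 = u $ 8"
    unfolding Ev_simps c c9_def c8_def c7_def c6_def c11_def c5_def s s2 by (intro conjI) (simp_all add: algebra_simps)
  have "Ev c $ j = u $ j" for j
  proof -
    have "j \<in> {1, 2, 3, 4, 5, 6, 7, 8}" using UNIV_8 by blast
    thus ?thesis using E by (elim insertE emptyE) simp_all
  qed
  hence "Ev c = u" by (simp add: vec_eq_iff)
  thus ?thesis using c by blast
qed

lemma Ev_inj:
  fixes v w :: "'a::{comm_ring_1, ring_char_0, idom} ^ 12"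
  assumes E: "Ev v = Ev w" and c: "v$0 = w$0" "v$1 = w$1" "v$2 = w$2" "v$3 = w$3"
  shows "v = w"
proof -
  note e = arg_cong[OF E, of "\<lambda>x. x $ j" for j]
  have 4: "v$4 = w$4" using e[of 8] by (simp add: Ev_simps)
  have 10: "v$10 = w$10" using e[of 7] 4 by (simp add: Ev_simps)
  have 9: "v$9 = w$9" using e[of 6] 4 10 by (simp add: Ev_simps)
  have 8: "v$8 = w$8" using e[of 5] 4 9 by (simp add: Ev_simps)
  have 7: "v$7 = w$7" using e[of 4] 4 8 by (simp add: Ev_simps)
  have 6: "v$6 = w$6" using e[of 3] 4 7 by (simp add: Ev_simps)
  have a: "v$4 + 2 * v$11 - 2 * v$5 = w$4 + 2 * w$11 - 2 * w$5" using e[of 1] by (simp only: Ev_simps)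
  have b: "- v$4 + 2 * v$11 + 2 * v$5 - 2 * v$6 = - w$4 + 2 * w$11 + 2 * w$5 - 2 * w$6"
    using e[of 2] by (simp only: Ev_simps)
  have "4 * v$11 = (v$4 + 2 * v$11 - 2 * v$5) + (- v$4 + 2 * v$11 + 2 * v$5 - 2 * v$6) + 2 * v$6" by (simp add: algebra_simps)
  also have "\<dots> = (w$4 + 2 * w$11 - 2 * w$5) + (- w$4 + 2 * w$11 + 2 * w$5 - 2 * w$6) + 2 * v$6" by (simp only: a b)
  also have "\<dots> = 4 * w$11" by (simp only: 6) (simp add: algebra_simps)
  finally have 11: "v$11 = w$11" by simp
  have "2 * v$5 = v$4 + 2 * v$11 - (v$4 + 2 * v$11 - 2 * v$5)" by simp
  also have "\<dots> = v$4 + 2 * v$11 - (w$4 + 2 * w$11 - 2 * w$5)" by (simp only: a)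
  also have "\<dots> = 2 * w$5" by (simp only: 4 11) simp
  finally have 5: "v$5 = w$5" by simp
  have "v $ i = w $ i" for i
  proof -
    have "i \<in> {0, 1, 2, 3, 4, 5, 6, 7, 8, 9, 10, 11}" using UNIV_12 by blast
    thus ?thesis by (elim insertE emptyE) (simp_all only: c 4 5 6 7 8 9 10 11)
  qed
  thus ?thesis by (simp add: vec_eq_iff)
qed

definition co1 :: "int ^ 12 \<Rightarrow> int \<times> int \<times> (int ^ 8)" where "co1 l = (l$0, l$1, Ev l)"
definition co2 :: "int ^ 12 \<Rightarrow> int \<times> int \<times> (int ^ 8)" where "co2 l = (l$2, l$3, Ev l)"

lemma bij_co1: "bij_betw co1 M1 (UNIV \<times> UNIV \<times> Lam8)"
proof (rule bij_betwI')
  fix x assume "x \<in> M1" thus "co1 x \<in> UNIV \<times> UNIV \<times> Lam8" by (simp add: co1_def Ev_in_Lam8)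
next
  fix x y assume "x \<in> M1" "y \<in> M1" thus "(co1 x = co1 y) = (x = y)"
    by (auto simp: co1_def M1_def intro: Ev_inj)
next
  fix t :: "int \<times> int \<times> (int ^ 8)" assume "t \<in> UNIV \<times> UNIV \<times> Lam8"
  then obtain a b u where t: "t = (a, b, u)" "u \<in> Lam8" by auto
  obtain c :: "int ^ 12" where "Ev c = u" "c$0 = a" "c$1 = b" "c$2 = 0" "c$3 = 0"
    using Ev_surj[OF t(2), of a b 0 0] by blast
  thus "\<exists>x\<in>M1. t = co1 x" using t by (auto simp: co1_def M1_def)
qed

lemma bij_co2: "bij_betw co2 M2 (UNIV \<times> UNIV \<times> Lam8)"
proof (rule bij_betwI')
  fix x assume "x \<in> M2" thus "co2 x \<in> UNIV \<times> UNIV \<times> Lam8" by (simp add: co2_def Ev_in_Lam8)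
next
  fix x y assume "x \<in> M2" "y \<in> M2" thus "(co2 x = co2 y) = (x = y)"
    by (auto simp: co2_def M2_def intro: Ev_inj)
next
  fix t :: "int \<times> int \<times> (int ^ 8)" assume "t \<in> UNIV \<times> UNIV \<times> Lam8"
  then obtain a b u where t: "t = (a, b, u)" "u \<in> Lam8" by auto
  obtain c :: "int ^ 12" where "Ev c = u" "c$0 = 0" "c$1 = 0" "c$2 = a" "c$3 = b"
    using Ev_surj[OF t(2), of 0 0 a b] by blast
  thus "\<exists>x\<in>M2. t = co2 x" using t by (auto simp: co2_def M2_def)
qed

lemma sq_M1:
  assumes "l \<in> M1" shows "sq l = 4 * l$0 * l$1 - 2 * Qf (Ev l)"
proof -
  have "2 * sq l = 8 * (l$0 * l$1) - usq (Ev l)"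
    using assms unfolding sq_def bil_Ev usq_def M1_def by (simp add: power2_eq_square)
  thus ?thesis using usq_eq_Qf[OF Ev_in_Lam8, of l] by simp
qed

lemma sq_M2:
  assumes "l \<in> M2" shows "sq l = 2 * l$2 * l$3 - 2 * Qf (Ev l)"
proof -
  have "2 * sq l = 4 * (l$2 * l$3) - usq (Ev l)"
    using assms unfolding sq_def bil_Ev usq_def M2_def by (simp add: power2_eq_square)
  thus ?thesis using usq_eq_Qf[OF Ev_in_Lam8, of l] by simp
qed

lemma sq_M1R:
  assumes "y \<in> M1R" shows "sq y = 4 * y$0 * y$1 - norm (Ev y) ^ 2 / 2"
proof -
  have "2 * sq y = 8 * (y$0 * y$1) - norm (Ev y) ^ 2"
    using assms unfolding sq_def bil_Ev norm_vec_sq M1R_def by simp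
  thus ?thesis by (simp add: algebra_simps)
qed

lemma sq_M2R:
  assumes "y \<in> M2R" shows "sq y = 2 * y$2 * y$3 - norm (Ev y) ^ 2 / 2"
  using assms bil_Ev[of y y] unfolding sq_def norm_vec_sq M2R_def by simp

lemma bil_M2R:
  assumes "l \<in> M2" "y \<in> M2R"
  shows "bil (lift l) y = (of_int (l$2) * y$3 + of_int (l$3) * y$2) - (ru (Ev l) \<bullet> Ev y) / 2"
  using assms bil_Ev[of "lift l" y]
  by (simp add: M2_def M2R_def Ev_lift inner_vec_def ru_def) (simp add: lift_def)

lemma bil_M1C:
  assumes "l \<in> M1" "z \<in> M1C"
  shows "bil (lift l) z = 2 * (of_int (l$0) * z$1 + of_int (l$1) * z$0) - udot (Ev l) (Ev z) / 2"
proof -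
  have "2 * bil (lift l) z = 4 * (of_int (l$0) * z$1 + of_int (l$1) * z$0) - udot (Ev l) (Ev z)"
    using assms unfolding bil_Ev Ev_lift udot_def by (simp add: M1_def M1C_def lift_def)
  thus ?thesis by (simp add: field_simps)
qed

lemma bil_M2C:
  assumes "l \<in> M2" "z \<in> M2C"
  shows "bil (lift l) z = (of_int (l$2) * z$3 + of_int (l$3) * z$2) - udot (Ev l) (Ev z) / 2"
proof -
  have "2 * bil (lift l) z = 2 * (of_int (l$2) * z$3 + of_int (l$3) * z$2) - udot (Ev l) (Ev z)"
    using assms unfolding bil_Ev Ev_lift udot_def by (simp add: M2_def M2C_def lift_def)
  thus ?thesis by (simp add: field_simps)
qed

lemma bil_e1: "bil e1 w = w$3" and bil_e2: "bil e2 w = 2 * w$1" and bil_f2: "bil f2 w = 2 * w$0"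
  unfolding bil_expand by (simp_all add: bv_def)

lemma bil_e1_f1: "bil l (e1 - f1) = l$3 - l$2"
  unfolding bil_expand by (simp add: bv_def)

lemma all_12: "(\<forall>i::12. P i) \<longleftrightarrow> P 0 \<and> P 1 \<and> P 2 \<and> P 3 \<and> P 4 \<and> P 5 \<and> P 6 \<and> P 7 \<and> P 8 \<and> P 9 \<and> P 10 \<and> P 11"
proof -
  have "(\<forall>i::12. P i) \<longleftrightarrow> (\<forall>i\<in>{0, 1, 2, 3, 4, 5, 6, 7, 8, 9, 10, 11}. P i)" using UNIV_12 by auto
  thus ?thesis by simp
qed

lemma Ev_Imv: "Ev (Imv w) $ j = Im (Ev w $ j)"
  by (simp add: Ev_def Imv_def)

lemma Ev_add_bv:
  "Ev (w + t *s e1) = Ev w" "Ev (w + t *s e2) = Ev w" "Ev (w + t *s (e2 + f2)) = Ev w"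
  by (simp_all add: Ev_def bv_def vec_eq_iff)

lemma sq_M1C: "z \<in> M1C \<Longrightarrow> sq z = 4 * z$0 * z$1 - kap (Ev z) / 2"
  using bil_Ev[of z z] unfolding sq_def kap_def M1C_def by (simp add: power2_eq_square field_simps)

lemma sq_M2C: "w \<in> M2C \<Longrightarrow> sq w = 2 * w$2 * w$3 - kap (Ev w) / 2"
  using bil_Ev[of w w] unfolding sq_def kap_def M2C_def by (simp add: power2_eq_square field_simps)

lemma norm_Ev_Imv: "norm (Ev (Imv w)) ^ 2 = (\<Sum>j\<in>UNIV. Im (Ev w $ j) ^ 2)"
  unfolding norm_vec_sq Ev_Imv by (simp add: power2_eq_square)

section \<open>The passage between the two tube domains\<close>

text \<open>The point of the first tube domain on the line of \<open>iota2 w\<close>: dividing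
  \<open>iota2 w\<close> by its \<open>f1\<close>-coordinate \<open>- w$3\<close> normalizes that
  coordinate to 1, as in \<open>iota1\<close>.\<close>

definition zof :: "complex ^ 12 \<Rightarrow> complex ^ 12" where
  "zof w = (\<chi> i. if i = 0 then sq w / (2 * w$3) else if i = 1 then - 1 / (2 * w$3)
      else if i = 2 \<or> i = 3 then 0 else w$i / w$3)"

lemma tube2D:
  assumes "w \<in> tube2"
  shows "w \<in> M2C" "Imv w \<in> M2R" "sq (Imv w) > 0" "Im (w$3) > 0" "Im (w$2) > 0" "w$3 \<noteq> 0"
proof -
  show w: "w \<in> M2C" using assms by (simp add: tube2_def)
  show y: "Imv w \<in> M2R" and s: "sq (Imv w) > 0" using assms by (auto simp: tube2_def C2plus_def)
  have "bil e1 (Imv w) > 0" using assms by (simp add: tube2_def C2plus_def)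
  thus b: "Im (w$3) > 0" by (simp add: bil_e1 Imv_def)
  have "0 < 2 * Im (w$2) * Im (w$3) - norm (Ev (Imv w)) ^ 2 / 2"
    using s unfolding sq_M2R[OF y] by (simp add: Imv_def)
  hence "0 < 2 * Im (w$2) * Im (w$3)" using zero_le_power2[of "norm (Ev (Imv w))"] by linarith
  thus "Im (w$2) > 0" using b by (simp add: zero_less_mult_iff)
  show "w$3 \<noteq> 0" using b by auto
qed

lemma Ev_zof: "Ev (zof w) = (1 / w$3) *s Ev w"
  by (simp add: Ev_def zof_def vec_eq_iff algebra_simps diff_divide_distrib add_divide_distrib)

lemma zof_M1C: "zof w \<in> M1C"
  by (simp add: M1C_def zof_def)

text \<open>Exactly the value for which the \<open>e1\<close>-coordinates of the two embeddings
  match.\<close>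

lemma sq_zof:
  assumes "w \<in> tube2" shows "sq (zof w) = - 2 * w$2 / w$3"
proof -
  note w = tube2D[OF assms]
  have k: "kap (Ev (zof w)) = kap (Ev w) / (w$3) ^ 2"
    unfolding Ev_zof kap_def by (simp add: power_divide sum_divide_distrib)
  have z: "zof w $ 0 = sq w / (2 * w$3)" "zof w $ 1 = - 1 / (2 * w$3)" by (simp_all add: zof_def)
  show ?thesis unfolding sq_M1C[OF zof_M1C] k z sq_M2C[OF w(1)] using w(6)
    by (simp add: field_simps power2_eq_square)
qed

lemma iota2_zof:
  assumes "w \<in> tube2" shows "iota2 w = (- (w$3)) *s iota1 (zof w)"
proof -
  note w = tube2D[OF assms]
  have "w$0 = 0" "w$1 = 0" using w(1) by (auto simp: M2C_def)
  thus ?thesis using w(6)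
    unfolding vec_eq_iff all_12 iota1_def iota2_def sq_zof[OF assms]
    by (simp add: zof_def bv_def)
qed

text \<open>Meant for the E8 coordinates of w divided by \<open>w$3\<close>. The mixed terms on the
  right add up to one that cancels against the hyperbolic part.\<close>

lemma Im_component:
  assumes "w \<noteq> 0"
  shows "Im (p / w) ^ 2 = Im p ^ 2 / norm w ^ 2 - Im (- 1 / w) * Im (p^2 / w)"
proof -
  define x where "x = p / w"
  have p: "p = x * w" using assms by (simp add: x_def)
  have n: "norm w ^ 2 = Re w ^ 2 + Im w ^ 2" by (rule cmod_power2)
  have n0: "norm w ^ 2 \<noteq> 0" using assms by simp
  have i: "Im (- 1 / w) = Im w / norm w ^ 2" unfolding n by (simp add: Im_divide)
  have pw: "p^2 / w = x^2 * w" using assms by (simp add: p power2_eq_square)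
  have "norm w ^ 2 * Im x ^ 2 + Im w * Im (x^2 * w) = Im (x * w) ^ 2"
    unfolding n by (simp add: power2_eq_square algebra_simps)
  hence "Im x ^ 2 = (Im (x * w) ^ 2 - Im w * Im (x^2 * w)) / norm w ^ 2"
    using n0 by (simp add: field_simps)
  thus ?thesis unfolding i pw using p by (simp add: x_def[symmetric] diff_divide_distrib)
qed

lemma Im_zof_1: "Imv (zof w) $ 1 = Im (- 1 / w$3) / 2"
proof -
  have "Imv (zof w) $ 1 = Im ((- 1 / w$3) / 2)" by (simp add: Imv_def zof_def mult.commute)
  thus ?thesis by (simp only: Im_divide_numeral)
qed

text \<open>For both embeddings the Hermitian square of the image is twice the square of the
  imaginary part, and \<open>iota2 w\<close> is \<open>- w$3\<close> times
  \<open>iota1 (zof w)\<close>. The resulting scaling is verified in coordinates.\<close>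

lemma sq_Im_zof:
  assumes "w \<in> tube2" shows "sq (Imv (zof w)) = sq (Imv w) / norm (w$3) ^ 2"
proof -
  note w = tube2D[OF assms]
  have M: "Imv (zof w) \<in> M1R" by (simp add: M1R_def Imv_def zof_def)
  have i: "Im (- 1 / w$3) = Im (w$3) / norm (w$3) ^ 2" by (simp add: Im_divide cmod_power2)
  note z1 = Im_zof_1[of w]
  have "zof w $ 0 = w$2 - kap (Ev w) / (w$3) / 4"
    unfolding zof_def using w(6) by (simp add: sq_M2C[OF w(1)] field_simps)
  hence "Imv (zof w) $ 0 = Im (w$2 - kap (Ev w) / (w$3) / 4)" by (simp only: Imv_def vec_lambda_beta)
  hence z0: "Imv (zof w) $ 0 = Im (w$2) - Im (kap (Ev w) / w$3) / 4" by (simp only: minus_complex.sel Im_divide_numeral)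
  have "norm (Ev (Imv (zof w))) ^ 2 = (\<Sum>j\<in>UNIV. Im (Ev w $ j / w$3) ^ 2)"
    unfolding norm_Ev_Imv Ev_zof by simp
  also have "\<dots> = (\<Sum>j\<in>UNIV. Im (Ev w $ j) ^ 2 / norm (w$3) ^ 2 - Im (- 1 / w$3) * Im ((Ev w $ j)^2 / w$3))"
    by (simp only: Im_component[OF w(6)])
  also have "\<dots> = norm (Ev (Imv w)) ^ 2 / norm (w$3) ^ 2 - Im (- 1 / w$3) * Im (kap (Ev w) / w$3)"
    unfolding norm_Ev_Imv kap_def by (simp only: sum_subtractf sum_divide_distrib sum_distrib_left Im_sum)
  finally have e: "norm (Ev (Imv (zof w))) ^ 2 = norm (Ev (Imv w)) ^ 2 / norm (w$3) ^ 2 - Im (- 1 / w$3) * Im (kap (Ev w) / w$3)" .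
  define k where "k = Im (kap (Ev w) / w$3)"
  define N where "N = norm (w$3) ^ 2"
  show ?thesis
    unfolding sq_M1R[OF M] sq_M2R[OF w(2)] e z0 z1 i k_def[symmetric] N_def[symmetric]
    by (simp add: Imv_def algebra_simps diff_divide_distrib)
qed

lemma zof_tube1:
  assumes "w \<in> tube2" shows "zof w \<in> tube1"
proof -
  note w = tube2D[OF assms]
  have "sq (Imv (zof w)) > 0" unfolding sq_Im_zof[OF assms] using w(3,6) by simp
  moreover have "bil e2 (Imv (zof w)) > 0"
    using Im_minus_inverse_pos[OF w(4)] unfolding bil_e2 Im_zof_1 by simp
  ultimately show ?thesis by (simp add: tube1_def C1plus_def zof_M1C M1R_def) (simp add: Imv_def zof_def)
qed

lemma sq_add_e1:
  assumes "w \<in> M2C" shows "sq (w + t *s e1) = sq w + 2 * t * w$3"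
proof -
  have "w + t *s e1 \<in> M2C" using assms by (simp add: M2C_def bv_def)
  thus ?thesis using assms by (simp add: sq_M2C Ev_add_bv) (simp add: bv_def algebra_simps)
qed

text \<open>\<open>w$3\<close> does not change, and \<open>sq w\<close> grows by 2 t
  \<open>w$3\<close> since \<open>e1\<close> is isotropic, so the quotient in the
  \<open>e2\<close>-coordinate grows by t.\<close>

lemma zof_add:
  assumes "w \<in> tube2" shows "zof (w + t *s e1) = zof w + t *s e2"
proof -
  note w = tube2D[OF assms]
  show ?thesis using w(6) unfolding vec_eq_iff all_12
    by (simp add: zof_def sq_add_e1[OF w(1)]) (simp add: bv_def field_simps)
qed

lemma Imv_add_e1: "Imv (w + t *s e1) = Imv w + Im t *s e1"
  and Imv_add_e2: "Imv (w + t *s e2) = Imv w + Im t *s e2"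
  by (simp_all add: Imv_def bv_def vec_eq_iff)

lemma sq_Im_add_e1:
  assumes "w \<in> M2C" shows "sq (Imv (w + t *s e1)) = sq (Imv w) + 2 * Im t * Im (w$3)"
proof -
  have "Imv w \<in> M2R" "Imv (w + t *s e1) \<in> M2R" using assms by (simp_all add: M2C_def M2R_def Imv_def bv_def)
  thus ?thesis by (simp add: sq_M2R) (simp add: Imv_add_e1 Ev_add_bv, simp add: Imv_def bv_def algebra_simps)
qed

section \<open>Positive cones, Weyl chambers and index sets\<close>

lemma continuous_on_bil [continuous_intros]:
  fixes f g :: "'a::topological_space \<Rightarrow> real ^ 12"
  assumes "continuous_on S f" "continuous_on S g"
  shows "continuous_on S (\<lambda>x. bil (f x) (g x))"
  unfolding bil_def using assms by (intro continuous_intros)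

lemma C1plusD:
  assumes "y \<in> C1plus" shows "y$2 = 0" "y$3 = 0" "sq y > 0" "y$1 > 0" "y$0 > 0"
proof -
  show y: "y$2 = 0" "y$3 = 0" "sq y > 0" "y$1 > 0" using assms by (auto simp: C1plus_def M1R_def bil_e2)
  have M: "y \<in> M1R" using assms by (simp add: C1plus_def)
  have "0 < 4 * y$0 * y$1" using y(3) zero_le_power2[of "norm (Ev y)"] unfolding sq_M1R[OF M] by linarith
  thus "y$0 > 0" using y(4) by (simp add: zero_less_mult_iff)
qed

lemma C2plusD:
  assumes "y \<in> C2plus" shows "y \<in> M2R" "sq y > 0" "y$3 > 0" "y$2 > 0"
proof -
  show y: "y \<in> M2R" "sq y > 0" "y$3 > 0" using assms by (auto simp: C2plus_def bil_e1)
  have "0 < 2 * y$2 * y$3" using y(2) zero_le_power2[of "norm (Ev y)"] unfolding sq_M2R[OF y(1)] by linarith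
  thus "y$2 > 0" using y(3) by (simp add: zero_less_mult_iff)
qed

text \<open>Boundary points are approached by adding small multiples of \<open>e2 + f2\<close>,
  which lies inside the cone.\<close>

lemma closure_C1plus: "closure C1plus = {y \<in> M1R. sq y \<ge> 0 \<and> y$0 \<ge> 0 \<and> y$1 \<ge> 0}" (is "_ = ?K")
proof
  have "?K = {y. y$2 = 0} \<inter> {y. y$3 = 0} \<inter> {y. sq y \<ge> 0} \<inter> {y. y$0 \<ge> 0} \<inter> {y. y$1 \<ge> 0}"
    by (auto simp: M1R_def)
  also have "closed \<dots>" unfolding sq_def
    by (intro closed_Int closed_Collect_eq closed_Collect_le continuous_intros)
  finally have "closed ?K" .
  moreover have "C1plus \<subseteq> ?K" using C1plusD by (force simp: M1R_def)
  ultimately show "closure C1plus \<subseteq> ?K" by (rule closure_minimal[rotated])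
next
  show "?K \<subseteq> closure C1plus"
  proof
    fix y assume y: "y \<in> ?K"
    define Y where "Y n = y + (1 / real (Suc n)) *s (e2 + f2)" for n
    have "Y n \<in> C1plus" for n
    proof -
      define \<epsilon> where "\<epsilon> = 1 / real (Suc n)"
      have e: "\<epsilon> > 0" by (simp add: \<epsilon>_def)
      have c: "Y n $ 0 = y$0 + \<epsilon>" "Y n $ 1 = y$1 + \<epsilon>" "Y n \<in> M1R" "Ev (Y n) = Ev y"
        using y Ev_add_bv(3)[of y \<epsilon>] by (simp_all add: Y_def \<epsilon>_def bv_def M1R_def)
      have "sq (Y n) = sq y + 4 * \<epsilon> * (y$0 + y$1) + 4 * \<epsilon>^2"
        using y unfolding sq_M1R[OF c(3)] c by (simp add: sq_M1R power2_eq_square algebra_simps)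
      moreover have "0 \<le> 4 * \<epsilon> * (y$0 + y$1)" using e y by (intro mult_nonneg_nonneg) auto
      moreover have "0 < 4 * \<epsilon>^2" using e by simp
      moreover have "0 \<le> sq y" using y by simp
      ultimately have "sq (Y n) > 0" by linarith
      thus ?thesis using c e y by (auto simp: C1plus_def bil_e2)
    qed
    moreover have "Y \<longlonglongrightarrow> y"
    proof (rule vec_tendstoI)
      fix i
      have "(\<lambda>n. y$i + (1 / real (Suc n)) * (e2 + f2)$i) \<longlonglongrightarrow> y$i + 0 * (e2 + f2)$i"
        by (intro tendsto_intros LIMSEQ_Suc[OF lim_1_over_n])
      moreover have "Y n $ i = y$i + (1 / real (Suc n)) * (e2 + f2)$i" for n
        unfolding Y_def by (simp only: vector_add_component vector_smult_component)
      ultimately show "(\<lambda>n. Y n $ i) \<longlonglongrightarrow> y $ i" by simp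
    qed
    ultimately show "y \<in> closure C1plus" unfolding closure_sequential by blast
  qed
qed

lemma Qf_eq_0:
  assumes "u \<in> Lam8" "Qf u = 0" shows "u = 0"
proof -
  have "usq u = 0" using usq_eq_Qf[OF assms(1)] assms(2) by simp
  hence "\<forall>j\<in>UNIV. (u$j)^2 = 0" unfolding usq_def by (subst (asm) sum_nonneg_eq_0_iff) auto
  thus ?thesis by (simp add: vec_eq_iff)
qed

lemma sq_lift: "sq (lift l :: real ^ 12) = of_int (sq l)"
  by (simp add: sq_def bil_def lift_def)

lemma Ev_eq_0_M1: "l \<in> M1 \<Longrightarrow> l$1 = 0 \<Longrightarrow> Ev l = 0 \<Longrightarrow> l = l$0 *s e2"
  by (rule Ev_inj) (simp_all add: M1_def bv_def Ev_def vec_eq_iff)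

lemma Ev_eq_0_M2: "l \<in> M2 \<Longrightarrow> l$3 = 0 \<Longrightarrow> Ev l = 0 \<Longrightarrow> l = l$2 *s e1"
  by (rule Ev_inj) (simp_all add: M2_def bv_def Ev_def vec_eq_iff)

text \<open>At level zero a vector of the closed cone has no E8 part, so it is a multiple of
  \<open>e2\<close>.\<close>

theorem index_set_1:
  "{l \<in> M1. l \<noteq> 0 \<and> lift l \<in> closure C1plus} =
     {l \<in> M1. l$1 \<ge> 1 \<and> lift l \<in> closure C1plus} \<union> range (\<lambda>k::nat. int (Suc k) *s e2)" (is "?X = ?A \<union> ?B")
proof
  show "?X \<subseteq> ?A \<union> ?B"
  proof
    fix l assume l: "l \<in> ?X"
    hence "sq (lift l :: real ^ 12) \<ge> 0" by (simp add: closure_C1plus)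
    hence "sq l \<ge> 0" by (simp add: sq_lift)
    moreover have "l$0 \<ge> 0" "l$1 \<ge> 0" "l \<in> M1" "l \<noteq> 0"
      using l by (simp_all add: closure_C1plus) (simp_all add: lift_def)
    ultimately have c: "sq l \<ge> 0" "l$0 \<ge> 0" "l$1 \<ge> 0" "l \<in> M1" "l \<noteq> 0" .
    show "l \<in> ?A \<union> ?B"
    proof (cases "l$1 \<ge> 1")
      case False
      hence 1: "l$1 = 0" using c(3) by simp
      hence "Qf (Ev l) \<le> 0" using c(1) unfolding sq_M1[OF c(4)] by simp
      hence "Ev l = 0" using Qf_nonneg[of "Ev l"] by (intro Qf_eq_0 Ev_in_Lam8) simp
      hence e: "l = l$0 *s e2" using Ev_eq_0_M1[OF c(4) 1] by simp
      hence "l$0 \<noteq> 0" using c(5) by auto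
      hence "l$0 = int (Suc (nat (l$0 - 1)))" using c(2) by simp
      hence "l = int (Suc (nat (l$0 - 1))) *s e2" using e by simp
      thus ?thesis by blast
    qed (use l in simp)
  qed
  have "int (Suc k) *s e2 \<in> ?X" for k
  proof -
    have v: "(int (Suc k) *s e2) $ 0 = int (Suc k)" "(int (Suc k) *s e2) $ 1 = 0" "(int (Suc k) *s e2 :: int ^ 12) \<in> M1"
      "Ev (int (Suc k) *s e2) = 0"
      by (simp_all add: bv_def M1_def Ev_def vec_eq_iff)
    have "sq (int (Suc k) *s e2) = 0" unfolding sq_M1[OF v(3)] v by (simp add: Qf_def usq_def)
    moreover have "(int (Suc k) *s e2 :: int ^ 12) \<noteq> 0" using v(1) by (metis of_nat_eq_0_iff old.nat.distinct(2) zero_index)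
    ultimately show ?thesis unfolding closure_C1plus using v(3) by (simp add: sq_lift) (simp add: lift_def M1R_def bv_def)
  qed
  thus "?A \<union> ?B \<subseteq> ?X" by auto
qed

lemma bil_M2R_Lr: "l \<in> M2 \<Longrightarrow> y \<in> M2R \<Longrightarrow> bil (lift l) y = Lr (y$3) (y$2) (Ev y) (co2 l)"
  by (simp add: bil_M2R Lr_def co2_def)

lemma lift_uminus: "lift (- l) = - lift l"
  by (simp add: lift_def vec_eq_iff)

lemma bil_uminus: "bil (- v) w = - bil v w"
  by (simp add: bil_def sum_negf)

text \<open>Vectors of nonnegative square and positive level are positive on the whole cone. A root
  does not vanish on the connected chamber, so its sign is constant there; it is decided at the
  limit point \<open>e1\<close>, where the pairing equals the level.\<close>

lemma weyl_chamber_positive: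
  assumes W: "weyl_chamber W" and e: "(e1 :: real ^ 12) \<in> closure W"
    and l: "l \<in> M2" "sq l \<ge> - 2" "l$3 \<ge> 1" and y: "y \<in> W"
  shows "bil (lift l) y > (0 :: real)"
proof -
  have W': "W \<subseteq> C2plus - (\<Union>l\<in>roots_M2. {y. bil (lift l) y = 0})" "connected W"
    using W unfolding weyl_chamber_def by (auto dest: in_components_subset in_components_connected)
  have q: "sq l = 2 * (l$2 * l$3 - Qf (Ev l))" using sq_M2[OF l(1)] by simp
  show ?thesis
  proof (cases "l$2 * l$3 - Qf (Ev l) \<ge> 0")
    case True
    have "y \<in> C2plus" using y W' by auto
    note y' = C2plusD[OF this]
    have S: "2 * y$3 * y$2 - norm (Ev y) ^ 2 / 2 > 0" using y'(2) unfolding sq_M2R[OF y'(1)] by (simp add: mult_ac)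
    obtain \<eta> where \<eta>: "\<eta> > 0" "\<And>a b u. u \<in> Lam8 \<Longrightarrow> a \<ge> 0 \<Longrightarrow> b \<ge> 0 \<Longrightarrow> Qf u \<le> a * b \<Longrightarrow>
        Lr (y$3) (y$2) (Ev y) (a, b, u) \<ge> sqrt (2 * (2 * y$3 * y$2 - norm (Ev y) ^ 2 / 2) * of_int (a * b - Qf u))
        \<and> Lr (y$3) (y$2) (Ev y) (a, b, u) \<ge> \<eta> * (of_int a + of_int b + (\<Sum>j\<in>UNIV. \<bar>of_int (u $ j)\<bar>))"
      using Lr_cone[OF y'(3,4) S] by blast
    have "0 \<le> l$2 * l$3" using True Qf_nonneg[of "Ev l"] by linarith
    hence a: "l$2 \<ge> 0" using l(3) by (simp add: zero_le_mult_iff)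
    have "Lr (y$3) (y$2) (Ev y) (l$2, l$3, Ev l) \<ge> \<eta> * (of_int (l$2) + of_int (l$3) + (\<Sum>j\<in>UNIV. \<bar>of_int (Ev l $ j)\<bar>))"
      using \<eta>(2)[OF Ev_in_Lam8 a _ , of "l$3" l] l(3) True by simp
    moreover have "\<eta> * (of_int (l$2) + of_int (l$3) + (\<Sum>j\<in>UNIV. \<bar>of_int (Ev l $ j)\<bar>)) > 0" using \<eta>(1) a l(3) by (intro mult_pos_pos add_pos_nonneg add_nonneg_pos sum_nonneg) auto
    ultimately show ?thesis unfolding bil_M2R_Lr[OF l(1) y'(1)] co2_def by linarith
  next
    case False
    moreover define m where "m = l$2 * l$3 - Qf (Ev l)"
    ultimately have "m < 0" "sq l = 2 * m" using q by simp_all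
    \<comment> \<open>Squares in \<open>M2\<close> are even, so -2 is the only negative value
      allowed.\<close>
    hence "sq l = - 2" using l(2) by linarith
    hence r: "l \<in> roots_M2" using l(1) by (simp add: roots_M2_def)
    let ?f = "\<lambda>y :: real ^ 12. bil (lift l) y"
    have nz: "?f x \<noteq> 0" if "x \<in> W" for x using that W' r by blast
    have conn: "connected (?f ` W)" by (intro connected_continuous_image continuous_intros W')
    show ?thesis
    proof (rule ccontr)
      assume "\<not> ?f y > 0"
      hence neg: "?f y < 0" using nz[OF y] by simp
      have "?f x \<le> 0" if x: "x \<in> W" for x
      proof (rule ccontr)
        assume "\<not> ?f x \<le> 0"
        hence "0 \<in> ?f ` W" using connectedD_interval[OF conn, of "?f y" "?f x" 0] neg x y by auto
        thus False using nz by auto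
      qed
      hence "W \<subseteq> {x. ?f x \<le> 0}" by auto
      moreover have "closed {x. ?f x \<le> 0}" by (intro closed_Collect_le continuous_intros)
      ultimately have "closure W \<subseteq> {x. ?f x \<le> 0}" by (rule closure_minimal)
      hence "?f e1 \<le> 0" using e by blast
      moreover have "?f e1 = of_int (l$3)"
        unfolding bil_expand by (simp add: bv_def lift_def)
      ultimately show False using l(3) by simp
    qed
  qed
qed

text \<open>No root is orthogonal to \<open>e1\<close>: at level zero Qf <= 1, and Qf is even, so
  only multiples of \<open>e1\<close> are left. Elsewhere the sign of the level decides, and every
  chamber with \<open>e1\<close> in its closure has the same index set.\<close>

theorem index_set_2:
  assumes W: "weyl_chamber W" and e: "(e1 :: real ^ 12) \<in> closure W"
  shows "{l \<in> M2. (\<forall>y\<in>W. bil (lift l) y > (0::real)) \<and> sq l \<ge> -2} =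
     {l \<in> M2. l$3 \<ge> 1 \<and> sq l \<ge> - 2} \<union> range (\<lambda>k::nat. int (Suc k) *s e1)" (is "?X = ?A \<union> ?B")
proof -
  have "W \<noteq> {}" and W': "W \<subseteq> C2plus"
    using W unfolding weyl_chamber_def by (auto dest: in_components_nonempty in_components_subset)
  then obtain y0 where y0: "y0 \<in> W" by blast
  have C: "y \<in> M2R" "y$3 > 0" if "y \<in> W" for y using C2plusD that W' by blast+
  show ?thesis
  proof
    show "?A \<union> ?B \<subseteq> ?X"
    proof (intro Un_least subsetI)
      fix l assume "l \<in> ?A" thus "l \<in> ?X" using weyl_chamber_positive[OF W e] by simp
    next
      fix l assume "l \<in> ?B"
      then obtain k where k: "l = int (Suc k) *s e1" by blast
      have v: "l$2 = int (Suc k)" "l$3 = 0" "l \<in> M2" "Ev l = 0"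
        unfolding k by (simp_all add: bv_def M2_def Ev_def vec_eq_iff)
      have "sq l = 0" unfolding sq_M2[OF v(3)] v by (simp add: Qf_def usq_def)
      moreover have "bil (lift l) y > 0" if "y \<in> W" for y :: "real ^ 12"
        unfolding bil_M2R[OF v(3) C(1)[OF that]] v using C(2)[OF that] by (simp add: ru_def inner_vec_def)
      ultimately show "l \<in> ?X" using v(3) by simp
    qed
    show "?X \<subseteq> ?A \<union> ?B"
    proof
      fix l assume l: "l \<in> ?X"
      hence l': "l \<in> M2" "sq l \<ge> - 2" "bil (lift l) y0 > 0" using y0 by auto
      consider "l$3 \<ge> 1" | "l$3 \<le> - 1" | "l$3 = 0" by linarith
      thus "l \<in> ?A \<union> ?B"
      proof cases
        case 2
        have "- l \<in> M2" "sq (- l) \<ge> - 2" "(- l)$3 \<ge> 1"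
          using l' 2 by (simp_all add: M2_def sq_def bil_def)
        hence "bil (lift (- l)) y0 > 0" by (rule weyl_chamber_positive[OF W e _ _ _ y0])
        thus ?thesis using l'(3) by (simp add: lift_uminus bil_uminus)
      next
        case 3
        have "Qf (Ev l) \<le> 1" using l'(2) 3 unfolding sq_M2[OF l'(1)] by simp
        hence "Qf (Ev l) = 0" using even_Qf[OF Ev_in_Lam8, of l] Qf_nonneg[of "Ev l"]
          by (cases "Qf (Ev l) = 1") auto
        hence 0: "Ev l = 0" by (intro Qf_eq_0 Ev_in_Lam8)
        hence le: "l = l$2 *s e1" using Ev_eq_0_M2[OF l'(1) 3] by simp
        have "of_int (l$2) * y0$3 > 0"
          using l'(3) unfolding bil_M2R[OF l'(1) C(1)[OF y0]] 3 0 by (simp add: ru_def inner_vec_def)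
        hence "l$2 > 0" using C(2)[OF y0] by (simp add: zero_less_mult_iff)
        hence "l$2 = int (Suc (nat (l$2 - 1)))" by simp
        hence "l = int (Suc (nat (l$2 - 1))) *s e1" using le by simp
        thus ?thesis by blast
      qed (use l' in simp)
    qed
  qed
qed

section \<open>Analytic continuation of the product\<close>

lemma has_uprod_neutral:
  assumes "has_uprod f S P" "T \<subseteq> S" "\<And>x. x \<in> S - T \<Longrightarrow> f x = 1"
  shows "has_uprod f T P"
  unfolding has_uprod_def
proof (rule topological_tendstoI)
  fix U assume U: "open U" "P \<in> U"
  have "\<forall>\<^sub>F Y in finite_subsets_at_top S. prod f Y \<in> U"
    by (rule topological_tendstoD[OF assms(1)[unfolded has_uprod_def] U])
  then obtain X where X: "finite X" "X \<subseteq> S" "\<And>Y. finite Y \<Longrightarrow> X \<subseteq> Y \<Longrightarrow> Y \<subseteq> S \<Longrightarrow> prod f Y \<in> U"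
    unfolding eventually_finite_subsets_at_top by (elim exE conjE) simp
  have "prod f Y \<in> U" if Y: "finite Y" "X \<inter> T \<subseteq> Y" "Y \<subseteq> T" for Y
  proof -
    have "prod f (Y \<union> (X - T)) \<in> U" using Y X(1,2) assms(2) by (intro X(3)) auto
    moreover have "prod f (Y \<union> (X - T)) = prod f Y"
      using Y X(1,2) assms(3) by (intro prod.mono_neutral_right) auto
    ultimately show ?thesis by simp
  qed
  thus "\<forall>\<^sub>F Y in finite_subsets_at_top T. prod f Y \<in> U"
    unfolding eventually_finite_subsets_at_top using X(1) by (intro exI[of _ "X \<inter> T"] conjI allI impI) simp_all
qed

text \<open>It isolates the finitely many factors for which no logarithm is at hand.\<close>

lemma summable_finite_large:
  fixes f :: "'a \<Rightarrow> real"
  assumes f: "f summable_on A" "\<And>x. x \<in> A \<Longrightarrow> f x \<ge> 0" and c: "c > 0"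
  shows "finite {x \<in> A. f x > c}"
proof (rule ccontr)
  assume inf: "infinite {x \<in> A. f x > c}"
  obtain n :: nat where n: "real n * c > infsum f A" using reals_Archimedean3[OF c] by blast
  obtain B where B: "B \<subseteq> {x \<in> A. f x > c}" "finite B" "card B = n"
    using infinite_arbitrarily_large[OF inf] by blast
  have "real n * c = (\<Sum>x\<in>B. c)" using B by simp
  also have "\<dots> \<le> sum f B" using B by (intro sum_mono) auto
  also have "\<dots> \<le> infsum f A" using B f by (intro finite_sum_le_infsum) auto
  finally show False using n by simp
qed

section \<open>Holomorphy of the second product along a translation\<close>

definition Im8 :: "complex ^ 8 \<Rightarrow> real ^ 8" where "Im8 \<omega> = (\<chi> j. Im (\<omega> $ j))"

lemma Im_udot: "Im (udot y \<omega>) = ru y \<bullet> Im8 \<omega>"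
  by (simp add: udot_def ru_def Im8_def inner_vec_def)

lemma norm_u2: "norm (u2 \<tau> \<sigma> \<omega> x) = exp (- (2 * pi) * Lr (Im \<tau>) (Im \<sigma>) (Im8 \<omega>) x)"
proof -
  obtain a b y where x: "x = (a, b, y)" by (cases x)
  have "Im (of_int a * \<tau> + of_int b * \<sigma> - udot y \<omega> / 2) = Lr (Im \<tau>) (Im \<sigma>) (Im8 \<omega>) x"
    by (simp add: x Lr_def Im_udot)
  moreover have "Re (2 * pi * \<i> * c) = - (2 * pi) * Im c" for c by simp
  ultimately show ?thesis unfolding x u2_def prod.case norm_exp_eq_Re by (simp only:)
qed

lemma norm_u1: "norm (u1 \<tau> \<sigma> \<xi> (a, n, y)) = exp (- pi * Lr (Im \<tau>) (Im \<sigma> / 2) (Im8 \<xi>) (a, 2 * n, y))"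
proof -
  have "Im (of_int a * \<tau> + of_int n * \<sigma> - udot y \<xi> / 2) = Lr (Im \<tau>) (Im \<sigma> / 2) (Im8 \<xi>) (a, 2 * n, y)"
    by (simp add: Lr_def Im_udot)
  moreover have "Re (pi * \<i> * c) = - pi * Im c" for c by simp
  ultimately show ?thesis unfolding u1_def prod.case norm_exp_eq_Re by (simp only:)
qed

lemma Lr_shift: "Lr A (B + s) h (a, b, y) = Lr A B h (a, b, y) + of_int b * s"
  by (simp add: Lr_def algebra_simps)

text \<open>The pairing is at least -A, and raising B by s adds b s >= A + 1 at positive level, so
  it becomes at least 1.\<close>

lemma exp_Lr_small:
  assumes A: "A > 0" "B > 0" and S: "2 * A * B - norm h ^ 2 / 2 > 0"
    and x: "x \<in> Lvl" "cl x \<noteq> 0" and s: "s \<ge> A + 1" and \<kappa>: "\<kappa> \<ge> 1"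
  shows "exp (- \<kappa> * Lr A (B + s) h x) \<le> 1/2"
proof -
  obtain a b y where xe: "x = (a, b, y)" by (cases x)
  have "Lr A B h (a, b, y) \<ge> - A"
    using x cl_nonzero_imp[of a b y] unfolding xe by (intro Lr_ge[OF A S]) auto
  moreover have "of_int b * s \<ge> 1 * s" using x s A unfolding xe Lvl_def by (intro mult_right_mono) auto
  ultimately have L: "Lr A (B + s) h x \<ge> 1" unfolding xe Lr_shift using s by linarith
  have "1 * 1 \<le> \<kappa> * Lr A (B + s) h x" using L \<kappa> by (intro mult_mono) auto
  hence "exp (- \<kappa> * Lr A (B + s) h x) \<le> exp (- 1)" by simp
  also have "\<dots> \<le> 1/2" using exp_ge_add_one_self[of 1] by (simp add: exp_minus field_simps)
  finally show ?thesis .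
qed

text \<open>For a root a b = Qf y - 1 is odd, hence a and b are odd, the sign is 1 and so is the
  coefficient. The only factors that may have |u| >= 1 therefore occur with exponent 1.\<close>

lemma cl_pos_sign:
  assumes "x \<in> Lvl" "cl x \<noteq> 0"
  shows "sg x * cl x = 1 \<or> (\<exists>a b y. x = (a, b, y) \<and> y \<in> Lam8 \<and> a \<ge> 0 \<and> b \<ge> 1 \<and> Qf y \<le> a * b)"
proof -
  obtain a b y where x: "x = (a, b, y)" by (cases x)
  have b: "b \<ge> 1" "y \<in> Lam8" using assms(1) by (auto simp: x Lvl_def)
  have q: "Qf y \<le> a * b + 1" using assms(2) unfolding x by (rule cl_nonzero_imp)
  show ?thesis
  proof (cases "Qf y = a * b + 1")
    case True
    hence "odd (a * b)" using even_Qf[OF b(2)] by simp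
    hence "sg x = 1" by (simp add: x sg_def)
    moreover have "a * b - Qf y = - 1" using True by simp
    hence "cl x = 1" by (simp add: x cl_def cc_minus_one)
    ultimately show ?thesis by simp
  next
    case False
    hence q: "Qf y \<le> a * b" using q by simp
    hence "0 \<le> a * b" using Qf_nonneg[of y] by linarith
    hence "a \<ge> 0" using b(1) by (simp add: zero_le_mult_iff)
    thus ?thesis using x b q by blast
  qed
qed

lemma powi_eq_exp_Ln:
  assumes "z \<noteq> (0 :: complex)"
  shows "z powi n = exp (of_int n * Ln z)"
  using assms by (simp add: exp_power_int[symmetric])

text \<open>The majorant is taken on the lower edge Im t = -\<delta>, where the square of the
  imaginary part still reaches the threshold 2. Finitely many large factors are multiplied directly,
  the others through a uniformly convergent sum of logarithms. Zeros of root factors do no harm,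
  since their exponent is 1.\<close>

theorem second_product_holomorphic:
  assumes A: "Im \<tau> > 0" and B: "Im \<sigma> - \<delta> > 0"
    and S: "2 * Im \<tau> * (Im \<sigma> - \<delta>) - norm (Im8 \<omega>) ^ 2 / 2 \<ge> 2"
  shows "\<exists>V. V holomorphic_on {t. Im t > - \<delta>} \<and>
    (\<forall>t. Im t > - \<delta> \<longrightarrow> has_uprod (\<lambda>x. (1 - u2 \<tau> (\<sigma> + t) \<omega> x) powi (sg x * cl x)) Lvl (V t))"
proof -
  define H where "H = {t. Im t > - \<delta>}"
  have H: "open H" unfolding H_def by (rule open_halfspace_Im_gt)
  define h where "h = Im8 \<omega>"
  define M where "M x = exp (- (2 * pi) * Lr (Im \<tau>) (Im \<sigma> - \<delta>) h x)" for x
  define U where "U t = u2 \<tau> (\<sigma> + t) \<omega>" for t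
  have S0: "2 * Im \<tau> * (Im \<sigma> - \<delta>) - norm h ^ 2 / 2 > 0" using S unfolding h_def by linarith
  have sM: "(\<lambda>x. of_int (cl x) * M x) summable_on Lvl"
    unfolding M_def
  proof (rule summable_cl_exp[OF A B S0])
    have "sqrt (2 * (2 * Im \<tau> * (Im \<sigma> - \<delta>) - norm h ^ 2 / 2)) \<ge> 2"
      using S unfolding h_def by (intro real_le_rsqrt) (simp add: power2_eq_square)
    hence "2 * pi * 2 \<le> 2 * pi * sqrt (2 * (2 * Im \<tau> * (Im \<sigma> - \<delta>) - norm h ^ 2 / 2))" by (intro mult_left_mono) auto
    thus "4 * pi \<le> 2 * pi * sqrt (2 * (2 * Im \<tau> * (Im \<sigma> - \<delta>) - norm h ^ 2 / 2))" by simp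
  qed simp
  have UM: "norm (U t x) \<le> M x" if t: "t \<in> H" and x: "x \<in> Lvl" for t x
  proof -
    obtain a b y where xe: "x = (a, b, y)" by (cases x)
    have "Im \<sigma> + Im t = (Im \<sigma> - \<delta>) + (Im t + \<delta>)" by simp
    hence "Lr (Im \<tau>) (Im (\<sigma> + t)) h x = Lr (Im \<tau>) (Im \<sigma> - \<delta>) h x + of_int b * (Im t + \<delta>)"
      unfolding xe by (simp only: Lr_shift plus_complex.sel)
    moreover have "of_int b * (Im t + \<delta>) \<ge> 0" using t x by (intro mult_nonneg_nonneg) (auto simp: xe Lvl_def H_def)
    ultimately have "Lr (Im \<tau>) (Im (\<sigma> + t)) h x \<ge> Lr (Im \<tau>) (Im \<sigma> - \<delta>) h x" by linarith
    thus ?thesis unfolding U_def norm_u2 M_def h_def[symmetric] by simp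
  qed
  \<comment> \<open>A nonzero coefficient is at least 1, so outside \<open>F0\<close> the majorant
    is at most 1/4 wherever a factor matters.\<close>
  define F0 where "F0 = {x \<in> Lvl. of_int (cl x) * M x > 1/4}"
  have F0: "finite F0" "F0 \<subseteq> Lvl"
    unfolding F0_def by (rule summable_finite_large[OF sM]) (auto simp: cl_nonneg M_def)
  have small: "norm (U t x) \<le> 1/4" if "t \<in> H" "x \<in> Lvl - F0" "cl x \<noteq> 0" for t x
  proof -
    have "cl x \<ge> 1" using cl_nonneg[of x] that(3) by linarith
    hence "1 * M x \<le> of_int (cl x) * M x" by (intro mult_right_mono) (auto simp: M_def)
    also have "\<dots> \<le> 1/4" using that(2) by (auto simp: F0_def)
    finally show ?thesis using UM[OF that(1), of x] that(2) by auto
  qed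
  have holU: "(\<lambda>t. U t x) holomorphic_on H" for x
    unfolding U_def u2_def by (cases x) (auto intro!: holomorphic_intros)
  \<comment> \<open>Exponents other than 0 and 1 belong to vectors of the closed cone, whose pairing
    with the imaginary part is positive, so |u| < 1.\<close>
  have M1: "1 - U t x \<noteq> 0" if x: "x \<in> Lvl" "cl x \<noteq> 0" "sg x * cl x \<noteq> 1" and t: "t \<in> H" for t x
  proof -
    obtain a b y where xe: "x = (a, b, y)" "y \<in> Lam8" "a \<ge> 0" "b \<ge> 1" "Qf y \<le> a * b"
      using cl_pos_sign[OF x(1,2)] x(3) by blast
    obtain \<eta> where \<eta>: "\<eta> > 0" "\<And>a b u. u \<in> Lam8 \<Longrightarrow> a \<ge> 0 \<Longrightarrow> b \<ge> 0 \<Longrightarrow> Qf u \<le> a * b \<Longrightarrow>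
        Lr (Im \<tau>) (Im \<sigma> - \<delta>) h (a, b, u) \<ge> sqrt (2 * (2 * Im \<tau> * (Im \<sigma> - \<delta>) - norm h ^ 2 / 2) * of_int (a * b - Qf u))
        \<and> Lr (Im \<tau>) (Im \<sigma> - \<delta>) h (a, b, u) \<ge> \<eta> * (of_int a + of_int b + (\<Sum>j\<in>UNIV. \<bar>of_int (u $ j)\<bar>))"
      using Lr_cone[OF A B S0] by blast
    have "Lr (Im \<tau>) (Im \<sigma> - \<delta>) h x \<ge> \<eta> * (of_int a + of_int b + (\<Sum>j\<in>UNIV. \<bar>of_int (y $ j)\<bar>))"
      using \<eta>(2)[of y a b] xe by simp
    moreover have "\<eta> * (of_int a + of_int b + (\<Sum>j\<in>UNIV. \<bar>of_int (y $ j)\<bar>)) > 0"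
      using \<eta>(1) xe by (intro mult_pos_pos add_pos_nonneg add_nonneg_pos sum_nonneg) auto
    ultimately have "Lr (Im \<tau>) (Im \<sigma> - \<delta>) h x > 0" by linarith
    hence "M x < 1" unfolding M_def by simp
    hence "norm (U t x) < 1" using UM[OF t x(1)] by linarith
    thus ?thesis by auto
  qed
  define G where "G x t = of_int (sg x * cl x) * Ln (1 - U t x)" for x t
  have Gb: "norm (G x t) \<le> 2 * (of_int (cl x) * M x)" if t: "t \<in> H" and x: "x \<in> Lvl - F0" for x t
  proof (cases "cl x = 0")
    case False
    have "norm (Ln (1 + - U t x)) \<le> 2 * norm (- U t x)" using small[OF t x False] by (intro norm_Ln_le) auto
    also have "\<dots> \<le> 2 * M x" using UM[OF t, of x] x by simp
    finally have "norm (Ln (1 - U t x)) \<le> 2 * M x" by simp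
    moreover have "norm (complex_of_int (sg x * cl x)) = of_int (cl x)"
      using cl_nonneg[of x] by (auto simp: sg_def norm_mult split: prod.splits)
    moreover have "real_of_int (cl x) \<ge> 0" using cl_nonneg[of x] by simp
    ultimately have "norm (G x t) \<le> of_int (cl x) * (2 * M x)"
      unfolding G_def norm_mult by (simp only:) (rule mult_left_mono)
    thus ?thesis by (simp only: mult_ac)
  qed (simp add: G_def)
  have sM2: "(\<lambda>x. 2 * (of_int (cl x) * M x)) summable_on (Lvl - F0)"
    using sM by (intro summable_on_cmult_right) (rule summable_on_subset, auto)
  define V where "V t = (\<Prod>x\<in>F0. (1 - U t x) powi (sg x * cl x)) * exp (infsum (\<lambda>x. G x t) (Lvl - F0))" for t
  have "V holomorphic_on H"
    unfolding V_def
  proof (intro holomorphic_on_mult holomorphic_on_prod)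
    fix x assume x: "x \<in> F0"
    show "(\<lambda>t. (1 - U t x) powi (sg x * cl x)) holomorphic_on H"
    proof (cases "cl x = 0 \<or> sg x * cl x = 1")
      case True
      thus ?thesis using holU[of x] by (auto intro!: holomorphic_intros)
    next
      case False
      have "1 - U t x \<noteq> 0" if "t \<in> H" for t using M1[of x t] x F0(2) False that by auto
      thus ?thesis using holU[of x] by (intro holomorphic_intros) auto
    qed
  next
    have "(\<lambda>t. infsum (\<lambda>x. G x t) (Lvl - F0)) holomorphic_on H"
    proof (rule holomorphic_on_infsum[OF H])
      fix x assume x: "x \<in> Lvl - F0"
      show "G x holomorphic_on H"
      proof (cases "cl x = 0")
        case True
        hence "G x = (\<lambda>_. 0)" by (simp add: G_def fun_eq_iff)
        thus ?thesis by simp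
      next
        case False
        have "1 - U t x \<notin> \<real>\<^sub>\<le>\<^sub>0" if "t \<in> H" for t
        proof
          assume "1 - U t x \<in> \<real>\<^sub>\<le>\<^sub>0"
          hence "Re (1 - U t x) \<le> 0" by (auto simp: complex_nonpos_Reals_iff)
          moreover have "Re (U t x) \<le> 1/4" using small[OF that x False] complex_Re_le_cmod[of "U t x"] by linarith
          ultimately show False by simp
        qed
        thus ?thesis unfolding G_def using holU[of x] by (intro holomorphic_intros) auto
      qed
    next
      fix t assume t: "t \<in> H"
      show "\<exists>r>0. \<exists>M. M summable_on Lvl - F0 \<and> (\<forall>x\<in>Lvl - F0. \<forall>w\<in>cball t r \<inter> H. norm (G x w) \<le> M x)"
        using sM2 Gb by (intro exI[of _ 1] conjI exI[of _ "\<lambda>x. 2 * (of_int (cl x) * M x)"]) auto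
    qed
    thus "(\<lambda>t. exp (infsum (\<lambda>x. G x t) (Lvl - F0))) holomorphic_on H" by (intro holomorphic_intros)
  qed
  moreover have "has_uprod (\<lambda>x. (1 - U t x) powi (sg x * cl x)) Lvl (V t)" if t: "t \<in> H" for t
  proof -
    have "(\<lambda>x. G x t) summable_on (Lvl - F0)"
      by (rule abs_summable_summable[OF Infinite_Sum.abs_summable_on_comparison_test'[OF sM2]]) (use Gb[OF t] in auto)
    hence "((\<lambda>x. G x t) has_sum infsum (\<lambda>x. G x t) (Lvl - F0)) (Lvl - F0)" by (rule has_sum_infsum)
    hence "has_uprod (\<lambda>x. (1 - U t x) powi (sg x * cl x)) (Lvl - F0) (exp (infsum (\<lambda>x. G x t) (Lvl - F0)))"
    proof (rule has_uprod_exp_sum)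
      fix x assume x: "x \<in> Lvl - F0"
      show "(1 - U t x) powi (sg x * cl x) = exp (G x t)"
      proof (cases "cl x = 0")
        case False
        have "1 - U t x \<noteq> 0" using small[OF t x False] by auto
        thus ?thesis unfolding G_def by (rule powi_eq_exp_Ln)
      qed (simp add: G_def)
    qed
    hence "has_uprod (\<lambda>x. (1 - U t x) powi (sg x * cl x)) (F0 \<union> (Lvl - F0)) (V t)"
      unfolding V_def by (intro has_uprod_Un has_uprod_finite F0) auto
    moreover have "F0 \<union> (Lvl - F0) = Lvl" using F0(2) by blast
    ultimately show ?thesis by simp
  qed
  ultimately show ?thesis unfolding H_def U_def by blast
qed

section \<open>The values of the two products\<close>

text \<open>\<open>M1\<close> contains no roots: they would require Qf y = 2 a n + 1, but Qf is
  even. At positive level a nonzero coefficient therefore puts the vector into the closed cone, and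
  the sum over \<open>Lvl\<close> is one over the index set. Level zero contributes the power of
  \<theta>4.\<close>

lemma first_product_value:
  assumes z: "z \<in> tube1"
    and s: "((\<lambda>x. of_int (cl1 x) * (Ln (1 - u1 (2 * z$1) (2 * z$0) (Ev z) x) - Ln (1 + u1 (2 * z$1) (2 * z$0) (Ev z) x))) has_sum S) Lvl"
    and half: "\<And>x. x \<in> Lvl \<Longrightarrow> cl1 x \<noteq> 0 \<Longrightarrow> norm (u1 (2 * z$1) (2 * z$0) (Ev z) x) \<le> 1/2"
  shows "has_uprod (\<lambda>l. ((1 - exp (pi * \<i> * bil (lift l) z)) / (1 + exp (pi * \<i> * bil (lift l) z))) powi cc (sq l div 2))
     {l \<in> M1. l \<noteq> 0 \<and> lift l \<in> closure C1plus} (th (2 * z$1) (1/2) ^ 8 * exp S)"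
proof -
  let ?u = "u1 (2 * z$1) (2 * z$0) (Ev z)"
  let ?f = "\<lambda>l. ((1 - exp (pi * \<i> * bil (lift l) z)) / (1 + exp (pi * \<i> * bil (lift l) z))) powi cc (sq l div 2)"
  define A where "A = {l \<in> M1. l$1 \<ge> 1 \<and> lift l \<in> closure C1plus}"
  have zM: "z \<in> M1C" using z by (simp add: tube1_def)
  have z1: "Im (2 * z$1) > 0" using z by (simp add: tube1_def C1plus_def bil_e2 Imv_def)
  have inj: "inj_on co1 A" using bij_co1 unfolding bij_betw_def A_def by (auto intro: inj_on_subset)
  have sub: "co1 ` A \<subseteq> Lvl" by (auto simp: A_def co1_def Lvl_def Ev_in_Lam8)
  have "((\<lambda>x. of_int (cl1 x) * (Ln (1 - ?u x) - Ln (1 + ?u x))) has_sum S) (co1 ` A)"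
  proof (rule has_sum_cong_neutral[THEN iffD1, OF _ _ _ s])
    fix x assume x: "x \<in> Lvl - co1 ` A"
    obtain a n u where xe: "x = (a, n, u)" by (cases x)
    have nu: "n \<ge> 1" "u \<in> Lam8" using x by (auto simp: xe Lvl_def)
    have "x \<in> co1 ` M1" using bij_co1 nu unfolding bij_betw_def xe by auto
    then obtain l where l: "l \<in> M1" "co1 l = x" by auto
    have lc: "l$0 = a" "l$1 = n" "Ev l = u" using l(2) by (simp_all add: co1_def xe)
    have "cl1 x = 0"
    proof (rule ccontr)
      assume "cl1 x \<noteq> 0"
      hence "Qf u \<le> a * (2 * n) + 1" unfolding xe cl1_def prod.case by (rule cl_nonzero_imp)
      moreover have "Qf u \<noteq> a * (2 * n) + 1" using even_Qf[OF nu(2)] by auto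
      ultimately have q: "Qf u \<le> 2 * (a * n)" by simp
      hence "0 \<le> a * n" using Qf_nonneg[of u] by linarith
      hence "a \<ge> 0" using nu(1) by (simp add: zero_le_mult_iff)
      moreover have "sq l \<ge> 0" unfolding sq_M1[OF l(1)] lc using q by simp
      ultimately have "lift l \<in> closure C1plus"
        unfolding closure_C1plus using l(1) lc nu(1) by (simp add: sq_lift) (simp add: lift_def M1_def M1R_def)
      hence "l \<in> A" using l lc nu by (simp add: A_def)
      thus False using x l(2) by blast
    qed
    thus "of_int (cl1 x) * (Ln (1 - ?u x) - Ln (1 + ?u x)) = 0" by simp
  qed (use sub in auto)
  hence "((\<lambda>l. of_int (cl1 (co1 l)) * (Ln (1 - ?u (co1 l)) - Ln (1 + ?u (co1 l)))) has_sum S) A"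
    unfolding has_sum_reindex[OF inj] by (simp add: o_def)
  hence A: "has_uprod ?f A (exp S)"
  proof (rule has_uprod_exp_sum)
    fix l assume l: "l \<in> A"
    hence lM: "l \<in> M1" and x: "co1 l \<in> Lvl" using sub by (auto simp: A_def)
    have u: "exp (pi * \<i> * bil (lift l) z) = ?u (co1 l)"
      unfolding bil_M1C[OF lM zM] u1_def co1_def prod.case by (rule arg_cong[of _ _ exp]) (simp add: algebra_simps)
    have "sq l div 2 = l$0 * (2 * l$1) - Qf (Ev l)" unfolding sq_M1[OF lM] by simp
    hence c: "cc (sq l div 2) = cl1 (co1 l)" by (simp add: cl1_def cl_def co1_def)
    show "?f l = exp (of_int (cl1 (co1 l)) * (Ln (1 - ?u (co1 l)) - Ln (1 + ?u (co1 l))))"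
    proof (cases "cl1 (co1 l) = 0")
      case False
      have n: "norm (?u (co1 l)) \<le> 1/2" by (rule half[OF x False])
      have "1 - ?u (co1 l) \<noteq> 0" using n by auto
      moreover have "1 + ?u (co1 l) \<noteq> 0"
      proof
        assume "1 + ?u (co1 l) = 0"
        hence "?u (co1 l) = - 1" by (simp add: add_eq_0_iff)
        thus False using n by simp
      qed
      ultimately have "(1 - ?u (co1 l)) / (1 + ?u (co1 l)) = exp (Ln (1 - ?u (co1 l)) - Ln (1 + ?u (co1 l)))"
        by (simp add: exp_diff)
      thus ?thesis unfolding u c by (simp only: exp_power_int)
    qed (simp add: u c)
  qed
  have B: "has_uprod ?f (range (\<lambda>k::nat. int (Suc k) *s e2)) (th (2 * z$1) (1/2) ^ 8)"
  proof (subst has_uprod_reindex)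
    show "inj (\<lambda>k::nat. int (Suc k) *s (e2 :: int ^ 12))"
      by (rule injI, drule arg_cong[of _ _ "\<lambda>v. v $ 0"]) (simp add: bv_def)
    have "?f (int (Suc k) *s e2) = ((1 - exp (pi * \<i> * of_nat (Suc k) * (2 * z$1))) / (1 + exp (pi * \<i> * of_nat (Suc k) * (2 * z$1)))) powi cc 0" for k
    proof -
      have v: "(int (Suc k) *s e2 :: int ^ 12) $ 0 = int (Suc k)" "(int (Suc k) *s e2 :: int ^ 12) $ 1 = 0"
        "(int (Suc k) *s e2 :: int ^ 12) \<in> M1" "Ev (int (Suc k) *s e2) = (0 :: int ^ 8)"
        by (simp_all add: bv_def M1_def Ev_def vec_eq_iff)
      have "sq (int (Suc k) *s e2 :: int ^ 12) = 0" unfolding sq_M1[OF v(3)] v by (simp add: Qf_def usq_def)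
      moreover have "bil (lift (int (Suc k) *s e2)) z = of_nat (Suc k) * (2 * z$1)"
        unfolding bil_M1C[OF v(3) zM] v by (simp add: udot_def)
      ultimately show ?thesis by (simp only: mult.assoc div_0)
    qed
    thus "has_uprod (\<lambda>k. ?f (int (Suc k) *s e2)) UNIV (th (2 * z$1) (1/2) ^ 8)"
      using has_uprod_isotropic_1[OF z1] by (simp only:)
  qed
  have "A \<inter> range (\<lambda>k::nat. int (Suc k) *s e2) = {}" by (auto simp: A_def bv_def)
  from has_uprod_Un[OF A B this] show ?thesis unfolding index_set_1 A_def by (simp only: mult.commute)
qed

text \<open>The multiples of \<open>e1\<close> together with the prefactor give the power of
  \<theta>2; elements of \<open>Lvl\<close> outside the index set have exponent 0.\<close>

lemma second_product_value:
  assumes W: "weyl_chamber W" and e: "(e1 :: real ^ 12) \<in> closure W" and w: "w \<in> tube2"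
    and V: "has_uprod (\<lambda>x. (1 - u2 (w$3) (w$2) (Ev w) x) powi (sg x * cl x)) Lvl V"
  shows "\<exists>P. has_uprod (\<lambda>l. (1 - exp (2 * pi * \<i> * bil (lift l) w)) powi ((if even (bil l (e1 - f1)) then 1 else -1) * cc (sq l div 2)))
      {l \<in> M2. (\<forall>y\<in>W. bil (lift l) y > (0::real)) \<and> sq l \<ge> -2} P
      \<and> 2 ^ 8 * exp (2 * pi * \<i> * bil e1 w) * P = th1 (w$3) 0 ^ 8 * V"
proof -
  let ?u = "u2 (w$3) (w$2) (Ev w)"
  let ?f = "\<lambda>l. (1 - exp (2 * pi * \<i> * bil (lift l) w)) powi ((if even (bil l (e1 - f1)) then 1 else -1) * cc (sq l div 2))"
  define A where "A = {l \<in> M2. l$3 \<ge> 1 \<and> sq l \<ge> - 2}"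
  note w' = tube2D[OF w]
  have inj: "inj_on co2 A" using bij_co2 unfolding bij_betw_def A_def by (auto intro: inj_on_subset)
  have sub: "co2 ` A \<subseteq> Lvl" by (auto simp: A_def co2_def Lvl_def Ev_in_Lam8)
  have "has_uprod (\<lambda>x. (1 - ?u x) powi (sg x * cl x)) (co2 ` A) V"
  proof (rule has_uprod_neutral[OF V sub])
    fix x assume x: "x \<in> Lvl - co2 ` A"
    obtain a b u where xe: "x = (a, b, u)" by (cases x)
    have bu: "b \<ge> 1" "u \<in> Lam8" using x by (auto simp: xe Lvl_def)
    have "x \<in> co2 ` M2" using bij_co2 bu unfolding bij_betw_def xe by auto
    then obtain l where l: "l \<in> M2" "co2 l = x" by auto
    have lc: "l$2 = a" "l$3 = b" "Ev l = u" using l(2) by (simp_all add: co2_def xe)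
    have "cl x = 0"
    proof (rule ccontr)
      assume "cl x \<noteq> 0"
      hence "Qf u \<le> a * b + 1" unfolding xe by (rule cl_nonzero_imp)
      hence "sq l \<ge> - 2" unfolding sq_M2[OF l(1)] lc by simp
      hence "l \<in> A" using l lc bu by (simp add: A_def)
      thus False using x l(2) by blast
    qed
    thus "(1 - ?u x) powi (sg x * cl x) = 1" by simp
  qed
  hence "has_uprod (\<lambda>l. (1 - ?u (co2 l)) powi (sg (co2 l) * cl (co2 l))) A V"
    unfolding has_uprod_reindex[OF inj] .
  moreover have "(1 - ?u (co2 l)) powi (sg (co2 l) * cl (co2 l)) = ?f l" if "l \<in> A" for l
  proof -
    have lM: "l \<in> M2" using that by (simp add: A_def)
    have u: "exp (2 * pi * \<i> * bil (lift l) w) = ?u (co2 l)"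
      unfolding bil_M2C[OF lM w'(1)] u2_def co2_def prod.case ..
    have "sq l div 2 = l$2 * l$3 - Qf (Ev l)" unfolding sq_M2[OF lM] by simp
    hence c: "cc (sq l div 2) = cl (co2 l)" by (simp add: cl_def co2_def)
    have "(if even (bil l (e1 - f1)) then 1 else - 1) = sg (co2 l)"
      unfolding bil_e1_f1 sg_def co2_def prod.case ..
    thus ?thesis unfolding u c by (simp only:)
  qed
  ultimately have A: "has_uprod ?f A V" by (subst (asm) has_uprod_cong) auto
  obtain P where P: "has_uprod (\<lambda>k::nat. (1 - exp (2 * pi * \<i> * of_nat (Suc k) * w$3)) powi ((if even (Suc k) then 1 else -1) * cc 0)) UNIV P"
    "2 ^ 8 * exp (2 * pi * \<i> * w$3) * P = th1 (w$3) 0 ^ 8"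
    using has_uprod_isotropic_2[OF w'(4)] by blast
  have B: "has_uprod ?f (range (\<lambda>k::nat. int (Suc k) *s e1)) P"
  proof (subst has_uprod_reindex)
    show "inj (\<lambda>k::nat. int (Suc k) *s (e1 :: int ^ 12))"
      by (rule injI, drule arg_cong[of _ _ "\<lambda>v. v $ 2"]) (simp add: bv_def)
    have "?f (int (Suc k) *s e1) = (1 - exp (2 * pi * \<i> * of_nat (Suc k) * w$3)) powi ((if even (Suc k) then 1 else -1) * cc 0)" for k
    proof -
      have v: "(int (Suc k) *s e1 :: int ^ 12) $ 2 = int (Suc k)" "(int (Suc k) *s e1 :: int ^ 12) $ 3 = 0"
        "(int (Suc k) *s e1 :: int ^ 12) \<in> M2" "Ev (int (Suc k) *s e1) = (0 :: int ^ 8)"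
        by (simp_all add: bv_def M2_def Ev_def vec_eq_iff)
      have "sq (int (Suc k) *s e1 :: int ^ 12) = 0" unfolding sq_M2[OF v(3)] v by (simp add: Qf_def usq_def)
      moreover have "bil (lift (int (Suc k) *s e1)) w = of_nat (Suc k) * w$3"
        unfolding bil_M2C[OF v(3) w'(1)] v by (simp add: udot_def)
      moreover have "even (bil (int (Suc k) *s e1) (e1 - f1) :: int) = even (Suc k)" unfolding bil_e1_f1 v by simp
      ultimately show ?thesis by (simp only: mult.assoc div_0)
    qed
    thus "has_uprod (\<lambda>k. ?f (int (Suc k) *s e1)) UNIV P" using P(1) by (simp only:)
  qed
  have "A \<inter> range (\<lambda>k::nat. int (Suc k) *s e1) = {}" by (auto simp: A_def bv_def)
  from has_uprod_Un[OF A B this] have "has_uprod ?f {l \<in> M2. (\<forall>y\<in>W. bil (lift l) y > (0::real)) \<and> sq l \<ge> -2} (V * P)"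
    unfolding index_set_2[OF W e] A_def .
  moreover have "2 ^ 8 * exp (2 * pi * \<i> * bil e1 w) * (V * P) = th1 (w$3) 0 ^ 8 * V"
    unfolding bil_e1 P(2)[symmetric] by (simp only: mult_ac)
  ultimately show ?thesis by blast
qed

section \<open>Translation along an isotropic vector and continuation\<close>

lemma tube2_translate:
  assumes "w \<in> tube2" "sq (Imv w) + 2 * Im t * Im (w$3) > 0"
  shows "w + t *s e1 \<in> tube2"
proof -
  have "w \<in> M2C" by (rule tube2D[OF assms(1)])
  moreover have "Im (w$3) > 0" by (rule tube2D[OF assms(1)])
  ultimately show ?thesis using assms(2) sq_Im_add_e1[of w t]
    by (simp add: tube2_def C2plus_def bil_e1) (simp add: M2C_def M2R_def Imv_def bv_def)
qed

text \<open>Affine in t because \<open>e2\<close> is isotropic, so that \<open>iota1\<close> moves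
  along a complex line and one-variable continuation applies.\<close>

lemma iota1_translate:
  assumes "z \<in> M1C"
  shows "iota1 (z + t *s e2) = iota1 z + t *s ((- 2 * z$1) *s e1 + e2)"
proof -
  have "z + t *s e2 \<in> M1C" using assms by (simp add: M1C_def bv_def)
  hence "sq (z + t *s e2) = sq z + 4 * t * z$1"
    using assms by (simp add: sq_M1C Ev_add_bv) (simp add: bv_def algebra_simps)
  thus ?thesis unfolding iota1_def vec_eq_iff
    by (simp add: algebra_simps add_divide_distrib)
qed

text \<open>Complex linearity of the derivative makes the restriction complex differentiable, not
  just real differentiable.\<close>

lemma holo_on_line:
  assumes "holo_on X f" and "open H" and X: "\<And>t. t \<in> H \<Longrightarrow> a + t *s v \<in> X"
  shows "(\<lambda>t. f (a + t *s v)) holomorphic_on H"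
  unfolding holomorphic_on_open[OF \<open>open H\<close>]
proof (intro ballI)
  fix t assume "t \<in> H"
  then obtain D where D: "(f has_derivative D) (at (a + t *s v))" "\<And>c v. D (c *s v) = c * D v"
    using assms(1) X unfolding holo_on_def by blast
  have "((\<lambda>t. a + t *s v) has_derivative (\<lambda>s. s *s v)) (at t)"
  proof -
    have l: "bounded_linear (\<lambda>s :: complex. s *s v)"
    proof (rule linear_conv_bounded_linear[THEN iffD1], rule linearI)
      fix b1 b2 :: complex show "(b1 + b2) *s v = b1 *s v + b2 *s v" by (rule vector_sadd_rdistrib)
    next
      fix r :: real and b :: complex show "(r *\<^sub>R b) *s v = r *\<^sub>R (b *s v)"
        by (simp add: vec_eq_iff)
    qed
    show ?thesis using has_derivative_add[OF has_derivative_const bounded_linear_imp_has_derivative[OF l], of a "at t"] by simp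
  qed
  from has_derivative_compose[OF this D(1)] have "((\<lambda>t. f (a + t *s v)) has_derivative (\<lambda>s. s * D v)) (at t)"
    by (simp add: D(2))
  moreover have "(\<lambda>s. s * D v) = (*) (D v)" by (simp add: fun_eq_iff mult.commute)
  ultimately show "\<exists>d. ((\<lambda>t. f (a + t *s v)) has_field_derivative d) (at t)"
    by (intro exI[of _ "D v"]) (simp add: has_field_derivative_def)
qed

lemma Ev_Imv_Im8: "Ev (Imv z) = Im8 (Ev z)"
  by (simp add: Im8_def vec_eq_iff Ev_Imv)

text \<open>The relations between the parameters in the shape that \<open>log_products_agree\<close>
  expects.\<close>

lemma zof_parameters:
  assumes w: "w \<in> tube2"
  defines "z \<equiv> zof w"
  shows "Im (2 * z$1) > 0" "w$3 = - 1 / (2 * z$1)" "Ev w = (- 1 / (2 * z$1)) *s Ev z"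
    "w$2 = (2 * z$0 - kap (Ev z) / (2 * (2 * z$1))) / 2"
proof -
  note w' = tube2D[OF w]
  have z1: "2 * z$1 = - 1 / w$3" and z0: "z$0 = sq w / (2 * w$3)" using w'(6) by (simp_all add: z_def zof_def)
  show "Im (2 * z$1) > 0" unfolding z1 by (rule Im_minus_inverse_pos[OF w'(4)])
  show "w$3 = - 1 / (2 * z$1)" unfolding z1 using w'(6) by simp
  show "Ev w = (- 1 / (2 * z$1)) *s Ev z" unfolding z1 unfolding z_def Ev_zof using w'(6) by (simp add: vec_eq_iff)
  have k: "kap (Ev z) = kap (Ev w) / (w$3) ^ 2"
    unfolding z_def Ev_zof kap_def by (simp add: power_divide sum_divide_distrib)
  show "w$2 = (2 * z$0 - kap (Ev z) / (2 * (2 * z$1))) / 2"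
    unfolding k z0 z1 sq_M2C[OF w'(1)] using w'(6) by (simp add: field_simps power2_eq_square)
qed

text \<open>The exponent carries pi instead of 2 pi, hence the threshold 8, as pi sqrt 16 = 4 pi.
  The family is the restriction to even levels of one that is summable over
  \<open>Lvl\<close>.\<close>

lemma summable_first_product:
  assumes z: "z \<in> tube1" and S: "sq (Imv z) \<ge> 8"
  shows "(\<lambda>x. of_int (cl1 x) * norm (u1 (2 * z$1) (2 * z$0) (Ev z) x)) summable_on Lvl"
proof -
  define y where "y = Imv z"
  have y: "y \<in> C1plus" using z by (simp add: tube1_def y_def)
  note y' = C1plusD[OF y]
  have yM: "y \<in> M1R" using y by (simp add: C1plus_def)
  have s: "2 * (2 * y$1) * y$0 - norm (Ev y) ^ 2 / 2 = sq y" unfolding sq_M1R[OF yM] by simp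
  have "sqrt (2 * sq y) \<ge> 4" using S unfolding y_def by (intro real_le_rsqrt) simp
  hence "pi * 4 \<le> pi * sqrt (2 * sq y)" by (intro mult_left_mono) auto
  hence sm: "(\<lambda>x. of_int (cl x) * exp (- pi * Lr (2 * y$1) (y$0) (Ev y) x)) summable_on Lvl"
    using y' by (intro summable_cl_exp) (simp_all only: s, auto)
  define d :: "int \<times> int \<times> (int ^ 8) \<Rightarrow> int \<times> int \<times> (int ^ 8)" where "d = (\<lambda>(a, n, u). (a, 2 * n, u))"
  have "d ` Lvl \<subseteq> Lvl" by (auto simp: d_def Lvl_def)
  hence "(\<lambda>x. of_int (cl x) * exp (- pi * Lr (2 * y$1) (y$0) (Ev y) x)) summable_on (d ` Lvl)"
    by (rule summable_on_subset[OF sm])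
  moreover have "inj_on d Lvl" by (auto simp: d_def inj_on_def)
  ultimately have "(\<lambda>x. of_int (cl (d x)) * exp (- pi * Lr (2 * y$1) (y$0) (Ev y) (d x))) summable_on Lvl"
    by (simp add: summable_on_reindex o_def)
  moreover have "of_int (cl1 x) * norm (u1 (2 * z$1) (2 * z$0) (Ev z) x) =
      of_int (cl (d x)) * exp (- pi * Lr (2 * y$1) (y$0) (Ev y) (d x))" for x
    unfolding y_def Ev_Imv_Im8 by (cases x) (simp add: norm_u1 cl1_def d_def Imv_def)
  ultimately show ?thesis by simp
qed

text \<open>Translating \<open>w\<close> by \<open>t e1\<close> translates the corresponding point of the other tube domain by
  \<open>t e2\<close>, so for large imaginary part of \<open>t\<close> both product expansions converge and can be compared.\<close>

theorem Phi_iota2_far: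
  fixes Phi :: "complex ^ 12 \<Rightarrow> complex"
  assumes hom: "\<And>Z c. Z \<in> OmegaCone \<Longrightarrow> c \<noteq> 0 \<Longrightarrow> Phi (c *s Z) = c powi (-4) * Phi Z"
    and prod: "\<And>z. z \<in> tube1 \<Longrightarrow> sq (Imv z) > R \<Longrightarrow> has_uprod
          (\<lambda>l. ((1 - exp (pi * \<i> * bil (lift l) z)) / (1 + exp (pi * \<i> * bil (lift l) z))) powi cc (sq l div 2))
          {l \<in> M1. l \<noteq> 0 \<and> lift l \<in> closure C1plus} (Phi (iota1 z))"
    and w0: "w0 \<in> tube2" and w: "w = w0 + t *s e1"
    and t: "Im t \<ge> Im (w0$3) + 1" "Im t \<ge> 2 * Im (zof w0 $ 1) + 1"
      "2 * Im t * Im (w0$3) \<ge> norm (w0$3) ^ 2 * (\<bar>R\<bar> + 8)"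
    and V: "has_uprod (\<lambda>x. (1 - u2 (w$3) (w$2) (Ev w) x) powi (sg x * cl x)) Lvl V"
    and s2: "(\<lambda>x. of_int (cl x) * norm (u2 (w$3) (w$2) (Ev w) x)) summable_on Lvl"
  shows "Phi (iota2 w) = th1 (w$3) 0 ^ 8 * V"
proof -
  note w0' = tube2D[OF w0]
  have Imt: "Im t > 0" using t(1) w0'(4) by linarith
  have "sq (Imv w0) + 2 * Im t * Im (w0$3) > 0"
    using w0'(3,4) Imt by (intro add_pos_pos mult_pos_pos) auto
  hence wt: "w \<in> tube2" unfolding w by (rule tube2_translate[OF w0])
  note w' = tube2D[OF wt]
  define z where "z = zof w"
  have zt: "z \<in> tube1" unfolding z_def by (rule zof_tube1[OF wt])
  note par = zof_parameters[OF wt, folded z_def]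
  have w3: "w$3 = w0$3" "w$2 = w0$2 + t" "Ev w = Ev w0" unfolding w Ev_add_bv by (simp_all add: bv_def)
  have zw: "z = zof w0 + t *s e2" unfolding z_def w by (rule zof_add[OF w0])
  have z3: "z$1 = zof w0 $ 1" "z$0 = zof w0 $ 0 + t" "Ev z = Ev (zof w0)" unfolding zw Ev_add_bv by (simp_all add: bv_def)
  have "sq (Imv z) = (sq (Imv w0) + 2 * Im t * Im (w0$3)) / norm (w0$3) ^ 2"
    unfolding z_def sq_Im_zof[OF wt] w3 unfolding w by (simp add: sq_Im_add_e1[OF w0'(1)])
  moreover have "norm (w0$3) ^ 2 * (\<bar>R\<bar> + 8) < sq (Imv w0) + 2 * Im t * Im (w0$3)" using t(3) w0'(3) by linarith
  \<comment> \<open>The part |R| is for the expansion of \<open>Phi\<close>, the part 8 for the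
    convergence of the first product.\<close>
  ultimately have Sz: "sq (Imv z) > \<bar>R\<bar> + 8" using w0'(6) by (simp add: pos_less_divide_eq mult.commute)
  have half1: "norm (u1 (2 * z$1) (2 * z$0) (Ev z) x) \<le> 1/2" if x: "x \<in> Lvl" "cl1 x \<noteq> 0" for x
  proof -
    obtain a n u where xe: "x = (a, n, u)" by (cases x)
    \<comment> \<open>The untranslated point is the base point; the translation supplies the margin
      Im t that makes the terms small.\<close>
    define y where "y = Imv (zof w0)"
    have y: "y \<in> C1plus" using zof_tube1[OF w0] by (simp add: tube1_def y_def)
    note y' = C1plusD[OF y]
    have yM: "y \<in> M1R" using y by (simp add: C1plus_def)
    have "2 * (2 * y$1) * y$0 - norm (Ev y) ^ 2 / 2 > 0" using y'(3) unfolding sq_M1R[OF yM] by (simp add: mult_ac)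
    hence "exp (- pi * Lr (2 * y$1) (y$0 + Im t) (Ev y) (a, 2 * n, u)) \<le> 1/2"
    proof (rule exp_Lr_small[rotated 2])
      show "(a, 2 * n, u) \<in> Lvl" using x(1) by (auto simp: xe Lvl_def)
      show "cl (a, 2 * n, u) \<noteq> 0" using x(2) by (simp add: xe cl1_def)
      show "2 * y$1 + 1 \<le> Im t" using t(2) by (simp add: y_def Imv_def)
      show "1 \<le> pi" using pi_gt3 by linarith
    qed (use y' in auto)
    moreover have "Im (2 * z$1) = 2 * y$1" "Im (2 * z$0) / 2 = y$0 + Im t" "Im8 (Ev z) = Ev y"
      unfolding z3 y_def Ev_Imv_Im8 by (simp_all add: Imv_def)
    ultimately show ?thesis unfolding xe norm_u1 by (simp only:)
  qed
  have half2: "norm (u2 (w$3) (w$2) (Ev w) x) \<le> 1/2" if x: "x \<in> Lvl" "cl x \<noteq> 0" for x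
  proof -
    define y where "y = Imv w0"
    have "2 * Im (w0$3) * Im (w0$2) - norm (Im8 (Ev w0)) ^ 2 / 2 > 0"
      using w0'(3) unfolding sq_M2R[OF w0'(2)] Ev_Imv_Im8 by (simp add: Imv_def mult_ac)
    hence "exp (- (2 * pi) * Lr (Im (w0$3)) (Im (w0$2) + Im t) (Im8 (Ev w0)) x) \<le> 1/2"
      using x t(1) w0' pi_gt3 by (intro exp_Lr_small) auto
    thus ?thesis unfolding norm_u2 w3 plus_complex.sel .
  qed
  have s1: "(\<lambda>x. of_int (cl1 x) * norm (u1 (2 * z$1) (2 * z$0) (Ev z) x)) summable_on Lvl"
    using Sz by (intro summable_first_product[OF zt]) linarith
  obtain S where S: "((\<lambda>x. of_int (cl1 x) * (Ln (1 - u1 (2 * z$1) (2 * z$0) (Ev z) x) - Ln (1 + u1 (2 * z$1) (2 * z$0) (Ev z) x))) has_sum S) Lvl"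
     "((\<lambda>x. of_int (sg x * cl x) * Ln (1 - u2 (w$3) (w$2) (Ev w) x)) has_sum S) Lvl"
    using log_products_agree[OF par s1 half1 s2 half2] by blast
  have "has_uprod (\<lambda>x. (1 - u2 (w$3) (w$2) (Ev w) x) powi (sg x * cl x)) Lvl (exp S)"
    using S(2)
  proof (rule has_uprod_exp_sum)
    fix x assume x: "x \<in> Lvl"
    show "(1 - u2 (w$3) (w$2) (Ev w) x) powi (sg x * cl x) = exp (of_int (sg x * cl x) * Ln (1 - u2 (w$3) (w$2) (Ev w) x))"
    proof (cases "cl x = 0")
      case False
      have "1 - u2 (w$3) (w$2) (Ev w) x \<noteq> 0" using half2[OF x False] by auto
      thus ?thesis by (rule powi_eq_exp_Ln)
    qed simp
  qed
  hence VS: "V = exp S" using V has_uprod_unique by blast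
  have "Phi (iota1 z) = th (2 * z$1) (1/2) ^ 8 * exp S"
    using Sz by (intro has_uprod_unique[OF prod[OF zt] first_product_value[OF zt S(1) half1]]) auto
  moreover have "2 * z$1 = - 1 / w$3" using w'(6) by (simp add: z_def zof_def)
  moreover have "iota1 z \<in> OmegaCone"
    unfolding OmegaCone_def using zt by (intro CollectI exI[of _ 1] exI[of _ z]) simp
  hence "Phi (iota2 w) = (- (w$3)) powi (-4) * Phi (iota1 z)"
    unfolding iota2_zof[OF wt] z_def[symmetric] using w'(6) by (intro hom) auto
  moreover have "(- (w$3)) powi (-4) = (w$3) powi (-4)" by (simp add: power_int_minus)
  ultimately have "Phi (iota2 w) = ((w$3) powi (-4) * th (- 1 / w$3) (1/2) ^ 8) * V"
    unfolding VS by (simp only: mult.assoc)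
  thus ?thesis unfolding theta_isotropic_ratio[OF w'(4)] .
qed

theorem theorem2p2:
  fixes Phi :: "complex ^ 12 \<Rightarrow> complex" and W :: "(real ^ 12) set"
  assumes "is_borcherds_Phi Phi"
    and "weyl_chamber W"
    and "(e1 :: real ^ 12) \<in> closure W"
  shows "\<exists>R. \<forall>w\<in>tube2. sq (Imv w) > R \<longrightarrow>
           (\<exists>P. has_uprod
                  (\<lambda>l. (1 - exp (2 * pi * \<i> * bil (lift l) w))
                         powi ((if even (bil l (e1 - f1)) then 1 else -1) * cc (sq l div 2)))
                  {l \<in> M2. (\<forall>y\<in>W. bil (lift l) y > (0::real)) \<and> sq l \<ge> -2}
                  P
              \<and> Phi (iota2 w) = 2^8 * exp (2 * pi * \<i> * bil e1 w) * P)"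
proof (rule exI[of _ 2], intro ballI impI)
  fix w assume w: "w \<in> tube2" and S: "sq (Imv w) > 2"
  note w' = tube2D[OF w]
  have holo: "holo_on OmegaCone Phi"
    and hom: "\<And>Z c. Z \<in> OmegaCone \<Longrightarrow> c \<noteq> 0 \<Longrightarrow> Phi (c *s Z) = c powi (-4) * Phi Z"
    using assms(1) unfolding is_borcherds_Phi_def by blast+
  obtain R where prod: "\<And>z. z \<in> tube1 \<Longrightarrow> sq (Imv z) > R \<Longrightarrow> has_uprod
          (\<lambda>l. ((1 - exp (pi * \<i> * bil (lift l) z)) / (1 + exp (pi * \<i> * bil (lift l) z))) powi cc (sq l div 2))
          {l \<in> M1. l \<noteq> 0 \<and> lift l \<in> closure C1plus} (Phi (iota1 z))"
    using assms(1) unfolding is_borcherds_Phi_def by blast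
  define A where "A = Im (w$3)"
  have A: "A > 0" using w'(4) by (simp add: A_def)
  \<comment> \<open>Translation by t changes (Im w)^2 by 2 A Im t, so \<delta> is how far w can move
    down before (Im w)^2 reaches 2.\<close>
  define \<delta> where "\<delta> = (sq (Imv w) - 2) / (2 * A)"
  have \<delta>: "\<delta> > 0" using S A by (simp add: \<delta>_def)
  have sqw: "2 * A * Im (w$2) - norm (Im8 (Ev w)) ^ 2 / 2 = sq (Imv w)"
    unfolding sq_M2R[OF w'(2)] Ev_Imv_Im8 A_def by (simp add: Imv_def mult_ac)
  have A\<delta>: "2 * A * \<delta> = sq (Imv w) - 2" using A by (simp add: \<delta>_def)
  have ge2: "2 * A * (Im (w$2) - \<delta>) - norm (Im8 (Ev w)) ^ 2 / 2 \<ge> 2"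
    using sqw A\<delta> by (simp add: algebra_simps)
  have "2 * A * (Im (w$2) - \<delta>) > 0" using ge2 zero_le_power2[of "norm (Im8 (Ev w))"] by linarith
  hence B: "Im (w$2) - \<delta> > 0" using A by (simp add: zero_less_mult_iff)
  define H where "H = {t. Im t > - \<delta>}"
  obtain V where V: "V holomorphic_on H"
    "\<And>t. t \<in> H \<Longrightarrow> has_uprod (\<lambda>x. (1 - u2 (w$3) (w$2 + t) (Ev w) x) powi (sg x * cl x)) Lvl (V t)"
    using second_product_holomorphic[OF w'(4) B ge2[unfolded A_def]] unfolding H_def by blast
  have Ht: "w + t *s e1 \<in> tube2" if "t \<in> H" for t
  proof (rule tube2_translate[OF w])
    have "2 * A * (Im t + \<delta>) > 0" using that A by (simp add: H_def)
    hence "2 * A * Im t + (sq (Imv w) - 2) > 0" using A\<delta> by (simp add: algebra_simps)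
    thus "sq (Imv w) + 2 * Im t * Im (w$3) > 0" unfolding A_def by (simp add: mult_ac)
  qed
  define L where "L t = Phi (iota2 (w + t *s e1))" for t
  define z where "z = zof w"
  have L: "L t = (- (w$3)) powi (-4) * Phi (iota1 z + t *s ((- 2 * z$1) *s e1 + e2))"
    and cone: "iota1 z + t *s ((- 2 * z$1) *s e1 + e2) \<in> OmegaCone" if t: "t \<in> H" for t
  proof -
    have z: "zof (w + t *s e1) = z + t *s e2" unfolding z_def by (rule zof_add[OF w])
    have i: "iota1 z + t *s ((- 2 * z$1) *s e1 + e2) = iota1 (z + t *s e2)"
      unfolding z_def by (rule iota1_translate[OF zof_M1C, symmetric])
    have "z + t *s e2 \<in> tube1" using zof_tube1[OF Ht[OF t]] unfolding z .
    hence c: "iota1 (z + t *s e2) \<in> OmegaCone"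
      unfolding OmegaCone_def by (intro CollectI exI[of _ 1] exI[of _ "z + t *s e2"]) simp
    thus "iota1 z + t *s ((- 2 * z$1) *s e1 + e2) \<in> OmegaCone" unfolding i .
    have w3: "(w + t *s e1)$3 = w$3" by (simp add: bv_def)
    thus "L t = (- (w$3)) powi (-4) * Phi (iota1 z + t *s ((- 2 * z$1) *s e1 + e2))"
      unfolding L_def iota2_zof[OF Ht[OF t]] z i w3 using hom[OF c, of "- (w$3)"] w'(6) by simp
  qed
  have openH: "open H" unfolding H_def by (rule open_halfspace_Im_gt)
  have "(\<lambda>t. (- (w$3)) powi (-4) * Phi (iota1 z + t *s ((- 2 * z$1) *s e1 + e2))) holomorphic_on H"
    by (intro holomorphic_on_mult holomorphic_on_const holo_on_line[OF holo openH] cone)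
  hence Lhol: "L holomorphic_on H" by (rule holomorphic_transform) (simp add: L)
  \<comment> \<open>Beyond T the terms of both products have modulus at most 1/2 wherever their
    coefficient is nonzero, and the given expansion of \<open>Phi\<close> is valid.\<close>
  define T where "T = Max {0, A + 1, 2 * Im (z$1) + 1, norm (w$3) ^ 2 * (\<bar>R\<bar> + 8) / (2 * A)}"
  have T: "0 \<le> T" "A + 1 \<le> T" "2 * Im (z$1) + 1 \<le> T" "norm (w$3) ^ 2 * (\<bar>R\<bar> + 8) / (2 * A) \<le> T"
    unfolding T_def by (rule Max_ge; simp)+
  have "L 0 = th1 (w$3) 0 ^ 8 * V 0"
  proof (rule analytic_continuation_open[of "{t. Im t > T}" H L "\<lambda>t. th1 (w$3) 0 ^ 8 * V t" 0])
    show "open {t. Im t > T}" by (rule open_halfspace_Im_gt)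
    have "\<i> * of_real (T + 1) \<in> {t. Im t > T}" by simp
    thus "{t. Im t > T} \<noteq> {}" by blast
    show "connected H" unfolding H_def by (intro convex_connected convex_halfspace_Im_gt)
    show sub: "{t. Im t > T} \<subseteq> H" using T(1) \<delta> by (auto simp: H_def)
    show "(\<lambda>t. th1 (w$3) 0 ^ 8 * V t) holomorphic_on H" using V(1) by (intro holomorphic_intros)
    show "0 \<in> H" using \<delta> by (simp add: H_def)
    fix t assume "t \<in> {t. Im t > T}"
    hence t: "Im t > T" "t \<in> H" using sub by auto
    define w1 where "w1 = w + t *s e1"
    have w1: "w1$3 = w$3" "w1$2 = w$2 + t" "Ev w1 = Ev w" unfolding w1_def Ev_add_bv by (simp_all add: bv_def)
    have "Phi (iota2 w1) = th1 (w1$3) 0 ^ 8 * V t"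
    proof (rule Phi_iota2_far[OF hom prod w w1_def])
      show "Im (w$3) + 1 \<le> Im t" "2 * Im (zof w $ 1) + 1 \<le> Im t" using T t by (simp_all add: A_def z_def)
      have "norm (w$3) ^ 2 * (\<bar>R\<bar> + 8) / (2 * A) \<le> Im t" using T t by linarith
      thus "norm (w$3) ^ 2 * (\<bar>R\<bar> + 8) \<le> 2 * Im t * Im (w$3)" using A unfolding A_def by (simp add: pos_divide_le_eq mult_ac)
      show "has_uprod (\<lambda>x. (1 - u2 (w1$3) (w1$2) (Ev w1) x) powi (sg x * cl x)) Lvl (V t)" unfolding w1 by (rule V(2)[OF t(2)])
      define s where "s = 2 * A * (Im (w$2) + Im t) - norm (Im8 (Ev w)) ^ 2 / 2"
      have "2 * A * Im t \<ge> 0" using A t T by (intro mult_nonneg_nonneg) auto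
      hence s: "s \<ge> 2" using sqw S unfolding s_def by (simp add: algebra_simps)
      hence "sqrt (2 * s) \<ge> 2" by (intro real_le_rsqrt) simp
      hence "2 * pi * 2 \<le> 2 * pi * sqrt (2 * s)" by (intro mult_left_mono) auto
      moreover have "Im (w$2) + Im t > 0" using B \<delta> t T by linarith
      ultimately have "(\<lambda>x. of_int (cl x) * exp (- (2 * pi) * Lr A (Im (w$2) + Im t) (Im8 (Ev w)) x)) summable_on Lvl"
        using A s unfolding s_def by (intro summable_cl_exp) auto
      thus "(\<lambda>x. of_int (cl x) * norm (u2 (w1$3) (w1$2) (Ev w1) x)) summable_on Lvl"
        unfolding norm_u2 w1 A_def by simp
    qed auto
    thus "L t = th1 (w$3) 0 ^ 8 * V t" unfolding L_def w1_def[symmetric] w1 .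
  qed (use openH Lhol in auto)
  hence val: "Phi (iota2 w) = th1 (w$3) 0 ^ 8 * V 0" by (simp add: L_def)
  have "0 \<in> H" using \<delta> by (simp add: H_def)
  from V(2)[OF this] have "has_uprod (\<lambda>x. (1 - u2 (w$3) (w$2) (Ev w) x) powi (sg x * cl x)) Lvl (V 0)" by simp
  from second_product_value[OF assms(2,3) w this] val
  show "\<exists>P. has_uprod (\<lambda>l. (1 - exp (2 * pi * \<i> * bil (lift l) w))
                         powi ((if even (bil l (e1 - f1)) then 1 else -1) * cc (sq l div 2)))
                  {l \<in> M2. (\<forall>y\<in>W. bil (lift l) y > (0::real)) \<and> sq l \<ge> -2} P
              \<and> Phi (iota2 w) = 2^8 * exp (2 * pi * \<i> * bil e1 w) * P" by (elim exE conjE) (rule exI, rule conjI, assumption, simp only:)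
qed

end
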